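(* Let $m,n\ge 1$ be integers and $T>0$. Let $A(t,D_x)=\sum_{k=1}^n A_k(t)D_{x_k}$ and $B(t)$, where the entries of the $m\times m$ matrices $A_1(t),\dots,A_n(t)$ and $B(t)$ are of class $C^{m-1}$ on $[0,T]$. Assume that for all $t\in[0,T]$ and $\xi\in\mathbb{R}^n$ the matrix $A(t,\xi)=\sum_{k=1}^n\xi_kA_k(t)$ has $m$ real eigenvalues (counted with multiplicity), ordered as $\lambda_1(t,\xi)\le\dots\le\lambda_m(t,\xi)$. Assume that, for some $0<\alpha\le 1$, the eigenvalues are of H\"older class $C^\alpha$ with respect to $t$ (Lipschitz if $\alpha=1$), i.e. there is a constant $M>0$ such that $$|\lambda_j(t,\xi)-\lambda_j(t',\xi)|\le M|\xi|\,|t-t'|^\alpha\quad\text{for all } 1\le j\le m,\ t,t'\in[0,T],\ \xi\in\mathbb{R}^n.$$ Assume moreover that there is a constant $c>0$ such that $$|\lambda_i(t,\xi)-\lambda_j(t,\xi)|\le c\,|\lambda_k(t,\xi)-\lambda_{k-1}(t,\xi)|$$ for all $1\le i,j\le m$, $2\le k\le m$, $t\in[0,T]$ and $\xi\in\mathbb{R}^n$. Let $$1\le s<1+\min\Bigl\{\alpha,\frac{1}{m-1}\Bigr\}$$ and let $g_0\in\gamma^s(\mathbb{R}^n)^m$. Then the Cauchy problem $$D_tu-A(t,D_x)u-B(t)u=0,\quad x\in\mathbb{R}^n,\ t\in[0,T],\qquad u|_{t=0}=g_0,$$ has a unique solution $u\in C^1([0,T],\gamma^s(\mathbb{R}^n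)^m)$.
   Context: Notation: $D_t=-\mathrm{i}\,\partial_t$ and $D_{x_k}=-\mathrm{i}\,\partial_{x_k}$; $u$ and $g_0$ are column vectors with $m$ entries. The coefficients are complex valued and depend only on $t$. For $m=1$, $\frac{1}{m-1}$ is read as $+\infty$. For $s\ge 1$, the Gevrey class $\gamma^s(\mathbb{R}^n)$ (Gevrey-Roumieu type) is the space of all $f\in C^\infty(\mathbb{R}^n)$ such that for every compact set $K\subset\mathbb{R}^n$ there exists a constant $C>0$ such that for all $\beta\in\mathbb{N}_0^n$ $$\sup_{x\in K}|\partial^\beta f(x)|\le C^{|\beta|+1}(\beta!)^s,$$ equipped with its usual locally convex topology. For $s=1$ this is the class of real analytic functions. $\gamma^s(\mathbb{R}^n)^m$ denotes the $m$-vectors with entries in $\gamma^s(\mathbb{R}^n)$. *)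

theory Defs
  imports "HOL-Analysis.Analysis" "HOL-Computational_Algebra.Polynomial"
begin

section \<open>Smooth functions and multi-index derivatives\<close>

definition partial_deriv ::
  "'n::finite \<Rightarrow> (real^'n \<Rightarrow> 'b::real_normed_vector) \<Rightarrow> real^'n \<Rightarrow> 'b" where
  "partial_deriv k f x = vector_derivative (\<lambda>h. f (x + h *\<^sub>R axis k 1)) (at 0)"

definition iterated_partial ::
  "'n::finite list \<Rightarrow> (real^'n \<Rightarrow> 'b::real_normed_vector) \<Rightarrow> real^'n \<Rightarrow> 'b" where
  "iterated_partial ks f = foldr partial_deriv ks f"

definition smooth :: "(real^'n::finite \<Rightarrow> 'b::real_normed_vector) \<Rightarrow> bool" where
  "smooth f \<longleftrightarrow> (\<forall>ks. continuous_on UNIV (iterated_partial ks f) \<and>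
     (\<forall>k x. (\<lambda>h. iterated_partial ks f (x + h *\<^sub>R axis k 1)) differentiable (at 0)))"

text \<open>Multi-indices are functions \<open>\<beta> :: 'n \<Rightarrow> nat\<close>. The derivative of multi-index \<open>\<beta>\<close> applies the
  \<open>k\<close>-th partial derivative \<open>\<beta> k\<close> times for every \<open>k\<close>, in an arbitrarily chosen order, since the
  index type is not ordered; for smooth functions the order is irrelevant.\<close>

definition multi_deriv ::
  "('n::finite \<Rightarrow> nat) \<Rightarrow> (real^'n \<Rightarrow> 'b::real_normed_vector) \<Rightarrow> real^'n \<Rightarrow> 'b" where
  "multi_deriv \<beta> f = iterated_partial (SOME ks. \<forall>k. count_list ks k = \<beta> k) f"

definition multi_abs :: "('n::finite \<Rightarrow> nat) \<Rightarrow> nat" where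
  "multi_abs \<beta> = (\<Sum>k\<in>UNIV. \<beta> k)"

definition multi_fact :: "('n::finite \<Rightarrow> nat) \<Rightarrow> nat" where
  "multi_fact \<beta> = (\<Prod>k\<in>UNIV. fact (\<beta> k))"


section \<open>Gevrey spaces and their topology\<close>

definition gevrey :: "real \<Rightarrow> (real^'n::finite \<Rightarrow> complex) set" where
  "gevrey s = {f. smooth f \<and>
     (\<forall>K. compact K \<longrightarrow> (\<exists>C>0. \<forall>\<beta>. \<forall>x\<in>K.
        norm (multi_deriv \<beta> f x) \<le> C ^ (multi_abs \<beta> + 1) * real (multi_fact \<beta>) powr s))}"

text \<open>The usual topology is that of the projective limit over the compact sets \<open>K\<close> of the locally
  convex inductive limits, as \<open>h\<close> tends to infinity, of the spaces \<open>E K h\<close> of smooth functions with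
  \<open>|\<partial>\<^sup>\<beta> f| \<le> M h\<^bsup>|\<beta>|\<^esup> (\<beta>!)\<^sup>s\<close> on \<open>K\<close> for all \<open>\<beta>\<close>, normed by the least such \<open>M\<close>. The elements of \<open>E K h\<close>
  are represented by functions on the whole space; functions with the same derivatives on \<open>K\<close>
  have distance 0 and are thereby identified.\<close>

definition gevrey_bound ::
  "real \<Rightarrow> (real^'n::finite) set \<Rightarrow> real \<Rightarrow> real \<Rightarrow> (real^'n \<Rightarrow> complex) \<Rightarrow> bool" where
  "gevrey_bound s K h M f \<longleftrightarrow> smooth f \<and>
     (\<forall>\<beta>. \<forall>x\<in>K. norm (multi_deriv \<beta> f x) \<le> M * h ^ multi_abs \<beta> * real (multi_fact \<beta>) powr s)"

definition gevrey_on :: "real \<Rightarrow> (real^'n::finite) set \<Rightarrow> (real^'n \<Rightarrow> complex) set" where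
  "gevrey_on s K = {f. \<exists>h>0. \<exists>M. gevrey_bound s K h M f}"

text \<open>A seminorm on a locally convex inductive limit is continuous iff its restriction to each step
  \<open>E K h\<close> is continuous, i.e. bounded by a multiple of the norm of \<open>E K h\<close>.\<close>

definition gevrey_seminorm ::
  "real \<Rightarrow> (real^'n::finite) set \<Rightarrow> ((real^'n \<Rightarrow> complex) \<Rightarrow> real) \<Rightarrow> bool" where
  "gevrey_seminorm s K q \<longleftrightarrow>
     (\<forall>f\<in>gevrey_on s K. \<forall>g\<in>gevrey_on s K. q (\<lambda>x. f x + g x) \<le> q f + q g) \<and>
     (\<forall>f\<in>gevrey_on s K. \<forall>a. q (\<lambda>x. a * f x) = norm a * q f) \<and>
     (\<forall>h>0. \<exists>C. \<forall>f M. gevrey_bound s K h M f \<longrightarrow> q f \<le> C * M)"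

definition gevrey_topology :: "real \<Rightarrow> (real^'n::finite \<Rightarrow> complex) topology" where
  "gevrey_topology s = topology_generated_by
     {{f \<in> gevrey s. q (\<lambda>x. f x - g x) < \<epsilon>} | K q g \<epsilon>.
        compact K \<and> gevrey_seminorm s K q \<and> g \<in> gevrey s \<and> \<epsilon> > 0}"

text \<open>The space of vectors with entries in the Gevrey class, with the product topology; an \<open>m\<close>-vector
  of functions is written as a vector-valued function.\<close>

definition gevrey_vec :: "real \<Rightarrow> (real^'n::finite \<Rightarrow> complex^'m::finite) set" where
  "gevrey_vec s = {f. \<forall>i. (\<lambda>x. f x $ i) \<in> gevrey s}"

definition gevrey_vec_topology ::
  "real \<Rightarrow> (real^'n::finite \<Rightarrow> complex^'m::finite) topology" where
  "gevrey_vec_topology s =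
     pullback_topology (gevrey_vec s) (\<lambda>f i x. f x $ i)
       (product_topology (\<lambda>_. gevrey_topology s) UNIV)"

text \<open>Continuously differentiable maps from \<open>[0,T]\<close> to the Gevrey space: the difference quotients
  converge, and the derivative is continuous, in the topology of that space.\<close>

definition gevrey_C1 ::
  "real \<Rightarrow> real \<Rightarrow> (real \<Rightarrow> real^'n::finite \<Rightarrow> complex^'m::finite) set" where
  "gevrey_C1 s T = {u. (\<forall>t\<in>{0..T}. u t \<in> gevrey_vec s) \<and>
     (\<exists>u'. (\<forall>t\<in>{0..T}. limitin (gevrey_vec_topology s)
               (\<lambda>\<tau> x. (u \<tau> x - u t x) /\<^sub>R (\<tau> - t)) (u' t) (at t within {0..T})) \<and>
           continuous_map (top_of_set {0..T}) (gevrey_vec_topology s) u')}"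


section \<open>The differential operators, regularity in time and eigenvalues\<close>

definition Dx ::
  "'n::finite \<Rightarrow> (real^'n \<Rightarrow> complex^'m::finite) \<Rightarrow> real^'n \<Rightarrow> complex^'m" where
  "Dx k f x = (- \<i>) *s partial_deriv k f x"

definition Dt ::
  "real \<Rightarrow> (real \<Rightarrow> real^'n::finite \<Rightarrow> complex^'m::finite) \<Rightarrow> real \<Rightarrow> real^'n \<Rightarrow> complex^'m" where
  "Dt T u t x = (- \<i>) *s vector_derivative (\<lambda>\<tau>. u \<tau> x) (at t within {0..T})"

text \<open>One-sided derivatives are used at the end points of \<open>S\<close> if \<open>S\<close> is a compact interval.\<close>

definition Ck_on :: "nat \<Rightarrow> real set \<Rightarrow> (real \<Rightarrow> complex) \<Rightarrow> bool" where
  "Ck_on k S f \<longleftrightarrow> (\<exists>D. (\<forall>t\<in>S. D 0 t = f t) \<and>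
     (\<forall>j<k. \<forall>t\<in>S. (D j has_vector_derivative D (Suc j) t) (at t within S)) \<and>
     (\<forall>j\<le>k. continuous_on S (D j)))"

definition symbol :: "('n::finite \<Rightarrow> real \<Rightarrow> complex^'m^'m::finite) \<Rightarrow> real \<Rightarrow> real^'n \<Rightarrow> complex^'m^'m" where
  "symbol A t \<xi> = (\<Sum>k\<in>UNIV. (\<xi> $ k) *\<^sub>R A k t)"

definition charpoly :: "complex^'m^'m::finite \<Rightarrow> complex poly" where
  "charpoly P = det (\<chi> i j. (if i = j then [:0, 1:] else 0) - [:P $ i $ j:])"

text \<open>\<open>l 1, \<dots>, l m\<close> are the eigenvalues of \<open>P\<close>, counted with (algebraic) multiplicity, all of which
  are real, in increasing order; other values of \<open>l\<close> are irrelevant.\<close>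

definition ordered_real_eigenvalues :: "complex^'m^'m::finite \<Rightarrow> (nat \<Rightarrow> real) \<Rightarrow> bool" where
  "ordered_real_eigenvalues P l \<longleftrightarrow>
     proots (charpoly P) = image_mset (\<lambda>j. complex_of_real (l j)) (mset_set {1..CARD('m)}) \<and>
     mono_on {1..CARD('m)} l"

definition cauchy_solution ::
  "('n::finite \<Rightarrow> real \<Rightarrow> complex^'m^'m::finite) \<Rightarrow> (real \<Rightarrow> complex^'m^'m) \<Rightarrow> real \<Rightarrow>
   (real^'n \<Rightarrow> complex^'m) \<Rightarrow> (real \<Rightarrow> real^'n \<Rightarrow> complex^'m) \<Rightarrow> bool" where
  "cauchy_solution A B T g u \<longleftrightarrow>
     (\<forall>t\<in>{0..T}. \<forall>x. Dt T u t x - (\<Sum>k\<in>UNIV. A k t *v Dx k (u t) x) - B t *v u t x = 0) \<and>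
     (\<forall>x. u 0 x = g x)"

end

theory Submission
  imports Defs "HOL-Probability.Probability" "HOL-Complex_Analysis.Complex_Analysis"
    "HOL-Computational_Algebra.Fundamental_Theorem_Algebra"
begin

text \<open>The Fourier transform in \<open>x\<close> turns the system into ordinary differential equations in \<open>t\<close> with parameter \<open>\<xi>\<close>.
By the Cayley-Hamilton theorem the characteristic polynomial of \<open>A(t, \<xi>)\<close>, evaluated at \<open>D\<^sub>t\<close>, annihilates each Fourier
mode up to terms of order \<open>m - 1\<close>. With \<open>\<beta> = min \<alpha> (1 / (m - 1))\<close>, \<open>l = 1 + |\<xi>|\<close> and \<open>p = 1 / (1 + \<beta>)\<close>, the eigenvalues
are averaged over time intervals of length \<open>d\<close> with \<open>l d\<^sup>\<alpha> = l\<^sup>p\<close> and then shifted apart by multiples of \<open>l\<^sup>p\<close>. The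
new roots are separated and differentiable, so the Lagrange basis at these nodes diagonalises the equation with an error
of size \<open>l\<^sup>p\<close>, and the modes grow at most like \<open>exp (C l\<^sup>p)\<close>. Gevrey data of order \<open>s < 1 + \<beta>\<close>, cut off by Gevrey functions of
order \<open>s' < 1 + \<beta>\<close>, have Fourier transforms of size \<open>exp (- c |\<xi>|\<^bsup>1/s'\<^esup>)\<close>, which absorbs this growth; all bounds are linear
in the data and hence carry over to derivatives of every order. Testing a solution against derivatives of
narrow Gaussians (Holmgren's method) gives local uniqueness and finite propagation speed. This allows the
solutions for truncated data to be patched together, and shows that the derivatives of the solution are controlled by
those of the data.\<close>

unbundle no fps_syntax
no_notation fps_nth (infixl "$" 75)

text \<open>The matrices A(t, \<xi>) need not be diagonalisable, and their eigenvalues may meet and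
  are only Hoelder in t, so a bounded smooth diagonalisation cannot be expected. Separation is
  created artificially, and every cost is measured against the gap g = l^p. Averaging displaces the
  roots by about l d^\<alpha>, which should be of size g; the nodes then move with speed g / d, and
  dividing by the gap leaves 1 / d, which is at most g because \<beta> <= \<alpha>. The passage to a
  scalar equation leaves a remainder of order m - 1, which the Lagrange denominators g^(m-1) turn
  into (l / g)^(m-1); this is at most g when \<beta> (m - 1) <= 1. Both restrictions on \<beta>
  arise here, and 1 / p = 1 + \<beta> is the threshold for s. The second obstacle is s = 1: no
  cutoff is analytic. Hence two orders are used. The order s' > 1 governs the cutoffs and the
  Fourier decay of one truncated function, while the order s is recorded only in the size of the
  successive derivatives of the data, a factor that all estimates carry along linearly.\<close>

abbreviation cor :: "real => complex" where "cor \<equiv> complex_of_real"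

subsection \<open>Fourier inversion\<close>

text \<open>\<open>partial_deriv\<close> has a value even where no derivative exists; this relation
  also asserts existence, so that the derivative rules can be composed.\<close>

definition has_partial ::
 "'n::finite => (real^'n => 'b::real_normed_vector) => 'b => real^'n => bool" where
 "has_partial k f d x \<longleftrightarrow> ((\<lambda>h. f (x + h *\<^sub>R axis k 1)) has_vector_derivative d) (at 0)"

lemma has_partial_imp: "has_partial k f d x ==> partial_deriv k f x = d"
 unfolding has_partial_def partial_deriv_def by (rule vector_derivative_at)

lemma has_partial_line:
 assumes "has_partial k f d (x + h *\<^sub>R axis k 1)"
 shows "((\<lambda>h. f (x + h *\<^sub>R axis k 1)) has_vector_derivative d) (at h)"
proof -
 have "((\<lambda>s. f ((x + h *\<^sub>R axis k 1) + s *\<^sub>R axis k 1)) has_vector_derivative d) (at (h - h))"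
  using assms unfolding has_partial_def by simp
 then have "((\<lambda>s. f ((x + h *\<^sub>R axis k 1) + s *\<^sub>R axis k 1)) \<circ> (\<lambda>s. s - h) has_vector_derivative 1 *\<^sub>R d) (at h)"
  by (intro vector_diff_chain_at) (auto intro!: derivative_eq_intros)
 then show ?thesis
  by (simp add: o_def algebra_simps)
qed

lemma integrable_translation:
 fixes f :: "'a::euclidean_space => complex"
 assumes "integrable lborel f"
 shows "integrable lborel (\<lambda>x. f (x + c))" and "(\<integral>x. f (x + c) \<partial>lborel) = (\<integral>x. f x \<partial>lborel)"
proof -
 have m: "f \<in> borel_measurable borel"
  using assms by (auto dest: borel_measurable_integrable)
 have "integrable (distr lborel borel ((+) c)) f"
  using assms by (simp add: lborel_distr_plus)
 then show "integrable lborel (\<lambda>x. f (x + c))"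
  using m by (subst (asm) integrable_distr_eq) (auto simp: add.commute)
 have "(\<integral>x. f x \<partial>lborel) = (\<integral>x. f x \<partial>distr lborel borel ((+) c))"
  by (simp add: lborel_distr_plus)
 also have "\<dots> = (\<integral>x. f (x + c) \<partial>lborel)"
  using m by (subst integral_distr) (auto simp: add.commute)
 finally show "(\<integral>x. f (x + c) \<partial>lborel) = (\<integral>x. f x \<partial>lborel)" by simp
qed

lemma vector_derivative_bound_le:
 fixes f :: "real => 'a::real_normed_vector"
 assumes "a \<le> b" and "\<And>x. a \<le> x ==> x \<le> b ==> (f has_vector_derivative f' x) (at x within {a..b})"
  and "\<And>x. a \<le> x ==> x \<le> b ==> norm (f' x) \<le> B"
 shows "norm (f b - f a) \<le> B * (b - a)"
proof (cases "a = b")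
 case False
 with assms have ab: "a < b" by simp
 have "norm (f b - f a) \<le> B * b - B * a"
 proof (rule differentiable_bound_general[OF ab, where f' = f' and \<phi>' = "\<lambda>_. B"])
  show "continuous_on {a..b} f"
   using has_vector_derivative_continuous[OF assms(2)] by (simp add: continuous_on_eq_continuous_within)
  show "(f has_vector_derivative f' x) (at x)" if "a < x" "x < b" for x
   using assms(2)[of x] that by (simp add: at_within_Icc_at)
 qed (auto intro!: continuous_intros derivative_eq_intros assms(3))
 then show ?thesis by (simp add: algebra_simps)
qed simp

lemma has_vector_derivative_quotient:
 fixes f :: "real => 'a::real_normed_vector"
 assumes "(f has_vector_derivative d) (at x)"
 shows "((\<lambda>h. (f (x + h) - f x) /\<^sub>R h) \<longlongrightarrow> d) (at 0)"
proof -
 have "((\<lambda>h. norm (f (x + h) - f x - h *\<^sub>R d) / norm h) \<longlongrightarrow> 0) (at 0)"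
  using assms unfolding has_vector_derivative_def has_derivative_at by simp
 note lim = this
 have eq: "norm (f (x + h) - f x - h *\<^sub>R d) / norm h = norm ((f (x + h) - f x) /\<^sub>R h - d)" if "h \<noteq> 0" for h
 proof -
  have "(f (x + h) - f x) /\<^sub>R h - d = (f (x + h) - f x - h *\<^sub>R d) /\<^sub>R h"
   using that by (simp add: scaleR_diff_right)
  then show ?thesis by (simp add: divide_inverse mult.commute)
 qed
 have "((\<lambda>h. norm ((f (x + h) - f x) /\<^sub>R h - d)) \<longlongrightarrow> 0) (at 0)"
  by (rule Lim_transform_eventually[OF lim]) (auto simp: eventually_at_filter eq[unfolded real_norm_def] intro!: always_eventually)
 then show ?thesis
  by (rule LIM_zero_cancel[OF tendsto_norm_zero_cancel])
qed

text \<open>By translation invariance every difference quotient of \<open>f\<close> integrates to 0.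
  The mean value inequality along a segment of length at most 1 bounds the quotients by
  \<open>g\<close>, and dominated convergence passes to \<open>f'\<close>.\<close>

lemma integral_partial_eq_0:
 fixes f f' :: "real^'n::finite => complex"
 assumes d: "\<And>x. has_partial k f (f' x) x"
  and f: "integrable lborel f" and f': "f' \<in> borel_measurable borel"
  and g: "integrable lborel g"
  and b: "\<And>x h. 0 \<le> h ==> h \<le> 1 ==> norm (f' (x + h *\<^sub>R axis k 1)) \<le> g x"
 shows "integral\<^sup>L lborel f' = 0"
proof -
 define s where "s i x = (f (x + (1 / real (Suc i)) *\<^sub>R axis k 1) - f x) /\<^sub>R (1 / real (Suc i))" for i x
 have sint: "integrable lborel (s i)" for i
  unfolding s_def by (intro integrable_scaleR_right Bochner_Integration.integrable_diff integrable_translation f)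
 have int0: "integral\<^sup>L lborel (s i) = 0" for i
 proof -
  define c where "c = (1 / real (Suc i)) *\<^sub>R (axis k 1 :: real^'n)"
  define r where "r = inverse (1 / real (Suc i))"
  have s: "s i = (\<lambda>x. r *\<^sub>R (f (x + c) - f x))"
   by (rule ext) (simp only: s_def r_def c_def)
  have "integral\<^sup>L lborel (\<lambda>x. f (x + c) - f x) = 0"
   using integrable_translation[OF f, of c] f by simp
  then show ?thesis unfolding s by simp
 qed
 have "(\<lambda>i. integral\<^sup>L lborel (s i)) \<longlonglongrightarrow> integral\<^sup>L lborel f'"
 proof (rule integral_dominated_convergence[where w = g and s = s and f = f' and M = lborel])
  show "s i \<in> borel_measurable lborel" for i
   using sint by (rule borel_measurable_integrable)
  show "AE x in lborel. (\<lambda>i. s i x) \<longlonglongrightarrow> f' x"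
  proof (rule AE_I2)
   fix x
   have A: "((\<lambda>h. (f (x + h *\<^sub>R axis k 1) - f x) /\<^sub>R h) \<longlongrightarrow> f' x) (at 0)"
    using has_vector_derivative_quotient[OF d[of x, unfolded has_partial_def]] by simp
   have B: "filterlim (\<lambda>i. 1 / real (Suc i)) (at 0) sequentially"
    unfolding filterlim_at using LIMSEQ_inverse_real_of_nat[unfolded inverse_eq_divide] by simp
   show "(\<lambda>i. s i x) \<longlonglongrightarrow> f' x"
    using filterlim_compose[OF A B] by (simp only: s_def)
  qed
  show "AE x in lborel. norm (s i x) \<le> g x" for i
  proof (rule AE_I2)
   fix x
   let ?h = "1 / real (Suc i)"
   have "norm (f (x + ?h *\<^sub>R axis k 1) - f (x + 0 *\<^sub>R axis k 1)) \<le> g x * (?h - 0)"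
   proof (rule vector_derivative_bound_le[where f = "\<lambda>h. f (x + h *\<^sub>R axis k 1)" and f' = "\<lambda>h. f' (x + h *\<^sub>R axis k 1)" and a = 0 and b = ?h])
    fix h :: real assume h: "0 \<le> h" "h \<le> ?h"
    show "((\<lambda>h. f (x + h *\<^sub>R axis k 1)) has_vector_derivative f' (x + h *\<^sub>R axis k 1)) (at h within {0..?h})"
     by (rule has_vector_derivative_at_within[OF has_partial_line[OF d]])
    have "?h \<le> 1" by simp
    with h have "h \<le> 1" by linarith
    with h show "norm (f' (x + h *\<^sub>R axis k 1)) \<le> g x"
     by (intro b)
   qed simp
   moreover have "?h > 0" by simp
   ultimately have "norm (f (x + ?h *\<^sub>R axis k 1) - f x) / ?h \<le> g x"
    by (simp only: pos_divide_le_eq scaleR_zero_left add_0_right diff_zero)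
   then show "norm (s i x) \<le> g x"
    using \<open>?h > 0\<close> unfolding s_def norm_scaleR norm_inverse real_norm_def
    by (simp add: divide_inverse[of _ "1 / real (Suc i)"] mult.commute del: of_nat_Suc)
  qed
 qed (use f' g in \<open>simp_all\<close>)
 then have "(\<lambda>i::nat. 0::complex) \<longlonglongrightarrow> integral\<^sup>L lborel f'"
  by (simp only: int0)
 from LIMSEQ_unique[OF this tendsto_const]
 show ?thesis .
qed

section \<open>Integrals of products of one-variable functions, and Gaussians\<close>

lemma
 fixes f :: "'a::euclidean_space => real => 'b::{real_normed_field,banach,second_countable_topology}"
 assumes f: "\<And>b. b \<in> Basis ==> integrable lborel (f b)"
 shows integrable_lborel_prod: "integrable lborel (\<lambda>x. \<Prod>b\<in>Basis. f b (x \<bullet> b))"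
  and integral_lborel_prod: "(\<integral>x. (\<Prod>b\<in>Basis. f b (x \<bullet> b)) \<partial>lborel) = (\<Prod>b\<in>Basis. \<integral>x. f b x \<partial>lborel)"
proof -
 interpret product_sigma_finite "\<lambda>_::'a. lborel :: real measure" ..
 have [measurable]: "b \<in> Basis ==> f b \<in> borel_measurable borel" for b
  using f by (auto dest: borel_measurable_integrable)
 have m: "(\<lambda>x. \<Prod>b\<in>Basis. f b (x \<bullet> b)) \<in> borel_measurable borel"
  by measurable
 have s: "b \<in> Basis ==> (\<Sum>b\<in>Basis. x b *\<^sub>R b) \<bullet> b = x b" for b :: 'a and x
  by simp
 show "integrable lborel (\<lambda>x. \<Prod>b\<in>Basis. f b (x \<bullet> b))"
  using m product_integrable_prod[of Basis f, OF finite_Basis f]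
  by (subst lborel_eq, subst integrable_distr_eq) (auto cong: prod.cong)
 show "(\<integral>x. (\<Prod>b\<in>Basis. f b (x \<bullet> b)) \<partial>lborel) = (\<Prod>b\<in>Basis. \<integral>x. f b x \<partial>lborel)"
  using m product_integral_prod[of Basis f, OF finite_Basis f]
  by (subst lborel_eq, subst integral_distr) (auto cong: prod.cong)
qed

lemma Basis_real_vec: "(Basis :: (real^'n::finite) set) = range (\<lambda>i. axis i 1)"
 by (auto simp: Basis_vec_def)

lemma prod_Basis_vec: "(\<Prod>b\<in>(Basis :: (real^'n::finite) set). f b (x \<bullet> b)) = (\<Prod>i\<in>UNIV. f (axis i 1) (x $ i))"
 unfolding Basis_real_vec
 by (subst prod.reindex) (auto simp: inj_on_def axis_eq_axis inner_axis)

lemma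
 fixes f :: "'n::finite => real => 'b::{real_normed_field,banach,second_countable_topology}"
 assumes f: "\<And>i. integrable lborel (f i)"
 shows integrable_prod_vec: "integrable lborel (\<lambda>x::real^'n. \<Prod>i\<in>UNIV. f i (x $ i))"
  and integral_prod_vec: "integral\<^sup>L lborel (\<lambda>x::real^'n. \<Prod>i\<in>UNIV. f i (x $ i)) = (\<Prod>i\<in>UNIV. \<integral>x. f i x \<partial>lborel)"
proof -
 \<comment> \<open>The general product formula is indexed by basis vectors; the choice inverts the
   map from i to \<open>axis i 1\<close>.\<close>
 define g where "g b = f (SOME i. b = axis i (1::real))" for b :: "real^'n"
 have g: "g (axis i 1) = f i" for i
  unfolding g_def by (simp add: axis_eq_axis)
 have gi: "b \<in> Basis ==> integrable lborel (g b)" for b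
  unfolding g_def by (rule f)
 show "integrable lborel (\<lambda>x::real^'n. \<Prod>i\<in>UNIV. f i (x $ i))"
  using integrable_lborel_prod[of g, OF gi] by (simp add: prod_Basis_vec g)
 have "(\<Prod>b\<in>Basis. \<integral>x. g b x \<partial>lborel) = (\<Prod>i\<in>UNIV. \<integral>x. f i x \<partial>lborel)"
  unfolding Basis_real_vec by (subst prod.reindex) (auto simp: inj_on_def axis_eq_axis g)
 then show "integral\<^sup>L lborel (\<lambda>x::real^'n. \<Prod>i\<in>UNIV. f i (x $ i)) = (\<Prod>i\<in>UNIV. \<integral>x. f i x \<partial>lborel)"
  using integral_lborel_prod[of g, OF gi] by (simp add: prod_Basis_vec g)
qed

text \<open>The transform is read off from the characteristic function of the standard normal
  distribution; a linear substitution introduces the scale \<open>e\<close>.\<close>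

lemma integral_gaussian_cis:
 fixes e :: real
 assumes "e > 0"
 shows "integrable lborel (\<lambda>x. cis (z * x) * cor (exp (- (e * x)\<^sup>2 / 2)))"
  and "(\<integral>x. cis (z * x) * cor (exp (- (e * x)\<^sup>2 / 2)) \<partial>lborel)
   = cor (sqrt (2 * pi) / e * exp (- (z / e)\<^sup>2 / 2))"
proof -
 have m: "cis \<in> borel_measurable borel"
  by (intro borel_measurable_continuous_onI continuous_intros)
 note [measurable] = m
 have std: "std_normal_density x = exp (- x\<^sup>2 / 2) / sqrt (2 * pi)" for x
  by (simp add: std_normal_density_def)
 have "integrable lborel std_normal_density"
  by simp
 then have "integrable lborel (\<lambda>x. sqrt (2 * pi) * std_normal_density x)"
  by simp
 then have gi: "integrable lborel (\<lambda>x::real. exp (- x\<^sup>2 / 2))"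
  by (simp add: std)
 have ci: "integrable lborel (\<lambda>x. cis (z * x) * cor (exp (- x\<^sup>2 / 2)))" for z
  by (rule Bochner_Integration.integrable_bound[OF gi]) (auto simp: norm_mult)
 have g1: "(\<integral>x. cis (z * x) * cor (exp (- x\<^sup>2 / 2)) \<partial>lborel) = sqrt (2 * pi) * exp (- z\<^sup>2 / 2)" for z
 proof -
  have "(\<integral>x. cis (z * x) * cor (exp (- x\<^sup>2 / 2)) \<partial>lborel)
    = (\<integral>x. cor (sqrt (2 * pi)) * (std_normal_density x *\<^sub>R cis (z * x)) \<partial>lborel)"
   by (intro Bochner_Integration.integral_cong) (auto simp: std scaleR_conv_of_real)
  also have "\<dots> = cor (sqrt (2 * pi)) * (\<integral>x. std_normal_density x *\<^sub>R cis (z * x) \<partial>lborel)"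
   by (rule integral_mult_right_zero)
  also have "(\<integral>x. std_normal_density x *\<^sub>R cis (z * x) \<partial>lborel) = char std_normal_distribution z"
   unfolding char_def by (subst integral_density) (auto simp: cis_conv_exp)
  finally show ?thesis
   by (simp add: char_std_normal_distribution)
 qed
 let ?f = "\<lambda>x. cis (z / e * x) * cor (exp (- x\<^sup>2 / 2))"
 have eq: "?f (0 + e * x) = cis (z * x) * cor (exp (- (e * x)\<^sup>2 / 2))" for x
  using assms by simp
 show "integrable lborel (\<lambda>x. cis (z * x) * cor (exp (- (e * x)\<^sup>2 / 2)))"
  using lborel_integrable_real_affine[OF ci[of "z / e"], of e 0] assms unfolding eq by simp
 have "integral\<^sup>L lborel ?f = \<bar>e\<bar> *\<^sub>R (\<integral>x. ?f (0 + e * x) \<partial>lborel)"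
  using assms by (intro lborel_integral_real_affine) simp
 then have "(\<integral>x. ?f (0 + e * x) \<partial>lborel) = integral\<^sup>L lborel ?f / e"
  using assms by (simp add: scaleR_conv_of_real field_simps)
 then show "(\<integral>x. cis (z * x) * cor (exp (- (e * x)\<^sup>2 / 2)) \<partial>lborel)
   = cor (sqrt (2 * pi) / e * exp (- (z / e)\<^sup>2 / 2))"
  unfolding eq g1[of "z / e"] by simp
qed

text \<open>Written as a product over the coordinates so that the product formula for integrals
  applies without rearrangement.\<close>

definition gaussian :: "real^'n::finite => real" where
 "gaussian x = (\<Prod>i\<in>UNIV. exp (- (x $ i)\<^sup>2 / 2))"

lemma gaussian_pos: "gaussian x > 0"
 unfolding gaussian_def by (auto intro: prod_pos)

lemma gaussian_le_1: "gaussian x \<le> 1"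
 unfolding gaussian_def by (auto intro!: prod_le_1)

lemma continuous_on_gaussian [continuous_intros]:
 "continuous_on S f ==> continuous_on S (\<lambda>x. gaussian (f x))"
 unfolding gaussian_def by (intro continuous_intros) auto

lemma cis_inner_vec: "cis (z \<bullet> (x :: real^'n::finite)) = (\<Prod>i\<in>UNIV. cis (z $ i * x $ i))"
 by (simp add: inner_vec_def cis_conv_exp exp_sum[symmetric] sum_distrib_left)

lemma fourier_gaussian:
 fixes z :: "real^'n::finite"
 assumes "e > 0"
 shows "integrable lborel (\<lambda>\<xi>. cis (z \<bullet> \<xi>) * cor (gaussian (e *\<^sub>R \<xi>)))"
  and "(\<integral>\<xi>. cis (z \<bullet> \<xi>) * cor (gaussian (e *\<^sub>R \<xi>)) \<partial>lborel)
   = cor ((sqrt (2 * pi) / e) ^ CARD('n) * gaussian ((1 / e) *\<^sub>R z))"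
proof -
 have eq: "cis (z \<bullet> \<xi>) * cor (gaussian (e *\<^sub>R \<xi>)) =
   (\<Prod>i\<in>UNIV. cis (z $ i * \<xi> $ i) * cor (exp (- (e * \<xi> $ i)\<^sup>2 / 2)))" for \<xi>
  unfolding gaussian_def cis_inner_vec by (simp add: prod.distrib)
 note g = integral_gaussian_cis[OF assms]
 show "integrable lborel (\<lambda>\<xi>. cis (z \<bullet> \<xi>) * cor (gaussian (e *\<^sub>R \<xi>)))"
  unfolding eq by (rule integrable_prod_vec) (rule g)
 show "(\<integral>\<xi>. cis (z \<bullet> \<xi>) * cor (gaussian (e *\<^sub>R \<xi>)) \<partial>lborel)
   = cor ((sqrt (2 * pi) / e) ^ CARD('n) * gaussian ((1 / e) *\<^sub>R z))"
  unfolding eq integral_prod_vec[of "\<lambda>i x. cis (z $ i * x) * cor (exp (- (e * x)\<^sup>2 / 2))", OF g(1)] g(2)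
  by (simp add: gaussian_def prod.distrib prod_dividef power_divide)
qed

lemma integrable_gaussian: "integrable lborel (gaussian :: real^'n::finite => real)"
proof -
 have "integrable lborel (\<lambda>\<xi>::real^'n. norm (cis (0 \<bullet> \<xi>) * cor (gaussian (1 *\<^sub>R \<xi>))))"
  by (intro integrable_norm fourier_gaussian) simp
 then show ?thesis
  by (simp add: norm_mult gaussian_pos[THEN less_imp_le] abs_of_nonneg)
qed

lemma integrable_cis_mult:
 fixes f :: "'a::euclidean_space => complex"
 assumes "integrable lborel f"
 shows "integrable lborel (\<lambda>x. cis (c * (x \<bullet> \<xi>)) * f x)"
proof (rule Bochner_Integration.integrable_bound[OF assms])
 have "f \<in> borel_measurable borel"
  using assms by (auto dest: borel_measurable_integrable)
 then have "(\<lambda>x. cis (c * (x \<bullet> \<xi>)) * f x) \<in> borel_measurable borel"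
  by (intro borel_measurable_times) (intro borel_measurable_continuous_onI continuous_intros)
 then show "(\<lambda>x. cis (c * (x \<bullet> \<xi>)) * f x) \<in> borel_measurable lborel" by simp
qed (simp add: norm_mult)

lemma continuous_on_integral_cis:
 fixes f :: "'a::euclidean_space => complex"
 assumes f: "integrable lborel f"
 shows "continuous_on UNIV (\<lambda>\<xi>. \<integral>x. cis (c * (x \<bullet> \<xi>)) * f x \<partial>lborel)"
proof (rule continuous_on_sequentiallyI)
 fix u :: "nat => 'a" and a
 assume u: "u \<longlonglongrightarrow> a"
 show "(\<lambda>n. \<integral>x. cis (c * (x \<bullet> u n)) * f x \<partial>lborel) \<longlonglongrightarrow> (\<integral>x. cis (c * (x \<bullet> a)) * f x \<partial>lborel)"
 proof (rule integral_dominated_convergence[where w = "\<lambda>x. norm (f x)"])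
  show "AE x in lborel. (\<lambda>n. cis (c * (x \<bullet> u n)) * f x) \<longlonglongrightarrow> cis (c * (x \<bullet> a)) * f x"
  proof (rule AE_I2)
   fix x
   have "(\<lambda>n. c * (x \<bullet> u n)) \<longlonglongrightarrow> c * (x \<bullet> a)"
    by (intro tendsto_mult_left tendsto_inner tendsto_const u)
   from tendsto_mult_right[OF tendsto_cis[OF this], of "f x"]
   show "(\<lambda>n. cis (c * (x \<bullet> u n)) * f x) \<longlonglongrightarrow> cis (c * (x \<bullet> a)) * f x" .
  qed
 qed (use f integrable_cis_mult[OF f, THEN borel_measurable_integrable] in \<open>auto simp: norm_mult\<close>)
qed

section \<open>The Fourier transform and its inversion\<close>

definition fourier :: "(real^'n::finite => complex) => real^'n => complex" where
 "fourier f \<xi> = (\<integral>x. cis (- (x \<bullet> \<xi>)) * f x \<partial>lborel)"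

definition inv_fourier :: "(real^'n::finite => complex) => real^'n => complex" where
 "inv_fourier f x = (\<integral>\<xi>. cis (x \<bullet> \<xi>) * f \<xi> \<partial>lborel)"

text \<open>The constant of the inversion formula for these unnormalised transforms. It is left
  unevaluated, since only its positivity matters.\<close>

definition gauss_const :: "'n::finite itself => real" where
 "gauss_const _ = sqrt (2 * pi) ^ CARD('n) * (\<integral>z. gaussian (z::real^'n) \<partial>lborel)"

lemma continuous_on_fourier: "integrable lborel f ==> continuous_on UNIV (fourier f)"
 using continuous_on_integral_cis[of f "-1"] by (simp add: fourier_def[abs_def])

lemma continuous_on_inv_fourier: "integrable lborel f ==> continuous_on UNIV (inv_fourier f)"
 using continuous_on_integral_cis[of f 1] by (simp add: inv_fourier_def[abs_def] inner_commute)

lemma gauss_const_pos: "gauss_const TYPE('n::finite) > 0"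
proof -
 have "(\<integral>z. gaussian (z::real^'n) \<partial>lborel) > 0"
 proof (rule ccontr)
  assume "\<not> ?thesis"
  moreover have "(\<integral>z. gaussian (z::real^'n) \<partial>lborel) \<ge> 0"
   by (intro integral_nonneg_AE AE_I2 less_imp_le gaussian_pos)
  ultimately have "(\<integral>z. gaussian (z::real^'n) \<partial>lborel) = 0" by simp
  then have "AE z in lborel. gaussian (z::real^'n) = 0"
   by (subst (asm) integral_nonneg_eq_0_iff_AE[OF integrable_gaussian]) (auto simp: less_imp_le gaussian_pos)
  then have "AE z::real^'n in lborel. False"
   using gaussian_pos by (auto elim!: eventually_mono dest: less_imp_neq[symmetric])
  then have "(UNIV :: (real^'n) set) \<in> null_sets lborel"
   by (simp add: AE_iff_null_sets)
  then show False
   by (simp add: null_sets_def)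
 qed
 then show ?thesis
  unfolding gauss_const_def by simp
qed

lemma integral_affine:
 fixes f :: "'a::euclidean_space => complex"
 assumes "e > 0" and [measurable]: "f \<in> borel_measurable borel"
 shows "integral\<^sup>L lborel f = e ^ DIM('a) * (\<integral>x. f (t + e *\<^sub>R x) \<partial>lborel)"
proof -
 have "integral\<^sup>L lborel f = integral\<^sup>L (density (distr lborel borel (\<lambda>x. t + e *\<^sub>R x)) (\<lambda>_. ennreal (\<bar>e\<bar> ^ DIM('a)))) f"
  using assms by (subst lborel_affine[of e t]) (auto simp: ennreal_power)
 also have "\<dots> = (\<integral>x. (e ^ DIM('a)) *\<^sub>R f x \<partial>distr lborel borel (\<lambda>x. t + e *\<^sub>R x))"
  using assms by (subst integral_density) auto
 also have "\<dots> = (\<integral>x. (e ^ DIM('a)) *\<^sub>R f (t + e *\<^sub>R x) \<partial>lborel)"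
  by (subst integral_distr) auto
 finally show ?thesis by (simp add: scaleR_conv_of_real)
qed

text \<open>Inserting a Gaussian convergence factor makes Fubini applicable; the factor turns into an
 approximate identity on the other side.\<close>

lemma fourier_inversion:
 fixes f :: "real^'n::finite => complex"
 assumes cont: "continuous_on UNIV f" and int: "integrable lborel f" and bnd: "\<And>x. norm (f x) \<le> B"
  and ft: "integrable lborel (fourier f)"
 shows "inv_fourier (fourier f) x = gauss_const TYPE('n) * f x"
proof -
 note cont' = continuous_on_compose2[OF cont _ subset_UNIV]
  continuous_on_compose2[OF continuous_on_fourier[OF int] _ subset_UNIV]
 define e where "e k = 1 / real (Suc k)" for k
 have e: "e k > 0" for k by (simp add: e_def)
 have e0: "e \<longlonglongrightarrow> 0"
  unfolding e_def[abs_def] using LIMSEQ_inverse_real_of_nat[unfolded inverse_eq_divide] .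
 define I where "I k = (\<integral>\<xi>. cis (x \<bullet> \<xi>) * fourier f \<xi> * gaussian (e k *\<^sub>R \<xi>) \<partial>lborel)" for k
 have g0: "gaussian (0::real^'n) = 1" by (simp add: gaussian_def)
 have L: "I \<longlonglongrightarrow> inv_fourier (fourier f) x"
  unfolding I_def inv_fourier_def
 proof (rule integral_dominated_convergence[where w = "\<lambda>\<xi>. norm (fourier f \<xi>)"])
  show "AE \<xi> in lborel. (\<lambda>k. cis (x \<bullet> \<xi>) * fourier f \<xi> * gaussian (e k *\<^sub>R \<xi>)) \<longlonglongrightarrow> cis (x \<bullet> \<xi>) * fourier f \<xi>"
  proof (rule AE_I2)
   fix \<xi> :: "real^'n"
   have "(\<lambda>k. e k *\<^sub>R \<xi>) \<longlonglongrightarrow> 0 *\<^sub>R \<xi>"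
    by (intro tendsto_intros e0)
   then have "(\<lambda>k. gaussian (e k *\<^sub>R \<xi>)) \<longlonglongrightarrow> gaussian (0 *\<^sub>R \<xi>)"
    by (rule continuous_on_tendsto_compose[OF continuous_on_gaussian[OF continuous_on_id], of _ _ _ UNIV]) simp_all
   then show "(\<lambda>k. cis (x \<bullet> \<xi>) * fourier f \<xi> * gaussian (e k *\<^sub>R \<xi>)) \<longlonglongrightarrow> cis (x \<bullet> \<xi>) * fourier f \<xi>"
    using tendsto_mult_left[OF tendsto_of_real, of "\<lambda>k. gaussian (e k *\<^sub>R \<xi>)" "gaussian (0 *\<^sub>R \<xi>)"] by (simp add: g0)
  qed
  show "AE \<xi> in lborel. norm (cis (x \<bullet> \<xi>) * fourier f \<xi> * gaussian (e k *\<^sub>R \<xi>)) \<le> norm (fourier f \<xi>)" for k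
   by (intro AE_I2) (simp add: norm_mult gaussian_pos[THEN less_imp_le] abs_of_nonneg gaussian_le_1 mult_left_le)
  show "integrable lborel (\<lambda>\<xi>. norm (fourier f \<xi>))" using ft by simp
  show "(\<lambda>\<xi>. cis (x \<bullet> \<xi>) * fourier f \<xi>) \<in> borel_measurable lborel"
   unfolding measurable_lborel2 by (intro borel_measurable_continuous_onI continuous_intros cont')
  show "(\<lambda>\<xi>. cis (x \<bullet> \<xi>) * fourier f \<xi> * gaussian (e k *\<^sub>R \<xi>)) \<in> borel_measurable lborel" for k
   unfolding measurable_lborel2 by (intro borel_measurable_continuous_onI continuous_intros cont')
 qed
 have E: "I k = sqrt (2 * pi) ^ CARD('n) * (\<integral>z. f (x + e k *\<^sub>R z) * gaussian z \<partial>lborel)" for k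
 proof -
  let ?F = "\<lambda>(\<xi>, y). cis ((x - y) \<bullet> \<xi>) * f y * cor (gaussian (e k *\<^sub>R \<xi>))"
  have gi: "integrable lborel (\<lambda>\<xi>::real^'n. gaussian (e k *\<^sub>R \<xi>))"
   using integrable_norm[OF fourier_gaussian(1)[OF e, of 0]]
   by (simp add: norm_mult gaussian_pos[THEN less_imp_le] abs_of_nonneg)
  have mf: "?F \<in> borel_measurable (lborel \<Otimes>\<^sub>M lborel)"
  proof -
   have "?F \<in> borel_measurable borel"
    unfolding case_prod_unfold
    by (intro borel_measurable_continuous_onI continuous_intros cont')
   then show ?thesis by (simp add: lborel_prod)
  qed
  have nF: "norm (?F (\<xi>, y)) = norm (f y) * gaussian (e k *\<^sub>R \<xi>)" for \<xi> y
   by (simp add: norm_mult gaussian_pos[THEN less_imp_le] abs_of_nonneg)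
  have intF: "integrable (lborel \<Otimes>\<^sub>M lborel) ?F"
  proof (rule lborel_pair.Fubini_integrable[OF mf])
   show "integrable lborel (\<lambda>\<xi>. \<integral>y. norm (?F (\<xi>, y)) \<partial>lborel)"
    unfolding nF using gi by simp
   show "AE \<xi> in lborel. integrable lborel (\<lambda>y. ?F (\<xi>, y))"
   proof (rule AE_I2)
    fix \<xi> :: "real^'n"
    have "integrable lborel (\<lambda>y. f y * cor (gaussian (e k *\<^sub>R \<xi>)))"
     using int by simp
    moreover have "(\<lambda>y. ?F (\<xi>, y)) \<in> borel_measurable lborel"
     unfolding measurable_lborel2 prod.case by (intro borel_measurable_continuous_onI continuous_intros cont')
    ultimately show "integrable lborel (\<lambda>y. ?F (\<xi>, y))"
     by (rule Bochner_Integration.integrable_bound) (simp add: norm_mult)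
   qed
  qed
  have "I k = (\<integral>\<xi>. (\<integral>y. cis ((x - y) \<bullet> \<xi>) * f y * gaussian (e k *\<^sub>R \<xi>) \<partial>lborel) \<partial>lborel)"
  proof -
   have "cis (x \<bullet> \<xi>) * (cis (- (y \<bullet> \<xi>)) * f y) * G = cis ((x - y) \<bullet> \<xi>) * f y * G" for y \<xi> and G :: complex
    by (simp add: cis_mult inner_diff_left flip: mult.assoc)
   then show ?thesis
    unfolding I_def fourier_def
    by (simp only: integral_mult_right_zero[symmetric] integral_mult_left_zero[symmetric])
  qed
  also have "\<dots> = (\<integral>y. (\<integral>\<xi>. cis ((x - y) \<bullet> \<xi>) * f y * gaussian (e k *\<^sub>R \<xi>) \<partial>lborel) \<partial>lborel)"
   using lborel_pair.Fubini_integral[OF intF] by simp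
  also have "\<dots> = (\<integral>y. f y * (\<integral>\<xi>. cis ((x - y) \<bullet> \<xi>) * gaussian (e k *\<^sub>R \<xi>) \<partial>lborel) \<partial>lborel)"
  proof -
   have "(\<integral>\<xi>. cis ((x - y) \<bullet> \<xi>) * f y * gaussian (e k *\<^sub>R \<xi>) \<partial>lborel)
     = f y * (\<integral>\<xi>. cis ((x - y) \<bullet> \<xi>) * gaussian (e k *\<^sub>R \<xi>) \<partial>lborel)" for y
    by (subst integral_mult_right_zero[symmetric]) (simp add: ac_simps)
   then show ?thesis by simp
  qed
  also have "\<dots> = (\<integral>y. f y * cor ((sqrt (2 * pi) / e k) ^ CARD('n) * gaussian ((1 / e k) *\<^sub>R (x - y))) \<partial>lborel)"
   by (simp only: fourier_gaussian(2)[OF e])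
  also have "\<dots> = e k ^ CARD('n) * (\<integral>z. f (x + e k *\<^sub>R z) * cor ((sqrt (2 * pi) / e k) ^ CARD('n) * gaussian ((1 / e k) *\<^sub>R (x - (x + e k *\<^sub>R z)))) \<partial>lborel)"
   by (subst integral_affine[OF e[of k], where t = x])
    (intro borel_measurable_continuous_onI continuous_intros cont', simp)
  also have "\<dots> = e k ^ CARD('n) * (\<integral>z. cor ((sqrt (2 * pi) / e k) ^ CARD('n)) * (f (x + e k *\<^sub>R z) * gaussian z) \<partial>lborel)"
  proof -
   have "(1 / e k) *\<^sub>R (x - (x + e k *\<^sub>R z)) = - z" for z
    using e[of k] by simp
   moreover have "gaussian (- z) = gaussian z" for z :: "real^'n"
    by (simp add: gaussian_def)
   ultimately have "f (x + e k *\<^sub>R z) * cor ((sqrt (2 * pi) / e k) ^ CARD('n) * gaussian ((1 / e k) *\<^sub>R (x - (x + e k *\<^sub>R z))))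
     = cor ((sqrt (2 * pi) / e k) ^ CARD('n)) * (f (x + e k *\<^sub>R z) * gaussian z)" for z
    by (simp only: of_real_mult ac_simps)
   then show ?thesis by (simp only:)
  qed
  also have "\<dots> = sqrt (2 * pi) ^ CARD('n) * (\<integral>z. f (x + e k *\<^sub>R z) * gaussian z \<partial>lborel)"
   using e[of k] by (subst integral_mult_right_zero) (simp add: power_divide)
  finally show ?thesis .
 qed
 have "(\<lambda>k. (\<integral>z. f (x + e k *\<^sub>R z) * gaussian z \<partial>lborel)) \<longlonglongrightarrow> (\<integral>z. f x * gaussian (z::real^'n) \<partial>lborel)"
 proof (rule integral_dominated_convergence[where w = "\<lambda>z::real^'n. B * gaussian z"])
  show "AE z in lborel. (\<lambda>k. f (x + e k *\<^sub>R z) * gaussian z) \<longlonglongrightarrow> f x * gaussian z"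
  proof (rule AE_I2)
   fix z :: "real^'n"
   have "(\<lambda>k. f (x + e k *\<^sub>R z)) \<longlonglongrightarrow> f (x + 0 *\<^sub>R z)"
    by (rule continuous_on_tendsto_compose[OF cont, rotated]) (auto intro!: tendsto_intros e0 simp del: scaleR_zero_left)
   then show "(\<lambda>k. f (x + e k *\<^sub>R z) * gaussian z) \<longlonglongrightarrow> f x * gaussian z"
    using tendsto_mult_right by fastforce
  qed
  show "AE z in lborel. norm (f (x + e k *\<^sub>R z) * gaussian z) \<le> B * gaussian z" for k
   using bnd by (auto simp: norm_mult gaussian_pos[THEN less_imp_le] intro!: AE_I2 mult_right_mono)
  show "integrable lborel (\<lambda>z::real^'n. B * gaussian z)"
   by (intro integrable_mult_right integrable_gaussian)
  show "(\<lambda>z::real^'n. f x * cor (gaussian z)) \<in> borel_measurable lborel"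
   unfolding measurable_lborel2 by (intro borel_measurable_continuous_onI continuous_intros)
  show "(\<lambda>z. f (x + e k *\<^sub>R z) * cor (gaussian z)) \<in> borel_measurable lborel" for k
   unfolding measurable_lborel2 by (intro borel_measurable_continuous_onI continuous_intros cont')
 qed
 then have G: "(\<lambda>k. cor (sqrt (2 * pi) ^ CARD('n)) * (\<integral>z. f (x + e k *\<^sub>R z) * gaussian z \<partial>lborel))
   \<longlonglongrightarrow> cor (sqrt (2 * pi) ^ CARD('n)) * (\<integral>z. f x * gaussian (z::real^'n) \<partial>lborel)"
  by (rule tendsto_mult_left)
 have I: "I = (\<lambda>k. cor (sqrt (2 * pi) ^ CARD('n)) * (\<integral>z. f (x + e k *\<^sub>R z) * gaussian z \<partial>lborel))"
  by (rule ext) (simp only: E of_real_mult)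
 have "inv_fourier (fourier f) x = cor (sqrt (2 * pi) ^ CARD('n)) * (\<integral>z. f x * gaussian (z::real^'n) \<partial>lborel)"
  using LIMSEQ_unique[OF L G[folded I]] .
 also have "(\<integral>z. f x * cor (gaussian (z::real^'n)) \<partial>lborel) = f x * cor (\<integral>z. gaussian (z::real^'n) \<partial>lborel)"
  by simp
 finally show ?thesis
  unfolding gauss_const_def by (simp add: ac_simps)
qed

subsection \<open>Gevrey cutoff functions\<close>

text \<open>The classical bump exp (- (1 - x^2)^(-a)), of Gevrey order 1 + 1/a, on complex
  arguments, so that Cauchy's inequality can bound its derivatives near the singularities 1 and
  -1.\<close>

definition bump_fun :: "nat => complex => complex" where
 "bump_fun a z = exp (- (1 / (1 - z\<^sup>2) ^ a))"

definition bump_dom :: "complex set" where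
 "bump_dom = {z. z\<^sup>2 \<noteq> 1}"

lemma open_bump_dom: "open bump_dom"
proof -
 have eq: "bump_dom = (\<lambda>z. z\<^sup>2) -` (- {1})" by (auto simp: bump_dom_def)
 show ?thesis unfolding eq by (intro open_vimage continuous_intros open_Compl closed_singleton)
qed

lemma bump_fun_holomorphic: "bump_fun a holomorphic_on bump_dom"
 unfolding bump_fun_def by (intro holomorphic_intros) (auto simp: bump_dom_def)

lemma of_real_in_bump_dom: "\<bar>x\<bar> < 1 ==> cor x \<in> bump_dom"
 by (auto simp: bump_dom_def abs_square_less_1[symmetric] simp flip: of_real_power)

text \<open>With D = 1 - x^2 one has 1 - (x + w)^2 = D (1 + v), where |v| <= 3 \<delta> on the disc,
  so (1 + v)^(-a) stays near 1 with real part above 1/2. The radius shrinks like D, which is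
  comparable to the distance from the singularities.\<close>

lemma bump_fun_disc:
 obtains \<delta> where "0 < \<delta>" "\<delta> < 1"
  "\<And>x w. \<bar>x\<bar> < 1 ==> norm w \<le> \<delta> * (1 - x\<^sup>2) ==>
   cor x + w \<in> bump_dom \<and> norm (bump_fun a (cor x + w)) \<le> exp (- (1 / (2 * (1 - x\<^sup>2) ^ a)))"
proof -
 have "((\<lambda>v::complex. Re (1 / (1 + v) ^ a)) \<longlongrightarrow> Re (1 / (1 + 0) ^ a)) (nhds 0)"
  by (intro tendsto_intros filterlim_ident) auto
 then have "eventually (\<lambda>v::complex. Re (1 / (1 + v) ^ a) > 1 / 2) (nhds 0)"
  by (rule order_tendstoD) simp
 then obtain d where d: "d > 0" "\<And>v::complex. norm v < d ==> Re (1 / (1 + v) ^ a) > 1 / 2"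
  by (auto simp: eventually_nhds_metric dist_norm)
 define \<delta> where "\<delta> = min (1/6) (d / 6)"
 show ?thesis
 proof (rule that[of \<delta>])
  show "0 < \<delta>" "\<delta> < 1" using d by (auto simp: \<delta>_def)
  fix x :: real and w :: complex
  assume x: "\<bar>x\<bar> < 1" and w: "norm w \<le> \<delta> * (1 - x\<^sup>2)"
  define D where "D = 1 - x\<^sup>2"
  have D: "0 < D" "D \<le> 1" using x by (auto simp: D_def abs_square_less_1)
  define v where "v = - (2 * cor x * w + w\<^sup>2) / cor D"
  have w1: "norm w \<le> 1"
  proof -
   have "norm w \<le> \<delta> * D" using w by (simp add: D_def)
   also have "\<dots> \<le> 1 * 1" using D d by (intro mult_mono) (auto simp: \<delta>_def)
   finally show ?thesis by simp
  qed
  have "norm (2 * cor x * w + w\<^sup>2) \<le> 2 * \<bar>x\<bar> * norm w + norm w * norm w"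
   by (rule order_trans[OF norm_triangle_ineq]) (simp add: norm_mult power2_eq_square)
  also have "\<dots> \<le> 2 * 1 * norm w + 1 * norm w"
   using x w1 by (intro add_mono mult_mono) auto
  also have "\<dots> \<le> 3 * (\<delta> * D)" using w by (simp add: D_def)
  finally have "norm v \<le> 3 * \<delta>"
   using D unfolding v_def norm_divide norm_minus_cancel by (simp add: divide_le_eq)
  then have v: "norm v < d" "norm v < 1" using d by (auto simp: \<delta>_def)
  have eq: "1 - (cor x + w)\<^sup>2 = cor D * (1 + v)"
   using D unfolding v_def by (simp add: field_simps) (simp add: D_def power2_eq_square algebra_simps)
  have "1 + v \<noteq> 0"
   using v(2) by (metis add.commute add_cancel_left_left diff_add_cancel norm_minus_cancel norm_one less_irrefl add_eq_0_iff)
  then have ne: "1 - (cor x + w)\<^sup>2 \<noteq> 0"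
   using D unfolding eq by simp
  have "Re (1 / (1 - (cor x + w)\<^sup>2) ^ a) = Re (cor (1 / D ^ a) * (1 / (1 + v) ^ a))"
   unfolding eq by (simp add: power_mult_distrib)
  also have "\<dots> = (1 / D ^ a) * Re (1 / (1 + v) ^ a)"
   by (simp only: Re_complex_of_real times_complex.sel Im_complex_of_real mult_zero_left diff_zero)
  also have "\<dots> \<ge> (1 / D ^ a) * (1 / 2)"
   using d(2)[OF v(1)] D by (intro mult_left_mono) auto
  finally have "Re (1 / (1 - (cor x + w)\<^sup>2) ^ a) \<ge> 1 / (2 * D ^ a)"
   by simp
  then show "cor x + w \<in> bump_dom \<and> norm (bump_fun a (cor x + w)) \<le> exp (- (1 / (2 * (1 - x\<^sup>2) ^ a)))"
   using ne unfolding bump_dom_def bump_fun_def by (auto simp: norm_exp_eq_Re D_def)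
 qed
qed

lemma power_div_fact_le_exp:
 assumes "(z::real) \<ge> 0"
 shows "z ^ j / fact j \<le> exp z"
proof -
 have "sum (\<lambda>i. z ^ i /\<^sub>R fact i) {j} \<le> exp z"
  unfolding exp_def by (rule sum_le_suminf[OF summable_exp_generic]) (use assms in auto)
 then show ?thesis by (simp add: divide_inverse_commute)
qed

text \<open>The decay factor \<open>exp (- D\<^bsup>-a\<^esup> / 2)\<close> beats the Cauchy factor \<open>D\<^bsup>-j\<^esup>\<close> at the cost of \<open>j!\<^bsup>1/a\<^esup>\<close>.\<close>

lemma inverse_power_exp_bound:
 assumes "0 < D" "a > 0"
 shows "(1 / D) ^ j * exp (- (1 / (2 * D ^ a))) \<le> (2 / real a powr (1 / real a)) ^ j * fact j powr (1 / real a)"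
proof -
 define y where "y = 1 / D ^ a"
 have y: "y > 0" using assms by (simp add: y_def)
 have a: "real a > 0" using assms by simp
 \<comment> \<open>The factor a in the argument is chosen so that the a-th root of exp (- a y / 2)
   is exactly exp (- y / 2).\<close>
 have "(real a * y / 2) ^ j / fact j \<le> exp (real a * y / 2)"
  using y by (intro power_div_fact_le_exp) simp
 then have "y ^ j * exp (- (real a * y / 2)) \<le> (2 / real a) ^ j * fact j"
  using a by (simp add: field_simps exp_minus power_divide power_mult_distrib)
 then have 1: "(y ^ j * exp (- (real a * y / 2))) powr (1 / real a) \<le> ((2 / real a) ^ j * fact j) powr (1 / real a)"
  using y a by (intro powr_mono2) auto
 have 2: "(y ^ j * exp (- (real a * y / 2))) powr (1 / real a) = (1 / D) ^ j * exp (- (1 / (2 * D ^ a)))"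
 proof -
  have "(y ^ j) powr (1 / real a) = (1 / D) ^ j"
  proof -
   have "y ^ j = ((1 / D) ^ j) powr real a"
    using assms by (simp add: y_def powr_realpow power_divide flip: power_mult) (simp add: mult.commute)
   then show ?thesis using assms by (simp add: powr_powr)
  qed
  moreover have "exp (- (real a * y / 2)) powr (1 / real a) = exp (- (1 / (2 * D ^ a)))"
   using a by (simp add: exp_powr_real y_def)
  ultimately show ?thesis using y by (simp add: powr_mult)
 qed
 have 3: "((2 / real a) ^ j * fact j) powr (1 / real a) = ((2 / real a) powr (1 / real a)) ^ j * fact j powr (1 / real a)"
 proof -
  have "((2 / real a) ^ j) powr (1 / real a) = ((2 / real a) powr (1 / real a)) ^ j"
   using a by (simp add: powr_realpow[symmetric] powr_powr mult.commute)
  then show ?thesis using a by (simp add: powr_mult)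
 qed
 have le: "((2 / real a) powr (1 / real a)) ^ j \<le> (2 / real a powr (1 / real a)) ^ j"
 proof (rule power_mono)
  have "2 powr (1 / real a) \<le> 2 powr 1" using a assms by (intro powr_mono) auto
  then show "(2 / real a) powr (1 / real a) \<le> 2 / real a powr (1 / real a)"
   using a by (simp add: powr_divide divide_right_mono)
 qed simp
 show ?thesis
  using order_trans[OF 1[unfolded 2 3] mult_right_mono[OF le]] by simp
qed

text \<open>Candidates for all derivatives of the real bump extended by 0, given explicitly instead
  of by iterating a real derivative operator.\<close>

definition bump_deriv :: "nat => nat => real => real" where
 "bump_deriv a j x = (if \<bar>x\<bar> < 1 then Re ((deriv ^^ j) (bump_fun a) (cor x)) else 0)"

lemma bump_fun_of_real: "bump_fun a (cor x) = cor (exp (- (1 / (1 - x\<^sup>2) ^ a)))"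
 by (simp add: bump_fun_def flip: exp_of_real)

text \<open>Cauchy's inequality on a disc of radius \<delta> (1 - x^2): each derivative costs one
  factor 1 / (1 - x^2), while the exponential decay survives with half its exponent.\<close>

lemma bump_deriv_Cauchy:
 assumes "a > 0"
 obtains K where "K > 0" "\<And>j x. \<bar>x\<bar> < 1 ==>
  \<bar>bump_deriv a j x\<bar> \<le> fact j * K ^ j * ((1 / (1 - x\<^sup>2)) ^ j * exp (- (1 / (2 * (1 - x\<^sup>2) ^ a))))"
proof -
 obtain \<delta> where \<delta>: "0 < \<delta>" "\<delta> < 1" and disc:
  "\<And>x w. \<bar>x\<bar> < 1 ==> norm w \<le> \<delta> * (1 - x\<^sup>2) ==>
   cor x + w \<in> bump_dom \<and> norm (bump_fun a (cor x + w)) \<le> exp (- (1 / (2 * (1 - x\<^sup>2) ^ a)))"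
  by (rule bump_fun_disc[of a]) blast
 show ?thesis
 proof (rule that[of "1 / \<delta>"])
  fix j and x :: real
  assume x: "\<bar>x\<bar> < 1"
  define D where "D = 1 - x\<^sup>2"
  have D: "0 < D" using x by (auto simp: D_def abs_square_less_1)
  have sub: "cball (cor x) (\<delta> * D) \<subseteq> bump_dom"
  proof
   fix z assume "z \<in> cball (cor x) (\<delta> * D)"
   then have "norm (z - cor x) \<le> \<delta> * (1 - x\<^sup>2)"
    by (simp add: dist_norm norm_minus_commute D_def)
   from disc[OF x this] show "z \<in> bump_dom" by simp
  qed
  have "norm ((deriv ^^ j) (bump_fun a) (cor x)) \<le> fact j * exp (- (1 / (2 * (1 - x\<^sup>2) ^ a))) / (\<delta> * D) ^ j"
  proof (rule Cauchy_inequality)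
   show "bump_fun a holomorphic_on ball (cor x) (\<delta> * D)"
    using bump_fun_holomorphic sub ball_subset_cball by (blast intro: holomorphic_on_subset)
   show "continuous_on (cball (cor x) (\<delta> * D)) (bump_fun a)"
    using bump_fun_holomorphic sub by (blast intro: holomorphic_on_subset holomorphic_on_imp_continuous_on)
   show "0 < \<delta> * D" using \<delta> D by simp
   show "norm (bump_fun a z) \<le> exp (- (1 / (2 * (1 - x\<^sup>2) ^ a)))" if "norm (cor x - z) = \<delta> * D" for z
    using disc[OF x, of "z - cor x"] that by (simp add: D_def norm_minus_commute)
  qed
  moreover have "\<bar>bump_deriv a j x\<bar> \<le> norm ((deriv ^^ j) (bump_fun a) (cor x))"
   using x abs_Re_le_cmod by (simp add: bump_deriv_def)
  ultimately show "\<bar>bump_deriv a j x\<bar> \<le> fact j * (1 / \<delta>) ^ j * ((1 / (1 - x\<^sup>2)) ^ j * exp (- (1 / (2 * (1 - x\<^sup>2) ^ a))))"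
   by (simp add: D_def power_mult_distrib power_divide mult_ac)
 qed (use \<delta> in simp)
qed

text \<open>Cauchy's inequality produces j!, and absorbing the powers of 1 / (1 - x^2) produces
  j!^(1/a); together they give the order 1 + 1/a.\<close>

lemma bump_deriv_bound:
 assumes "a > 0"
 obtains H where "H > 0" "\<And>j x. \<bar>bump_deriv a j x\<bar> \<le> H ^ j * fact j powr (1 + 1 / real a)"
proof -
 obtain K where K: "K > 0" "\<And>j x. \<bar>x\<bar> < 1 ==>
  \<bar>bump_deriv a j x\<bar> \<le> fact j * K ^ j * ((1 / (1 - x\<^sup>2)) ^ j * exp (- (1 / (2 * (1 - x\<^sup>2) ^ a))))"
  by (rule bump_deriv_Cauchy[OF assms]) blast
 define Q where "Q = 2 / real a powr (1 / real a)"
 have Q: "Q > 0" using assms by (simp add: Q_def)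
 show ?thesis
 proof (rule that[of "K * Q"])
  show "K * Q > 0" using K Q by simp
  fix j and x :: real
  show "\<bar>bump_deriv a j x\<bar> \<le> (K * Q) ^ j * fact j powr (1 + 1 / real a)"
  proof (cases "\<bar>x\<bar> < 1")
   case True
   then have D: "0 < 1 - x\<^sup>2" by (auto simp: abs_square_less_1)
   have "\<bar>bump_deriv a j x\<bar> \<le> fact j * K ^ j * ((1 / (1 - x\<^sup>2)) ^ j * exp (- (1 / (2 * (1 - x\<^sup>2) ^ a))))"
    by (rule K(2)[OF True])
   also have "\<dots> \<le> fact j * K ^ j * (Q ^ j * fact j powr (1 / real a))"
    unfolding Q_def using K(1) by (intro mult_left_mono inverse_power_exp_bound[OF D assms]) auto
   finally show ?thesis
    by (simp add: powr_add power_mult_distrib mult_ac)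
  next
   case False
   have "0 \<le> (K * Q) ^ j * fact j powr (1 + 1 / real a)"
    using K(1) Q by (intro mult_nonneg_nonneg zero_le_power) auto
   then show ?thesis using False by (simp add: bump_deriv_def)
  qed
 qed
qed

lemma has_real_derivative_zeroI:
 fixes f :: "real => real"
 assumes "\<And>y. \<bar>f y - f x\<bar> \<le> C * \<bar>y - x\<bar>\<^sup>2"
 shows "(f has_real_derivative 0) (at x)"
 unfolding has_field_derivative_iff
proof (rule Lim_null_comparison)
 show "\<forall>\<^sub>F y in at x. norm ((f y - f x) / (y - x)) \<le> C * \<bar>y - x\<bar>"
 proof (rule eventually_mono[OF eventually_neq_at_within[of x]])
  fix y assume "y \<noteq> x"
  then have "\<bar>y - x\<bar> > 0" by simp
  have "\<bar>f y - f x\<bar> \<le> (C * \<bar>y - x\<bar>) * \<bar>y - x\<bar>"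
   using assms[of y] by (simp add: power2_eq_square mult_ac)
  then show "norm ((f y - f x) / (y - x)) \<le> C * \<bar>y - x\<bar>"
   using \<open>\<bar>y - x\<bar> > 0\<close> by (simp add: abs_divide pos_divide_le_eq)
 qed
 have "((\<lambda>y. C * \<bar>y - x\<bar>) \<longlongrightarrow> C * \<bar>x - x\<bar>) (at x)"
  by (intro tendsto_intros)
 then show "((\<lambda>y. C * \<bar>y - x\<bar>) \<longlongrightarrow> 0) (at x)" by simp
qed

lemma bump_deriv_has_derivative:
 assumes "a > 0"
 shows "(bump_deriv a j has_real_derivative bump_deriv a (Suc j) x) (at x)"
proof -
 consider "\<bar>x\<bar> < 1" | "\<bar>x\<bar> > 1" | "\<bar>x\<bar> = 1" by linarith
 then show ?thesis
 proof cases
  case 1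
  let ?F = "(deriv ^^ j) (bump_fun a)"
  have "?F holomorphic_on bump_dom"
   by (rule holomorphic_higher_deriv[OF bump_fun_holomorphic open_bump_dom])
  then have "(?F has_field_derivative deriv ?F (cor x)) (at (cor x))"
   by (rule holomorphic_derivI[OF _ open_bump_dom of_real_in_bump_dom[OF 1]])
  then have "((\<lambda>y. ?F (cor y)) has_vector_derivative deriv ?F (cor x)) (at x)"
   by (rule has_vector_derivative_real_field)
  then have "((\<lambda>y. Re (?F (cor y))) has_vector_derivative Re (deriv ?F (cor x))) (at x)"
   by (rule bounded_linear.has_vector_derivative[OF bounded_linear_Re])
  then have "((\<lambda>y. Re (?F (cor y))) has_real_derivative bump_deriv a (Suc j) x) (at x)"
   using 1 by (simp add: has_real_derivative_iff_has_vector_derivative bump_deriv_def)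
  then show ?thesis
   by (rule has_field_derivative_transform_within_open[of _ _ _ "{-1<..<1}"])
     (use 1 in \<open>auto simp: bump_deriv_def abs_less_iff\<close>)
 next
  case 2
  have "((\<lambda>_. 0) has_real_derivative bump_deriv a (Suc j) x) (at x)"
   using 2 by (auto simp: bump_deriv_def)
  moreover have "open {y::real. \<bar>y\<bar> > 1}"
   by (intro open_Collect_less continuous_intros)
  ultimately show ?thesis
   by (rule has_field_derivative_transform_within_open) (use 2 in \<open>auto simp: bump_deriv_def\<close>)
 next
  case 3
  obtain K where K: "K > 0" "\<And>j x. \<bar>x\<bar> < 1 ==>
   \<bar>bump_deriv a j x\<bar> \<le> fact j * K ^ j * ((1 / (1 - x\<^sup>2)) ^ j * exp (- (1 / (2 * (1 - x\<^sup>2) ^ a))))"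
   by (rule bump_deriv_Cauchy[OF assms]) blast
  \<comment> \<open>Flatness at the end points: the bound is used with j + 2 in place of j. The two
    spare powers of D = 1 - y^2, with D <= 3 |y - x|, give the quadratic contact that makes the next
    derivative vanish.\<close>
  define R where "R = (2 / real a powr (1 / real a)) ^ (j + 2) * fact (j + 2) powr (1 / real a)"
  have R: "R \<ge> 0" by (simp add: R_def)
  have b: "\<bar>bump_deriv a j y - bump_deriv a j x\<bar> \<le> (fact j * K ^ j * R * 9) * \<bar>y - x\<bar>\<^sup>2" for y
  proof (cases "\<bar>y\<bar> < 1")
   case True
   define D where "D = 1 - y\<^sup>2"
   have D: "0 < D" using True by (auto simp: D_def abs_square_less_1)
   have "x\<^sup>2 = 1" using 3 by (metis one_power2 power2_abs)
   then have "D = (x - y) * (x + y)" by (simp add: D_def power2_eq_square algebra_simps)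
   then have "D = \<bar>y - x\<bar> * \<bar>x + y\<bar>" using D by (metis abs_mult abs_of_pos abs_minus_commute)
   also have "\<dots> \<le> \<bar>y - x\<bar> * 3" using True 3 by (intro mult_left_mono) auto
   finally have "D\<^sup>2 \<le> (\<bar>y - x\<bar> * 3)\<^sup>2" using D by (intro power_mono) auto
   then have D2: "D\<^sup>2 \<le> 9 * \<bar>y - x\<bar>\<^sup>2" by (simp add: power_mult_distrib)
   have "(1 / D) ^ j * exp (- (1 / (2 * D ^ a))) = D\<^sup>2 * ((1 / D) ^ (j + 2) * exp (- (1 / (2 * D ^ a))))"
    using D by (simp add: power_add power_divide field_simps power2_eq_square)
   also have "\<dots> \<le> D\<^sup>2 * R"
    unfolding R_def by (intro mult_left_mono inverse_power_exp_bound[OF D assms]) auto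
   also have "\<dots> \<le> (9 * \<bar>y - x\<bar>\<^sup>2) * R"
    using D2 R by (intro mult_right_mono) auto
   finally have e: "(1 / D) ^ j * exp (- (1 / (2 * D ^ a))) \<le> (9 * \<bar>y - x\<bar>\<^sup>2) * R" .
   have "\<bar>bump_deriv a j y\<bar> \<le> fact j * K ^ j * ((1 / D) ^ j * exp (- (1 / (2 * D ^ a))))"
    unfolding D_def by (rule K(2)[OF True])
   also have "\<dots> \<le> fact j * K ^ j * ((9 * \<bar>y - x\<bar>\<^sup>2) * R)"
    using K(1) by (intro mult_left_mono e) auto
   finally show ?thesis using 3 by (simp add: bump_deriv_def mult_ac)
  next
   case False
   then show ?thesis using 3 K(1) R by (simp add: bump_deriv_def)
  qed
  have "bump_deriv a (Suc j) x = 0" using 3 by (simp add: bump_deriv_def)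
  with has_real_derivative_zeroI[OF b] show ?thesis by simp
 qed
qed

section \<open>Cutoffs with control of all derivatives\<close>

definition is_cutoff :: "real => (nat => real => real) => bool" where
 "is_cutoff L \<psi> \<longleftrightarrow> (\<forall>j x. (\<psi> j has_real_derivative \<psi> (Suc j) x) (at x)) \<and>
  (\<forall>x. \<bar>x\<bar> \<le> 2 * L --> \<psi> 0 x = 1) \<and> (\<forall>j x. \<bar>x\<bar> \<le> 2 * L --> \<psi> (Suc j) x = 0) \<and>
  (\<forall>j x. \<bar>x\<bar> \<ge> 4 * L --> \<psi> j x = 0)"

text \<open>An antiderivative of the bump is a step of Gevrey order 1 + 1/a, and the difference of
  two translated steps is a plateau. Any a > 1 / (s - 1) brings the order down to at most s.\<close>

lemma gevrey_cutoff_exists: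
 assumes "s > 1" "L > 0"
 shows "\<exists>\<psi>. is_cutoff L \<psi> \<and> (\<exists>H>0. \<forall>j x. \<bar>\<psi> j x\<bar> \<le> H ^ Suc j * fact j powr s)"
proof -
 obtain a :: nat where a: "1 / (s - 1) < real a" using reals_Archimedean2 by blast
 have a0: "real a > 0" using a assms by (meson diff_gt_0_iff_gt less_trans zero_less_divide_1_iff)
 then have a1: "a > 0" by simp
 have as: "1 + 1 / real a \<le> s" using a a0 assms by (simp add: field_simps)
 obtain H0 where H0: "H0 > 0" "\<And>j x. \<bar>bump_deriv a j x\<bar> \<le> H0 ^ j * fact j powr (1 + 1 / real a)"
  by (rule bump_deriv_bound[OF a1]) blast
 have out: "bump_deriv a j x = 0" if "\<bar>x\<bar> \<ge> 1" for j x using that by (simp add: bump_deriv_def)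
 have cont: "continuous_on UNIV (bump_deriv a j)" for j
  using bump_deriv_has_derivative[OF a1] by (auto intro!: continuous_at_imp_continuous_on DERIV_isCont)
 have "\<exists>F. \<forall>x::real. -\<infinity> < ereal x --> ereal x < \<infinity> --> (F has_vector_derivative bump_deriv a 0 x) (at x)"
  by (rule einterval_antiderivative) (use cont in \<open>auto simp: continuous_on_eq_continuous_at\<close>)
 then obtain F where F: "\<And>x. (F has_real_derivative bump_deriv a 0 x) (at x)"
  by (auto simp: has_real_derivative_iff_has_vector_derivative)
 have contF: "continuous_on S F" for S
  using F by (auto intro!: continuous_at_imp_continuous_on DERIV_isCont)
 have F1: "F x = F 1" if "x \<ge> 1" for x
 proof (cases "x = 1")
  case False
  with that have "1 < x" by simp
  then show ?thesis
   by (rule DERIV_isconst_end[OF _ contF]) (use F out in \<open>force intro: DERIV_cong\<close>)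
 qed simp
 have Fm1: "F x = F (-1)" if "x \<le> -1" for x
 proof (cases "x = -1")
  case False
  with that have "x < -1" by simp
  then have "F (-1) = F x"
   by (rule DERIV_isconst_end[OF _ contF]) (use F out in \<open>force intro: DERIV_cong\<close>)
  then show ?thesis by simp
 qed simp
 have nonneg: "bump_deriv a 0 x \<ge> 0" and pos: "\<bar>x\<bar> < 1 ==> bump_deriv a 0 x > 0" for x
  by (auto simp: bump_deriv_def bump_fun_of_real)
 have mono: "F x \<le> F y" if "x \<le> y" for x y
  using that by (rule DERIV_nonneg_imp_nondecreasing) (use F nonneg in blast)
 have "F (-1) < F 1"
  by (rule DERIV_pos_imp_increasing_open[OF _ _ contF]) (use F pos in \<open>auto simp: abs_less_iff\<close>)
 define I where "I = F 1 - F (-1)"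
 have I: "I > 0" using \<open>F (-1) < F 1\<close> by (simp add: I_def)
 have range: "F (-1) \<le> F x" "F x \<le> F 1" for x
 proof -
  show "F (-1) \<le> F x" using mono[of "-1" x] Fm1[of x] by linarith
  show "F x \<le> F 1" using mono[of x 1] F1[of x] by linarith
 qed
 \<comment> \<open>\<open>F\<close> varies only on [-1, 1]. The shifts by 3 place the two
   transitions where |x| / L lies between 2 and 4, so the value is 1 for |x| <= 2 L and 0 for |x| >=
   4 L.\<close>
 define \<psi> where "\<psi> j x = (case j of 0 => (F (x / L + 3) - F (x / L - 3)) / I
   | Suc i => (bump_deriv a i (x / L + 3) - bump_deriv a i (x / L - 3)) / (I * L ^ Suc i))" for j x
 define H where "H = 1 + H0 / L + 2 / I + 1 / L"
 have H: "H \<ge> 1" "H \<ge> H0 / L" "H \<ge> 2 / I" "H \<ge> 1 / L" using H0 I assms by (auto simp: H_def)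
 have chain: "((\<lambda>x. g (x / L + c)) has_real_derivative g' (x / L + c) / L) (at x)"
  if "\<And>x. (g has_real_derivative g' x) (at x)" for g g' :: "real => real" and c x
 proof -
  have "((\<lambda>x. x / L + c) has_real_derivative 1 / L) (at x)"
   using DERIV_add[OF DERIV_cdivide[OF DERIV_ident, of L x UNIV] DERIV_const[of c]] by simp
  from DERIV_chain2[OF that this] show ?thesis by simp
 qed
 have chain': "((\<lambda>x. g (x / L - c)) has_real_derivative g' (x / L - c) / L) (at x)"
  if "\<And>x. (g has_real_derivative g' x) (at x)" for g g' :: "real => real" and c x
  using chain[OF that, of "- c" x] by simp
 show ?thesis
  unfolding is_cutoff_def
 proof (intro exI[of _ \<psi>] exI[of _ H] conjI allI impI)
  show "H > 0" using H by simp
 next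
  fix j x
  show "(\<psi> j has_real_derivative \<psi> (Suc j) x) (at x)"
  proof (cases j)
   case 0
   have "((\<lambda>x. (F (x / L + 3) - F (x / L - 3)) / I) has_real_derivative
     (bump_deriv a 0 (x / L + 3) / L - bump_deriv a 0 (x / L - 3) / L) / I) (at x)"
    by (intro DERIV_cdivide DERIV_diff chain chain' F)
   then show ?thesis using 0 by (simp add: \<psi>_def[abs_def] diff_divide_distrib mult.commute)
  next
   case (Suc i)
   have "((\<lambda>x. (bump_deriv a i (x / L + 3) - bump_deriv a i (x / L - 3)) / (I * L ^ Suc i)) has_real_derivative
     (bump_deriv a (Suc i) (x / L + 3) / L - bump_deriv a (Suc i) (x / L - 3) / L) / (I * L ^ Suc i)) (at x)"
    by (intro DERIV_cdivide DERIV_diff chain chain' bump_deriv_has_derivative a1)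
   then show ?thesis using Suc by (simp add: \<psi>_def[abs_def] diff_divide_distrib mult_ac)
  qed
 next
  fix j x
  show "\<bar>\<psi> j x\<bar> \<le> H ^ Suc j * fact j powr s"
  proof (cases j)
   case 0
   have "\<bar>F (x / L + 3) - F (x / L - 3)\<bar> \<le> I"
    using range[of "x / L + 3"] range[of "x / L - 3"] by (auto simp: I_def)
   then have "\<bar>\<psi> j x\<bar> \<le> 1" using 0 I by (simp add: \<psi>_def)
   then show ?thesis using 0 H by simp
  next
   case (Suc i)
   have "\<bar>bump_deriv a i (x / L + 3) - bump_deriv a i (x / L - 3)\<bar> \<le> 2 * (H0 ^ i * fact i powr (1 + 1 / real a))"
    using H0(2)[of i "x / L + 3"] H0(2)[of i "x / L - 3"] by linarith
   also have "\<dots> \<le> 2 * (H0 ^ i * fact (Suc i) powr s)"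
   proof -
    have "fact i powr (1 + 1 / real a) \<le> fact i powr s"
     using as by (intro powr_mono) auto
    also have "\<dots> \<le> fact (Suc i) powr s"
     using assms by (intro powr_mono2 fact_mono) auto
    finally show ?thesis using H0 by (intro mult_left_mono) auto
   qed
   finally have "\<bar>\<psi> j x\<bar> \<le> 2 * (H0 ^ i * fact (Suc i) powr s) / (I * L ^ Suc i)"
    using Suc I assms by (simp add: \<psi>_def abs_divide abs_mult divide_right_mono)
   also have "\<dots> = (2 / I) * (1 / L) * (H0 / L) ^ i * fact j powr s"
    using Suc by (simp add: power_divide)
   also have "\<dots> \<le> H * H * H ^ i * fact j powr s"
    using H H0 I assms by (intro mult_right_mono mult_mono power_mono) auto
   finally show ?thesis using Suc by (simp add: mult_ac)
  qed
 next
  fix x :: real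
  assume x: "\<bar>x\<bar> \<le> 2 * L"
  then have x1: "x / L + 3 \<ge> 1" "x / L - 3 \<le> -1"
   using assms by (auto simp: field_simps abs_le_iff)
  show "\<psi> 0 x = 1"
   using F1[OF x1(1)] Fm1[OF x1(2)] I by (simp add: \<psi>_def I_def)
  show "\<psi> (Suc j) x = 0" for j
   using out[of "x / L + 3" j] out[of "x / L - 3" j] x1 by (simp add: \<psi>_def)
 next
  fix j and x :: real
  assume x: "\<bar>x\<bar> \<ge> 4 * L"
  then consider "x / L + 3 \<ge> 1" "x / L - 3 \<ge> 1" | "x / L + 3 \<le> -1" "x / L - 3 \<le> -1"
  proof (cases "x \<ge> 0")
   case True
   with x have "4 \<le> x / L" using assms by (simp add: pos_le_divide_eq)
   then show ?thesis by (intro that(1)) simp_all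
  next
   case False
   with x have "x / L \<le> -4" using assms by (simp add: pos_divide_le_eq)
   then show ?thesis by (intro that(2)) simp_all
  qed
  then show "\<psi> j x = 0"
  proof cases
   case 1
   then show ?thesis using F1[OF 1(1)] F1[OF 1(2)] out[of "x / L + 3"] out[of "x / L - 3"] by (cases j) (simp_all add: \<psi>_def)
  next
   case 2
   then show ?thesis using Fm1[OF 2(1)] Fm1[OF 2(2)] out[of "x / L + 3"] out[of "x / L - 3"] by (cases j) (simp_all add: \<psi>_def)
  qed
 qed
qed

definition gevrey_cutoff :: "real => real => nat => real => real" where
 "gevrey_cutoff s L = (SOME \<psi>. is_cutoff L \<psi> \<and> (\<exists>H>0. \<forall>j x. \<bar>\<psi> j x\<bar> \<le> H ^ Suc j * fact j powr s))"

lemma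
 assumes "s > 1" "L > 0"
 shows is_cutoff_gevrey_cutoff: "is_cutoff L (gevrey_cutoff s L)"
  and gevrey_cutoff_bound: "\<exists>H>0. \<forall>j x. \<bar>gevrey_cutoff s L j x\<bar> \<le> H ^ Suc j * fact j powr s"
 using someI_ex[OF gevrey_cutoff_exists[OF assms]] unfolding gevrey_cutoff_def by blast+

subsection \<open>Linear ordinary differential equations\<close>

lemma vector_derivative_bound_general:
 fixes f :: "real => 'a::real_normed_vector"
 assumes "a \<le> b"
  and f: "\<And>x. x \<in> {a..b} ==> (f has_vector_derivative f' x) (at x within {a..b})"
  and g: "\<And>x. x \<in> {a..b} ==> (g has_real_derivative g' x) (at x within {a..b})"
  and le: "\<And>x. x \<in> {a..b} ==> norm (f' x) \<le> g' x"
 shows "norm (f b - f a) \<le> g b - g a"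
proof (cases "a = b")
 case False
 with assms have ab: "a < b" by simp
 show ?thesis
 proof (rule differentiable_bound_general[OF ab, where f' = f' and \<phi>' = g'])
  show "continuous_on {a..b} f"
   using has_vector_derivative_continuous[OF f] by (simp add: continuous_on_eq_continuous_within)
  show "continuous_on {a..b} g"
   using DERIV_continuous[OF g] by (simp add: continuous_on_eq_continuous_within)
  show "(f has_vector_derivative f' x) (at x)" if "a < x" "x < b" for x
   using f[of x] that by (simp add: at_within_Icc_at)
  show "(g has_vector_derivative g' x) (at x)" if "a < x" "x < b" for x
   using g[of x] that by (simp add: at_within_Icc_at has_real_derivative_iff_has_vector_derivative)
  show "norm (f' x) \<le> g' x" if "a < x" "x < b" for x
   using le[of x] that by simp
 qed
qed simp

lemma has_real_derivative_cmod_square: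
 assumes "(v has_vector_derivative v') (at t within S)"
 shows "((\<lambda>t. (cmod (v t))\<^sup>2) has_real_derivative 2 * Re (cnj (v t) * v')) (at t within S)"
proof -
 have 1: "((\<lambda>t. Re (v t)) has_real_derivative Re v') (at t within S)"
  using bounded_linear.has_vector_derivative[OF bounded_linear_Re assms]
  by (simp add: has_real_derivative_iff_has_vector_derivative)
 have 2: "((\<lambda>t. Im (v t)) has_real_derivative Im v') (at t within S)"
  using bounded_linear.has_vector_derivative[OF bounded_linear_Im assms]
  by (simp add: has_real_derivative_iff_has_vector_derivative)
 have "((\<lambda>t. (Re (v t))\<^sup>2 + (Im (v t))\<^sup>2) has_real_derivative 2 * Re (cnj (v t) * v')) (at t within S)"
  by (rule derivative_eq_intros 1 2 refl)+ (simp add: algebra_simps)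
 then show ?thesis by (simp add: cmod_power2)
qed

text \<open>The real rotation speeds \<open>\<theta>\<close> do not affect the growth of the moduli.\<close>

lemma gronwall_skew:
 fixes v h :: "'a => real => complex"
 assumes I: "finite I" and \<kappa>: "\<kappa> \<ge> 0" and t: "t \<in> {0..T}"
  and d: "\<And>a t. a \<in> I ==> t \<in> {0..T} ==>
   (v a has_vector_derivative (\<i> * cor (\<theta> a t) * v a t + h a t)) (at t within {0..T})"
  and h: "\<And>a t. a \<in> I ==> t \<in> {0..T} ==> cmod (h a t) \<le> \<kappa> * (\<Sum>b\<in>I. cmod (v b t))"
 shows "(\<Sum>a\<in>I. (cmod (v a t))\<^sup>2) \<le> (\<Sum>a\<in>I. (cmod (v a 0))\<^sup>2) * exp (2 * \<kappa> * real (card I) * t)"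
proof -
 define c where "c = 2 * \<kappa> * real (card I)"
 define S where "S t = (\<Sum>a\<in>I. (cmod (v a t))\<^sup>2)" for t
 define S' where "S' t = (\<Sum>a\<in>I. 2 * Re (cnj (v a t) * (\<i> * cor (\<theta> a t) * v a t + h a t)))" for t
 have S: "(S has_real_derivative S' t) (at t within {0..T})" if "t \<in> {0..T}" for t
  unfolding S_def[abs_def] S'_def by (intro DERIV_sum has_real_derivative_cmod_square d that)
 have le: "S' t \<le> c * S t" if t: "t \<in> {0..T}" for t
 proof -
  have "S' t \<le> (\<Sum>a\<in>I. 2 * (cmod (v a t) * (\<kappa> * (\<Sum>b\<in>I. cmod (v b t)))))"
   unfolding S'_def
  proof (rule sum_mono)
   fix a assume a: "a \<in> I"
   \<comment> \<open>The rotation contributes the real part of \<i> \<theta> |v|^2, which is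
     0.\<close>
   have "Re (cnj (v a t) * (\<i> * cor (\<theta> a t) * v a t + h a t)) = Re (cnj (v a t) * h a t)"
    by (simp add: algebra_simps)
   also have "\<dots> \<le> cmod (cnj (v a t) * h a t)" by (rule complex_Re_le_cmod)
   also have "\<dots> \<le> cmod (v a t) * (\<kappa> * (\<Sum>b\<in>I. cmod (v b t)))"
    unfolding norm_mult complex_mod_cnj by (intro mult_left_mono h a t) auto
   finally show "2 * Re (cnj (v a t) * (\<i> * cor (\<theta> a t) * v a t + h a t))
     \<le> 2 * (cmod (v a t) * (\<kappa> * (\<Sum>b\<in>I. cmod (v b t))))" by simp
  qed
  also have "\<dots> = 2 * \<kappa> * (\<Sum>b\<in>I. cmod (v b t))\<^sup>2"
   by (simp add: power2_eq_square sum_distrib_left sum_distrib_right mult_ac)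
  also have "\<dots> \<le> 2 * \<kappa> * (real (card I) * S t)"
  proof (rule mult_left_mono)
   show "(\<Sum>b\<in>I. cmod (v b t))\<^sup>2 \<le> real (card I) * S t"
    unfolding S_def using Cauchy_Schwarz_ineq_sum[of "\<lambda>_. 1" "\<lambda>b. cmod (v b t)" I] by simp
  qed (use \<kappa> in simp)
  finally show ?thesis by (simp add: c_def mult_ac)
 qed
 \<comment> \<open>The mean value bound is applied to the zero function with majorant - S exp (- c
   t); it then says that S exp (- c t) does not increase.\<close>
 have "norm (0 - (0::real)) \<le> - (S t * exp (- c * t)) - (- (S 0 * exp (- c * 0)))"
 proof (rule vector_derivative_bound_general[where f = "\<lambda>_. 0" and f' = "\<lambda>_. 0" and a = 0 and b = t and g = "\<lambda>t. - (S t * exp (- c * t))"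
    and g' = "\<lambda>t. - (S' t * exp (- c * t) + S t * (exp (- c * t) * (- c)))"])
  show "0 \<le> t" using t by simp
  fix x assume "x \<in> {0..t}"
  then have x: "x \<in> {0..T}" using t by auto
  show "((\<lambda>t. - (S t * exp (- c * t))) has_real_derivative - (S' x * exp (- c * x) + S x * (exp (- c * x) * (- c)))) (at x within {0..t})"
   by (rule derivative_eq_intros refl DERIV_subset[OF S[OF x]] | use t in force)+
  have "(S' x - c * S x) * exp (- c * x) \<le> 0"
   using le[OF x] by (intro mult_nonpos_nonneg) auto
  then show "norm (0::real) \<le> - (S' x * exp (- c * x) + S x * (exp (- c * x) * (- c)))"
   by (simp add: algebra_simps)
 qed auto
 then have "S t * exp (- c * t) \<le> S 0" by simp
 then have "S t * exp (- c * t) * exp (c * t) \<le> S 0 * exp (c * t)"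
  by (rule mult_right_mono) simp
 also have "S t * exp (- c * t) * exp (c * t) = S t"
  by (simp add: mult.assoc flip: exp_add)
 finally show ?thesis
  by (simp add: S_def c_def)
qed

text \<open>Picard iteration. Measured against the weight exp (2 K t), successive differences
  contract by 1/2 on the whole interval, so no continuation from short intervals is
  required.\<close>

lemma ode_lipschitz_exists:
 fixes F :: "real => 'a::euclidean_space => 'a"
 assumes T: "T > 0" and K: "K > 0"
  and cont: "\<And>y. continuous_on {0..T} y ==> continuous_on {0..T} (\<lambda>t. F t (y t))"
  and lip: "\<And>t x y. t \<in> {0..T} ==> norm (F t x - F t y) \<le> K * norm (x - y)"
 obtains y where "y 0 = a" "\<And>t. t \<in> {0..T} ==> (y has_vector_derivative F t (y t)) (at t within {0..T})"
proof -
 define Y where "Y = rec_nat (\<lambda>_. a) (\<lambda>_ y t. a + integral {0..t} (\<lambda>\<tau>. F \<tau> (y \<tau>)))"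
 have Y0: "Y 0 = (\<lambda>_. a)" and YS: "Y (Suc k) = (\<lambda>t. a + integral {0..t} (\<lambda>\<tau>. F \<tau> (Y k \<tau>)))" for k
  by (simp_all add: Y_def)
 have YS0: "Y k 0 = a" for k by (cases k) (simp_all add: Y0 YS)
 have step: "(Y (Suc k) has_vector_derivative F t (Y k t)) (at t within {0..T})"
  if "continuous_on {0..T} (Y k)" "t \<in> {0..T}" for k t
  unfolding YS
  by (rule derivative_eq_intros refl integral_has_vector_derivative cont that)+ simp
 have Yc: "continuous_on {0..T} (Y k)" for k
 proof (induction k)
  case (Suc k)
  show ?case
   using has_vector_derivative_continuous[OF step[OF Suc]] by (simp add: continuous_on_eq_continuous_within)
 qed (simp add: Y0)
 note step = step[OF Yc]
 obtain C where C: "\<And>t. t \<in> {0..T} ==> norm (F t a) \<le> C" and C0: "C \<ge> 0"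
 proof -
  have "compact ((\<lambda>t. F t a) ` {0..T})"
   by (intro compact_continuous_image cont) auto
  then obtain C where "\<And>x. x \<in> (\<lambda>t. F t a) ` {0..T} ==> norm x \<le> C"
   using compact_imp_bounded bounded_iff by metis
  then show ?thesis using that[of "max C 0"] by force
 qed
 have bound: "norm (Y (Suc k) t - Y k t) \<le> (C / (2 * K)) * (1 / 2) ^ k * exp (2 * K * t)" if "t \<in> {0..T}" for k t
  using that
 proof (induction k arbitrary: t)
  case 0
  have "norm (Y (Suc 0) t - Y (Suc 0) 0) \<le> (C / (2 * K)) * exp (2 * K * t) - (C / (2 * K)) * exp (2 * K * 0)"
  proof (rule vector_derivative_bound_general[where f = "Y (Suc 0)" and g = "\<lambda>t. C / (2 * K) * exp (2 * K * t)" and a = 0 and b = t and f' = "\<lambda>t. F t (Y 0 t)" and g' = "\<lambda>t. C * exp (2 * K * t)"])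
   fix x assume x: "x \<in> {0..t}"
   then have x': "x \<in> {0..T}" using 0 by auto
   show "(Y (Suc 0) has_vector_derivative F x (Y 0 x)) (at x within {0..t})"
    by (rule has_vector_derivative_within_subset[OF step[OF x']]) (use 0 in auto)
   show "((\<lambda>t. C / (2 * K) * exp (2 * K * t)) has_real_derivative C * exp (2 * K * x)) (at x within {0..t})"
    using K by (auto intro!: derivative_eq_intros)
   have "C * 1 \<le> C * exp (2 * K * x)" using K x C0 by (intro mult_left_mono) auto
   then show "norm (F x (Y 0 x)) \<le> C * exp (2 * K * x)"
    using C[OF x'] by (simp add: Y0)
  qed (use 0 in auto)
  moreover have "C / (2 * K) \<ge> 0" using C0 K by simp
  ultimately show ?case by (simp add: YS0 Y0)
 next
  case (Suc k)
  let ?D = "C / (2 * K) * (1 / 2) ^ Suc k"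
  have "norm ((Y (Suc (Suc k)) t - Y (Suc k) t) - (Y (Suc (Suc k)) 0 - Y (Suc k) 0)) \<le> ?D * exp (2 * K * t) - ?D * exp (2 * K * 0)"
  proof (rule vector_derivative_bound_general[where f = "\<lambda>t. Y (Suc (Suc k)) t - Y (Suc k) t" and g = "\<lambda>t. ?D * exp (2 * K * t)" and a = 0 and b = t and f' = "\<lambda>t. F t (Y (Suc k) t) - F t (Y k t)" and g' = "\<lambda>t. 2 * K * ?D * exp (2 * K * t)"])
   fix x assume x: "x \<in> {0..t}"
   then have x': "x \<in> {0..T}" using Suc.prems by auto
   show "((\<lambda>t. Y (Suc (Suc k)) t - Y (Suc k) t) has_vector_derivative F x (Y (Suc k) x) - F x (Y k x)) (at x within {0..t})"
    by (rule has_vector_derivative_within_subset[OF has_vector_derivative_diff[OF step step]]) (use Suc.prems x in auto)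
   show "((\<lambda>t. ?D * exp (2 * K * t)) has_real_derivative 2 * K * ?D * exp (2 * K * x)) (at x within {0..t})"
    by (auto intro!: derivative_eq_intros)
   have "norm (F x (Y (Suc k) x) - F x (Y k x)) \<le> K * norm (Y (Suc k) x - Y k x)" by (rule lip[OF x'])
   also have "\<dots> \<le> K * (C / (2 * K) * (1 / 2) ^ k * exp (2 * K * x))"
    using Suc.IH[OF x'] K by (intro mult_left_mono) auto
   also have "\<dots> = 2 * K * ?D * exp (2 * K * x)" by simp
   finally show "norm (F x (Y (Suc k) x) - F x (Y k x)) \<le> 2 * K * ?D * exp (2 * K * x)" .
  qed (use Suc.prems in auto)
  moreover have "?D \<ge> 0" using C0 K by simp
  ultimately show ?case by (simp add: YS0)
 qed
 have bound': "norm (Y (Suc k) t - Y k t) \<le> (C / (2 * K)) * exp (2 * K * T) * (1 / 2) ^ k" if "t \<in> {0..T}" for k t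
 proof -
  have "(C / (2 * K)) * (1 / 2) ^ k * exp (2 * K * t) \<le> (C / (2 * K)) * (1 / 2) ^ k * exp (2 * K * T)"
   using that C0 K by (intro mult_left_mono) auto
  with bound[OF that, of k] show ?thesis by (simp add: mult_ac)
 qed
 define y where "y t = a + (\<Sum>k. Y (Suc k) t - Y k t)" for t
 have "uniform_limit {0..T} (\<lambda>n t. \<Sum>i<n. Y (Suc i) t - Y i t) (\<lambda>t. \<Sum>i. Y (Suc i) t - Y i t) sequentially"
  by (rule Weierstrass_m_test[OF bound']) (auto intro!: summable_mult summable_geometric)
 then have "uniform_limit {0..T} (\<lambda>n t. a + (\<Sum>i<n. Y (Suc i) t - Y i t)) y sequentially"
  unfolding y_def by (intro uniform_limit_add uniform_limit_const)
 moreover have "(\<Sum>i<n. Y (Suc i) t - Y i t) = Y n t - a" for n t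
  by (subst sum_lessThan_telescope) (simp add: Y0)
 ultimately have ul: "uniform_limit {0..T} Y y sequentially" by (simp add: fun_eq_iff)
 have yc: "continuous_on {0..T} y"
  by (rule uniform_limit_theorem[OF _ ul]) (auto simp: Yc)
 have ulF: "uniform_limit {0..T} (\<lambda>n t. F t (Y n t)) (\<lambda>t. F t (y t)) sequentially"
 proof (rule uniform_limitI)
  fix e :: real assume "e > 0"
  then have "e / K > 0" using K by simp
  from uniform_limitD[OF ul this]
  show "\<forall>\<^sub>F n in sequentially. \<forall>x\<in>{0..T}. dist (F x (Y n x)) (F x (y x)) < e"
  proof (rule eventually_mono, intro ballI)
   fix n x assume "\<forall>x\<in>{0..T}. dist (Y n x) (y x) < e / K" and x: "x \<in> {0..T}"
   then have "K * norm (Y n x - y x) < e" using K by (auto simp: dist_norm field_simps)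
   then show "dist (F x (Y n x)) (F x (y x)) < e"
    using lip[OF x, of "Y n x" "y x"] by (simp add: dist_norm)
  qed
 qed
 have yint: "y t = a + integral {0..t} (\<lambda>\<tau>. F \<tau> (y \<tau>))" if t: "t \<in> {0..T}" for t
 proof -
  have sub: "{0..t} \<subseteq> {0..T}" using t by auto
  obtain I J where I: "\<And>n. ((\<lambda>\<tau>. F \<tau> (Y n \<tau>)) has_integral I n) {0..t}"
   and J: "((\<lambda>\<tau>. F \<tau> (y \<tau>)) has_integral J) {0..t}" and IJ: "I \<longlonglongrightarrow> J"
   by (rule uniform_limit_integral[OF uniform_limit_on_subset[OF ulF sub]])
     (auto intro: continuous_on_subset[OF cont[OF Yc] sub])
  have "(\<lambda>n. a + I n) \<longlonglongrightarrow> a + J" by (intro tendsto_intros IJ)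
  moreover have "a + I n = Y (Suc n) t" for n
   unfolding YS using integral_unique[OF I[of n]] by simp
  ultimately have "(\<lambda>n. Y (Suc n) t) \<longlonglongrightarrow> a + J" by simp
  moreover have "(\<lambda>n. Y (Suc n) t) \<longlonglongrightarrow> y t"
   using tendsto_uniform_limitI[OF ul t] by (rule LIMSEQ_Suc)
  ultimately have "y t = a + J" by (metis LIMSEQ_unique)
  then show ?thesis using integral_unique[OF J] by simp
 qed
 show ?thesis
 proof (rule that[of y])
  show "y 0 = a" using yint[of 0] T by simp
  fix t assume t: "t \<in> {0..T}"
  have "((\<lambda>t. a + integral {0..t} (\<lambda>\<tau>. F \<tau> (y \<tau>))) has_vector_derivative F t (y t)) (at t within {0..T})"
   by (rule derivative_eq_intros refl integral_has_vector_derivative cont yc t)+ simp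
  then show "(y has_vector_derivative F t (y t)) (at t within {0..T})"
   by (rule has_vector_derivative_transform[OF t, rotated]) (use yint in auto)
 qed
qed

subsection \<open>The characteristic polynomial\<close>

text \<open>\<open>poly_act P q v\<close> is \<open>q(P) v\<close>, evaluated by Horner's scheme.\<close>

definition poly_act :: "complex^'m^'m::finite => complex poly => complex^'m => complex^'m" where
 "poly_act P q v = fold_coeffs (\<lambda>a w. a *s v + P *v w) q 0"

lemma poly_act_0 [simp]: "poly_act P 0 v = 0"
 by (simp add: poly_act_def)

lemma poly_act_pCons: "poly_act P (pCons a q) v = a *s v + P *v poly_act P q v"
proof (cases "a = 0 \<and> q = 0")
 case True
 then show ?thesis by (simp add: poly_act_def)
next
 case False
 then show ?thesis by (auto simp: poly_act_def)
qed

lemma poly_act_add: "poly_act P (p + q) v = poly_act P p v + poly_act P q v"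
 by (induction p q rule: poly_induct2)
   (simp_all add: poly_act_pCons matrix_vector_right_distrib vec.scale_left_distrib)

lemma poly_act_smult: "poly_act P (smult a q) v = a *s poly_act P q v"
 by (induction q)
   (simp_all add: poly_act_pCons vec.scale_right_distrib vector_scalar_commute vec.scale)

lemma poly_act_mult: "poly_act P (p * q) v = poly_act P p (poly_act P q v)"
proof (induction p)
 case (pCons a p)
 then show ?case
  by (simp add: mult_pCons_left poly_act_add poly_act_smult poly_act_pCons)
qed simp

lemma poly_act_vec_0 [simp]: "poly_act P q 0 = 0"
 by (induction q) (simp_all add: poly_act_pCons)

lemma poly_act_vec_add: "poly_act P q (v + w) = poly_act P q v + poly_act P q w"
 by (induction q) (simp_all add: poly_act_pCons matrix_vector_right_distrib vec.scale_right_distrib)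

lemma poly_act_vec_smult: "poly_act P q (c *s v) = c *s poly_act P q v"
 by (induction q) (simp_all add: poly_act_pCons vec.scale_right_distrib vector_scalar_commute vec.scale mult.commute)

lemma poly_act_sum: "poly_act P (\<Sum>i\<in>I. f i) v = (\<Sum>i\<in>I. poly_act P (f i) v)"
 by (induction I rule: infinite_finite_induct) (simp_all add: poly_act_add)

lemma poly_act_vec_sum: "poly_act P q (\<Sum>i\<in>I. f i) = (\<Sum>i\<in>I. poly_act P q (f i))"
 by (induction I rule: infinite_finite_induct) (simp_all add: poly_act_vec_add)

text \<open>The cofactor as a full determinant with one row replaced by a unit vector;
  multilinearity in that row then replaces any sign bookkeeping.\<close>

definition cofac :: "'a::comm_ring_1^'m^'m::finite => 'm => 'm => 'a" where
 "cofac Q i k = det (\<chi> r. if r = i then axis k 1 else Q $ r)"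

text \<open>By linearity in row i the sum is the determinant of \<open>Q\<close> with row i replaced
  by row j: either \<open>Q\<close> itself or a matrix with two equal rows.\<close>

lemma cofac_expansion: "(\<Sum>k\<in>UNIV. Q $ j $ k * cofac Q i k) = (if i = j then det Q else 0)"
proof -
 have "(\<Sum>k\<in>UNIV. Q $ j $ k * cofac Q i k) = (\<Sum>k\<in>UNIV. det (\<chi> r. if r = i then Q $ j $ k *s axis k 1 else Q $ r))"
  unfolding cofac_def by (simp add: det_row_mul)
 also have "\<dots> = det (\<chi> r. if r = i then (\<Sum>k\<in>UNIV. Q $ j $ k *s axis k 1) else Q $ r)"
  by (subst det_linear_row_sum) auto
 also have "(\<Sum>k\<in>UNIV. Q $ j $ k *s axis k 1) = Q $ j"
  by (rule basis_expansion)
 also have "det (\<chi> r. if r = i then Q $ j else Q $ r) = (if i = j then det Q else 0)"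
 proof (cases "i = j")
  case True
  then have "(\<chi> r. if r = i then Q $ j else Q $ r) = Q" by (simp add: vec_eq_iff)
  then show ?thesis using True by simp
 next
  case False
  then have "det (\<chi> r. if r = i then Q $ j else Q $ r) = 0"
   by (intro det_identical_rows[of i j]) (auto simp: row_def vec_eq_iff)
  then show ?thesis using False by simp
 qed
 finally show ?thesis .
qed

text \<open>For Q = X - P the entries Q $ j $ k, acting on the unit vectors e_j and summed over j,
  give P e_k - P e_k = 0. Applying the cofactors to these relations and summing over k produces det
  Q acting on e_i.\<close>

lemma cayley_hamilton:
 fixes P :: "complex^'m^'m::finite"
 shows "poly_act P (charpoly P) v = 0"
proof -
 define Q :: "complex poly^'m^'m" where "Q = (\<chi> i j. (if i = j then [:0, 1:] else 0) - [:P $ i $ j:])"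
 have cp: "charpoly P = det Q" by (simp add: charpoly_def Q_def)
 have Pe: "P *v axis k 1 = (\<Sum>j\<in>UNIV. P $ j $ k *s axis j 1)" for k
  by (simp add: vec_eq_iff matrix_vector_mult_def axis_def if_distrib cong: if_cong)
 have zero: "(\<Sum>j\<in>UNIV. poly_act P (Q $ j $ k) (axis j 1)) = 0" for k
 proof -
  have "poly_act P (Q $ j $ k) (axis j 1) = (if j = k then P *v axis k 1 else 0) - P $ j $ k *s axis j 1" for j
  proof -
   have "Q $ j $ k = (if j = k then [:0, 1:] else 0) + [:- P $ j $ k:]"
    by (simp add: Q_def)
   then show ?thesis
    by (simp add: poly_act_add poly_act_pCons)
  qed
  then show ?thesis by (simp add: sum_subtractf Pe)
 qed
 have e: "poly_act P (det Q) (axis i 1) = 0" for i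
 proof -
  have "poly_act P (det Q) (axis i 1) = (\<Sum>j\<in>UNIV. poly_act P (\<Sum>k\<in>UNIV. Q $ j $ k * cofac Q i k) (axis j 1))"
   by (simp add: cofac_expansion if_distrib[of "\<lambda>p. poly_act P p _"] cong: if_cong)
  also have "\<dots> = (\<Sum>j\<in>UNIV. \<Sum>k\<in>UNIV. poly_act P (cofac Q i k) (poly_act P (Q $ j $ k) (axis j 1)))"
   by (simp add: poly_act_sum mult.commute[of "Q $ _ $ _"] poly_act_mult)
  also have "\<dots> = (\<Sum>k\<in>UNIV. poly_act P (cofac Q i k) (\<Sum>j\<in>UNIV. poly_act P (Q $ j $ k) (axis j 1)))"
   by (subst sum.swap) (simp add: poly_act_vec_sum)
  also have "\<dots> = 0" by (simp add: zero)
  finally show ?thesis .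
 qed
 have "poly_act P (det Q) v = poly_act P (det Q) (\<Sum>i\<in>UNIV. v $ i *s axis i 1)"
  by (simp add: basis_expansion)
 also have "\<dots> = 0"
  by (simp add: poly_act_vec_sum poly_act_vec_smult e)
 finally show ?thesis by (simp add: cp)
qed

lemma poly_det:
 fixes Q :: "'a::comm_ring_1 poly^'m^'m::finite"
 shows "poly (det Q) z = det (\<chi> i j. poly (Q $ i $ j) z)"
 by (simp add: det_def poly_sum poly_prod)

lemma poly_charpoly: "poly (charpoly P) z = det (mat z - P)"
proof -
 have "(\<chi> i j. poly ((if i = j then [:0, 1:] else 0) - [:P $ i $ j:]) z) = mat z - P"
  by (simp add: vec_eq_iff mat_def)
 then show ?thesis by (simp add: charpoly_def poly_det)
qed

text \<open>The eigenvector equation is read in the coordinate where the eigenvector is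
  largest.\<close>

lemma eigenvalue_bound:
 fixes P :: "complex^'m^'m::finite"
 assumes "poly (charpoly P) z = 0"
 shows "cmod z \<le> (\<Sum>i\<in>UNIV. \<Sum>j\<in>UNIV. cmod (P $ i $ j))"
proof -
 have "\<not> invertible (mat z - P)"
  using assms by (simp add: invertible_det_nz poly_charpoly)
 then obtain x where x: "(mat z - P) *v x = 0" "x \<noteq> 0"
  unfolding invertible_left_inverse matrix_left_invertible_ker by blast
 have "mat z *v x = z *s x"
  by (simp add: vec_eq_iff matrix_vector_mult_def mat_def if_distrib if_distribR cong: if_cong)
 with x have Px: "P *v x = z *s x"
  by (simp add: matrix_vector_mult_diff_rdistrib)
 define N where "N = Max (range (\<lambda>i. cmod (x $ i)))"
 have le: "cmod (x $ i) \<le> N" for i by (simp add: N_def)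
 have "N \<in> range (\<lambda>i. cmod (x $ i))" unfolding N_def by (intro Max_in) auto
 then obtain k where k: "cmod (x $ k) = N" by auto
 have "N > 0"
 proof -
  obtain i where "x $ i \<noteq> 0" using x(2) by (auto simp: vec_eq_iff)
  then show ?thesis using le[of i] by (meson less_le_trans zero_less_norm_iff)
 qed
 have "cmod z * N = cmod ((P *v x) $ k)" by (simp add: Px norm_mult k)
 also have "\<dots> \<le> (\<Sum>j\<in>UNIV. cmod (P $ k $ j) * N)"
  unfolding matrix_vector_mult_def by (simp add: norm_mult, intro order_trans[OF norm_sum] sum_mono)
    (simp add: norm_mult mult_left_mono le)
 also have "\<dots> = (\<Sum>j\<in>UNIV. cmod (P $ k $ j)) * N" by (simp add: sum_distrib_right)
 finally have "cmod z \<le> (\<Sum>j\<in>UNIV. cmod (P $ k $ j))" using \<open>N > 0\<close> by simp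
 also have "\<dots> \<le> (\<Sum>i\<in>UNIV. \<Sum>j\<in>UNIV. cmod (P $ i $ j))"
  by (rule member_le_sum[where f = "\<lambda>i. \<Sum>j\<in>UNIV. cmod (P $ i $ j)"]) (auto intro: sum_nonneg)
 finally show ?thesis .
qed

text \<open>The new factor stands on the right, matching the recursion of
  \<open>time_deriv_mat\<close>, to which these powers are compared.\<close>

primrec mat_pow :: "complex^'m^'m::finite => nat => complex^'m^'m" where
 "mat_pow P 0 = mat 1"
| "mat_pow P (Suc k) = mat_pow P k ** P"

lemma mat_pow_commute: "P ** mat_pow P k = mat_pow P k ** P"
 by (induction k) (simp_all add: matrix_mul_assoc)

lemma matrix_vector_mult_sum:
 fixes P :: "'a::comm_semiring_1^'n^'m"
 shows "P *v (\<Sum>i\<in>I. f i) = (\<Sum>i\<in>I. P *v f i)"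
 by (induction I rule: infinite_finite_induct) (simp_all add: matrix_vector_right_distrib)

lemma poly_act_eq_sum:
 "degree q \<le> n ==> poly_act P q v = (\<Sum>l\<le>n. coeff q l *s (mat_pow P l *v v))"
proof (induction q arbitrary: n)
 case (pCons a q)
 show ?case
 proof (cases n)
  case 0
  with pCons.prems have "q = 0" by (simp split: if_splits)
  then show ?thesis using 0 by (simp add: poly_act_pCons)
 next
  case (Suc k)
  then have "degree q \<le> k" using pCons.prems by (auto split: if_splits)
  then have "poly_act P (pCons a q) v = a *s v + P *v (\<Sum>l\<le>k. coeff q l *s (mat_pow P l *v v))"
   by (simp add: poly_act_pCons pCons.IH)
  also have "P *v (\<Sum>l\<le>k. coeff q l *s (mat_pow P l *v v)) = (\<Sum>l\<le>k. coeff q l *s (mat_pow P (Suc l) *v v))"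
   by (simp add: matrix_vector_mult_sum vector_scalar_commute matrix_vector_mul_assoc mat_pow_commute)
  also have "a *s v + \<dots> = (\<Sum>l\<le>n. coeff (pCons a q) l *s (mat_pow P l *v v))"
   unfolding Suc sum.atMost_Suc_shift by simp
  finally show ?thesis .
 qed
qed simp

text \<open>The leading coefficient of the characteristic polynomial is irrelevant: it is enough that
 the polynomial is nonzero.\<close>

lemma ordered_real_eigenvalues_props:
 fixes P :: "complex^'m^'m::finite"
 assumes "ordered_real_eigenvalues P l"
 shows "\<And>j. 1 \<le> j ==> j \<le> CARD('m) ==> \<bar>l j\<bar> \<le> (\<Sum>i\<in>UNIV. \<Sum>j\<in>UNIV. cmod (P $ i $ j))"
  and "(\<Sum>k\<le>CARD('m). coeff (\<Prod>j\<in>{1..CARD('m)}. [:- cor (l j), 1:]) k * mat_pow P k $ a $ b) = 0"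
proof -
 have pr: "proots (charpoly P) = image_mset (\<lambda>j. cor (l j)) (mset_set {1..CARD('m)})"
  using assms by (simp add: ordered_real_eigenvalues_def)
 have nz: "charpoly P \<noteq> 0"
 proof
  assume "charpoly P = 0"
  then have "image_mset (\<lambda>j. cor (l j)) (mset_set {1..CARD('m)}) = {#}"
   using pr by simp
  then show False by (simp add: mset_set_empty_iff)
 qed
 show "\<bar>l j\<bar> \<le> (\<Sum>i\<in>UNIV. \<Sum>j\<in>UNIV. cmod (P $ i $ j))" if "1 \<le> j" "j \<le> CARD('m)" for j
 proof -
  have "cor (l j) \<in># proots (charpoly P)"
   unfolding pr using that by auto
  then have "poly (charpoly P) (cor (l j)) = 0" using nz by simp
  from eigenvalue_bound[OF this] show ?thesis by simp
 qed
 define p where "p = (\<Prod>j\<in>{1..CARD('m)}. [:- cor (l j), 1:])"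
 have "smult (lead_coeff (charpoly P)) (\<Prod>x\<in>#proots (charpoly P). [:-x, 1:]) = charpoly P"
  by (rule complex_poly_decompose_multiset)
 then have "charpoly P = smult (lead_coeff (charpoly P)) p"
  unfolding pr by (simp add: p_def prod_unfold_prod_mset multiset.map_comp o_def)
 then have "lead_coeff (charpoly P) *s poly_act P p (axis b 1) = 0"
  using cayley_hamilton[of P "axis b 1"] by (metis poly_act_smult)
 then have act: "poly_act P p (axis b 1) = 0" using nz by simp
 have deg: "degree p \<le> CARD('m)"
  unfolding p_def using degree_prod_sum_le[of "{1..CARD('m)}" "\<lambda>j. [:- cor (l j), 1:]"] by simp
 have "(\<Sum>k\<le>CARD('m). coeff p k *s (mat_pow P k *v axis b 1)) $ a = 0"
  using poly_act_eq_sum[OF deg, of P "axis b 1"] act by simp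
 then show "(\<Sum>k\<le>CARD('m). coeff (\<Prod>j\<in>{1..CARD('m)}. [:- cor (l j), 1:]) k * mat_pow P k $ a $ b) = 0"
  by (simp add: p_def matrix_vector_mul_component inner_axis matrix_vector_mult_def axis_def if_distrib cong: if_cong)
qed

subsection \<open>Symbols\<close>

text \<open>Families with k derivatives in t, all of growth order d in the weight
  \<open>Lam\<close>, uniformly in the parameter. Differentiation in t does not change the order d,
  and the recursion on k lets sums and products be treated by the derivative rules.\<close>

primrec symb :: "real => ('a => real) => nat => nat => ('a => real => complex) => bool" where
 "symb T Lam 0 d f \<longleftrightarrow> (\<exists>C. \<forall>x. \<forall>t\<in>{0..T}. cmod (f x t) \<le> C * Lam x ^ d)"
| "symb T Lam (Suc k) d f \<longleftrightarrow> (\<exists>C. \<forall>x. \<forall>t\<in>{0..T}. cmod (f x t) \<le> C * Lam x ^ d) \<and>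
   (\<exists>f'. (\<forall>x. \<forall>t\<in>{0..T}. (f x has_vector_derivative f' x t) (at t within {0..T})) \<and> symb T Lam k d f')"

lemma symb_0: "symb T Lam k d f ==> symb T Lam 0 d f"
 by (cases k) auto

lemma symb_bound:
 assumes "symb T Lam k d f" "\<And>x. Lam x \<ge> 1"
 obtains C where "C \<ge> 0" "\<And>x t. t \<in> {0..T} ==> cmod (f x t) \<le> C * Lam x ^ d"
proof -
 obtain C where C: "\<And>x t. t \<in> {0..T} ==> cmod (f x t) \<le> C * Lam x ^ d"
  using symb_0[OF assms(1)] unfolding symb.simps by blast
 show ?thesis
 proof (rule that[of "max C 0"])
  fix x t assume "t \<in> {0..T}"
  then have "cmod (f x t) \<le> C * Lam x ^ d" by (rule C)
  also have "\<dots> \<le> max C 0 * Lam x ^ d"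
   using assms(2)[of x] by (intro mult_right_mono) auto
  finally show "cmod (f x t) \<le> max C 0 * Lam x ^ d" .
 qed simp
qed

lemma symb_Suc: "symb T Lam (Suc k) d f ==> symb T Lam k d f"
proof (induction k arbitrary: f)
 case 0
 then show ?case by simp
next
 case (Suc k)
 from Suc.prems obtain f' where "\<forall>x. \<forall>t\<in>{0..T}. (f x has_vector_derivative f' x t) (at t within {0..T})" "symb T Lam (Suc k) d f'"
  unfolding symb.simps(2)[of _ _ "Suc k"] by blast
 with Suc.IH[of f'] symb_0[OF Suc.prems] show ?case unfolding symb.simps by blast
qed

lemma symb_le: "symb T Lam k d f ==> k' \<le> k ==> symb T Lam k' d f"
 by (induction k) (auto simp: le_Suc_eq dest: symb_Suc simp del: symb.simps)

lemma symb_cong: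
 assumes "\<And>x t. t \<in> {0..T} ==> f x t = g x t" "symb T Lam k d f"
 shows "symb T Lam k d g"
proof (cases k)
 case (Suc k')
 obtain f' where f': "\<forall>x. \<forall>t\<in>{0..T}. (f x has_vector_derivative f' x t) (at t within {0..T})" "symb T Lam k' d f'"
  using assms(2) unfolding Suc symb.simps by blast
 have "(g x has_vector_derivative f' x t) (at t within {0..T})" if "t \<in> {0..T}" for x t
  by (rule has_vector_derivative_transform[OF that _ f'(1)[rule_format, OF that]]) (simp add: assms(1))
 moreover have "symb T Lam 0 d g"
  using symb_0[OF assms(2)] assms(1) by auto
 ultimately show ?thesis using f'(2) unfolding Suc symb.simps by blast
qed (use assms in auto)

lemma symb_deriv:
 assumes "T > 0" "symb T Lam (Suc k) d f"
 shows "\<And>x t. t \<in> {0..T} ==> (f x has_vector_derivative vector_derivative (f x) (at t within {0..T})) (at t within {0..T})"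
  and "symb T Lam k d (\<lambda>x t. vector_derivative (f x) (at t within {0..T}))"
proof -
 obtain f' where f': "\<And>x t. t \<in> {0..T} ==> (f x has_vector_derivative f' x t) (at t within {0..T})" "symb T Lam k d f'"
  using assms(2) unfolding symb.simps by blast
 have eq: "vector_derivative (f x) (at t within {0..T}) = f' x t" if "t \<in> {0..T}" for x t
  by (rule vector_derivative_within_closed_interval[OF assms(1) that f'(1)[OF that]])
 show "(f x has_vector_derivative vector_derivative (f x) (at t within {0..T})) (at t within {0..T})" if "t \<in> {0..T}" for x t
  using f'(1)[OF that] eq[OF that] by simp
 show "symb T Lam k d (\<lambda>x t. vector_derivative (f x) (at t within {0..T}))"
  by (rule symb_cong[OF _ f'(2)]) (simp add: eq)
qed

lemma symb_SucI:
 assumes "symb T Lam 0 d f" "symb T Lam k d f'"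
  and "\<And>x t. t \<in> {0..T} ==> (f x has_vector_derivative f' x t) (at t within {0..T})"
 shows "symb T Lam (Suc k) d f"
 using assms by (auto intro!: exI[of _ f'])

lemma symb_add:
 assumes L: "\<And>x. Lam x \<ge> 1"
 shows "symb T Lam k d f ==> symb T Lam k d g ==> symb T Lam k d (\<lambda>x t. f x t + g x t)"
proof (induction k arbitrary: f g)
 case b: (0 f g)
 obtain C where C: "\<And>x t. t \<in> {0..T} ==> cmod (f x t) \<le> C * Lam x ^ d" using b(1) unfolding symb.simps by blast
 obtain C' where C': "\<And>x t. t \<in> {0..T} ==> cmod (g x t) \<le> C' * Lam x ^ d" using b(2) unfolding symb.simps by blast
 have "cmod (f x t + g x t) \<le> (C + C') * Lam x ^ d" if "t \<in> {0..T}" for x t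
  using norm_triangle_ineq[of "f x t" "g x t"] C[OF that, of x] C'[OF that, of x] by (simp add: distrib_right)
 then show ?case unfolding symb.simps by blast
next
 case (Suc k f g)
 obtain f' where f': "\<And>x t. t \<in> {0..T} ==> (f x has_vector_derivative f' x t) (at t within {0..T})" "symb T Lam k d f'"
  using Suc.prems unfolding symb.simps by blast
 obtain g' where g': "\<And>x t. t \<in> {0..T} ==> (g x has_vector_derivative g' x t) (at t within {0..T})" "symb T Lam k d g'"
  using Suc.prems unfolding symb.simps by blast
 have "symb T Lam 0 d (\<lambda>x t. f x t + g x t)"
  using Suc.IH[OF Suc.prems[THEN symb_Suc]] by (rule symb_0)
 moreover have "symb T Lam k d (\<lambda>x t. f' x t + g' x t)" by (intro Suc.IH f' g')
 moreover have "\<And>x t. t \<in> {0..T} ==> ((\<lambda>t. f x t + g x t) has_vector_derivative f' x t + g' x t) (at t within {0..T})"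
  by (intro has_vector_derivative_add f' g')
 ultimately show ?case by (rule symb_SucI)
qed

lemma symb_mult:
 assumes L: "\<And>x. Lam x \<ge> 1"
 shows "symb T Lam k d f ==> symb T Lam k e g ==> symb T Lam k (d + e) (\<lambda>x t. f x t * g x t)"
proof (induction k arbitrary: f g)
 case b: (0 f g)
 obtain C where C: "C \<ge> 0" "\<And>x t. t \<in> {0..T} ==> cmod (f x t) \<le> C * Lam x ^ d" using symb_bound[OF b(1) L] by metis
 obtain C' where C': "C' \<ge> 0" "\<And>x t. t \<in> {0..T} ==> cmod (g x t) \<le> C' * Lam x ^ e" using symb_bound[OF b(2) L] by metis
 have L0: "0 \<le> Lam x" for x using L[of x] by simp
 have "cmod (f x t * g x t) \<le> (C * C') * Lam x ^ (d + e)" if "t \<in> {0..T}" for x t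
  using mult_mono[OF C(2)[OF that, of x] C'(2)[OF that, of x]] C(1) L0[of x]
  by (simp add: norm_mult power_add mult_ac)
 then show ?case unfolding symb.simps by blast
next
 case (Suc k f g)
 obtain f' where f': "\<And>x t. t \<in> {0..T} ==> (f x has_vector_derivative f' x t) (at t within {0..T})" "symb T Lam k d f'"
  using Suc.prems unfolding symb.simps by blast
 obtain g' where g': "\<And>x t. t \<in> {0..T} ==> (g x has_vector_derivative g' x t) (at t within {0..T})" "symb T Lam k e g'"
  using Suc.prems unfolding symb.simps by blast
 have "symb T Lam 0 (d + e) (\<lambda>x t. f x t * g x t)"
  using Suc.IH[OF Suc.prems[THEN symb_Suc]] by (rule symb_0)
 moreover have "symb T Lam k (d + e) (\<lambda>x t. f x t * g' x t + f' x t * g x t)"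
  by (intro symb_add[OF L] Suc.IH f' g' Suc.prems[THEN symb_Suc])
 moreover have "\<And>x t. t \<in> {0..T} ==> ((\<lambda>t. f x t * g x t) has_vector_derivative f x t * g' x t + f' x t * g x t) (at t within {0..T})"
  by (intro has_vector_derivative_mult f' g')
 ultimately show ?case by (rule symb_SucI)
qed

lemma symb_const_time:
 assumes "\<And>x. cmod (f x) \<le> C * Lam x ^ d"
 shows "symb T Lam k d (\<lambda>x t. f x)"
 using assms
proof (induction k arbitrary: f C)
 case (Suc k f C)
 have "symb T Lam k d (\<lambda>x t. 0)"
 proof (rule Suc.IH[of "\<lambda>_. 0" C])
  show "cmod 0 \<le> C * Lam x ^ d" for x using order_trans[OF norm_ge_zero Suc.prems] by simp
 qed
 then show ?case
  using Suc.prems by (auto intro!: exI[of _ C] exI[of _ "\<lambda>x t. 0"])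
qed auto

lemma symb_cmult:
 assumes "\<And>x. Lam x \<ge> 1" "symb T Lam k d f"
 shows "symb T Lam k d (\<lambda>x t. c * f x t)"
 using symb_mult[OF assms(1) symb_const_time[of "\<lambda>_. c" "cmod c" Lam 0] assms(2)] by simp

lemma symb_diff:
 assumes L: "\<And>x. Lam x \<ge> 1" and "symb T Lam k d f" "symb T Lam k d g"
 shows "symb T Lam k d (\<lambda>x t. f x t - g x t)"
 using symb_add[OF L assms(2) symb_cmult[OF L assms(3), of "-1"]] by simp

lemma symb_sum:
 assumes L: "\<And>x. Lam x \<ge> 1" and "\<And>i. i \<in> I ==> symb T Lam k d (f i)"
 shows "symb T Lam k d (\<lambda>x t. \<Sum>i\<in>I. f i x t)"
 using assms(2)
proof (induction I rule: infinite_finite_induct)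
 case (insert i I)
 then show ?case by (simp add: symb_add[OF L])
qed (use symb_const_time[of "\<lambda>_. 0" 0 Lam d] in simp_all)

lemma symb_of_Ck_on:
 assumes "Ck_on n {0..T} f"
 shows "symb T Lam n 0 (\<lambda>x. f)"
proof -
 obtain D where D: "\<And>t. t \<in> {0..T} ==> D 0 t = f t"
  "\<And>j t. j < n ==> t \<in> {0..T} ==> (D j has_vector_derivative D (Suc j) t) (at t within {0..T})"
  "\<And>j. j \<le> n ==> continuous_on {0..T} (D j)"
  using assms unfolding Ck_on_def by blast
 \<comment> \<open>Induction on the number k of derivatives still available, from the last
   derivative \<open>D n\<close> back to \<open>D 0\<close>.\<close>
 have "symb T Lam k 0 (\<lambda>x::'a. D (n - k))" if "k \<le> n" for k
  using that
 proof (induction k)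
  case 0
  have "bounded (D n ` {0..T})"
   by (intro compact_imp_bounded compact_continuous_image D(3)) auto
  then obtain C where "\<And>z. z \<in> D n ` {0..T} ==> cmod z \<le> C" by (auto simp: bounded_iff)
  then show ?case by auto
 next
  case (Suc k)
  have "bounded (D (n - Suc k) ` {0..T})"
   by (intro compact_imp_bounded compact_continuous_image D(3)) auto
  then obtain C where "\<And>z. z \<in> D (n - Suc k) ` {0..T} ==> cmod z \<le> C" by (auto simp: bounded_iff)
  moreover have "(D (n - Suc k) has_vector_derivative D (n - k) t) (at t within {0..T})" if "t \<in> {0..T}" for t
  proof -
   have "Suc (n - Suc k) = n - k" using Suc.prems by simp
   then show ?thesis using D(2)[of "n - Suc k" t] Suc.prems that by simp
  qed
  ultimately show ?case using Suc
   by (intro symb_SucI[where f' = "\<lambda>_. D (n - k)"]) auto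
 qed
 from this[of n] have "symb T Lam n 0 (\<lambda>x::'a. D 0)" by simp
 then show ?thesis by (rule symb_cong[rotated]) (simp add: D(1))
qed

subsection \<open>The energy estimate for the Fourier modes\<close>

abbreviation lin :: "complex => complex poly" where "lin x \<equiv> [:- x, 1:]"

lemma coeff_lin_mult: "coeff (lin x * q) k = (if k = 0 then 0 else coeff q (k - 1)) - x * coeff q k"
 by (cases k) (simp_all add: mult_pCons_left)

lemma degree_prod_lin_le: "finite S ==> degree (\<Prod>j\<in>S. lin (x j)) \<le> card S"
 using degree_prod_sum_le[of S "\<lambda>j. lin (x j)"] by simp

text \<open>The product rule read coefficientwise: differentiating the root x_j replaces the factor
  X - x_j by the constant - x_j'.\<close>

lemma coeff_prod_lin_deriv:
 assumes "finite S" and "\<And>j. j \<in> S ==> (x j has_vector_derivative x' j) (at t within A)"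
 shows "((\<lambda>t. coeff (\<Prod>j\<in>S. lin (x j t)) k) has_vector_derivative
  coeff (\<Sum>j\<in>S. smult (- x' j) (\<Prod>i\<in>S - {j}. lin (x i t))) k) (at t within A)"
 using assms
proof (induction S arbitrary: k rule: finite_induct)
 case (insert a S)
 let ?P = "\<lambda>t. \<Prod>j\<in>S. lin (x j t)"
 let ?P' = "\<Sum>j\<in>S. smult (- x' j) (\<Prod>i\<in>S - {j}. lin (x i t))"
 have IH: "((\<lambda>t. coeff (?P t) k) has_vector_derivative coeff ?P' k) (at t within A)" for k
  by (rule insert.IH) (use insert.prems in auto)
 have xa: "(x a has_vector_derivative x' a) (at t within A)" using insert.prems by simp
 have "(\<Sum>j\<in>S. smult (- x' j) (\<Prod>i\<in>insert a S - {j}. lin (x i t))) = (\<Sum>j\<in>S. smult (- x' j) (lin (x a t) * (\<Prod>i\<in>S - {j}. lin (x i t))))"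
 proof (rule sum.cong)
  fix j assume "j \<in> S"
  then have "insert a S - {j} = insert a (S - {j})" using insert.hyps by auto
  then show "smult (- x' j) (\<Prod>i\<in>insert a S - {j}. lin (x i t)) = smult (- x' j) (lin (x a t) * (\<Prod>i\<in>S - {j}. lin (x i t)))"
   using insert.hyps by simp
 qed simp
 also have "\<dots> = lin (x a t) * ?P'"
  by (simp add: sum_distrib_left del: mult_pCons_left)
 finally have d: "(\<Sum>j\<in>insert a S. smult (- x' j) (\<Prod>i\<in>insert a S - {j}. lin (x i t))) = smult (- x' a) (?P t) + lin (x a t) * ?P'"
  using insert.hyps by (simp del: mult_pCons_left)
 have p: "(\<Prod>j\<in>insert a S. lin (x j t)) = lin (x a t) * ?P t" for t
  using insert.hyps by simp
 have m: "((\<lambda>t. x a t * coeff (?P t) k) has_vector_derivative x a t * coeff ?P' k + x' a * coeff (?P t) k) (at t within A)"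
  by (intro has_vector_derivative_mult xa IH)
 have "((\<lambda>t. (if k = 0 then 0 else coeff (?P t) (k - 1)) - x a t * coeff (?P t) k) has_vector_derivative
   (if k = 0 then 0 else coeff ?P' (k - 1)) - (x a t * coeff ?P' k + x' a * coeff (?P t) k)) (at t within A)"
 proof (cases "k = 0")
  case True
  show ?thesis
   using has_vector_derivative_diff[OF has_vector_derivative_const[of 0] m] by (simp only: True if_True refl)
 next
  case False
  then show ?thesis
   using has_vector_derivative_diff[OF IH[of "k - 1"] m] by (simp only: if_False)
 qed
 then show ?case
  unfolding d p coeff_lin_mult coeff_add coeff_smult by (simp add: algebra_simps del: mult_pCons_left)
qed simp

text \<open>The difference of both sides vanishes at all nodes, which are more numerous than its
  degree.\<close>

lemma lagrange_interpolation:
 assumes S: "finite S" and inj: "inj_on x S" and deg: "degree q < card S"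
 shows "q = (\<Sum>l\<in>S. smult (poly q (x l) / poly (\<Prod>i\<in>S - {l}. lin (x i)) (x l)) (\<Prod>i\<in>S - {l}. lin (x i)))"
  (is "q = (\<Sum>l\<in>S. smult (?c l) (?P l))")
proof (rule ccontr)
 define d where "d = q - (\<Sum>l\<in>S. smult (?c l) (?P l))"
 assume "\<not> ?thesis"
 then have "d \<noteq> 0" by (simp add: d_def)
 have P0: "poly (?P l) (x k) = 0" if "k \<in> S" "l \<in> S" "k \<noteq> l" for k l
  using that S by (auto simp: poly_prod intro!: prod_zero)
 have P1: "poly (?P l) (x l) \<noteq> 0" if "l \<in> S" for l
  using that S inj by (auto simp: poly_prod dest: inj_onD)
 have "poly d (x k) = 0" if k: "k \<in> S" for k
 proof -
  have "poly (\<Sum>l\<in>S. smult (?c l) (?P l)) (x k) = (\<Sum>l\<in>S. ?c l * poly (?P l) (x k))"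
   by (simp add: poly_sum)
  also have "\<dots> = (\<Sum>l\<in>S. if l = k then poly q (x k) else 0)"
   by (intro sum.cong refl) (use k P0 P1 in auto)
  finally show ?thesis using k S by (simp add: d_def)
 qed
 then have sub: "x ` S \<subseteq> {z. poly d z = 0}" by auto
 have "degree (smult (?c l) (?P l)) \<le> card S - 1" if "l \<in> S" for l
  using that S degree_prod_lin_le[of "S - {l}" x] by (auto intro: order_trans[OF degree_smult_le])
 then have "degree d \<le> card S - 1"
  unfolding d_def using deg S by (intro degree_diff_le degree_sum_le) auto
 then have "degree d < card S" using deg by linarith
 have "card S = card (x ` S)" using inj by (simp add: card_image)
 also have "\<dots> \<le> card {z. poly d z = 0}"
  by (intro card_mono poly_roots_finite \<open>d \<noteq> 0\<close> sub)
 also have "\<dots> \<le> degree d" by (rule card_poly_roots_bound[OF \<open>d \<noteq> 0\<close>])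
 finally show False using \<open>degree d < card S\<close> by simp
qed

text \<open>Energy estimate for a scalar equation \<open>p(t, D\<^sub>t) w = f\<close>: the roots of \<open>p\<close> are replaced by nearby
 separated \<open>C\<^sup>1\<close> roots \<open>mu\<close>, and the Lagrange basis of the new nodes, applied to \<open>w\<close>, diagonalises the
 equation up to the errors measured by the constant \<open>\<kappa>\<close>.\<close>

lemma sylvester_energy:
 fixes w :: "nat => 'i::finite => real => complex" and lam mu mu' :: "nat => real => real"
 assumes m: "m \<ge> 1" and g: "g > 0" and c1: "c1 \<ge> 0" and D: "D \<ge> 0" and r: "r \<ge> 0"
  and gap: "\<And>i j t. i \<in> {1..m} ==> j \<in> {1..m} ==> i \<noteq> j ==> t \<in> {0..T} ==> g \<le> \<bar>mu i t - mu j t\<bar>"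
  and dmu: "\<And>j t. j \<in> {1..m} ==> t \<in> {0..T} ==> (mu j has_real_derivative mu' j t) (at t within {0..T})"
  and bmu: "\<And>j t. j \<in> {1..m} ==> t \<in> {0..T} ==> \<bar>mu' j t\<bar> \<le> D"
  and near: "\<And>j t. j \<in> {1..m} ==> t \<in> {0..T} ==> \<bar>mu j t - lam j t\<bar> \<le> c1 * g"
  and w: "\<And>k i t. k < m ==> t \<in> {0..T} ==> (w k i has_vector_derivative \<i> * w (Suc k) i t) (at t within {0..T})"
  and R: "\<And>i t. t \<in> {0..T} ==>
   cmod (\<Sum>k\<le>m. coeff (\<Prod>j\<in>{1..m}. lin (cor (lam j t))) k * w k i t) \<le> r * (\<Sum>j\<in>UNIV. cmod (w 0 j t))"
 defines "v \<equiv> \<lambda>l i t. \<Sum>k<m. coeff (\<Prod>j\<in>{1..m} - {l}. lin (cor (mu j t))) k * w k i t"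
  and "\<kappa> \<equiv> r / g ^ (m - 1) + c1 * g * (1 + c1) ^ (m - 1) + D / g * real (m + 1)"
 assumes t: "t \<in> {0..T}"
 shows "(\<Sum>(l, i)\<in>{1..m} \<times> UNIV. (cmod (v l i t))\<^sup>2)
   \<le> (\<Sum>(l, i)\<in>{1..m} \<times> UNIV. (cmod (v l i 0))\<^sup>2) * exp (2 * \<kappa> * real (m * CARD('i)) * t)"
  and "cmod (w 0 i t) \<le> (\<Sum>l\<in>{1..m}. cmod (v l i t)) / g ^ (m - 1)"
proof -
 define S where "S = {1..m}"
 have S: "finite S" "card S = m" by (auto simp: S_def)
 \<comment> \<open>\<open>ev q\<close> is q(\<open>D\<^sub>t\<close>) applied to component i: the
   power X^k is replaced by \<open>w k\<close>, which by hypothesis is the k-th derivative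
   \<open>D\<^sub>t\<close> of \<open>w 0\<close>.\<close>
 define ev where "ev q i t = (\<Sum>k\<le>m. coeff q k * w k i t)" for q i t
 have ev_add: "ev (p + q) i t = ev p i t + ev q i t" for p q i t
  by (simp add: ev_def distrib_right sum.distrib)
 have ev_smult: "ev (smult c q) i t = c * ev q i t" for c q i t
  by (simp add: ev_def sum_distrib_left mult.assoc)
 have ev_sum: "ev (\<Sum>a\<in>A. f a) i t = (\<Sum>a\<in>A. ev (f a) i t)" for f :: "nat => complex poly" and A i t
  by (induction A rule: infinite_finite_induct) (simp_all add: ev_add, simp_all add: ev_def)
 define x where "x j t = cor (mu j t)" for j t
 define P where "P l t = (\<Prod>j\<in>S - {l}. lin (x j t))" for l t
 have degP: "degree (P l t) \<le> m - 1" if "l \<in> S" for l t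
  unfolding P_def using degree_prod_lin_le[of "S - {l}" "\<lambda>j. x j t"] S that by simp
 have v_ev: "v l i t = ev (P l t) i t" if "l \<in> S" for l i t
 proof -
  have "coeff (P l t) m = 0" using degP[OF that, of t] m by (intro coeff_eq_0) simp
  moreover have "{..m} = insert m {..<m}" by auto
  ultimately have "ev (P l t) i t = (\<Sum>k<m. coeff (P l t) k * w k i t)"
   by (simp add: ev_def)
  then show ?thesis by (simp add: v_def P_def S_def x_def)
 qed
 have gap': "g \<le> cmod (x i t - x j t)" if "i \<in> S" "j \<in> S" "i \<noteq> j" "t \<in> {0..T}" for i j t
  using gap[of i j t] that by (simp add: S_def x_def norm_of_real flip: of_real_diff)
 have inj: "inj_on (\<lambda>j. x j t) S" if "t \<in> {0..T}" for t
  using gap'[OF _ _ _ that] g by (intro inj_onI) force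
 have Pl: "poly (P l t) (x l t) = (\<Prod>j\<in>S - {l}. x l t - x j t)" for l t
  by (simp add: P_def poly_prod)
 have Plb: "g ^ (m - 1) \<le> cmod (poly (P l t) (x l t))" if "l \<in> S" "t \<in> {0..T}" for l t
 proof -
  have "(\<Prod>j\<in>S - {l}. g) \<le> (\<Prod>j\<in>S - {l}. cmod (x l t - x j t))"
   by (rule prod_mono) (use g gap' that in auto)
  then show ?thesis using that S by (simp add: Pl prod_norm)
 qed
 have lagr: "ev q i t = (\<Sum>l\<in>S. poly q (x l t) / poly (P l t) (x l t) * v l i t)"
  if "degree q < m" "t \<in> {0..T}" for q i t
 proof -
  have "ev q i t = ev (\<Sum>l\<in>S. smult (poly q (x l t) / poly (P l t) (x l t)) (P l t)) i t"
   using lagrange_interpolation[OF S(1) inj[OF that(2)], of q] that S by (simp add: P_def)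
  also have "\<dots> = (\<Sum>l\<in>S. poly q (x l t) / poly (P l t) (x l t) * v l i t)"
   by (simp add: ev_sum ev_smult v_ev)
  finally show ?thesis .
 qed
 have w0: "cmod (w 0 i t) \<le> (\<Sum>l\<in>S. cmod (v l i t)) / g ^ (m - 1)" if "t \<in> {0..T}" for i t
 proof -
  have "w 0 i t = ev 1 i t"
  proof -
   have "(\<Sum>k\<le>m. coeff 1 k * w k i t) = (\<Sum>k\<le>m. if k = 0 then w 0 i t else 0)"
    by (intro sum.cong) auto
   then show ?thesis by (simp add: ev_def)
  qed
  also have "\<dots> = (\<Sum>l\<in>S. poly 1 (x l t) / poly (P l t) (x l t) * v l i t)"
   by (rule lagr) (use m that in auto)
  also have "cmod \<dots> \<le> (\<Sum>l\<in>S. cmod (v l i t) / g ^ (m - 1))"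
  proof (intro order_trans[OF norm_sum] sum_mono)
   fix l assume "l \<in> S"
   have "cmod (v l i t) / cmod (poly (P l t) (x l t)) \<le> cmod (v l i t) / g ^ (m - 1)"
    by (rule frac_le) (use Plb[OF \<open>l \<in> S\<close> that] g in simp_all)
   then show "cmod (poly 1 (x l t) / poly (P l t) (x l t) * v l i t) \<le> cmod (v l i t) / g ^ (m - 1)"
    by (simp add: norm_mult norm_divide)
  qed
  finally show ?thesis by (simp add: sum_divide_distrib)
 qed
 then show "cmod (w 0 i t) \<le> (\<Sum>l\<in>{1..m}. cmod (v l i t)) / g ^ (m - 1)"
  using t by (simp add: S_def)
 define pt where "pt t = (\<Prod>j\<in>S. lin (x j t))" for t
 define pl where "pl t = (\<Prod>j\<in>S. lin (cor (lam j t)))" for t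
 \<comment> \<open>Three errors remain besides the rotation with speed \<open>mu l\<close>: the
   value of the original equation, the exchange of its roots for the nodes, and the motion of the
   nodes.\<close>
 define h where "h l i t = \<i> * ev (pl t) i t + \<i> * ev (pt t - pl t) i t
   - (\<Sum>j\<in>S - {l}. cor (mu' j t) / (x l t - x j t) * (v l i t - v j i t))" for l i t
 have dv: "(v l i has_vector_derivative \<i> * cor (mu l t) * v l i t + h l i t) (at t within {0..T})"
  if l: "l \<in> S" and t: "t \<in> {0..T}" for l i t
 proof -
  define P' where "P' = (\<Sum>j\<in>S - {l}. smult (- cor (mu' j t)) (\<Prod>i\<in>S - {l} - {j}. lin (x i t)))"
  have dx: "(x j has_vector_derivative cor (mu' j t)) (at t within {0..T})" if "j \<in> S" for j
   unfolding x_def using dmu[of j t] that t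
   by (intro has_vector_derivative_of_real) (auto simp: S_def has_real_derivative_iff_has_vector_derivative)
  have dP: "((\<lambda>t. coeff (P l t) k) has_vector_derivative coeff P' k) (at t within {0..T})" for k
   unfolding P_def P'_def by (rule coeff_prod_lin_deriv) (use S dx in auto)
  have d1: "((\<lambda>t. \<Sum>k<m. coeff (P l t) k * w k i t) has_vector_derivative
    (\<Sum>k<m. coeff (P l t) k * (\<i> * w (Suc k) i t) + coeff P' k * w k i t)) (at t within {0..T})"
   by (intro has_vector_derivative_sum has_vector_derivative_mult dP w t) auto
  have e2: "(\<lambda>t. \<Sum>k<m. coeff (P l t) k * w k i t) = v l i"
   by (simp add: v_def P_def S_def x_def fun_eq_iff)
  have e3: "(\<Sum>k<m. coeff (P l t) k * (\<i> * w (Suc k) i t) + coeff P' k * w k i t)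
    = \<i> * ev (pCons 0 (P l t)) i t + ev P' i t"
  proof -
   have 1: "ev (pCons 0 (P l t)) i t = (\<Sum>k<m. coeff (P l t) k * w (Suc k) i t)"
   proof -
    obtain m' where m': "m = Suc m'" using m by (cases m) auto
    show ?thesis
     unfolding ev_def m' sum.atMost_Suc_shift by (simp add: lessThan_Suc_atMost)
   qed
   have "degree P' \<le> m - 1"
    unfolding P'_def
   proof (rule degree_sum_le)
    fix j assume "j \<in> S - {l}"
    have "card (S - {l} - {j}) \<le> m - 1" using S l by (metis card_Diff1_le card_Diff_singleton finite_Diff)
    then show "degree (smult (- cor (mu' j t)) (\<Prod>i\<in>S - {l} - {j}. lin (x i t))) \<le> m - 1"
     using degree_prod_lin_le[of "S - {l} - {j}" "\<lambda>i. x i t"] S by (meson degree_smult_le finite_Diff order_trans)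
   qed (use S in auto)
   then have "coeff P' m = 0" using m by (intro coeff_eq_0) simp
   moreover have "{..m} = insert m {..<m}" by auto
   ultimately have 2: "ev P' i t = (\<Sum>k<m. coeff P' k * w k i t)"
    by (simp add: ev_def)
   show ?thesis unfolding 1 2 by (simp add: sum.distrib sum_distrib_left mult_ac)
  qed
  \<comment> \<open>X times the l-th basis polynomial is \<open>x l\<close> times that polynomial
    plus the product over all nodes; the latter is compared with the product over the original
    roots.\<close>
  have e4: "ev (pCons 0 (P l t)) i t = x l t * v l i t + ev (pl t) i t + ev (pt t - pl t) i t"
  proof -
   have "pt t = lin (x l t) * P l t"
    unfolding pt_def P_def using l S by (subst prod.remove[of _ l]) auto
   then have "pCons 0 (P l t) = smult (x l t) (P l t) + (pl t + (pt t - pl t))"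
    by (simp add: mult_pCons_left)
   then show ?thesis using l by (simp only: ev_add ev_smult v_ev add.assoc)
  qed
  \<comment> \<open>Omitting a second factor is a divided difference: P_l - P_j = (x_l - x_j) Q. The
    moving nodes therefore lead back to the unknowns \<open>v\<close>, with the gap in the
    denominator.\<close>
  have e5: "ev P' i t = - (\<Sum>j\<in>S - {l}. cor (mu' j t) / (x l t - x j t) * (v l i t - v j i t))"
  proof -
   have "ev (\<Prod>i\<in>S - {l} - {j}. lin (x i t)) i t = (v l i t - v j i t) / (x l t - x j t)" if j: "j \<in> S - {l}" for j
   proof -
    let ?Q = "\<Prod>i\<in>S - {l} - {j}. lin (x i t)"
    have "P l t = lin (x j t) * ?Q"
     unfolding P_def using j S by (subst prod.remove[of _ j]) auto
    moreover have "P j t = lin (x l t) * ?Q"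
    proof -
     have "S - {j} - {l} = S - {l} - {j}" by auto
     then show ?thesis unfolding P_def using j l S by (subst prod.remove[of _ l]) auto
    qed
    ultimately have "P l t = P j t + smult (x l t - x j t) ?Q"
     by (simp add: mult_pCons_left smult_diff_left)
    then have "v l i t = v j i t + (x l t - x j t) * ev ?Q i t"
     using l j by (simp only: v_ev ev_add ev_smult DiffD1)
    moreover have "x l t - x j t \<noteq> 0" using gap'[of l j t] l j t g by auto
    ultimately show ?thesis by (simp add: field_simps)
   qed
   then show ?thesis
    unfolding P'_def ev_sum ev_smult sum_negf[symmetric] by (intro sum.cong refl) (simp del: mult_pCons_left)
  qed
  have "\<i> * (x l t * v l i t + ev (pl t) i t + ev (pt t - pl t) i t) + - X
    = \<i> * x l t * v l i t + (\<i> * ev (pl t) i t + \<i> * ev (pt t - pl t) i t - X)" for X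
   by (simp add: algebra_simps)
  note eq = this[of "\<Sum>j\<in>S - {l}. cor (mu' j t) / (x l t - x j t) * (v l i t - v j i t)"]
  show ?thesis
   using d1 unfolding e2 e3 e4 e5 eq h_def x_def[symmetric] .
 qed
 let ?I = "S \<times> (UNIV :: 'i set)"
 define N where "N t = (\<Sum>(l, i)\<in>?I. cmod (v l i t))" for t
 have N1: "N t = (\<Sum>i\<in>UNIV. \<Sum>l\<in>S. cmod (v l i t))" for t
  unfolding N_def by (subst sum.cartesian_product[symmetric]) (rule sum.swap)
 have N0: "(\<Sum>l\<in>S. cmod (v l i t)) \<le> N t" for i t
  unfolding N1 by (rule member_le_sum[of i UNIV "\<lambda>i. \<Sum>l\<in>S. cmod (v l i t)"]) (auto intro: sum_nonneg)
 have Nv: "cmod (v l i t) \<le> (\<Sum>l\<in>S. cmod (v l i t))" if "l \<in> S" for l i t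
  by (rule member_le_sum[of l S "\<lambda>l. cmod (v l i t)"]) (use that S in auto)
 have hb: "cmod (h l i t) \<le> \<kappa> * N t" if l: "l \<in> S" and t: "t \<in> {0..T}" for l i t
 proof -
  have "cmod (ev (pl t) i t) \<le> r * (\<Sum>j\<in>UNIV. cmod (w 0 j t))"
   using R[OF t, of i] by (simp add: ev_def pl_def S_def)
  also have "\<dots> \<le> r * (\<Sum>j\<in>UNIV. (\<Sum>l\<in>S. cmod (v l j t)) / g ^ (m - 1))"
   by (intro mult_left_mono sum_mono w0 t r)
  finally have 1: "cmod (ev (pl t) i t) \<le> r / g ^ (m - 1) * N t"
   by (simp only: N1 sum_divide_distrib[symmetric] times_divide_eq_left times_divide_eq_right)
  \<comment> \<open>Both products are monic, so their difference has degree below m and can be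
    interpolated. At the node with index l only \<open>pl\<close> survives: its factor with index l
    is at most c1 g, and every other factor is at most 1 + c1 times the matching factor of the
    Lagrange denominator.\<close>
  have 2: "cmod (ev (pt t - pl t) i t) \<le> c1 * g * (1 + c1) ^ (m - 1) * N t"
  proof -
   have ml: "lead_coeff (\<Prod>j\<in>S. lin (y j)) = 1" "degree (\<Prod>j\<in>S. lin (y j)) = m" for y
    using S by (simp only: lead_coeff_prod, simp) (simp add: degree_prod_sum_eq S)
   have "degree (pt t - pl t) < m"
   proof -
    have "degree (pt t - pl t) \<le> m" by (intro degree_diff_le) (simp_all add: pt_def pl_def ml)
    moreover have c0: "coeff (pt t - pl t) m = 0"
     using ml(1)[of "\<lambda>j. x j t"] ml(1)[of "\<lambda>j. cor (lam j t)"] by (simp add: pt_def pl_def ml(2))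
    moreover have "degree (pt t - pl t) \<noteq> m"
    proof
     assume d: "degree (pt t - pl t) = m"
     then have "pt t - pl t = 0" using c0 by (metis leading_coeff_0_iff)
     then show False using d m by simp
    qed
    ultimately show ?thesis by simp
   qed
   then have "ev (pt t - pl t) i t = (\<Sum>l\<in>S. poly (pt t - pl t) (x l t) / poly (P l t) (x l t) * v l i t)"
    by (rule lagr[OF _ t])
   also have "cmod \<dots> \<le> (\<Sum>l\<in>S. c1 * g * (1 + c1) ^ (m - 1) * cmod (v l i t))"
   proof (intro order_trans[OF norm_sum] sum_mono)
    fix l assume l: "l \<in> S"
    have "poly (pt t) (x l t) = 0"
     using l S by (auto simp: pt_def poly_prod intro!: prod_zero)
    then have "cmod (poly (pt t - pl t) (x l t)) = cmod (poly (pl t) (x l t))" by simp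
    also have "\<dots> = (\<Prod>j\<in>S. cmod (x l t - cor (lam j t)))"
     by (simp add: pl_def poly_prod prod_norm)
    also have "\<dots> = cmod (x l t - cor (lam l t)) * (\<Prod>j\<in>S - {l}. cmod (x l t - cor (lam j t)))"
     using l S by (intro prod.remove) auto
    also have "\<dots> \<le> (c1 * g) * (\<Prod>j\<in>S - {l}. (1 + c1) * cmod (x l t - x j t))"
    proof (intro mult_mono prod_mono conjI)
     show "cmod (x l t - cor (lam l t)) \<le> c1 * g"
      using near[of l t] l t by (simp add: S_def x_def norm_of_real flip: of_real_diff)
     fix j assume j: "j \<in> S - {l}"
     have "cmod (x l t - cor (lam j t)) \<le> cmod (x l t - x j t) + cmod (x j t - cor (lam j t))"
      by (rule norm_diff_triangle_ineq[of "x l t" "x j t" "x j t", simplified])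
     also have "cmod (x j t - cor (lam j t)) \<le> c1 * g"
      using near[of j t] j t by (simp add: S_def x_def norm_of_real flip: of_real_diff)
     also have "c1 * g \<le> c1 * cmod (x l t - x j t)"
      using gap'[of l j t] l j t c1 by (intro mult_left_mono) auto
     finally show "cmod (x l t - cor (lam j t)) \<le> (1 + c1) * cmod (x l t - x j t)"
      by (simp add: distrib_right)
    qed (use c1 g in \<open>auto intro: prod_nonneg\<close>)
    also have "\<dots> = c1 * g * (1 + c1) ^ (m - 1) * cmod (poly (P l t) (x l t))"
     using l S by (simp add: Pl prod.distrib prod_norm)
    finally have "cmod (poly (pt t - pl t) (x l t)) \<le> c1 * g * (1 + c1) ^ (m - 1) * cmod (poly (P l t) (x l t))" .
    moreover have "cmod (poly (P l t) (x l t)) > 0"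
     using Plb[OF l t] g by (meson less_le_trans zero_less_power)
    ultimately have "cmod (poly (pt t - pl t) (x l t)) / cmod (poly (P l t) (x l t)) \<le> c1 * g * (1 + c1) ^ (m - 1)"
     by (simp add: pos_divide_le_eq)
    then show "cmod (poly (pt t - pl t) (x l t) / poly (P l t) (x l t) * v l i t) \<le> c1 * g * (1 + c1) ^ (m - 1) * cmod (v l i t)"
     unfolding norm_mult norm_divide by (intro mult_right_mono) auto
   qed
   also have "\<dots> = c1 * g * (1 + c1) ^ (m - 1) * (\<Sum>l\<in>S. cmod (v l i t))"
    by (simp add: sum_distrib_left)
   also have "\<dots> \<le> c1 * g * (1 + c1) ^ (m - 1) * N t"
    by (intro mult_left_mono N0) (use c1 g in auto)
   finally show ?thesis .
  qed
  have 3: "cmod (\<Sum>j\<in>S - {l}. cor (mu' j t) / (x l t - x j t) * (v l i t - v j i t)) \<le> D / g * real (m + 1) * N t"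
  proof -
   have "cmod (\<Sum>j\<in>S - {l}. cor (mu' j t) / (x l t - x j t) * (v l i t - v j i t))
     \<le> (\<Sum>j\<in>S - {l}. D / g * (cmod (v l i t) + cmod (v j i t)))"
   proof (intro order_trans[OF norm_sum] sum_mono)
    fix j assume j: "j \<in> S - {l}"
    have "cmod (cor (mu' j t) / (x l t - x j t)) \<le> D / g"
     unfolding norm_divide norm_of_real using bmu[of j t] gap'[of l j t] j l t g D
     by (intro frac_le) (auto simp: S_def)
    then show "cmod (cor (mu' j t) / (x l t - x j t) * (v l i t - v j i t)) \<le> D / g * (cmod (v l i t) + cmod (v j i t))"
     unfolding norm_mult using D g by (intro mult_mono norm_triangle_ineq4) auto
   qed
   also have "\<dots> \<le> (\<Sum>j\<in>S. D / g * (cmod (v l i t) + cmod (v j i t)))"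
    using S D g by (intro sum_mono2) auto
   also have "\<dots> = D / g * (real m * cmod (v l i t) + (\<Sum>j\<in>S. cmod (v j i t)))"
    by (simp only: sum_distrib_left[symmetric] sum.distrib sum_constant S)
   also have "\<dots> \<le> D / g * (real m * N t + N t)"
    using order_trans[OF Nv[OF l] N0] N0 D g by (intro mult_left_mono add_mono) auto
   finally show ?thesis by (simp add: algebra_simps)
  qed
  have "cmod (h l i t) \<le> cmod (ev (pl t) i t) + cmod (ev (pt t - pl t) i t)
    + cmod (\<Sum>j\<in>S - {l}. cor (mu' j t) / (x l t - x j t) * (v l i t - v j i t))"
   unfolding h_def
   by (rule order_trans[OF norm_triangle_ineq4]) (use norm_triangle_ineq[of "\<i> * ev (pl t) i t" "\<i> * ev (pt t - pl t) i t"] in \<open>simp add: norm_mult\<close>)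
  also have "\<dots> \<le> \<kappa> * N t"
   using 1 2 3 by (simp add: \<kappa>_def distrib_right)
  finally show ?thesis .
 qed
 have \<kappa>0: "\<kappa> \<ge> 0" using r g c1 D by (simp add: \<kappa>_def)
 have "(\<Sum>a\<in>?I. (cmod (v (fst a) (snd a) t))\<^sup>2)
   \<le> (\<Sum>a\<in>?I. (cmod (v (fst a) (snd a) 0))\<^sup>2) * exp (2 * \<kappa> * real (card ?I) * t)"
  by (rule gronwall_skew[where v = "\<lambda>a. v (fst a) (snd a)" and h = "\<lambda>a. h (fst a) (snd a)" and \<theta> = "\<lambda>a. mu (fst a)" and T = T])
    (use S \<kappa>0 t dv hb in \<open>auto simp: N_def case_prod_unfold\<close>)
 then show "(\<Sum>(l, i)\<in>{1..m} \<times> UNIV. (cmod (v l i t))\<^sup>2)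
   \<le> (\<Sum>(l, i)\<in>{1..m} \<times> UNIV. (cmod (v l i 0))\<^sup>2) * exp (2 * \<kappa> * real (m * CARD('i)) * t)"
  by (simp only: case_prod_unfold S_def card_cartesian_product card_atLeastAtMost diff_Suc_1 One_nat_def diff_Suc_Suc diff_zero)
qed

declare symb.simps [simp del]

section \<open>Regularised roots, and time derivatives of the modes\<close>

lemma symb_const:
 assumes "\<And>x. Lam x \<ge> 1"
 shows "symb T Lam k d (\<lambda>x t. c)"
proof (rule symb_const_time)
 show "cmod c \<le> cmod c * Lam x ^ d" for x
  using mult_left_mono[OF one_le_power[OF assms[of x], of d], of "cmod c"] by simp
qed

text \<open>Averaging over \<open>[t, t + d]\<close> makes the roots \<open>C\<^sup>1\<close> and keeps their order.\<close>

lemma averaged_roots: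
 fixes f :: "nat => real => real"
 assumes T: "T > 0" and d: "d > 0" and \<alpha>: "\<alpha> > 0" and H: "H \<ge> 0"
  and hol: "\<And>j t t'. j \<in> J ==> t \<in> {0..T} ==> t' \<in> {0..T} ==> \<bar>f j t - f j t'\<bar> \<le> H * \<bar>t - t'\<bar> powr \<alpha>"
  and mono: "\<And>i j t. i \<in> J ==> j \<in> J ==> i \<le> j ==> t \<in> {0..T} ==> f i t \<le> f j t"
 obtains g g' where
  "\<And>j t. j \<in> J ==> t \<in> {0..T} ==> (g j has_real_derivative g' j t) (at t within {0..T})"
  "\<And>j t. j \<in> J ==> t \<in> {0..T} ==> \<bar>g' j t\<bar> \<le> H * d powr \<alpha> / d"
  "\<And>j t. j \<in> J ==> t \<in> {0..T} ==> \<bar>g j t - f j t\<bar> \<le> H * d powr \<alpha>"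
  "\<And>i j t. i \<in> J ==> j \<in> J ==> i \<le> j ==> t \<in> {0..T} ==> g i t \<le> g j t"
proof -
 \<comment> \<open>The window [t, t + d] may leave [0, T]; clamping extends the roots by their end
   values and preserves the Hoelder bound and the order.\<close>
 define cl where "cl s = max 0 (min s T)" for s :: real
 have cl: "cl s \<in> {0..T}" for s using T by (auto simp: cl_def)
 have cl_id: "cl s = s" if "s \<in> {0..T}" for s using that by (auto simp: cl_def)
 have cl_lip: "\<bar>cl s - cl s'\<bar> \<le> \<bar>s - s'\<bar>" for s s' by (auto simp: cl_def)
 have hol': "\<bar>f j (cl s) - f j (cl s')\<bar> \<le> H * \<bar>s - s'\<bar> powr \<alpha>" if "j \<in> J" for j s s'
 proof -
  have "\<bar>f j (cl s) - f j (cl s')\<bar> \<le> H * \<bar>cl s - cl s'\<bar> powr \<alpha>"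
   by (rule hol[OF that cl cl])
  also have "\<dots> \<le> H * \<bar>s - s'\<bar> powr \<alpha>"
   using H \<alpha> cl_lip by (intro mult_left_mono powr_mono2) auto
  finally show ?thesis .
 qed
 have cont: "isCont (\<lambda>s. f j (cl s)) s" if j: "j \<in> J" for j s
  unfolding isCont_def
 proof (rule LIM_zero_cancel, rule Lim_null_comparison)
  show "\<forall>\<^sub>F x in at s. norm (f j (cl x) - f j (cl s)) \<le> H * \<bar>x - s\<bar> powr \<alpha>"
   using hol'[OF j] by simp
  have "((\<lambda>x. \<bar>x - s\<bar>) \<longlongrightarrow> \<bar>s - s\<bar>) (at s)" by (intro tendsto_intros)
  then have "((\<lambda>x. \<bar>x - s\<bar> powr \<alpha>) \<longlongrightarrow> 0) (at s)"
   by (intro tendsto_zero_powrI[OF _ tendsto_const]) (use \<alpha> in auto)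
  then show "((\<lambda>x. H * \<bar>x - s\<bar> powr \<alpha>) \<longlongrightarrow> 0) (at s)"
   by (rule tendsto_mult_right_zero)
 qed
 have "\<exists>F. \<forall>s. (F has_real_derivative f j (cl s)) (at s)" if "j \<in> J" for j
 proof -
  have "\<exists>F. \<forall>x::real. -\<infinity> < ereal x --> ereal x < \<infinity> --> (F has_vector_derivative f j (cl x)) (at x)"
   by (rule einterval_antiderivative) (use cont[OF that] in auto)
  then show ?thesis by (auto simp: has_real_derivative_iff_has_vector_derivative)
 qed
 then obtain F where F: "\<And>j s. j \<in> J ==> (F j has_real_derivative f j (cl s)) (at s)"
  by metis
 define g where "g j t = (F j (t + d) - F j t) / d" for j t
 define g' where "g' j t = (f j (cl (t + d)) - f j (cl t)) / d" for j t
 \<comment> \<open>The mean value theorem for a linear combination gives one point z for all its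
   terms. Applied to a difference of two roots it shows that the averages inherit the order the
   roots have at z.\<close>
 have mvt: "\<exists>z. t < z \<and> z < t + d \<and> (\<Sum>j\<in>K. c j * g j t) = (\<Sum>j\<in>K. c j * f j (cl z))"
  if K: "finite K" "K \<subseteq> J" for K t and c :: "nat => real"
 proof -
  have "((\<lambda>s. \<Sum>j\<in>K. c j * F j s) has_real_derivative (\<Sum>j\<in>K. c j * f j (cl s))) (at s)" for s
   using K by (intro DERIV_sum DERIV_cmult F) auto
  then obtain z where z: "t < z" "z < t + d"
   "(\<Sum>j\<in>K. c j * F j (t + d)) - (\<Sum>j\<in>K. c j * F j t) = (t + d - t) * (\<Sum>j\<in>K. c j * f j (cl z))"
   using MVT2[of t "t + d" "\<lambda>s. \<Sum>j\<in>K. c j * F j s" "\<lambda>s. \<Sum>j\<in>K. c j * f j (cl s)"] d by auto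
  have "(\<Sum>j\<in>K. c j * g j t) = ((\<Sum>j\<in>K. c j * F j (t + d)) - (\<Sum>j\<in>K. c j * F j t)) / d"
   by (simp add: g_def sum_divide_distrib sum_subtractf[symmetric] algebra_simps diff_divide_distrib)
  then show ?thesis using z d by auto
 qed
 show ?thesis
 proof (rule that[of g g'])
  fix j t assume j: "j \<in> J" and t: "t \<in> {0..T}"
  have "((\<lambda>t. F j (t + d)) has_real_derivative f j (cl (t + d))) (at t)"
   using F[OF j, of "t + d"] by (simp add: DERIV_shift)
  then have "(g j has_real_derivative g' j t) (at t)"
   unfolding g_def g'_def by (intro DERIV_cdivide DERIV_diff F[OF j])
  then show "(g j has_real_derivative g' j t) (at t within {0..T})"
   by (rule has_field_derivative_at_within)
  show "\<bar>g' j t\<bar> \<le> H * d powr \<alpha> / d"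
   using hol'[OF j, of "t + d" t] d by (simp add: g'_def abs_divide divide_right_mono)
  obtain z where z: "t < z" "z < t + d" "g j t = f j (cl z)"
   using mvt[of "{j}" t "\<lambda>_. 1"] j by auto
  have "\<bar>f j (cl z) - f j (cl t)\<bar> \<le> H * \<bar>z - t\<bar> powr \<alpha>" by (rule hol'[OF j])
  also have "\<dots> \<le> H * d powr \<alpha>"
   using z H \<alpha> by (intro mult_left_mono powr_mono2) auto
  finally show "\<bar>g j t - f j t\<bar> \<le> H * d powr \<alpha>"
   using z(3) cl_id[OF t] by simp
 next
  fix i j t assume ij: "i \<in> J" "j \<in> J" "i \<le> j" and t: "t \<in> {0..T}"
  show "g i t \<le> g j t"
  proof (cases "i = j")
   case False
   obtain z where "(\<Sum>l\<in>{i, j}. (if l = j then 1 else - 1) * g l t) = (\<Sum>l\<in>{i, j}. (if l = j then 1 else - 1) * f l (cl z))"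
    using mvt[of "{i, j}" t "\<lambda>l. if l = j then 1 else - 1"] ij by auto
   then have "g j t - g i t = f j (cl z) - f i (cl z)" using False by simp
   then show ?thesis using mono[OF ij cl[of z]] by simp
  qed simp
 qed
qed

text \<open>\<open>time_deriv_mat k\<close> expresses \<open>D\<^sub>t\<^sup>k y\<close> through \<open>y\<close> for a solution of \<open>D\<^sub>t y = M y\<close>.\<close>

primrec time_deriv_mat ::
 "real => ('m::finite => 'm => 'a => real => complex) => nat => 'm => 'm => 'a => real => complex" where
 "time_deriv_mat T M 0 i j = (\<lambda>x t. if i = j then 1 else 0)"
| "time_deriv_mat T M (Suc k) i j = (\<lambda>x t. (\<Sum>l\<in>UNIV. time_deriv_mat T M k i l x t * M l j x t)
   - \<i> * vector_derivative (time_deriv_mat T M k i j x) (at t within {0..T}))"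

text \<open>Each step uses up one time derivative and raises the order by one. As the zeroth matrix
  is constant, the first m - 1 derivatives of \<open>M\<close> reach exactly to k = m.\<close>

lemma time_deriv_mat_symb:
 assumes T: "T > 0" and L: "\<And>x. Lam x \<ge> 1" and M: "\<And>i j. symb T Lam (m - 1) 1 (M i j)" and k: "k \<le> m"
 shows "symb T Lam (m - k) k (time_deriv_mat T M k i j)"
 using k
proof (induction k arbitrary: i j)
 case 0
 show ?case using symb_const[of Lam, OF L] by simp
next
 case (Suc k)
 then have "m - k = Suc (m - Suc k)" by simp
 then have IH: "symb T Lam (Suc (m - Suc k)) k (time_deriv_mat T M k i j)" for i j
  using Suc by simp
 have M': "symb T Lam (m - Suc k) 1 (M i j)" for i j
  by (rule symb_le[OF M]) simp
 have 1: "symb T Lam (m - Suc k) (k + 1) (\<lambda>x t. \<Sum>l\<in>UNIV. time_deriv_mat T M k i l x t * M l j x t)"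
  by (intro symb_sum[OF L] symb_mult[OF L] symb_Suc[OF IH] M')
 have 2: "symb T Lam (m - Suc k) (k + 1) (\<lambda>x t. \<i> * vector_derivative (time_deriv_mat T M k i j x) (at t within {0..T}))"
  using symb_mult[OF L symb_cmult[OF L symb_deriv(2)[OF T IH]] symb_const[of Lam _ _ 1 1, OF L], of \<i> i j]
  by simp
 from symb_diff[OF L 1 2] show ?case by simp
qed

text \<open>With y' = \<i> M y, the derivative of N y is \<i> (N M - \<i> N') y, which is the
  recursion of \<open>time_deriv_mat\<close>.\<close>

lemma time_deriv_mat_has_derivative:
 assumes T: "T > 0" and L: "\<And>x. Lam x \<ge> 1" and M: "\<And>i j. symb T Lam (m - 1) 1 (M i j)" and k: "k < m"
  and y: "\<And>i t. t \<in> {0..T} ==> (y i has_vector_derivative \<i> * (\<Sum>j\<in>UNIV. M i j x t * y j t)) (at t within {0..T})"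
  and t: "t \<in> {0..T}"
 shows "((\<lambda>t. \<Sum>j\<in>UNIV. time_deriv_mat T M k i j x t * y j t) has_vector_derivative
  \<i> * (\<Sum>j\<in>UNIV. time_deriv_mat T M (Suc k) i j x t * y j t)) (at t within {0..T})"
proof -
 let ?N = "time_deriv_mat T M k i"
 let ?d = "\<lambda>j. vector_derivative (?N j x) (at t within {0..T})"
 have "m - k = Suc (m - Suc k)" using k by simp
 then have N: "symb T Lam (Suc (m - Suc k)) k (?N j)" for j
  using time_deriv_mat_symb[where k = k and i = i and j = j, OF T L M] k by simp
 have "((\<lambda>t. \<Sum>j\<in>UNIV. ?N j x t * y j t) has_vector_derivative
   (\<Sum>j\<in>UNIV. ?N j x t * (\<i> * (\<Sum>l\<in>UNIV. M j l x t * y l t)) + ?d j * y j t)) (at t within {0..T})"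
  by (intro has_vector_derivative_sum has_vector_derivative_mult symb_deriv(1)[OF T N] y t)
 also have "(\<Sum>j\<in>UNIV. ?N j x t * (\<i> * (\<Sum>l\<in>UNIV. M j l x t * y l t)) + ?d j * y j t)
   = \<i> * (\<Sum>j\<in>UNIV. time_deriv_mat T M (Suc k) i j x t * y j t)"
 proof -
  have "(\<Sum>j\<in>UNIV. ?N j x t * (\<i> * (\<Sum>l\<in>UNIV. M j l x t * y l t))) = \<i> * (\<Sum>l\<in>UNIV. (\<Sum>j\<in>UNIV. ?N j x t * M j l x t) * y l t)"
   by (simp add: sum_distrib_left sum_distrib_right mult_ac) (rule sum.swap)
  moreover have "(\<Sum>j\<in>UNIV. ?d j * y j t) = - \<i> * (\<Sum>j\<in>UNIV. \<i> * ?d j * y j t)"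
   by (simp add: sum_distrib_left sum_negf[symmetric] flip: mult.assoc)
  ultimately show ?thesis
   by (simp add: sum.distrib left_diff_distrib sum_subtractf right_diff_distrib)
 qed
 finally show ?thesis .
qed

text \<open>The principal part of the k-th time derivative is the k-th power of the principal
  symbol: the matrix \<open>B\<close> has order 0 and derivatives in t do not raise the order, so
  what they contribute stays one order lower.\<close>

lemma time_deriv_mat_diff:
 fixes A :: "'a => real => complex^'m^'m::finite"
 assumes T: "T > 0" and L: "\<And>x. Lam x \<ge> 1"
  and A: "\<And>i j. symb T Lam (m - 1) 1 (\<lambda>x t. A x t $ i $ j)" and B: "\<And>i j. symb T Lam (m - 1) 0 (\<lambda>x t. B x t $ i $ j)"
  and k: "k \<le> m"
 defines "M \<equiv> \<lambda>i j x t. A x t $ i $ j + B x t $ i $ j"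
 shows "symb T Lam 0 (k - 1) (\<lambda>x t. time_deriv_mat T M k i j x t - mat_pow (A x t) k $ i $ j)"
  and "symb T Lam 0 k (\<lambda>x t. mat_pow (A x t) k $ i $ j)"
proof -
 have B1: "symb T Lam (m - 1) 1 (\<lambda>x t. B x t $ i $ j)" for i j
  using symb_mult[OF L B symb_const[of Lam _ _ 1 1, OF L], of i j] by simp
 have M: "symb T Lam (m - 1) 1 (M i j)" for i j
  unfolding M_def by (intro symb_add[OF L] A B1)
 have pow: "symb T Lam 0 k (\<lambda>x t. mat_pow (A x t) k $ i $ j)" for i j k
 proof (induction k arbitrary: i j)
  case 0
  show ?case using symb_const[of Lam, OF L] by (simp add: mat_def)
 next
  case (Suc k)
  have "symb T Lam 0 (k + 1) (\<lambda>x t. \<Sum>l\<in>UNIV. mat_pow (A x t) k $ i $ l * A x t $ l $ j)"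
   by (intro symb_sum[OF L] symb_mult[OF L] Suc symb_0[OF A])
  then show ?case by (simp add: matrix_matrix_mult_def)
 qed
 show "symb T Lam 0 k (\<lambda>x t. mat_pow (A x t) k $ i $ j)" by (rule pow)
 show "symb T Lam 0 (k - 1) (\<lambda>x t. time_deriv_mat T M k i j x t - mat_pow (A x t) k $ i $ j)"
  using k
 proof (induction k arbitrary: i j)
  case 0
  show ?case using symb_const[of Lam, OF L] by (simp add: mat_def)
 next
  case (Suc k)
  let ?E = "\<lambda>i j x t. time_deriv_mat T M k i j x t - mat_pow (A x t) k $ i $ j"
  have "m - k = Suc (m - Suc k)" using Suc.prems by simp
  then have N: "symb T Lam (Suc (m - Suc k)) k (time_deriv_mat T M k i j)" for i j
   using time_deriv_mat_symb[where k = k and i = i and j = j, OF T L M] Suc.prems by simp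
  \<comment> \<open>For k = 0 the difference vanishes; for k > 0 its order k - 1 is raised to k by
    \<open>M\<close>. The truncated subtraction makes the distinction necessary.\<close>
  have 1: "symb T Lam 0 k (\<lambda>x t. \<Sum>l\<in>UNIV. ?E i l x t * M l j x t)"
  proof (cases k)
   case 0
   then show ?thesis using symb_const[of Lam, OF L] by (simp add: mat_def)
  next
   case (Suc k')
   have "symb T Lam 0 ((k - 1) + 1) (\<lambda>x t. \<Sum>l\<in>UNIV. ?E i l x t * M l j x t)"
    by (intro symb_sum[OF L] symb_mult[OF L] Suc.IH symb_0[OF M]) (use \<open>Suc k \<le> m\<close> in simp)
   then show ?thesis using Suc by simp
  qed
  have 2: "symb T Lam 0 (k + 0) (\<lambda>x t. \<Sum>l\<in>UNIV. mat_pow (A x t) k $ i $ l * B x t $ l $ j)"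
   by (intro symb_sum[OF L] symb_mult[OF L] pow symb_0[OF B])
  have 3: "symb T Lam 0 k (\<lambda>x t. \<i> * vector_derivative (time_deriv_mat T M k i j x) (at t within {0..T}))"
   by (intro symb_cmult[OF L] symb_0[OF symb_deriv(2)[OF T N]])
  have eq: "time_deriv_mat T M (Suc k) i j x t - mat_pow (A x t) (Suc k) $ i $ j
   = (\<Sum>l\<in>UNIV. ?E i l x t * M l j x t) + (\<Sum>l\<in>UNIV. mat_pow (A x t) k $ i $ l * B x t $ l $ j)
    - \<i> * vector_derivative (time_deriv_mat T M k i j x) (at t within {0..T})" for x t
   by (simp add: matrix_matrix_mult_def M_def sum.distrib sum_subtractf algebra_simps)
  show ?case
   unfolding eq diff_Suc_1 by (rule symb_diff[OF L symb_add[OF L 1 2[unfolded add_0_right]] 3])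
 qed
qed

text \<open>Homogeneity: with roots of size \<open>Lam\<close>, the k-th coefficient has size
  \<open>Lam ^ (card S - k)\<close>. Multiplying by \<open>Lam ^ k\<close> avoids the subtraction
  and suits the induction.\<close>

lemma coeff_prod_lin_bound:
 assumes "finite S" "\<And>j. j \<in> S ==> cmod (x j) \<le> K * Lam" "Lam \<ge> 1" "K \<ge> 0"
 shows "cmod (coeff (\<Prod>j\<in>S. lin (x j)) k) * Lam ^ k \<le> ((1 + K) * Lam) ^ card S"
 using assms(1,2)
proof (induction S arbitrary: k rule: finite_induct)
 case empty
 then show ?case using assms(3) by (cases k) simp_all
next
 case (insert a S)
 let ?Q = "\<Prod>j\<in>S. lin (x j)"
 let ?B = "((1 + K) * Lam) ^ card S"
 have IH: "cmod (coeff ?Q k) * Lam ^ k \<le> ?B" for k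
  using insert by simp
 have B0: "?B \<ge> 0" using assms by simp
 have 1: "cmod (if k = 0 then 0 else coeff ?Q (k - 1)) * Lam ^ k \<le> Lam * ?B"
 proof (cases k)
  case (Suc k')
  then show ?thesis using mult_left_mono[OF IH[of k'], of Lam] assms(3) by (simp add: mult_ac)
 qed (use B0 assms in simp)
 have "cmod (x a * coeff ?Q k) * Lam ^ k = cmod (x a) * (cmod (coeff ?Q k) * Lam ^ k)"
  by (simp add: norm_mult mult_ac)
 also have "\<dots> \<le> (K * Lam) * ?B"
  using insert.prems[of a] IH assms by (intro mult_mono) auto
 finally have 2: "cmod (x a * coeff ?Q k) * Lam ^ k \<le> (K * Lam) * ?B" .
 have "cmod (coeff (\<Prod>j\<in>insert a S. lin (x j)) k) * Lam ^ k
   \<le> (cmod (if k = 0 then 0 else coeff ?Q (k - 1)) + cmod (x a * coeff ?Q k)) * Lam ^ k"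
 proof (rule mult_right_mono)
  have "(\<Prod>j\<in>insert a S. lin (x j)) = lin (x a) * ?Q" using insert.hyps by simp
  then show "cmod (coeff (\<Prod>j\<in>insert a S. lin (x j)) k) \<le> cmod (if k = 0 then 0 else coeff ?Q (k - 1)) + cmod (x a * coeff ?Q k)"
   by (simp only: coeff_lin_mult norm_triangle_ineq4)
 qed (use assms in simp)
 also have "\<dots> \<le> Lam * ?B + (K * Lam) * ?B"
  using 1 2 by (simp add: distrib_right)
 also have "\<dots> = ((1 + K) * Lam) ^ card (insert a S)"
  using insert.hyps by (simp add: algebra_simps)
 finally show ?case .
qed

lemma symb_bound_mat:
 fixes f :: "'m::finite => 'm => 'a => real => complex"
 assumes "\<And>i j. symb T Lam k d (f i j)" and L: "\<And>x. Lam x \<ge> 1"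
 obtains C where "C \<ge> 0" "\<And>x t. t \<in> {0..T} ==> (\<Sum>i\<in>UNIV. \<Sum>j\<in>UNIV. cmod (f i j x t)) \<le> C * Lam x ^ d"
proof -
 have "\<exists>C\<ge>0. \<forall>x t. t \<in> {0..T} --> cmod (f i j x t) \<le> C * Lam x ^ d" for i j
  by (rule symb_bound[OF assms(1)[of i j] L]) auto
 then obtain C where C: "\<And>i j. C i j \<ge> 0" "\<And>i j x t. t \<in> {0..T} ==> cmod (f i j x t) \<le> C i j * Lam x ^ d"
  by metis
 show ?thesis
 proof (rule that[of "\<Sum>i\<in>UNIV. \<Sum>j\<in>UNIV. C i j"])
  fix x t assume "t \<in> {0..T}"
  then have "(\<Sum>i\<in>UNIV. \<Sum>j\<in>UNIV. cmod (f i j x t)) \<le> (\<Sum>i\<in>UNIV. \<Sum>j\<in>UNIV. C i j * Lam x ^ d)"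
   by (intro sum_mono C)
  then show "(\<Sum>i\<in>UNIV. \<Sum>j\<in>UNIV. cmod (f i j x t)) \<le> (\<Sum>i\<in>UNIV. \<Sum>j\<in>UNIV. C i j) * Lam x ^ d"
   by (simp add: sum_distrib_right)
 qed (intro sum_nonneg C)
qed

lemma entry_le_sum: "(f i j :: real) \<le> (\<Sum>i\<in>UNIV. \<Sum>j\<in>UNIV. f i j)"
 if "\<And>i j. f i j \<ge> 0" for f :: "'m::finite => 'n::finite => real"
proof -
 have "f i j \<le> (\<Sum>j\<in>UNIV. f i j)" by (rule member_le_sum) (use that in auto)
 also have "\<dots> \<le> (\<Sum>i\<in>UNIV. \<Sum>j\<in>UNIV. f i j)"
  by (rule member_le_sum[where f = "\<lambda>i. \<Sum>j\<in>UNIV. f i j"]) (use that in \<open>auto intro: sum_nonneg\<close>)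
 finally show ?thesis .
qed

lemma symbol_component: "symbol A t \<xi> $ i $ j = (\<Sum>k\<in>UNIV. cor (\<xi> $ k) * A k t $ i $ j)"
proof -
 have "symbol A t \<xi> $ i $ j = (\<Sum>k\<in>UNIV. \<xi> $ k *\<^sub>R A k t $ i $ j)"
  by (simp add: symbol_def)
 then show ?thesis by (simp add: scaleR_conv_of_real)
qed

lemma symbol_symb:
 fixes A :: "'n::finite => real => complex^'m^'m::finite"
 assumes "\<And>k i j. Ck_on n {0..T} (\<lambda>t. A k t $ i $ j)"
 shows "symb T (\<lambda>\<xi>. 1 + norm \<xi>) n 1 (\<lambda>\<xi> t. symbol A t \<xi> $ i $ j)"
proof -
 have L: "1 + norm \<xi> \<ge> 1" for \<xi> :: "real^'n" by simp
 have "symb T (\<lambda>\<xi>. 1 + norm \<xi>) n (1 + 0) (\<lambda>\<xi> t. cor (\<xi> $ k) * A k t $ i $ j)" for k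
 proof (intro symb_mult[OF L] symb_of_Ck_on assms)
  show "symb T (\<lambda>\<xi>. 1 + norm \<xi>) n 1 (\<lambda>\<xi> t. cor (\<xi> $ k))"
  proof (rule symb_const_time[where C = 1])
   show "cmod (cor (\<xi> $ k)) \<le> 1 * (1 + norm \<xi>) ^ 1" for \<xi> :: "real^'n"
    using component_le_norm_cart[of \<xi> k] by simp
  qed
 qed
 then have "symb T (\<lambda>\<xi>. 1 + norm \<xi>) n 1 (\<lambda>\<xi> t. \<Sum>k\<in>UNIV. cor (\<xi> $ k) * A k t $ i $ j)"
  by (intro symb_sum[OF L]) simp
 then show ?thesis
  by (simp only: symbol_component)
qed

text \<open>The hypothesis on \<open>c\<close> is the Cayley-Hamilton identity. It removes the
  powers of the principal symbol, so that only the differences of order k - 1 act on y, and the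
  total order drops from m to m - 1. The constant is chosen before the coefficients
  \<open>c\<close>.\<close>

lemma lower_order_remainder:
 fixes A B :: "'a => real => complex^'m^'m::finite"
 assumes T: "T > 0" and L: "\<And>x. Lam x \<ge> 1" and m: "m \<ge> 1"
  and A: "\<And>i j. symb T Lam (m - 1) 1 (\<lambda>x t. A x t $ i $ j)" and B: "\<And>i j. symb T Lam (m - 1) 0 (\<lambda>x t. B x t $ i $ j)"
 defines "M \<equiv> \<lambda>i j x t. A x t $ i $ j + B x t $ i $ j"
 shows "\<exists>C\<ge>0. \<forall>c K x t i (y :: 'm => complex). t \<in> {0..T} --> K \<ge> 0 --> (\<forall>k. cmod (c k) * Lam x ^ k \<le> K * Lam x ^ m) -->
   (\<forall>i j. (\<Sum>k\<le>m. c k * mat_pow (A x t) k $ i $ j) = 0) -->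
   cmod (\<Sum>k\<le>m. c k * (\<Sum>j\<in>UNIV. time_deriv_mat T M k i j x t * y j)) \<le> C * K * Lam x ^ (m - 1) * (\<Sum>j\<in>UNIV. cmod (y j))"
proof -
 define E where "E k i j x t = time_deriv_mat T M k i j x t - mat_pow (A x t) k $ i $ j" for k i j x t
 have "\<forall>k. \<exists>C\<ge>0. k \<le> m --> (\<forall>x t. t \<in> {0..T} --> (\<Sum>i\<in>UNIV. \<Sum>j\<in>UNIV. cmod (E k i j x t)) \<le> C * Lam x ^ (k - 1))"
 proof
  fix k
  show "\<exists>C\<ge>0. k \<le> m --> (\<forall>x t. t \<in> {0..T} --> (\<Sum>i\<in>UNIV. \<Sum>j\<in>UNIV. cmod (E k i j x t)) \<le> C * Lam x ^ (k - 1))"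
  proof (cases "k \<le> m")
   case True
   have *: "symb T Lam 0 (k - 1) (E k i j)" for i j
    unfolding E_def M_def by (rule time_deriv_mat_diff(1)[OF T L A B True])
   show ?thesis by (rule symb_bound_mat[of T Lam 0 "k - 1" "E k", OF * L]) auto
  qed auto
 qed
 from choice[OF this] obtain C where C: "\<And>k. C k \<ge> 0"
  "\<And>k x t. k \<le> m ==> t \<in> {0..T} ==> (\<Sum>i\<in>UNIV. \<Sum>j\<in>UNIV. cmod (E k i j x t)) \<le> C k * Lam x ^ (k - 1)"
  by blast
 \<comment> \<open>The term k = 0 contributes nothing, so the truncated exponent k - 1 does no harm
   there.\<close>
 have E0: "E 0 i j x t = 0" for i j x t by (simp add: E_def mat_def)
 show ?thesis
 proof (intro exI[of _ "\<Sum>k\<le>m. C k"] conjI allI impI)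
  show "(\<Sum>k\<le>m. C k) \<ge> 0" by (intro sum_nonneg C)
  fix c K x t i and y :: "'m => complex"
  assume t: "t \<in> {0..T}" and K: "K \<ge> 0" and c': "\<forall>k. cmod (c k) * Lam x ^ k \<le> K * Lam x ^ m"
   and ch: "\<forall>i j. (\<Sum>k\<le>m. c k * mat_pow (A x t) k $ i $ j) = 0"
  note c = c'[rule_format]
  have Lx: "Lam x > 0" using L[of x] by simp
  have cE: "cmod (c k * E k i j x t) \<le> C k * K * Lam x ^ (m - 1)" if k: "k \<le> m" for k j
  proof (cases k)
   case 0
   then show ?thesis using C(1)[of k] K Lx by (simp add: E0)
  next
   case (Suc k')
   have "cmod (E k i j x t) \<le> C k * Lam x ^ (k - 1)"
    using entry_le_sum[of "\<lambda>i j. cmod (E k i j x t)" i j] C(2)[OF k t, of x] by simp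
   then have "cmod (c k * E k i j x t) \<le> cmod (c k) * (C k * Lam x ^ (k - 1))"
    unfolding norm_mult by (intro mult_left_mono) auto
   also have "\<dots> = C k * (cmod (c k) * Lam x ^ k) / Lam x"
    using Suc Lx by simp
   also have "\<dots> \<le> C k * (K * Lam x ^ m) / Lam x"
    using C(1)[of k] Lx by (intro divide_right_mono mult_left_mono c) auto
   also have "\<dots> = C k * K * Lam x ^ (m - 1)"
    using m Lx by (cases m) simp_all
   finally show ?thesis .
  qed
  have "(\<Sum>k\<le>m. c k * (\<Sum>j\<in>UNIV. time_deriv_mat T M k i j x t * y j))
    = (\<Sum>j\<in>UNIV. (\<Sum>k\<le>m. c k * time_deriv_mat T M k i j x t) * y j)"
   by (simp add: sum_distrib_left sum_distrib_right mult.assoc) (rule sum.swap)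
  also have "\<dots> = (\<Sum>j\<in>UNIV. (\<Sum>k\<le>m. c k * E k i j x t) * y j)"
   using ch by (simp add: E_def right_diff_distrib sum_subtractf)
  also have "cmod \<dots> \<le> (\<Sum>j\<in>UNIV. (\<Sum>k\<le>m. C k * K * Lam x ^ (m - 1)) * cmod (y j))"
  proof (intro order_trans[OF norm_sum] sum_mono)
   fix j
   have "cmod (\<Sum>k\<le>m. c k * E k i j x t) \<le> (\<Sum>k\<le>m. C k * K * Lam x ^ (m - 1))"
    by (intro order_trans[OF norm_sum] sum_mono cE) simp
   then show "cmod ((\<Sum>k\<le>m. c k * E k i j x t) * y j) \<le> (\<Sum>k\<le>m. C k * K * Lam x ^ (m - 1)) * cmod (y j)"
    unfolding norm_mult by (rule mult_right_mono) simp
  qed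
  also have "\<dots> = (\<Sum>k\<le>m. C k) * K * Lam x ^ (m - 1) * (\<Sum>j\<in>UNIV. cmod (y j))"
   by (simp only: sum_distrib_left[symmetric] sum_distrib_right[symmetric])
  finally show "cmod (\<Sum>k\<le>m. c k * (\<Sum>j\<in>UNIV. time_deriv_mat T M k i j x t * y j))
    \<le> (\<Sum>k\<le>m. C k) * K * Lam x ^ (m - 1) * (\<Sum>j\<in>UNIV. cmod (y j))" .
 qed
qed

section \<open>The growth estimate for the Fourier modes of the system\<close>

definition ode_bound :: "('n::finite => real => complex^'m^'m::finite) => (real => complex^'m^'m) => real => real => bool" where
 "ode_bound A B T p \<longleftrightarrow> (\<exists>C>0. \<forall>\<xi> y.
   (\<forall>i. \<forall>t\<in>{0..T}. (y i has_vector_derivative \<i> * (\<Sum>j\<in>UNIV. (symbol A t \<xi> $ i $ j + B t $ i $ j) * y j t)) (at t within {0..T})) -->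
   (\<forall>i. \<forall>t\<in>{0..T}. cmod (y i t) \<le> C * exp (C * (1 + norm \<xi>) powr p) * (\<Sum>j\<in>UNIV. cmod (y j 0))))"

text \<open>The parameters are tuned so that each of the three errors of the scalar estimate is at
  most a constant times g = l^p. Passing from the initial values to Lagrange coordinates costs only
  a factor l^m, which the exponential absorbs.\<close>

lemma energy_estimate:
 fixes A :: "'n::finite => real => complex^'m^'m::finite" and lam :: "nat => real => real^'n => real"
 assumes T: "T > 0"
  and A: "\<And>k i j. Ck_on (CARD('m) - 1) {0..T} (\<lambda>t. A k t $ i $ j)"
  and B: "\<And>i j. Ck_on (CARD('m) - 1) {0..T} (\<lambda>t. B t $ i $ j)"
  and ev: "\<And>t \<xi>. t \<in> {0..T} ==> ordered_real_eigenvalues (symbol A t \<xi>) (\<lambda>j. lam j t \<xi>)"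
  and \<alpha>: "0 < \<alpha>" and M: "M > 0"
  and hol: "\<And>j t t' \<xi>. [|1 \<le> j; j \<le> CARD('m); t \<in> {0..T}; t' \<in> {0..T}|] ==>
      \<bar>lam j t \<xi> - lam j t' \<xi>\<bar> \<le> M * norm \<xi> * \<bar>t - t'\<bar> powr \<alpha>"
  and \<beta>: "0 < \<beta>" "\<beta> \<le> \<alpha>" "\<beta> * (real CARD('m) - 1) \<le> 1"
 shows "ode_bound A B T (1 / (1 + \<beta>))"
proof -
 define m where "m = CARD('m)"
 have m: "m \<ge> 1" by (simp add: m_def Suc_leI)
 define Lam where "Lam \<xi> = 1 + norm \<xi>" for \<xi> :: "real^'n"
 have L: "Lam \<xi> \<ge> 1" for \<xi> by (simp add: Lam_def)
 have Lam_eq: "Lam = (\<lambda>\<xi>. 1 + norm \<xi>)" by (rule ext) (simp add: Lam_def)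
 have As: "symb T Lam (m - 1) 1 (\<lambda>\<xi> t. symbol A t \<xi> $ i $ j)" for i j
  unfolding Lam_eq m_def by (rule symbol_symb[OF A])
 have Bs: "symb T Lam (m - 1) 0 (\<lambda>\<xi> t. B t $ i $ j)" for i j
  unfolding m_def by (rule symb_of_Ck_on[OF B])
 define Ms where "Ms = (\<lambda>i j \<xi> t. symbol A t \<xi> $ i $ j + B t $ i $ j)"
 have Msy: "symb T Lam (m - 1) 1 (Ms i j)" for i j
 proof -
  have "symb T Lam (m - 1) 1 (\<lambda>\<xi> t. B t $ i $ j)"
   using symb_mult[OF L Bs symb_const[of Lam _ _ 1 1, OF L], of i j] by simp
  from symb_add[OF L As this] show ?thesis unfolding Ms_def .
 qed
 obtain K where K: "K \<ge> 0" "\<And>\<xi> t. t \<in> {0..T} ==> (\<Sum>i\<in>UNIV. \<Sum>j\<in>UNIV. cmod (symbol A t \<xi> $ i $ j)) \<le> K * Lam \<xi>"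
  by (rule symb_bound_mat[of T Lam "m - 1" 1 "\<lambda>i j \<xi> t. symbol A t \<xi> $ i $ j", OF As L]) auto
 obtain CR where CR: "CR \<ge> 0" and rem: "\<forall>c K \<xi> t i (y :: 'm => complex). t \<in> {0..T} --> K \<ge> 0 --> (\<forall>k. cmod (c k) * Lam \<xi> ^ k \<le> K * Lam \<xi> ^ m) -->
   (\<forall>i j. (\<Sum>k\<le>m. c k * mat_pow (symbol A t \<xi>) k $ i $ j) = 0) -->
   cmod (\<Sum>k\<le>m. c k * (\<Sum>j\<in>UNIV. time_deriv_mat T Ms k i j \<xi> t * y j)) \<le> CR * K * Lam \<xi> ^ (m - 1) * (\<Sum>j\<in>UNIV. cmod (y j))"
  unfolding Ms_def using lower_order_remainder[of T Lam m "\<lambda>\<xi> t. symbol A t \<xi>" "\<lambda>\<xi> t. B t", OF T L m As Bs] by blast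
 have "\<forall>k. \<exists>C\<ge>0. k < m --> (\<forall>\<xi> t. t \<in> {0..T} --> (\<Sum>i\<in>UNIV. \<Sum>j\<in>UNIV. cmod (time_deriv_mat T Ms k i j \<xi> t)) \<le> C * Lam \<xi> ^ k)"
 proof
  fix k
  show "\<exists>C\<ge>0. k < m --> (\<forall>\<xi> t. t \<in> {0..T} --> (\<Sum>i\<in>UNIV. \<Sum>j\<in>UNIV. cmod (time_deriv_mat T Ms k i j \<xi> t)) \<le> C * Lam \<xi> ^ k)"
  proof (cases "k < m")
   case True
   have *: "symb T Lam (m - k) k (time_deriv_mat T Ms k i j)" for i j
    by (rule time_deriv_mat_symb[OF T L Msy]) (use True in simp)
   show ?thesis by (rule symb_bound_mat[of T Lam "m - k" k "time_deriv_mat T Ms k", OF * L]) auto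
  qed auto
 qed
 from choice[OF this] obtain CN where CN: "\<And>k. CN k \<ge> 0"
  "\<And>k \<xi> t. k < m ==> t \<in> {0..T} ==> (\<Sum>i\<in>UNIV. \<Sum>j\<in>UNIV. cmod (time_deriv_mat T Ms k i j \<xi> t)) \<le> CN k * Lam \<xi> ^ k"
  by blast
 define CNs where "CNs = (\<Sum>k<m. CN k)"
 have CNs: "CNs \<ge> 0" unfolding CNs_def by (intro sum_nonneg CN)
 define p where "p = 1 / (1 + \<beta>)"
 have p: "0 < p" "p \<le> 1" using \<beta> by (auto simp: p_def)
 have p\<beta>: "1 - \<beta> * p = p" using \<beta> by (simp add: p_def field_simps)
 define c1 where "c1 = M + real m"
 have c1: "c1 > 0" using M by (simp add: c1_def add_pos_nonneg)
 define K2 where "K2 = (1 + (K + c1)) ^ m"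
 have K2: "K2 \<ge> 0" using K c1 by (simp add: K2_def)
 \<comment> \<open>One summand for each error: lower order terms, displacement of the roots, speed
   of the nodes.\<close>
 define K1 where "K1 = CR * (1 + K) ^ m + c1 * (1 + c1) ^ (m - 1) + M * real (m + 1)"
 have K1: "K1 \<ge> 0" using CR K c1 M by (simp add: K1_def)
 \<comment> \<open>Then l^m <= (l^p)^n0, and one term of the exponential series bounds this by n0!
   exp (l^p).\<close>
 obtain n0 :: nat where n0: "real m / p < real n0" using reals_Archimedean2 by blast
 define C3 where "C3 = real m * (real m * (K2 * CNs))"
 have C3: "C3 \<ge> 0" using K2 CNs by (simp add: C3_def)
 have main: "cmod (y i t) \<le> C3 * Lam \<xi> ^ m * exp (K1 * Lam \<xi> powr p * real (m * m) * T) * (\<Sum>j\<in>UNIV. cmod (y j 0))"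
  if y: "\<And>i t. t \<in> {0..T} ==> (y i has_vector_derivative \<i> * (\<Sum>j\<in>UNIV. Ms i j \<xi> t * y j t)) (at t within {0..T})"
   and t: "t \<in> {0..T}" for \<xi> y i t
 proof -
  define l where "l = Lam \<xi>"
  have l: "l \<ge> 1" unfolding l_def by (rule L)
  \<comment> \<open>With this exponent d^\<alpha> = l^(- \<beta> p), and 1 - \<beta> p = p gives l
    d^\<alpha> = l^p.\<close>
  define d where "d = l powr - (\<beta> * p / \<alpha>)"
  have d: "d > 0" using l by (simp add: d_def)
  define g where "g = l powr p"
  have g1: "g \<ge> 1" unfolding g_def using l p by (intro ge_one_powr_ge_zero) auto
  then have g: "g > 0" by simp
  have d\<alpha>: "l * d powr \<alpha> = g"
  proof -
   have "d powr \<alpha> = l powr - (\<beta> * p)" using \<alpha> by (simp add: d_def powr_powr)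
   then have "l * d powr \<alpha> = l powr 1 * l powr - (\<beta> * p)" using l by simp
   also have "\<dots> = l powr (1 - \<beta> * p)" by (simp only: powr_add[symmetric] diff_conv_add_uminus)
   finally show ?thesis by (simp add: p\<beta> g_def)
  qed
  \<comment> \<open>Here \<beta> <= \<alpha> enters. The nodes move with speed at most M g / d,
    which relative to the gap is M / d.\<close>
  have inv_d: "1 / d \<le> g"
  proof -
   have "1 / d = l powr (\<beta> * p / \<alpha>)" by (simp add: d_def powr_minus_divide)
   also have "\<dots> \<le> l powr p"
    using l \<beta> p \<alpha> by (intro powr_mono) (auto simp: pos_divide_le_eq mult.commute mult_right_mono)
   finally show ?thesis by (simp add: g_def)
  qed
  have gl: "g \<le> l" unfolding g_def using l p powr_mono[of p 1 l] by simp
  \<comment> \<open>Here \<beta> (m - 1) <= 1 enters: the remainder of order m - 1 is divided by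
    Lagrange denominators of size at least g^(m-1).\<close>
  have lg: "l ^ (m - 1) / g ^ (m - 1) \<le> g"
  proof -
   have "l ^ (m - 1) / g ^ (m - 1) = (l powr 1 / l powr p) ^ (m - 1)" using l by (simp add: g_def power_divide)
   also have "l powr 1 / l powr p = l powr (1 - p)" by (simp only: powr_diff)
   also have "(l powr (1 - p)) ^ (m - 1) = (l powr (1 - p)) powr real (m - 1)"
    using l by (intro powr_realpow[symmetric]) simp
   also have "\<dots> = l powr ((1 - p) * real (m - 1))" by (rule powr_powr)
   also have "\<dots> \<le> l powr p"
   proof (rule powr_mono)
    have "1 - p = \<beta> * p" using p\<beta> by simp
    then have "(1 - p) * real (m - 1) = \<beta> * (real m - 1) * p" using m by (simp add: of_nat_diff)
    also have "\<dots> \<le> 1 * p" using \<beta>(3) p by (intro mult_right_mono) (auto simp: m_def)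
    finally show "(1 - p) * real (m - 1) \<le> p" by simp
   qed (use l in simp)
   finally show ?thesis by (simp add: g_def)
  qed
  have hol': "\<bar>lam j t \<xi> - lam j t' \<xi>\<bar> \<le> (M * l) * \<bar>t - t'\<bar> powr \<alpha>"
   if "j \<in> {1..m}" "t \<in> {0..T}" "t' \<in> {0..T}" for j t t'
  proof -
   have "\<bar>lam j t \<xi> - lam j t' \<xi>\<bar> \<le> M * norm \<xi> * \<bar>t - t'\<bar> powr \<alpha>"
    using that by (intro hol) (auto simp: m_def)
   also have "\<dots> \<le> (M * l) * \<bar>t - t'\<bar> powr \<alpha>"
    using M by (intro mult_right_mono mult_left_mono) (auto simp: l_def Lam_def)
   finally show ?thesis .
  qed
  have mono: "lam i t \<xi> \<le> lam j t \<xi>" if "i \<in> {1..m}" "j \<in> {1..m}" "i \<le> j" "t \<in> {0..T}" for i j t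
  proof -
   have "mono_on {1..CARD('m)} (\<lambda>j. lam j t \<xi>)"
    using ev[OF that(4), of \<xi>] unfolding ordered_real_eigenvalues_def by simp
   from mono_onD[OF this, of i j] that show ?thesis by (simp add: m_def)
  qed
  obtain nu nu' where
   dnu: "\<And>j t. j \<in> {1..m} ==> t \<in> {0..T} ==> (nu j has_real_derivative nu' j t) (at t within {0..T})"
   and bnu': "\<And>j t. j \<in> {1..m} ==> t \<in> {0..T} ==> \<bar>nu' j t\<bar> \<le> M * l * d powr \<alpha> / d"
   and near: "\<And>j t. j \<in> {1..m} ==> t \<in> {0..T} ==> \<bar>nu j t - lam j t \<xi>\<bar> \<le> M * l * d powr \<alpha>"
   and mono': "\<And>i j t. i \<in> {1..m} ==> j \<in> {1..m} ==> i \<le> j ==> t \<in> {0..T} ==> nu i t \<le> nu j t"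
  proof (rule averaged_roots[OF T d \<alpha>, of "M * l" "{1..m}" "\<lambda>j t. lam j t \<xi>"])
   show "0 \<le> M * l" using M l by simp
   show "\<bar>lam j t \<xi> - lam j t' \<xi>\<bar> \<le> M * l * \<bar>t - t'\<bar> powr \<alpha>"
    if "j \<in> {1..m}" "t \<in> {0..T}" "t' \<in> {0..T}" for j t t'
    using hol'[OF that] .
   show "lam i t \<xi> \<le> lam j t \<xi>" if "i \<in> {1..m}" "j \<in> {1..m}" "i \<le> j" "t \<in> {0..T}" for i j t
    using mono[OF that] .
  qed (rule that, blast+)
  have Mld: "M * l * d powr \<alpha> = M * g" using d\<alpha> by (simp add: mult.assoc)
  \<comment> \<open>The averages may coincide but keep their order, so adding j g separates them by
    at least g and displaces each by at most m g.\<close>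
  define mu where "mu j t = nu j t + real j * g" for j t
  have gap: "g \<le> \<bar>mu i t - mu j t\<bar>" if "i \<in> {1..m}" "j \<in> {1..m}" "i \<noteq> j" "t \<in> {0..T}" for i j t
  proof -
   have *: "g \<le> mu j t - mu i t" if ij: "i \<in> {1..m}" "j \<in> {1..m}" "i < j" for i j
   proof -
    have "nu i t \<le> nu j t" using ij \<open>t \<in> {0..T}\<close> by (intro mono') auto
    moreover have "1 * g \<le> (real j - real i) * g" using ij g by (intro mult_right_mono) auto
    ultimately show ?thesis by (simp add: mu_def left_diff_distrib)
   qed
   show ?thesis using *[of i j] *[of j i] that by (cases "i < j") auto
  qed
  have dmu: "(mu j has_real_derivative nu' j t) (at t within {0..T})" if "j \<in> {1..m}" "t \<in> {0..T}" for j t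
   unfolding mu_def using DERIV_add[OF dnu[OF that] DERIV_const[of "real j * g"]] by simp
  have near': "\<bar>mu j t - lam j t \<xi>\<bar> \<le> c1 * g" if "j \<in> {1..m}" "t \<in> {0..T}" for j t
  proof -
   have "\<bar>mu j t - lam j t \<xi>\<bar> \<le> \<bar>nu j t - lam j t \<xi>\<bar> + real j * g"
   proof -
    have "0 \<le> real j * g" using g by simp
    then show ?thesis unfolding mu_def by linarith
   qed
   also have "\<dots> \<le> M * g + real m * g"
    using near[OF that] that g unfolding Mld by (intro add_mono mult_right_mono) auto
   finally show ?thesis by (simp add: c1_def distrib_right)
  qed
  have lamb: "\<bar>lam j t \<xi>\<bar> \<le> K * l" if "j \<in> {1..m}" "t \<in> {0..T}" for j t
   using ordered_real_eigenvalues_props(1)[OF ev[OF that(2), of \<xi>], of j] K(2)[OF that(2), of \<xi>] that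
   by (auto simp: m_def l_def)
  have mub: "\<bar>mu j t\<bar> \<le> (K + c1) * l" if "j \<in> {1..m}" "t \<in> {0..T}" for j t
  proof -
   have "\<bar>mu j t\<bar> \<le> \<bar>lam j t \<xi>\<bar> + \<bar>mu j t - lam j t \<xi>\<bar>" by linarith
   also have "\<dots> \<le> K * l + c1 * l"
    using lamb[OF that] near'[OF that] mult_left_mono[OF gl less_imp_le[OF c1]] by linarith
   finally show ?thesis by (simp add: distrib_right)
  qed
  define w where "w k i t = (\<Sum>j\<in>UNIV. time_deriv_mat T Ms k i j \<xi> t * y j t)" for k i t
  have w0: "w 0 = y" by (simp add: w_def fun_eq_iff if_distrib if_distribR cong: if_cong)
  have dw: "(w k i has_vector_derivative \<i> * w (Suc k) i t) (at t within {0..T})" if "k < m" "t \<in> {0..T}" for k i t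
   unfolding w_def by (rule time_deriv_mat_has_derivative[OF T L Msy that(1) y that(2)])
  define r where "r = CR * (1 + K) ^ m * l ^ (m - 1)"
  have r: "r \<ge> 0" using CR K l by (simp add: r_def)
  have R: "cmod (\<Sum>k\<le>m. coeff (\<Prod>j\<in>{1..m}. lin (cor (lam j t \<xi>))) k * w k i t) \<le> r * (\<Sum>j\<in>UNIV. cmod (w 0 j t))"
   if t: "t \<in> {0..T}" for i t
   unfolding r_def w0 unfolding w_def l_def
  proof (rule rem[rule_format, OF t])
   show "(1 + K) ^ m \<ge> 0" using K by simp
   show "(\<Sum>k\<le>m. coeff (\<Prod>j\<in>{1..m}. lin (cor (lam j t \<xi>))) k * mat_pow (symbol A t \<xi>) k $ i $ j) = 0" for i j
    using ordered_real_eigenvalues_props(2)[OF ev[OF t, of \<xi>], of i j] by (simp add: m_def)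
   show "cmod (coeff (\<Prod>j\<in>{1..m}. lin (cor (lam j t \<xi>))) k) * Lam \<xi> ^ k \<le> (1 + K) ^ m * Lam \<xi> ^ m" for k
    using coeff_prod_lin_bound[of "{1..m}" "\<lambda>j. cor (lam j t \<xi>)" K "Lam \<xi>" k] lamb[OF _ t] L K
    by (simp add: l_def power_mult_distrib)
  qed
  define v where "v lx i t = (\<Sum>k<m. coeff (\<Prod>j\<in>{1..m} - {lx}. lin (cor (mu j t))) k * w k i t)" for lx i t
  define \<kappa> where "\<kappa> = r / g ^ (m - 1) + c1 * g * (1 + c1) ^ (m - 1) + (M * g / d) / g * real (m + 1)"
  have Dn: "M * g / d \<ge> 0" using M g d by simp
  have bmu: "\<bar>nu' j t\<bar> \<le> M * g / d" if "j \<in> {1..m}" "t \<in> {0..T}" for j t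
   using bnu'[OF that] unfolding Mld .
  have c1': "c1 \<ge> 0" using c1 by simp
  note lam_inst = sylvester_energy[where lam = "\<lambda>j t. lam j t \<xi>" and mu = mu and mu' = nu' and ?c1.0 = c1 and T = T
    and w = w and m = m and g = g and r = r and D = "M * g / d" and t = t]
  have en1: "(\<Sum>(lx, i)\<in>{1..m} \<times> UNIV. (cmod (v lx i t))\<^sup>2)
    \<le> (\<Sum>(lx, i)\<in>{1..m} \<times> UNIV. (cmod (v lx i 0))\<^sup>2) * exp (2 * \<kappa> * real (m * CARD('m)) * t)"
   unfolding v_def \<kappa>_def
   by (rule lam_inst(1)) (fact m g c1' Dn r gap dmu bmu near' dw R t)+
  have en2: "cmod (w 0 i t) \<le> (\<Sum>lx\<in>{1..m}. cmod (v lx i t)) / g ^ (m - 1)" for i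
   unfolding v_def
   by (rule lam_inst(2)) (fact m g c1' Dn r gap dmu bmu near' dw R t)+
  have \<kappa>: "\<kappa> \<le> K1 * g"
  proof -
   have "r / g ^ (m - 1) = CR * (1 + K) ^ m * (l ^ (m - 1) / g ^ (m - 1))" by (simp add: r_def)
   also have "\<dots> \<le> CR * (1 + K) ^ m * g" using CR K by (intro mult_left_mono lg) auto
   finally have 1: "r / g ^ (m - 1) \<le> CR * (1 + K) ^ m * g" .
   have "(M * g / d) / g * real (m + 1) = M * (1 / d) * real (m + 1)" using g by simp
   also have "\<dots> \<le> M * g * real (m + 1)"
    using M by (intro mult_right_mono mult_left_mono inv_d) auto
   finally have 2: "(M * g / d) / g * real (m + 1) \<le> M * g * real (m + 1)" .
   have "\<kappa> \<le> CR * (1 + K) ^ m * g + c1 * g * (1 + c1) ^ (m - 1) + M * g * real (m + 1)"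
    unfolding \<kappa>_def by (intro add_mono 1 2 order_refl)
   also have "\<dots> = K1 * g" by (simp add: K1_def algebra_simps)
   finally show ?thesis .
  qed
  have \<kappa>0: "\<kappa> \<ge> 0"
   unfolding \<kappa>_def using r g c1 Dn M d by (intro add_nonneg_nonneg mult_nonneg_nonneg divide_nonneg_nonneg) auto
  define N0 where "N0 = (\<Sum>j\<in>UNIV. cmod (y j 0))"
  have N0: "N0 \<ge> 0" by (simp add: N0_def sum_nonneg)
  have T0: "0 \<in> {0..T}" using T by simp
  have v0: "cmod (v lx i 0) \<le> K2 * CNs * l ^ m * N0" if lx: "lx \<in> {1..m}" for lx i
  proof -
   have cf: "cmod (coeff (\<Prod>j\<in>{1..m} - {lx}. lin (cor (mu j 0))) k) * l ^ k \<le> K2 * l ^ m" for k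
   proof -
    have "cmod (coeff (\<Prod>j\<in>{1..m} - {lx}. lin (cor (mu j 0))) k) * l ^ k \<le> ((1 + (K + c1)) * l) ^ card ({1..m} - {lx})"
     using mub[OF _ T0] l K c1 by (intro coeff_prod_lin_bound) auto
    also have "\<dots> \<le> ((1 + (K + c1)) * l) ^ m"
    proof (rule power_increasing)
     show "1 \<le> (1 + (K + c1)) * l" using l K c1 mult_mono[of 1 "1 + (K + c1)" 1 l] by simp
    qed (use lx in simp)
    finally show ?thesis by (simp add: K2_def power_mult_distrib)
   qed
   have wb: "cmod (w k i 0) \<le> CN k * l ^ k * N0" if "k < m" for k
   proof -
    have "cmod (w k i 0) \<le> (\<Sum>j\<in>UNIV. (CN k * l ^ k) * cmod (y j 0))"
     unfolding w_def
    proof (intro order_trans[OF norm_sum] sum_mono)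
     fix j
     have "cmod (time_deriv_mat T Ms k i j \<xi> 0) \<le> CN k * l ^ k"
      using entry_le_sum[of "\<lambda>i j. cmod (time_deriv_mat T Ms k i j \<xi> 0)" i j] CN(2)[OF that T0, of \<xi>] by (simp add: l_def)
     then show "cmod (time_deriv_mat T Ms k i j \<xi> 0 * y j 0) \<le> (CN k * l ^ k) * cmod (y j 0)"
      unfolding norm_mult by (rule mult_right_mono) simp
    qed
    then show ?thesis by (simp add: sum_distrib_left[symmetric] N0_def)
   qed
   have "cmod (v lx i 0) \<le> (\<Sum>k<m. K2 * l ^ m * (CN k * N0))"
    unfolding v_def
   proof (intro order_trans[OF norm_sum] sum_mono)
    fix k assume k: "k \<in> {..<m}"
    let ?c = "coeff (\<Prod>j\<in>{1..m} - {lx}. lin (cor (mu j 0))) k"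
    have "cmod (?c * w k i 0) \<le> cmod ?c * (CN k * l ^ k * N0)"
     unfolding norm_mult using k by (intro mult_left_mono wb) auto
    also have "\<dots> = (cmod ?c * l ^ k) * (CN k * N0)" by simp
    also have "\<dots> \<le> K2 * l ^ m * (CN k * N0)"
     using CN(1)[of k] N0 by (intro mult_right_mono cf) auto
    finally show "cmod (?c * w k i 0) \<le> K2 * l ^ m * (CN k * N0)" .
   qed
   then show ?thesis by (simp add: CNs_def sum_distrib_left sum_distrib_right mult_ac)
  qed
  let ?V = "K2 * CNs * l ^ m * N0"
  have V: "?V \<ge> 0" using K2 CNs l N0 by simp
  have vt: "cmod (v lx i t) \<le> real m * ?V * exp (K1 * g * real (m * m) * T)" if lx: "lx \<in> {1..m}" for lx i
  proof -
   have "(cmod (v lx i t))\<^sup>2 \<le> (\<Sum>(lx, i)\<in>{1..m} \<times> UNIV. (cmod (v lx i t))\<^sup>2)"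
    using member_le_sum[of "(lx, i)" "{1..m} \<times> UNIV" "\<lambda>(lx, i). (cmod (v lx i t))\<^sup>2"] lx by auto
   also have "\<dots> \<le> (\<Sum>(lx, i)\<in>{1..m} \<times> (UNIV::'m set). (cmod (v lx i 0))\<^sup>2) * exp (2 * \<kappa> * real (m * CARD('m)) * t)"
    by (rule en1)
   also have "\<dots> \<le> (\<Sum>(lx, i)\<in>{1..m} \<times> (UNIV::'m set). ?V\<^sup>2) * exp (2 * (K1 * g) * real (m * m) * T)"
   proof (rule mult_mono)
    show "(\<Sum>(lx, i)\<in>{1..m} \<times> (UNIV::'m set). (cmod (v lx i 0))\<^sup>2) \<le> (\<Sum>(lx, i)\<in>{1..m} \<times> (UNIV::'m set). ?V\<^sup>2)"
     using v0 by (intro sum_mono) (auto intro!: power_mono)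
    have "2 * \<kappa> * real (m * CARD('m)) * t \<le> 2 * (K1 * g) * real (m * m) * T"
     unfolding m_def[symmetric] using \<kappa> \<kappa>0 t K1 g T by (intro mult_mono) auto
    then show "exp (2 * \<kappa> * real (m * CARD('m)) * t) \<le> exp (2 * (K1 * g) * real (m * m) * T)" by simp
   qed (auto intro: sum_nonneg)
   also have "(\<Sum>(lx, i)\<in>{1..m} \<times> (UNIV::'m set). ?V\<^sup>2) = (real m * ?V)\<^sup>2"
    by (simp add: case_prod_unfold card_cartesian_product m_def[symmetric] power_mult_distrib power2_eq_square)
   also have "exp (2 * (K1 * g) * real (m * m) * T) = (exp (K1 * g * real (m * m) * T))\<^sup>2"
    by (simp add: exp_double[symmetric] mult_ac)
   also have "(real m * ?V)\<^sup>2 * (exp (K1 * g * real (m * m) * T))\<^sup>2 = (real m * ?V * exp (K1 * g * real (m * m) * T))\<^sup>2"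
    by (rule power_mult_distrib[symmetric])
   finally show ?thesis
    by (rule power2_le_imp_le) (use V in simp)
  qed
  have "cmod (y i t) \<le> (\<Sum>lx\<in>{1..m}. cmod (v lx i t)) / g ^ (m - 1)"
   using en2[of i] by (simp add: w0)
  also have "\<dots> \<le> (\<Sum>lx\<in>{1..m}. cmod (v lx i t)) / 1"
   using g1 by (intro divide_left_mono sum_nonneg) auto
  also have "\<dots> \<le> (\<Sum>lx\<in>{1..m}. real m * ?V * exp (K1 * g * real (m * m) * T))"
   unfolding div_by_1 by (rule sum_mono) (rule vt)
  also have "\<dots> = C3 * l ^ m * exp (K1 * g * real (m * m) * T) * N0 / 1"
   by (simp add: C3_def)
  finally show ?thesis by (simp add: l_def g_def N0_def)
 qed
 define C where "C = C3 * fact n0 + K1 * real (m * m) * T + 1"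
 have C: "C > 0" "C3 * fact n0 \<le> C" "K1 * real (m * m) * T + 1 \<le> C"
  using C3 K1 T by (auto simp: C_def add_pos_nonneg add_nonneg_pos)
 show ?thesis
  unfolding ode_bound_def p_def[symmetric]
 proof (rule exI[of _ C], intro conjI allI impI ballI)
  fix \<xi> :: "real^'n" and y :: "'m => real => complex" and i t
  assume y: "\<forall>i. \<forall>t\<in>{0..T}. (y i has_vector_derivative \<i> * (\<Sum>j\<in>UNIV. (symbol A t \<xi> $ i $ j + B t $ i $ j) * y j t)) (at t within {0..T})"
   and t: "t \<in> {0..T}"
  let ?g = "Lam \<xi> powr p"
  have g1: "?g \<ge> 1" using L p by (intro ge_one_powr_ge_zero) auto
  have "Lam \<xi> ^ m \<le> fact n0 * exp ?g"
  proof -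
   have "Lam \<xi> ^ m = Lam \<xi> powr (p * (real m / p))" using p L[of \<xi>] by (simp add: powr_realpow)
   also have "\<dots> = ?g powr (real m / p)" by (simp add: powr_powr)
   also have "\<dots> \<le> ?g powr real n0" using g1 n0 by (intro powr_mono) auto
   also have "\<dots> = ?g ^ n0" by (rule powr_realpow) (use g1 in linarith)
   also have "\<dots> \<le> fact n0 * exp ?g"
    using power_div_fact_le_exp[of ?g n0] by (simp add: pos_divide_le_eq mult.commute)
   finally show ?thesis .
  qed
  then have "C3 * Lam \<xi> ^ m * exp (K1 * ?g * real (m * m) * T) \<le> C3 * (fact n0 * exp ?g) * exp (K1 * ?g * real (m * m) * T)"
   using C3 by (intro mult_right_mono mult_left_mono) auto
  also have "\<dots> = (C3 * fact n0) * exp ((K1 * real (m * m) * T + 1) * ?g)"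
   by (simp add: exp_add[symmetric] algebra_simps)
  also have "\<dots> \<le> C * exp (C * ?g)"
   using C g1 by (intro mult_mono) (auto intro!: mult_right_mono)
  finally have b: "C3 * Lam \<xi> ^ m * exp (K1 * ?g * real (m * m) * T) \<le> C * exp (C * ?g)" .
  have "cmod (y i t) \<le> C3 * Lam \<xi> ^ m * exp (K1 * ?g * real (m * m) * T) * (\<Sum>j\<in>UNIV. cmod (y j 0))"
   by (rule main[OF _ t]) (use y in \<open>simp add: Ms_def\<close>)
  also have "\<dots> \<le> C * exp (C * ?g) * (\<Sum>j\<in>UNIV. cmod (y j 0))"
   by (intro mult_right_mono b sum_nonneg) simp
  finally show "cmod (y i t) \<le> C * exp (C * (1 + norm \<xi>) powr p) * (\<Sum>j\<in>UNIV. cmod (y j 0))"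
   by (simp add: Lam_def)
 qed (use C in simp)
qed

subsection \<open>Smooth functions\<close>

lemma finite_family_bound:
 fixes P :: "'a::finite => real => bool"
 assumes "\<And>i. \<exists>B. P i B" and "\<And>i B B'. P i B ==> B \<le> B' ==> P i B'"
 shows "\<exists>B>0. \<forall>i. P i B"
proof -
 obtain f where f: "\<And>i. P i (f i)" using assms(1) by metis
 have "P i (1 + (\<Sum>j\<in>UNIV. \<bar>f j\<bar>))" for i
 proof (rule assms(2)[OF f])
  have "\<bar>f i\<bar> \<le> (\<Sum>j\<in>UNIV. \<bar>f j\<bar>)" by (rule member_le_sum) auto
  then show "f i \<le> 1 + (\<Sum>j\<in>UNIV. \<bar>f j\<bar>)" by linarith
 qed
 moreover have "1 + (\<Sum>j\<in>UNIV. \<bar>f j\<bar>) > 0" by (simp add: add_pos_nonneg sum_nonneg)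
 ultimately show ?thesis by blast
qed

lemma iterated_partial_Nil [simp]: "iterated_partial [] f = f"
 by (simp add: iterated_partial_def)

lemma iterated_partial_Cons: "iterated_partial (k # ks) f = partial_deriv k (iterated_partial ks f)"
 by (simp add: iterated_partial_def)

lemma iterated_partial_append: "iterated_partial (ks @ ls) f = iterated_partial ks (iterated_partial ls f)"
 by (simp add: iterated_partial_def)

lemma smooth_has_partial:
 assumes "smooth f"
 shows "has_partial k (iterated_partial ks f) (iterated_partial (k # ks) f x) x"
proof -
 have "(\<lambda>h. iterated_partial ks f (x + h *\<^sub>R axis k 1)) differentiable (at 0)"
  using assms by (simp add: smooth_def)
 then have "((\<lambda>h. iterated_partial ks f (x + h *\<^sub>R axis k 1)) has_vector_derivative
   vector_derivative (\<lambda>h. iterated_partial ks f (x + h *\<^sub>R axis k 1)) (at 0)) (at 0)"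
  by (simp add: vector_derivative_works)
 then show ?thesis by (simp add: has_partial_def iterated_partial_Cons partial_deriv_def)
qed

lemma smooth_continuous: "smooth f ==> continuous_on UNIV (iterated_partial ks f)"
 by (simp add: smooth_def)

text \<open>A certificate for smoothness: a family of continuous functions indexed by all lists of
  directions, each of which has the next ones as partial derivatives. It also identifies the
  iterated partial derivatives.\<close>

lemma smooth_by_derivatives:
 assumes "D [] = f" and p: "\<And>ks k x. has_partial k (D ks) (D (k # ks) x) x"
  and c: "\<And>ks. continuous_on UNIV (D ks)"
 shows "smooth f" and "iterated_partial ks f = D ks"
proof -
 have eq: "iterated_partial ks f = D ks" for ks
 proof (induction ks)
  case (Cons k ks)
  show ?case
   unfolding iterated_partial_Cons Cons by (rule ext, rule has_partial_imp, rule p)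
 qed (simp add: assms(1))
 have "(\<lambda>h. D ks (x + h *\<^sub>R axis k 1)) differentiable (at 0)" for ks k x
  using p[of k ks x] unfolding has_partial_def by (blast intro: differentiableI_vector)
 then show "smooth f"
  unfolding smooth_def eq using c by blast
 show "iterated_partial ks f = D ks" by (rule eq)
qed

lemma smooth_iterated_partial: "smooth f ==> smooth (iterated_partial ls f)"
 by (rule smooth_by_derivatives(1)[where D = "\<lambda>ks. iterated_partial (ks @ ls) f"])
   (use smooth_has_partial smooth_continuous in auto)

lemma has_partial_lincomb:
 fixes f g :: "real^'n::finite => complex"
 assumes "has_partial k f d x" "has_partial k g e x"
 shows "has_partial k (\<lambda>x. a * f x + b * g x) (a * d + b * e) x"
 using assms unfolding has_partial_def
 by (intro has_vector_derivative_add has_vector_derivative_mult_right)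

lemma
 fixes f g :: "real^'n::finite => complex"
 assumes f: "smooth f" and g: "smooth g"
 shows smooth_lincomb: "smooth (\<lambda>x. a * f x + b * g x)"
  and iterated_partial_lincomb:
   "iterated_partial ks (\<lambda>x. a * f x + b * g x) x = a * iterated_partial ks f x + b * iterated_partial ks g x"
proof -
 let ?D = "\<lambda>ks x. a * iterated_partial ks f x + b * iterated_partial ks g x"
 have 1: "has_partial k (?D ks) (?D (k # ks) x) x" for k ks x
  by (intro has_partial_lincomb smooth_has_partial f g)
 have 2: "continuous_on UNIV (?D ks)" for ks
  by (intro continuous_intros smooth_continuous f g)
 show "smooth (\<lambda>x. a * f x + b * g x)"
  by (rule smooth_by_derivatives(1)[where D = ?D, OF _ 1 2]) simp
 show "iterated_partial ks (\<lambda>x. a * f x + b * g x) x = ?D ks x"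
  by (subst smooth_by_derivatives(2)[where D = ?D, OF _ 1 2]) simp_all
qed

lemma smooth_zero: "smooth (\<lambda>_. 0 :: complex)" and iterated_partial_zero: "iterated_partial ks (\<lambda>_. 0 :: complex) x = 0"
proof -
 have 1: "has_partial k (\<lambda>_. 0 :: complex) 0 x" for k and x :: "real^'n::finite"
  unfolding has_partial_def by (rule has_vector_derivative_const)
 show "smooth (\<lambda>_::real^'n::finite. 0 :: complex)"
  by (rule smooth_by_derivatives(1)[where D = "\<lambda>_ _. 0"]) (use 1 in auto)
 show "iterated_partial ks (\<lambda>_::real^'n::finite. 0 :: complex) x = 0" for ks and x :: "real^'n::finite"
  by (subst smooth_by_derivatives(2)[where D = "\<lambda>_ _. 0"]) (use 1 in auto)
qed

lemma
 fixes f :: "'a => real^'n::finite => complex"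
 assumes "finite I" "\<And>i. i \<in> I ==> smooth (f i)"
 shows smooth_sum: "smooth (\<lambda>x. \<Sum>i\<in>I. c i * f i x)"
  and iterated_partial_sum:
   "iterated_partial ks (\<lambda>x. \<Sum>i\<in>I. c i * f i x) x = (\<Sum>i\<in>I. c i * iterated_partial ks (f i) x)"
proof -
 have "smooth (\<lambda>x. \<Sum>i\<in>I. c i * f i x) \<and>
   iterated_partial ks (\<lambda>x. \<Sum>i\<in>I. c i * f i x) x = (\<Sum>i\<in>I. c i * iterated_partial ks (f i) x)"
  using assms
 proof (induction rule: finite_induct)
  case (insert i I)
  then have 1: "smooth (f i)" and 2: "smooth (\<lambda>x. \<Sum>i\<in>I. c i * f i x)"
   and 3: "iterated_partial ks (\<lambda>x. \<Sum>i\<in>I. c i * f i x) x = (\<Sum>i\<in>I. c i * iterated_partial ks (f i) x)"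
   by auto
  show ?case
   using smooth_lincomb[OF 1 2, of "c i" 1] iterated_partial_lincomb[OF 1 2, of ks "c i" 1 x] insert(1,2)
   by (simp add: 3)
 qed (simp add: smooth_zero iterated_partial_zero)
 then show "smooth (\<lambda>x. \<Sum>i\<in>I. c i * f i x)"
  and "iterated_partial ks (\<lambda>x. \<Sum>i\<in>I. c i * f i x) x = (\<Sum>i\<in>I. c i * iterated_partial ks (f i) x)" by auto
qed

section \<open>Locality of partial derivatives\<close>

lemma has_partial_transform_open:
 assumes "open S" "x \<in> S" "\<And>y. y \<in> S ==> f y = g y" "has_partial k f d x"
 shows "has_partial k g d x"
 unfolding has_partial_def
proof (rule has_vector_derivative_transform_within_open)
 show "((\<lambda>h. f (x + h *\<^sub>R axis k 1)) has_vector_derivative d) (at 0)"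
  using assms(4) by (simp add: has_partial_def)
 show "open ((\<lambda>h::real. x + h *\<^sub>R axis k 1) -` S)"
  by (intro open_vimage assms(1) continuous_intros)
qed (use assms in auto)

lemma partial_deriv_cong_open:
 assumes "open S" "x \<in> S" "\<And>y. y \<in> S ==> f y = g y"
 shows "partial_deriv k f x = partial_deriv k g x"
proof -
 have "has_partial k f d x = has_partial k g d x" for d
 proof
  show "has_partial k f d x ==> has_partial k g d x"
   by (rule has_partial_transform_open[where f = f and g = g, OF assms])
  show "has_partial k g d x ==> has_partial k f d x"
   by (rule has_partial_transform_open[where f = g and g = f, OF assms(1,2)]) (simp_all add: assms(3))
 qed
 then show ?thesis
  by (simp add: partial_deriv_def vector_derivative_def has_partial_def)
qed

lemma iterated_partial_cong_open:
 assumes "open S" "\<And>y. y \<in> S ==> f y = g y"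
 shows "x \<in> S ==> iterated_partial ks f x = iterated_partial ks g x"
proof (induction ks arbitrary: x)
 case (Cons k ks)
 then show ?case
  unfolding iterated_partial_Cons by (intro partial_deriv_cong_open[OF assms(1)]) auto
qed (use assms in auto)

lemma smooth_locally:
 assumes "\<And>x. \<exists>S g. open S \<and> x \<in> S \<and> smooth g \<and> (\<forall>y\<in>S. f y = g y)"
 shows "smooth f"
proof (rule smooth_by_derivatives(1)[where D = "\<lambda>ks. iterated_partial ks f"])
 fix ks k x
 obtain S g where S: "open S" "x \<in> S" "smooth g" "\<And>y. y \<in> S ==> f y = g y" using assms[of x] by metis
 have eq: "iterated_partial ks f y = iterated_partial ks g y" if "y \<in> S" for y ks
  using iterated_partial_cong_open[OF S(1,4) that] .
 show "has_partial k (iterated_partial ks f) (iterated_partial (k # ks) f x) x"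
  by (rule has_partial_transform_open[OF S(1,2), where f = "iterated_partial ks g"])
    (simp_all only: eq S(2) smooth_has_partial[OF S(3)])
next
 fix ks
 have "isCont (iterated_partial ks f) x" for x
 proof -
  obtain S g where S: "open S" "x \<in> S" "smooth g" "\<And>y. y \<in> S ==> f y = g y" using assms[of x] by metis
  have eq: "iterated_partial ks f y = iterated_partial ks g y" if "y \<in> S" for y
   using iterated_partial_cong_open[OF S(1,4) that] .
  have "continuous_on S (iterated_partial ks f)"
   by (subst continuous_on_cong[OF refl, of S _ "iterated_partial ks g"])
     (rule eq, assumption, rule continuous_on_subset[OF smooth_continuous[OF S(3)] subset_UNIV])
  then show ?thesis by (rule continuous_on_interior) (simp add: interior_open S(1,2))
 qed
 then show "continuous_on UNIV (iterated_partial ks f)"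
  by (intro continuous_at_imp_continuous_on ballI)
qed simp

subsection \<open>Inverse Fourier transforms of rapidly decaying functions\<close>

text \<open>With q = 1 / s this is the size, on the Fourier side, of compactly supported functions
  of Gevrey order s > 1.\<close>

definition decay :: "real => real => real^'n::finite => real" where
 "decay c q \<xi> = exp (- c * norm \<xi> powr q)"

lemma decay_pos: "decay c q \<xi> > 0"
 by (simp add: decay_def)

lemma decay_le_1: "c \<ge> 0 ==> decay c q \<xi> \<le> 1"
 by (simp add: decay_def)

text \<open>Since p < q, the decay term dominates once r^(q - p) exceeds 2^p C / c, where the 2
  comes from 1 + r <= 2 r. Below that radius the growth term is bounded.\<close>

lemma growth_absorb:
 fixes C c p q :: real
 assumes p: "0 < p" "p < q" and c: "c > 0" and C: "C \<ge> 0"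
 obtains B where "B > 0" "\<And>r. r \<ge> 0 ==> C * (1 + r) powr p - c * r powr q \<le> B"
proof -
 define R where "R = max 1 ((2 powr p * C / c) powr (1 / (q - p)))"
 have R: "R \<ge> 1" by (simp add: R_def)
 show ?thesis
 proof (rule that[of "C * (1 + R) powr p + 1"])
  show "C * (1 + R) powr p + 1 > 0" using C by (simp add: add_nonneg_pos)
  fix r :: real assume r: "r \<ge> 0"
  show "C * (1 + r) powr p - c * r powr q \<le> C * (1 + R) powr p + 1"
  proof (cases "r \<ge> R")
   case True
   then have r1: "r \<ge> 1" using R by simp
   have "2 powr p * C / c = ((2 powr p * C / c) powr (1 / (q - p))) powr (q - p)"
    using p c C by (simp add: powr_powr)
   also have "\<dots> \<le> r powr (q - p)"
    using p True by (intro powr_mono2) (auto simp: R_def)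
   finally have 1: "2 powr p * C \<le> c * r powr (q - p)"
    using c by (simp add: field_simps)
   have "(1 + r) powr p \<le> (2 * r) powr p" using r1 p by (intro powr_mono2) auto
   then have "C * (1 + r) powr p \<le> C * (2 * r) powr p" using C by (intro mult_left_mono)
   also have "\<dots> = (2 powr p * C) * r powr p" using r by (simp add: powr_mult)
   also have "\<dots> \<le> (c * r powr (q - p)) * r powr p" by (intro mult_right_mono 1) simp
   also have "\<dots> = c * r powr q" using r1 by (simp add: mult.assoc flip: powr_add)
   finally show ?thesis using C by (smt (verit) mult_nonneg_nonneg powr_ge_zero)
  next
   case False
   then have "(1 + r) powr p \<le> (1 + R) powr p" using r p by (intro powr_mono2) auto
   then have "C * (1 + r) powr p \<le> C * (1 + R) powr p" using C by (intro mult_left_mono)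
   moreover have "c * r powr q \<ge> 0" using c by simp
   ultimately show ?thesis by linarith
  qed
 qed
qed

lemma exp_growth_decay:
 assumes p: "0 < p" "p < q" and c: "c > 0" and C: "C \<ge> 0"
 obtains B where "B > 0"
  "\<And>\<xi>::real^'n::finite. exp (C * (1 + norm \<xi>) powr p) * decay c q \<xi> \<le> B * decay (c / 2) q \<xi>"
proof -
 obtain B where B: "B > 0" "\<And>r. r \<ge> 0 ==> C * (1 + r) powr p - c / 2 * r powr q \<le> B"
  using growth_absorb[of p q "c / 2" C] p c C by auto
 show ?thesis
 proof (rule that[of "exp B"])
  fix \<xi> :: "real^'n"
  have "exp (C * (1 + norm \<xi>) powr p) * decay c q \<xi> =
    exp (C * (1 + norm \<xi>) powr p - c / 2 * norm \<xi> powr q) * decay (c / 2) q \<xi>"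
   by (simp add: decay_def flip: exp_add)
  also have "\<dots> \<le> exp B * decay (c / 2) q \<xi>"
   using B(2)[of "norm \<xi>"] by (intro mult_right_mono) (auto simp: decay_pos less_imp_le)
  finally show "exp (C * (1 + norm \<xi>) powr p) * decay c q \<xi> \<le> exp B * decay (c / 2) q \<xi>" .
 qed simp
qed

text \<open>A power of 1 + |\<xi>| is at most an exponential of any small positive power of it; the
  exponent q / 2 reduces the claim to the absorption of subcritical exponential growth.\<close>

lemma power_decay:
 assumes q: "0 < q" and c: "c > 0"
 obtains B where "B > 0"
  "\<And>\<xi>::real^'n::finite. (1 + norm \<xi>) ^ N * decay c q \<xi> \<le> B * decay (c / 2) q \<xi>"
proof -
 define p where "p = q / 2"
 have p: "0 < p" "p < q" using q by (auto simp: p_def)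
 obtain B where B: "B > 0"
  "\<And>\<xi>::real^'n. exp (N / p * (1 + norm \<xi>) powr p) * decay c q \<xi> \<le> B * decay (c / 2) q \<xi>"
  using exp_growth_decay[of p q c "N / p"] p c by (auto simp: less_imp_le)
 show ?thesis
 proof (rule that[OF B(1)])
  fix \<xi> :: "real^'n"
  let ?r = "1 + norm \<xi>"
  have r: "?r > 0" by (simp add: add_pos_nonneg)
  have "p * ln ?r = ln (?r powr p)" using r by (simp add: ln_powr)
  also have "\<dots> \<le> ?r powr p - 1" using r by (intro ln_le_minus_one) simp
  finally have "ln ?r \<le> ?r powr p / p" using p by (simp add: field_simps)
  then have "N * ln ?r \<le> N * (?r powr p / p)" by (intro mult_left_mono) auto
  then have "exp (N * ln ?r) \<le> exp (N / p * ?r powr p)" by simp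
  then have "?r ^ N \<le> exp (N / p * ?r powr p)" using r by (simp add: exp_of_nat_mult)
  then show "?r ^ N * decay c q \<xi> \<le> B * decay (c / 2) q \<xi>"
   using B(2)[of \<xi>] by (meson decay_pos less_imp_le mult_right_mono order_trans)
 qed
qed

lemma continuous_on_decay: "q > 0 ==> continuous_on UNIV (decay c q :: real^'n::finite => real)"
 unfolding decay_def[abs_def] by (intro continuous_intros continuous_on_powr') auto

lemma integrable_inverse_prod:
 "integrable lborel (\<lambda>x::real^'n::finite. \<Prod>i\<in>UNIV. inverse (1 + (x $ i)\<^sup>2))"
proof (rule integrable_prod_vec)
 show "integrable lborel (\<lambda>x::real. inverse (1 + x\<^sup>2))"
  using integrable_inverse_1_plus_square by (simp add: set_integrable_def)
qed

text \<open>Comparison with the integrable product of the functions 1 / (1 + \<xi>_i^2), at the cost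
  of 2 n further powers of 1 + |\<xi>|, which the decay pays for.\<close>

lemma integrable_power_decay:
 assumes q: "0 < q" and c: "c > 0"
 shows "integrable lborel (\<lambda>\<xi>::real^'n::finite. (1 + norm \<xi>) ^ N * decay c q \<xi>)"
proof -
 obtain B where B: "B > 0"
  "\<And>\<xi>::real^'n. (1 + norm \<xi>) ^ (N + 2 * CARD('n)) * decay c q \<xi> \<le> B * decay (c / 2) q \<xi>"
  using power_decay[OF q c] by blast
 show ?thesis
 proof (rule Bochner_Integration.integrable_bound[OF integrable_mult_right[OF integrable_inverse_prod, of B]])
  show "(\<lambda>\<xi>::real^'n. (1 + norm \<xi>) ^ N * decay c q \<xi>) \<in> borel_measurable lborel"
   unfolding measurable_lborel2
   by (intro borel_measurable_continuous_onI continuous_intros continuous_on_decay q)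
  show "AE \<xi>::real^'n in lborel. norm ((1 + norm \<xi>) ^ N * decay c q \<xi>) \<le> norm (B * (\<Prod>i\<in>UNIV. inverse (1 + (\<xi> $ i)\<^sup>2)))"
  proof (rule AE_I2)
   fix \<xi> :: "real^'n"
   let ?r = "1 + norm \<xi>"
   have r: "?r > 0" by (simp add: add_pos_nonneg)
   have "(\<Prod>i\<in>(UNIV::'n set). 1 + (\<xi> $ i)\<^sup>2) \<le> (\<Prod>i\<in>(UNIV::'n set). ?r\<^sup>2)"
   proof (rule prod_mono, safe)
    fix i
    have "(\<xi> $ i)\<^sup>2 \<le> (norm \<xi>)\<^sup>2"
     using component_le_norm_cart[of \<xi> i] by (metis abs_ge_zero power2_abs power_mono)
    then show "1 + (\<xi> $ i)\<^sup>2 \<le> ?r\<^sup>2" by (simp add: power2_sum add_increasing2)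
   qed simp
   then have P: "(\<Prod>i\<in>(UNIV::'n set). 1 + (\<xi> $ i)\<^sup>2) \<le> ?r ^ (2 * CARD('n))"
    by (simp add: power_mult)
   have P0: "(\<Prod>i\<in>(UNIV::'n set). 1 + (\<xi> $ i)\<^sup>2) > 0"
    by (intro prod_pos) (auto intro: add_pos_nonneg)
   have Pi: "(\<Prod>i\<in>(UNIV::'n set). inverse (1 + (\<xi> $ i)\<^sup>2)) = inverse (\<Prod>i\<in>(UNIV::'n set). 1 + (\<xi> $ i)\<^sup>2)"
    using prod_inversef[of "\<lambda>i. 1 + (\<xi> $ i)\<^sup>2" "UNIV::'n set"] by (simp add: o_def)
   have "(?r ^ N * decay c q \<xi>) * (\<Prod>i\<in>(UNIV::'n set). 1 + (\<xi> $ i)\<^sup>2)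
     \<le> (?r ^ N * decay c q \<xi>) * ?r ^ (2 * CARD('n))"
    using r by (intro mult_left_mono P) (simp add: decay_pos less_imp_le)
   also have "\<dots> \<le> B * decay (c / 2) q \<xi>" using B(2)[of \<xi>] by (simp add: power_add mult_ac)
   also have "\<dots> \<le> B * 1" using B(1) c by (intro mult_left_mono decay_le_1) auto
   finally have "?r ^ N * decay c q \<xi> \<le> B * inverse (\<Prod>i\<in>(UNIV::'n set). 1 + (\<xi> $ i)\<^sup>2)"
    using P0 by (simp add: field_simps)
   then show "norm (?r ^ N * decay c q \<xi>) \<le> norm (B * (\<Prod>i\<in>UNIV. inverse (1 + (\<xi> $ i)\<^sup>2)))"
    using r B(1) P0 unfolding Pi by (simp add: decay_pos less_imp_le abs_mult abs_of_pos)
  qed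
 qed
qed

section \<open>Differentiation under the inverse Fourier integral\<close>

lemma norm_cis_minus_linear: "cmod (cis a - 1 - \<i> * a) \<le> a\<^sup>2"
proof -
 have "cmod (cis a - 1 - \<i> * a) \<le> a\<^sup>2 / 2"
  using iexp_approx1[of a 1] by (simp add: cis_conv_exp numeral_2_eq_2 diff_diff_eq)
 then show ?thesis by (rule order_trans) simp
qed

lemma has_vector_derivative_quadratic:
 fixes \<phi> :: "real => 'a::real_normed_vector"
 assumes "\<And>h. norm (\<phi> h - \<phi> 0 - h *\<^sub>R d) \<le> C * h\<^sup>2"
 shows "(\<phi> has_vector_derivative d) (at 0)"
 unfolding has_vector_derivative_def
proof (rule has_derivativeI_sandwich[where e = 1 and H = "\<lambda>h. C * norm h"])
 show "bounded_linear (\<lambda>x::real. x *\<^sub>R d)" by (rule bounded_linear_scaleR_left)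
 show "norm (\<phi> h - \<phi> 0 - (h - 0) *\<^sub>R d) / norm (h - 0) \<le> C * norm h" if "h \<noteq> 0" for h
  using assms[of h] that by (simp add: field_simps power2_eq_square)
 have "((\<lambda>h::real. C * norm h) \<longlongrightarrow> C * norm (0::real)) (at 0)"
  by (intro tendsto_intros)
 then show "((\<lambda>h::real. C * norm h) \<longlongrightarrow> 0) (at 0)" by simp
qed simp

text \<open>The Taylor remainder of the exponential is at most (h \<xi>_k)^2, so the integrable
  second moment makes the error of the difference quotient quadratic in h, uniformly in x.\<close>

lemma has_partial_inv_fourier:
 fixes f :: "real^'n::finite => complex"
 assumes f: "continuous_on UNIV f" and int: "integrable lborel (\<lambda>\<xi>. (1 + norm \<xi>)\<^sup>2 * cmod (f \<xi>))"
 shows "has_partial k (inv_fourier f) (inv_fourier (\<lambda>\<xi>. \<i> * cor (\<xi> $ k) * f \<xi>) x) x"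
 unfolding has_partial_def
proof (rule has_vector_derivative_quadratic)
 fix h :: real
 note cont' = continuous_on_compose2[OF f _ subset_UNIV]
 have w: "(\<xi> $ k)\<^sup>2 \<le> (1 + norm \<xi>)\<^sup>2" "\<bar>\<xi> $ k\<bar> \<le> (1 + norm \<xi>)\<^sup>2" "1 \<le> (1 + norm \<xi>)\<^sup>2" for \<xi> :: "real^'n"
 proof -
  have 1: "\<bar>\<xi> $ k\<bar> \<le> 1 + norm \<xi>" using component_le_norm_cart[of \<xi> k] by simp
  from power_mono[OF 1, of 2] show "(\<xi> $ k)\<^sup>2 \<le> (1 + norm \<xi>)\<^sup>2" by simp
  have "1 + norm \<xi> \<le> (1 + norm \<xi>)\<^sup>2" by (simp add: power2_sum)
  with 1 show "\<bar>\<xi> $ k\<bar> \<le> (1 + norm \<xi>)\<^sup>2" "1 \<le> (1 + norm \<xi>)\<^sup>2" by (auto intro: order_trans[rotated])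
 qed
 have i1: "integrable lborel f"
 proof (rule Bochner_Integration.integrable_bound[OF int])
  show "f \<in> borel_measurable lborel"
   unfolding measurable_lborel2 by (intro borel_measurable_continuous_onI f)
  have "cmod (f \<xi>) \<le> (1 + norm \<xi>)\<^sup>2 * cmod (f \<xi>)" for \<xi> :: "real^'n"
   using mult_right_mono[OF w(3)[of \<xi>], of "cmod (f \<xi>)"] by simp
  then show "AE x in lborel. norm (f x) \<le> norm ((1 + norm x)\<^sup>2 * norm (f x))" by (simp add: abs_mult)
 qed
 have i2: "integrable lborel (\<lambda>\<xi>. \<i> * cor (\<xi> $ k) * f \<xi>)"
 proof (rule Bochner_Integration.integrable_bound[OF int])
  show "(\<lambda>\<xi>. \<i> * cor (\<xi> $ k) * f \<xi>) \<in> borel_measurable lborel"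
   unfolding measurable_lborel2 by (intro borel_measurable_continuous_onI continuous_intros f)
  have "\<bar>\<xi> $ k\<bar> * cmod (f \<xi>) \<le> (1 + norm \<xi>)\<^sup>2 * cmod (f \<xi>)" for \<xi> :: "real^'n"
   by (intro mult_right_mono w) simp
  then show "AE x in lborel. norm (\<i> * cor (x $ k) * f x) \<le> norm ((1 + norm x)\<^sup>2 * norm (f x))"
   by (simp add: abs_mult norm_mult)
 qed
 have c: "integrable lborel (\<lambda>\<xi>. cis (x \<bullet> \<xi>) * g \<xi>)" if "integrable lborel g" for g :: "real^'n => complex" and x
  using integrable_cis_mult[OF that, of 1 x] by (simp add: inner_commute)
 have cis: "cis ((x + h *\<^sub>R axis k 1) \<bullet> \<xi>) = cis (x \<bullet> \<xi>) * cis (h * \<xi> $ k)" for \<xi> :: "real^'n"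
  by (simp add: inner_add_left cis_mult inner_axis')
 have eq: "inv_fourier f (x + h *\<^sub>R axis k 1) - inv_fourier f (x + 0 *\<^sub>R axis k 1) -
   h *\<^sub>R inv_fourier (\<lambda>\<xi>. \<i> * cor (\<xi> $ k) * f \<xi>) x =
   (\<integral>\<xi>. cis ((x + h *\<^sub>R axis k 1) \<bullet> \<xi>) * f \<xi> - cis (x \<bullet> \<xi>) * f \<xi> - h *\<^sub>R (cis (x \<bullet> \<xi>) * (\<i> * cor (\<xi> $ k) * f \<xi>)) \<partial>lborel)"
  unfolding inv_fourier_def using c[OF i1] c[OF i2] by simp
 have "norm (\<integral>\<xi>. cis ((x + h *\<^sub>R axis k 1) \<bullet> \<xi>) * f \<xi> - cis (x \<bullet> \<xi>) * f \<xi> - h *\<^sub>R (cis (x \<bullet> \<xi>) * (\<i> * cor (\<xi> $ k) * f \<xi>)) \<partial>lborel)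
   \<le> (\<integral>\<xi>. h\<^sup>2 * ((1 + norm \<xi>)\<^sup>2 * cmod (f \<xi>)) \<partial>lborel)"
 proof (rule Bochner_Integration.integral_norm_bound_integral)
  fix \<xi> :: "real^'n"
  have "cis ((x + h *\<^sub>R axis k 1) \<bullet> \<xi>) * f \<xi> - cis (x \<bullet> \<xi>) * f \<xi> - h *\<^sub>R (cis (x \<bullet> \<xi>) * (\<i> * cor (\<xi> $ k) * f \<xi>))
    = cis (x \<bullet> \<xi>) * (cis (h * \<xi> $ k) - 1 - \<i> * cor (h * \<xi> $ k)) * f \<xi>"
   unfolding cis by (simp add: algebra_simps scaleR_conv_of_real)
  also have "norm \<dots> \<le> (h * \<xi> $ k)\<^sup>2 * cmod (f \<xi>)"
   using mult_right_mono[OF norm_cis_minus_linear[of "h * \<xi> $ k"], of "cmod (f \<xi>)"] by (simp add: norm_mult)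
  also have "\<dots> = h\<^sup>2 * ((\<xi> $ k)\<^sup>2 * cmod (f \<xi>))" by (simp add: power_mult_distrib)
  also have "\<dots> \<le> h\<^sup>2 * ((1 + norm \<xi>)\<^sup>2 * cmod (f \<xi>))" by (intro mult_left_mono mult_right_mono w) auto
  finally show "norm (cis ((x + h *\<^sub>R axis k 1) \<bullet> \<xi>) * f \<xi> - cis (x \<bullet> \<xi>) * f \<xi> - h *\<^sub>R (cis (x \<bullet> \<xi>) * (\<i> * cor (\<xi> $ k) * f \<xi>)))
   \<le> h\<^sup>2 * ((1 + norm \<xi>)\<^sup>2 * cmod (f \<xi>))" .
 qed (use c[OF i1] c[OF i2] int in \<open>auto simp: mult.commute[of "h\<^sup>2"]\<close>)
 then show "norm (inv_fourier f (x + h *\<^sub>R axis k 1) - inv_fourier f (x + 0 *\<^sub>R axis k 1) -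
   h *\<^sub>R inv_fourier (\<lambda>\<xi>. \<i> * cor (\<xi> $ k) * f \<xi>) x)
  \<le> (\<integral>\<xi>. (1 + norm \<xi>)\<^sup>2 * cmod (f \<xi>) \<partial>lborel) * h\<^sup>2"
  unfolding eq by (simp add: mult.commute)
qed

text \<open>The Fourier multiplier that corresponds to \<open>iterated_partial ks\<close>.\<close>

definition freq :: "'n::finite list => real^'n => complex" where
 "freq ks \<xi> = prod_list (map (\<lambda>k. \<i> * cor (\<xi> $ k)) ks)"

lemma freq_Nil [simp]: "freq [] \<xi> = 1" and freq_Cons: "freq (k # ks) \<xi> = \<i> * cor (\<xi> $ k) * freq ks \<xi>"
 by (simp_all add: freq_def)

lemma norm_freq: "cmod (freq ks \<xi>) \<le> (1 + norm \<xi>) ^ length ks"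
proof (induction ks)
 case (Cons k ks)
 have "\<bar>\<xi> $ k\<bar> \<le> 1 + norm \<xi>" using component_le_norm_cart[of \<xi> k] by simp
 then show ?case
  unfolding freq_Cons norm_mult using Cons by (simp add: mult_mono)
qed simp

lemma continuous_on_freq: "continuous_on UNIV (freq ks)"
proof (induction ks)
 case (Cons k ks)
 then show ?case unfolding freq_Cons[abs_def] by (intro continuous_intros)
qed (simp add: freq_def[abs_def])

text \<open>\<open>B\<close> depends on the list and the rate but is fixed before \<open>D\<close>
  and \<open>f\<close>, which keeps the bound linear in the size of the data.\<close>

lemma freq_decay:
 fixes ks :: "'n::finite list"
 assumes "q > 0" "c > 0"
 obtains B where "B > 0"
  "\<And>D (f :: real^'n => complex) \<xi>. cmod (f \<xi>) \<le> D * decay c q \<xi> ==> cmod (freq ks \<xi> * f \<xi>) \<le> B * D * decay (c / 2) q \<xi>"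
proof -
 obtain B where B: "B > 0"
  "\<And>\<xi>::real^'n. (1 + norm \<xi>) ^ length ks * decay c q \<xi> \<le> B * decay (c / 2) q \<xi>"
  using power_decay[OF assms] by blast
 show ?thesis
 proof (rule that[OF B(1)])
  fix D f and \<xi> :: "real^'n" assume f: "cmod (f \<xi>) \<le> D * decay c q \<xi>"
  have "0 \<le> D * decay c q \<xi>" using f norm_ge_zero order_trans by blast
  then have D: "D \<ge> 0" using decay_pos[of c q \<xi>] by (simp add: zero_le_mult_iff)
  have "cmod (freq ks \<xi> * f \<xi>) \<le> (1 + norm \<xi>) ^ length ks * (D * decay c q \<xi>)"
   unfolding norm_mult by (intro mult_mono norm_freq f) auto
  also have "\<dots> = D * ((1 + norm \<xi>) ^ length ks * decay c q \<xi>)" by simp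
  also have "\<dots> \<le> D * (B * decay (c / 2) q \<xi>)" by (intro mult_left_mono B D)
  finally show "cmod (freq ks \<xi> * f \<xi>) \<le> B * D * decay (c / 2) q \<xi>" by (simp add: mult_ac)
 qed
qed

lemma integrable_by_decay:
 fixes f :: "real^'n::finite => complex"
 assumes "q > 0" "c > 0" "continuous_on UNIV f" "\<And>\<xi>. cmod (f \<xi>) \<le> D * decay c q \<xi>"
 shows "integrable lborel (\<lambda>\<xi>. (1 + norm \<xi>) ^ N * cmod (f \<xi>))" "integrable lborel f"
proof -
 have D: "integrable lborel (\<lambda>\<xi>::real^'n. D * ((1 + norm \<xi>) ^ N * decay c q \<xi>))" for N
  by (intro integrable_mult_right integrable_power_decay assms)
 show "integrable lborel (\<lambda>\<xi>. (1 + norm \<xi>) ^ N * cmod (f \<xi>))"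
 proof (rule Bochner_Integration.integrable_bound[OF D[of N]])
  show "(\<lambda>\<xi>. (1 + norm \<xi>) ^ N * cmod (f \<xi>)) \<in> borel_measurable lborel"
   unfolding measurable_lborel2 by (intro borel_measurable_continuous_onI continuous_intros assms)
  have "(1 + norm \<xi>) ^ N * cmod (f \<xi>) \<le> (1 + norm \<xi>) ^ N * (D * decay c q \<xi>)" for \<xi>
   by (intro mult_left_mono assms) simp
  then show "AE \<xi> in lborel. norm ((1 + norm \<xi>) ^ N * cmod (f \<xi>)) \<le> norm (D * ((1 + norm \<xi>) ^ N * decay c q \<xi>))"
   by (intro AE_I2) (simp add: mult_ac order_trans[OF _ abs_ge_self])
 qed
 show "integrable lborel f"
 proof (rule Bochner_Integration.integrable_bound[OF D[of 0]])
  show "f \<in> borel_measurable lborel"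
   unfolding measurable_lborel2 by (intro borel_measurable_continuous_onI assms)
  show "AE \<xi> in lborel. norm (f \<xi>) \<le> norm (D * ((1 + norm \<xi>) ^ 0 * decay c q \<xi>))"
   using assms(4) by (intro AE_I2) (simp add: order_trans[OF _ abs_ge_self])
 qed
qed

text \<open>The candidates for the derivatives are the inverse transforms of \<open>freq ks\<close>
  times \<open>f\<close>; these integrands decay again, at half the rate, so every candidate can be
  differentiated once more.\<close>

lemma
 fixes f :: "real^'n::finite => complex"
 assumes q: "q > 0" and c: "c > 0" and f: "continuous_on UNIV f" and d: "\<And>\<xi>. cmod (f \<xi>) \<le> D * decay c q \<xi>"
 shows smooth_inv_fourier: "smooth (inv_fourier f)"
  and iterated_partial_inv_fourier: "iterated_partial ks (inv_fourier f) = inv_fourier (\<lambda>\<xi>. freq ks \<xi> * f \<xi>)"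
proof -
 let ?D = "\<lambda>ks. inv_fourier (\<lambda>\<xi>. freq ks \<xi> * f \<xi>)"
 have c': "continuous_on UNIV (\<lambda>\<xi>. freq ks \<xi> * f \<xi>)" for ks
  by (intro continuous_intros continuous_on_freq f)
 have i: "integrable lborel (\<lambda>\<xi>. (1 + norm \<xi>)\<^sup>2 * cmod (freq ks \<xi> * f \<xi>)) \<and> integrable lborel (\<lambda>\<xi>. freq ks \<xi> * f \<xi>)" for ks
 proof -
  obtain B where B: "\<And>\<xi>. cmod (freq ks \<xi> * f \<xi>) \<le> B * D * decay (c / 2) q \<xi>"
   using freq_decay[OF q c, of ks] d by metis
  show ?thesis
   using integrable_by_decay(1)[OF q _ c' B, of 2] integrable_by_decay(2)[OF q _ c' B] c by simp
 qed
 have 1: "has_partial k (?D ks) (?D (k # ks) x) x" for k ks x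
  using has_partial_inv_fourier[OF c', of ks k x] i[of ks] by (simp add: freq_Cons mult.assoc)
 have 2: "continuous_on UNIV (?D ks)" for ks
  using i[of ks] by (intro continuous_on_inv_fourier) simp
 show "smooth (inv_fourier f)"
  by (rule smooth_by_derivatives(1)[where D = ?D, OF _ 1 2]) simp
 show "iterated_partial ks (inv_fourier f) = ?D ks"
  by (rule smooth_by_derivatives(2)[where D = ?D, OF _ 1 2]) simp
qed

text \<open>Pascal's rule, arranged so that one application of the product rule to the Leibniz sum
  of order N yields the sum of order N + 1.\<close>

lemma leibniz_sum:
 fixes g h :: "nat => 'a::comm_semiring_1"
 shows "(\<Sum>l\<le>Suc N. of_nat (Suc N choose l) * (g l * h (Suc N - l))) =
  (\<Sum>l\<le>N. of_nat (N choose l) * (g (Suc l) * h (N - l) + g l * h (Suc (N - l))))"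
proof -
 have "(\<Sum>l\<le>Suc N. of_nat (Suc N choose l) * (g l * h (Suc N - l))) =
   g 0 * h (Suc N) + (\<Sum>l\<le>N. of_nat (Suc N choose Suc l) * (g (Suc l) * h (N - l)))"
  by (subst sum.atMost_Suc_shift) simp
 also have "(\<Sum>l\<le>N. of_nat (Suc N choose Suc l) * (g (Suc l) * h (N - l))) =
   (\<Sum>l\<le>N. of_nat (N choose l) * (g (Suc l) * h (N - l))) + (\<Sum>l\<le>N. of_nat (N choose Suc l) * (g (Suc l) * h (N - l)))"
  by (simp add: algebra_simps sum.distrib)
 also have "g 0 * h (Suc N) + (\<dots>) = (\<Sum>l\<le>N. of_nat (N choose l) * (g (Suc l) * h (N - l))) +
   (g 0 * h (Suc N) + (\<Sum>l\<le>N. of_nat (N choose Suc l) * (g (Suc l) * h (N - l))))"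
  by (simp add: ac_simps)
 also have "g 0 * h (Suc N) + (\<Sum>l\<le>N. of_nat (N choose Suc l) * (g (Suc l) * h (N - l))) =
   (\<Sum>l\<le>Suc N. of_nat (N choose l) * (g l * h (Suc N - l)))"
  by (subst sum.atMost_Suc_shift) simp
 also have "\<dots> = (\<Sum>l\<le>N. of_nat (N choose l) * (g l * h (Suc (N - l))))"
  by (simp add: Suc_diff_le binomial_eq_0)
 finally show ?thesis by (simp add: sum.distrib algebra_simps)
qed

text \<open>A product of one-dimensional cutoffs: pure derivatives in one direction then
  differentiate a single factor.\<close>

definition box_cutoff :: "(nat => real => real) => real^'n::finite => real" where
 "box_cutoff \<psi> x = (\<Prod>j\<in>UNIV. \<psi> 0 (x $ j))"

section \<open>Box cutoffs and integrals over cubes\<close>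

definition cube :: "real => (real^'n::finite) set" where
 "cube r = {x. \<forall>j. \<bar>x $ j\<bar> \<le> r}"

lemma cube_cbox: "cube r = cbox (\<chi> i. - r) (\<chi> i. r)"
 by (auto simp: cube_def mem_box_cart abs_le_iff minus_le_iff)

lemma compact_cube: "compact (cube r)"
 by (simp add: cube_cbox)

lemma is_cutoffD:
 assumes "is_cutoff L \<psi>"
 shows "(\<psi> j has_real_derivative \<psi> (Suc j) x) (at x)" "\<bar>x\<bar> \<le> 2 * L ==> \<psi> 0 x = 1"
  "\<bar>x\<bar> \<le> 2 * L ==> \<psi> (Suc j) x = 0" "\<bar>x\<bar> \<ge> 4 * L ==> \<psi> j x = 0"
 using assms unfolding is_cutoff_def by blast+

lemma cutoff_continuous: "is_cutoff L \<psi> ==> continuous_on S (\<psi> j)"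
 by (meson DERIV_isCont continuous_at_imp_continuous_on is_cutoffD(1))

lemma box_cutoff_eq_1: "is_cutoff L \<psi> ==> x \<in> cube (2 * L) ==> box_cutoff \<psi> x = 1"
 by (simp add: box_cutoff_def cube_def is_cutoffD(2))

lemma box_cutoff_eq_0: "is_cutoff L \<psi> ==> x \<notin> cube (4 * L) ==> box_cutoff \<psi> x = 0"
 unfolding box_cutoff_def cube_def
 by (rule prod_zero) (auto simp: not_le intro!: is_cutoffD(4) less_imp_le)

lemma continuous_on_component_fun: "continuous_on UNIV f ==> continuous_on UNIV (\<lambda>x::real^'n::finite. f (x $ j))" for f :: "real => 'b::topological_space"
 by (rule continuous_on_compose2[where t = UNIV]) (auto intro!: continuous_intros)

lemma continuous_on_box_cutoff: "is_cutoff L \<psi> ==> continuous_on UNIV (box_cutoff \<psi>)"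
 unfolding box_cutoff_def[abs_def]
 by (intro continuous_on_prod continuous_on_component_fun cutoff_continuous)

lemma has_partial_component_fun:
 fixes f f' :: "real => real"
 assumes "(f has_real_derivative d) (at (x $ k))"
 shows "has_partial k (\<lambda>x. cor (f (x $ k))) (cor d) x"
proof -
 have 1: "((\<lambda>h. x $ k + h) has_real_derivative 0 + 1) (at 0)"
  by (rule DERIV_add[OF DERIV_const DERIV_ident])
 have "((\<lambda>h. f (x $ k + h)) has_real_derivative d * (0 + 1)) (at 0)"
  by (rule DERIV_chain2[OF _ 1]) (simp add: assms)
 then have "((\<lambda>h. f (x $ k + h)) has_real_derivative d) (at 0)" by simp
 then have "((\<lambda>h. f (x $ k + h)) has_vector_derivative d) (at 0)"
  by (simp add: has_real_derivative_iff_has_vector_derivative)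
 then have "((\<lambda>h. cor (f (x $ k + h))) has_vector_derivative cor d) (at 0)"
  by (rule bounded_linear.has_vector_derivative[OF bounded_linear_of_real])
 then show ?thesis by (simp add: has_partial_def axis_def)
qed

lemma has_partial_const_dir:
 assumes "\<And>h. f (x + h *\<^sub>R axis k 1) = f x"
 shows "has_partial k f 0 x"
 unfolding has_partial_def assms by (rule has_vector_derivative_const)

lemma has_partial_mult:
 fixes f g :: "real^'n::finite => complex"
 assumes "has_partial k f d x" "has_partial k g e x"
 shows "has_partial k (\<lambda>x. f x * g x) (f x * e + d * g x) x"
 using has_vector_derivative_mult[OF assms[unfolded has_partial_def]] by (simp add: has_partial_def)

lemma has_partial_sum:
 assumes "\<And>i. i \<in> I ==> has_partial k (f i) (d i) x"
 shows "has_partial k (\<lambda>x. \<Sum>i\<in>I. f i x) (\<Sum>i\<in>I. d i) x"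
 using assms unfolding has_partial_def by (intro has_vector_derivative_sum)

lemma integrable_compact_support:
 fixes f :: "real^'n::finite => complex"
 assumes "continuous_on UNIV f" "\<And>x. x \<notin> cube r ==> f x = 0"
 shows "integrable lborel f"
proof -
 have "set_integrable lborel (cube r) f"
  unfolding set_integrable_def
  by (rule borel_integrable_compact[OF compact_cube continuous_on_subset[OF assms(1) subset_UNIV]])
 moreover have "(\<lambda>x. indicator (cube r) x *\<^sub>R f x) = f"
  using assms(2) by (auto simp: fun_eq_iff indicator_def)
 ultimately show ?thesis by (simp add: set_integrable_def)
qed

lemma integrable_indicator_cube: "integrable lborel (\<lambda>x::real^'n::finite. B * indicator (cube r) x :: real)"
 by (intro integrable_mult_right integrable_real_indicator)
   (auto simp: cube_cbox emeasure_lborel_cbox_eq)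

lemma integral_bound_cube:
 fixes f :: "real^'n::finite => complex"
 assumes "\<And>x. x \<in> cube r ==> cmod (f x) \<le> B" "\<And>x. x \<notin> cube r ==> f x = 0" "B \<ge> 0"
 shows "cmod (integral\<^sup>L lborel f) \<le> B * measure lborel (cube r :: (real^'n) set)"
proof (cases "integrable lborel f")
 case True
 have "cmod (integral\<^sup>L lborel f) \<le> integral\<^sup>L lborel (\<lambda>x::real^'n. B * indicator (cube r) x)"
  by (rule Bochner_Integration.integral_norm_bound_integral)
    (use True integrable_indicator_cube[of B r] assms in \<open>auto simp: indicator_def\<close>)
 then show ?thesis by (simp add: cube_cbox)
qed (use assms(3) in \<open>simp add: not_integrable_integral_eq\<close>)

text \<open>Integration by parts: the partial derivative of the oscillating factor times
  \<open>f\<close> has integral 0. Compact support supplies the dominating function.\<close>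

lemma fourier_partial:
 fixes f f' :: "real^'n::finite => complex"
 assumes d: "\<And>x. has_partial k f (f' x) x" and c: "continuous_on UNIV f" "continuous_on UNIV f'"
  and supp: "\<And>x. x \<notin> cube r ==> f x = 0" "\<And>x. x \<notin> cube r ==> f' x = 0"
 shows "fourier f' \<xi> = \<i> * cor (\<xi> $ k) * fourier f \<xi>"
proof -
 let ?e = "\<lambda>x::real^'n. cis (- (x \<bullet> \<xi>))"
 let ?g = "\<lambda>x. ?e x * f' x + (- \<i> * cor (\<xi> $ k) * ?e x) * f x"
 have e: "has_partial k ?e (- \<i> * cor (\<xi> $ k) * ?e x) x" for x
 proof -
  have "((\<lambda>h. exp ((- \<i> * cor (\<xi> $ k)) * cor h) * ?e x) has_vector_derivative
    - \<i> * cor (\<xi> $ k) * ?e x) (at 0)"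
   by (rule derivative_eq_intros field_vector_diff_chain_at refl has_vector_derivative_of_real has_vector_derivative_real_field | simp)+
  moreover have "?e (x + h *\<^sub>R axis k 1) = exp ((- \<i> * cor (\<xi> $ k)) * cor h) * ?e x" for h
   by (simp add: cis_conv_exp inner_add_left inner_axis' algebra_simps flip: exp_add)
  ultimately show ?thesis unfolding has_partial_def by simp
 qed
 have ce: "continuous_on UNIV ?e" by (intro continuous_intros)
 have cg: "continuous_on UNIV ?g" by (intro continuous_intros c)
 \<comment> \<open>The larger cube contains every x that a shift of length at most 1 moves into the
   support.\<close>
 have "bounded (?g ` cube (r + 1))"
  by (intro compact_imp_bounded compact_continuous_image compact_cube continuous_on_subset[OF cg]) simp
 then obtain B where B: "\<And>x. x \<in> cube (r + 1) ==> cmod (?g x) \<le> B"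
  unfolding bounded_iff by blast
 have "integral\<^sup>L lborel ?g = 0"
 proof (rule integral_partial_eq_0[where k = k and f = "\<lambda>x. ?e x * f x" and g = "\<lambda>x. B * indicator (cube (r + 1)) x"])
  show "has_partial k (\<lambda>x. ?e x * f x) (?g x) x" for x
   using has_partial_mult[OF e d] by simp
  show "integrable lborel (\<lambda>x. ?e x * f x)"
   by (rule integrable_compact_support[where r = r]) (auto intro!: continuous_intros c simp: supp)
  show "?g \<in> borel_measurable borel" by (intro borel_measurable_continuous_onI cg)
  fix x h assume h: "0 \<le> h" "h \<le> (1::real)"
  show "norm (?g (x + h *\<^sub>R axis k 1)) \<le> B * indicator (cube (r + 1)) x"
  proof (cases "x + h *\<^sub>R axis k 1 \<in> cube r")
   case True
   have "\<bar>x $ j\<bar> \<le> r + 1" for j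
   proof -
    have "\<bar>x $ j + h * (axis k 1 :: real^'n) $ j\<bar> \<le> r" using True by (auto simp: cube_def)
    moreover have "\<bar>h * (axis k 1 :: real^'n) $ j\<bar> \<le> 1" using h by (auto simp: axis_def)
    ultimately show ?thesis by linarith
   qed
   then have "x \<in> cube (r + 1)" by (simp add: cube_def)
   moreover have "x + h *\<^sub>R axis k 1 \<in> cube (r + 1)"
    using True unfolding cube_def mem_Collect_eq by (meson le_add_same_cancel1 order_trans zero_le_one)
   ultimately show ?thesis using B by (simp add: indicator_def)
  next
   case False
   have "B * indicator (cube (r + 1)) x \<ge> 0"
   proof (cases "x \<in> cube (r + 1)")
    case True
    from order_trans[OF norm_ge_zero B[OF this]] True show ?thesis by (simp add: indicator_def)
   qed simp
   then show ?thesis using supp[OF False] by simp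
  qed
 qed (rule integrable_indicator_cube)
 moreover have "integrable lborel (\<lambda>x. ?e x * f' x)" "integrable lborel (\<lambda>x. ?e x * f x)"
  by (rule integrable_compact_support[where r = r], auto intro!: continuous_intros c simp: supp)+
 then have "integral\<^sup>L lborel ?g = fourier f' \<xi> + (- \<i> * cor (\<xi> $ k)) * fourier f \<xi>"
  unfolding fourier_def by (simp add: mult.assoc)
 ultimately show ?thesis by (simp add: add_eq_0_iff)
qed

subsection \<open>Fourier decay of Gevrey functions\<close>

text \<open>The hypothesis holds for every N, and the best choice is N close to (r / e)^(1/s): then
  N^s <= r / e, so N!^s <= (r / e)^N and a factor exp (- N) is gained. Rounding N down costs the
  factor exp 1.\<close>

lemma gevrey_optimal_order:
 fixes r s a B :: real
 assumes s: "s \<ge> 1" and r: "r \<ge> 0" and B: "B \<ge> 0"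
  and le: "\<And>N. r ^ N * a \<le> B * fact N powr s"
 shows "a \<le> B * exp 1 * exp (- ((r / exp 1) powr (1 / s)))"
proof -
 define x where "x = (r / exp 1) powr (1 / s)"
 define N where "N = nat \<lfloor>x\<rfloor>"
 have x: "x \<ge> 0" by (simp add: x_def)
 have N: "real N \<le> x" "x \<le> real N + 1" unfolding N_def using x by linarith+
 \<comment> \<open>For r = 0 the chosen order is N = 0, and the power is 0^0 = 1.\<close>
 have r0: "r ^ N > 0"
 proof (cases "r = 0")
  case True
  then have "x = 0" by (simp add: x_def)
  then show ?thesis by (simp add: N_def)
 qed (use r in simp)
 have "real N powr s \<le> x powr s" using N s by (intro powr_mono2) auto
 also have "x powr s = r / exp 1" using r s by (simp add: x_def powr_powr)
 finally have 1: "real N powr s \<le> r / exp 1" .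
 have "fact N powr s \<le> (real N ^ N) powr s"
  using fact_le_power[of N, where 'a = real] s by (intro powr_mono2) auto
 also have "\<dots> = (real N powr s) ^ N"
  by (cases "N = 0") (simp_all add: powr_powr powr_realpow[symmetric] mult.commute)
 also have "\<dots> \<le> (r / exp 1) ^ N" by (intro power_mono 1) simp
 also have "\<dots> = r ^ N * exp (- real N)"
  using exp_of_nat_mult[of N "1::real"] by (simp add: exp_minus divide_inverse power_mult_distrib power_inverse)
 finally have "B * fact N powr s \<le> B * (r ^ N * exp (- real N))" by (intro mult_left_mono B)
 with le[of N] have "r ^ N * a \<le> r ^ N * (B * exp (- real N))" by (simp add: mult_ac)
 then have "a \<le> B * exp (- real N)" using r0 by simp
 also have "\<dots> \<le> B * exp (1 - x)" using N B by (intro mult_left_mono) auto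
 finally show ?thesis by (simp add: x_def exp_diff exp_minus divide_inverse mult.assoc)
qed

lemma powr_fact_mult_le:
 assumes "l \<le> N" "s \<ge> 0"
 shows "fact l powr s * fact (N - l) powr s \<le> (fact N :: real) powr s"
proof -
 have "fact l * fact (N - l) dvd (fact N :: nat)"
  using assms(1) by (metis binomial_fact_lemma dvd_triv_left)
 then have "fact l * fact (N - l) \<le> (fact N :: nat)" by (intro dvd_imp_le) auto
 then have "real (fact l * fact (N - l)) \<le> real (fact N)" by (intro of_nat_mono)
 then have "(fact l * fact (N - l) :: real) \<le> fact N" by simp
 then show ?thesis using assms(2) by (simp add: powr_mult[symmetric] powr_mono2)
qed

text \<open>One coordinate carries a fixed share of the norm. Hence pure derivatives in one
  direction, chosen according to \<xi>, are enough for Fourier decay.\<close>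

lemma norm_le_component:
 fixes \<xi> :: "real^'n::finite"
 obtains k where "norm \<xi> \<le> real CARD('n) * \<bar>\<xi> $ k\<bar>"
proof -
 have "\<exists>k. norm \<xi> \<le> real CARD('n) * \<bar>\<xi> $ k\<bar>"
 proof (rule ccontr)
  assume "\<not> ?thesis"
  then have "\<bar>\<xi> $ k\<bar> < norm \<xi> / real CARD('n)" for k by (simp add: not_le field_simps)
  then have "(\<Sum>k\<in>UNIV. \<bar>\<xi> $ k\<bar>) < (\<Sum>k\<in>(UNIV::'n set). norm \<xi> / real CARD('n))"
   by (intro sum_strict_mono) auto
  also have "\<dots> = norm \<xi>" by simp
  finally show False using norm_le_l1_cart[of \<xi>] by simp
 qed
 then show ?thesis using that by blast
qed

text \<open>\<open>F k N\<close> is the N-th pure derivative in direction k of the truncated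
  function, expanded by the Leibniz rule; the other factors of the box cutoff are constant in that
  direction.\<close>

lemma cutoff_leibniz_bound:
 fixes f :: "real^'n::finite => complex"
 assumes \<psi>: "is_cutoff L \<psi>" and f: "smooth f"
 defines "F \<equiv> \<lambda>k N x. \<Sum>l\<le>N. of_nat (N choose l) * (cor (\<psi> l (x $ k)) *
   (cor (\<Prod>j\<in>UNIV - {k}. \<psi> 0 (x $ j)) * iterated_partial (replicate (N - l) k) f x))"
 shows "F k 0 x = cor (box_cutoff \<psi> x) * f x"
  and "has_partial k (F k N) (F k (Suc N) x) x"
  and "continuous_on UNIV (F k N)"
  and "x \<notin> cube (4 * L) ==> F k N x = 0"
proof -
 let ?P = "\<lambda>x. cor (\<Prod>j\<in>UNIV - {k}. \<psi> 0 (x $ j))"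
 let ?f = "\<lambda>N. iterated_partial (replicate N k) f"
 show "F k 0 x = cor (box_cutoff \<psi> x) * f x"
  unfolding F_def box_cutoff_def by (simp add: prod.remove[of UNIV k])
 have f1: "has_partial k (?f N) (?f (Suc N) x) x" for N x
  using smooth_has_partial[OF f, of k "replicate N k" x] by simp
 have P: "has_partial k ?P 0 x" for x
  by (rule has_partial_const_dir, intro arg_cong[where f = cor] prod.cong) (auto simp: axis_def)
 have h: "has_partial k (\<lambda>x. ?P x * ?f N x) (?P x * ?f (Suc N) x) x" for N x
  using has_partial_mult[OF P f1] by simp
 have g: "has_partial k (\<lambda>x. cor (\<psi> l (x $ k))) (cor (\<psi> (Suc l) (x $ k))) x" for l x
  by (rule has_partial_component_fun[where f = "\<psi> l", OF is_cutoffD(1)[OF \<psi>]])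
 have c: "has_partial k (\<lambda>_. of_nat (N choose l) :: complex) 0 x" for N l x
  by (rule has_partial_const_dir) simp
 have L: "F k (Suc N) x = (\<Sum>l\<le>N. of_nat (N choose l) * (cor (\<psi> (Suc l) (x $ k)) * (?P x * ?f (N - l) x)
   + cor (\<psi> l (x $ k)) * (?P x * ?f (Suc (N - l)) x)))"
  unfolding F_def by (rule leibniz_sum[of N "\<lambda>l. cor (\<psi> l (x $ k))" "\<lambda>l. ?P x * ?f l x"])
 have "has_partial k (F k N) (\<Sum>l\<le>N. of_nat (N choose l) * (cor (\<psi> l (x $ k)) * (?P x * ?f (Suc (N - l)) x)
   + cor (\<psi> (Suc l) (x $ k)) * (?P x * ?f (N - l) x)) + 0 * (cor (\<psi> l (x $ k)) * (?P x * ?f (N - l) x))) x"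
  unfolding F_def by (intro has_partial_sum has_partial_mult c g h)
 also have "(\<Sum>l\<le>N. of_nat (N choose l) * (cor (\<psi> l (x $ k)) * (?P x * ?f (Suc (N - l)) x)
   + cor (\<psi> (Suc l) (x $ k)) * (?P x * ?f (N - l) x)) + 0 * (cor (\<psi> l (x $ k)) * (?P x * ?f (N - l) x))) = F k (Suc N) x"
  unfolding L by (intro sum.cong refl) (simp add: add.commute)
 finally show "has_partial k (F k N) (F k (Suc N) x) x" .
 show "continuous_on UNIV (F k N)"
  unfolding F_def
  by (intro continuous_intros smooth_continuous f continuous_on_component_fun[where f = "\<psi> l" for l] cutoff_continuous[OF \<psi>])
 assume "x \<notin> cube (4 * L)"
 then obtain j where "\<not> \<bar>x $ j\<bar> \<le> 4 * L" by (auto simp: cube_def)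
 then have j: "\<bar>x $ j\<bar> \<ge> 4 * L" by simp
 note z = is_cutoffD(4)[OF \<psi> j]
 show "F k N x = 0"
 proof (cases "j = k")
  case True
  then show ?thesis unfolding F_def using z by simp
 next
  case False
  then have 0: "(\<Prod>j\<in>UNIV - {k}. \<psi> 0 (x $ j)) = 0"
   using z by (intro prod_zero) auto
  show ?thesis
   unfolding F_def by (simp only: 0 of_real_0 mult_zero_left mult_zero_right sum.neutral_const)
 qed
qed

text \<open>Only repeated derivatives in a single direction are bounded, because nothing else enters
  the Fourier decay. The size \<open>D\<close> is kept apart from the radius \<open>G\<close> so
  that constants can depend on \<open>G\<close> alone.\<close>

definition pure_bound :: "real => real => real => real => (real^'n::finite => complex) => bool" where
 "pure_bound s r G D f \<longleftrightarrow> smooth f \<and>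
   (\<forall>N k. \<forall>x\<in>cube r. cmod (iterated_partial (replicate N k) f x) \<le> D * G ^ N * fact N powr s)"

text \<open>The N-th pure derivative multiplies the transform by (\<i> \<xi>_k)^N, and its Leibniz
  sum is bounded by D (2 W)^N N!^s up to a constant, with 2^N from the binomial coefficients.
  Optimising over N gives the exponential decay, with \<open>C\<close> and \<open>c\<close> chosen
  before \<open>f\<close> and \<open>D\<close>.\<close>

lemma gevrey_fourier_decay:
 assumes \<psi>: "is_cutoff L \<psi>" and L: "L > 0" and s: "s \<ge> 1" and H: "H > 0" and G: "G > 0"
  and b: "\<And>j x. \<bar>\<psi> j x\<bar> \<le> H ^ Suc j * fact j powr s"
 shows "\<exists>C>0. \<exists>c>0. \<forall>(f :: real^'n::finite => complex) D. pure_bound s (4 * L) G D f -->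
    (\<forall>\<xi>. cmod (fourier (\<lambda>x. cor (box_cutoff \<psi> x) * f x) \<xi>) \<le> D * C * decay c (1 / s) \<xi>)"
proof -
 define W where "W = max H G"
 have W: "W > 0" "H \<le> W" "G \<le> W" using H by (auto simp: W_def)
 define V where "V = measure lborel (cube (4 * L) :: (real^'n) set) + 1"
 have V: "V > 0" "measure lborel (cube (4 * L) :: (real^'n) set) \<le> V" by (auto simp: V_def add_nonneg_pos)
 define C where "C = H * H ^ (CARD('n) - 1) * V"
 have C: "C > 0" using H V by (simp add: C_def)
 define c where "c = (1 / (real CARD('n) * (2 * W) * exp 1)) powr (1 / s)"
 have pos: "C * exp 1 > 0" "c > 0" using C W by (auto simp: c_def)
 show ?thesis
 proof (rule exI[of _ "C * exp 1"], rule conjI[OF pos(1)], rule exI[of _ c], rule conjI[OF pos(2)], intro allI impI)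
  fix f :: "real^'n => complex" and D :: real and \<xi> :: "real^'n"
  assume "pure_bound s (4 * L) G D f"
  then have f: "smooth f" and fb: "\<And>N k x. x \<in> cube (4 * L) ==> cmod (iterated_partial (replicate N k) f x) \<le> D * G ^ N * fact N powr s"
   by (auto simp: pure_bound_def)
  have "0 \<in> cube (4 * L)" using L by (simp add: cube_def)
  from fb[OF this, of 0] have D: "D \<ge> 0" using order_trans[OF norm_ge_zero, of "f 0" D] by simp
  obtain k where k: "norm \<xi> \<le> real CARD('n) * \<bar>\<xi> $ k\<bar>" using norm_le_component by blast
  define F where "F N x = (\<Sum>l\<le>N. of_nat (N choose l) * (cor (\<psi> l (x $ k)) *
   (cor (\<Prod>j\<in>UNIV - {k}. \<psi> 0 (x $ j)) * iterated_partial (replicate (N - l) k) f x)))" for N x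
  note F = cutoff_leibniz_bound[OF \<psi> f, where k = k, folded F_def]
  let ?\<phi> = "\<lambda>x. cor (box_cutoff \<psi> x) * f x"
  have F0: "F 0 = ?\<phi>" using F(1) by auto
  have ft: "fourier (F N) \<xi> = (\<i> * cor (\<xi> $ k)) ^ N * fourier ?\<phi> \<xi>" for N
  proof (induction N)
   case (Suc N)
   have "fourier (F (Suc N)) \<xi> = \<i> * cor (\<xi> $ k) * fourier (F N) \<xi>"
    by (rule fourier_partial[where r = "4 * L"]) (rule F | assumption)+
   then show ?case by (simp add: Suc)
  qed (simp add: F0)
  have bF: "cmod (F N x) \<le> H * H ^ (CARD('n) - 1) * D * (2 * W) ^ N * fact N powr s" if x: "x \<in> cube (4 * L)" for N x
  proof -
   have P: "\<bar>\<Prod>j\<in>UNIV - {k}. \<psi> 0 (x $ j)\<bar> \<le> H ^ (CARD('n) - 1)"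
   proof -
    have "(\<Prod>j\<in>UNIV - {k}. \<bar>\<psi> 0 (x $ j)\<bar>) \<le> (\<Prod>j\<in>UNIV - {k}. H)"
     using b[of 0] by (intro prod_mono) auto
    then show ?thesis by (simp add: abs_prod card_Diff_singleton)
   qed
   have t: "cmod (of_nat (N choose l) * (cor (\<psi> l (x $ k)) *
     (cor (\<Prod>j\<in>UNIV - {k}. \<psi> 0 (x $ j)) * iterated_partial (replicate (N - l) k) f x)))
     \<le> real (N choose l) * (H * H ^ (CARD('n) - 1) * D * W ^ N * fact N powr s)" if l: "l \<le> N" for l
   proof -
    have "\<bar>\<psi> l (x $ k)\<bar> * (\<bar>\<Prod>j\<in>UNIV - {k}. \<psi> 0 (x $ j)\<bar> * cmod (iterated_partial (replicate (N - l) k) f x))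
      \<le> (H ^ Suc l * fact l powr s) * (H ^ (CARD('n) - 1) * (D * G ^ (N - l) * fact (N - l) powr s))"
     using H by (intro mult_mono b P fb x) auto
    also have "\<dots> = (H * H ^ (CARD('n) - 1) * D) * ((H ^ l * G ^ (N - l)) * (fact l powr s * fact (N - l) powr s))"
     by (simp add: mult_ac)
    also have "\<dots> \<le> (H * H ^ (CARD('n) - 1) * D) * ((W ^ l * W ^ (N - l)) * fact N powr s)"
     using H G W D s l by (intro mult_left_mono mult_mono power_mono powr_fact_mult_le) auto
    also have "W ^ l * W ^ (N - l) = W ^ N" using l by (simp flip: power_add)
    finally show ?thesis
     unfolding norm_mult norm_of_nat norm_of_real by (intro mult_left_mono) (auto simp: mult_ac)
   qed
   have "cmod (F N x) \<le> (\<Sum>l\<le>N. real (N choose l) * (H * H ^ (CARD('n) - 1) * D * W ^ N * fact N powr s))"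
    unfolding F_def by (rule order_trans[OF norm_sum sum_mono]) (rule t, simp)
   also have "\<dots> = real (\<Sum>l\<le>N. N choose l) * (H * H ^ (CARD('n) - 1) * D * W ^ N * fact N powr s)"
    by (simp add: sum_distrib_right)
   also have "\<dots> = H * H ^ (CARD('n) - 1) * D * (2 * W) ^ N * fact N powr s"
    unfolding choose_row_sum by (simp add: power_mult_distrib mult_ac)
   finally show ?thesis .
  qed
  have le: "(norm \<xi> / (real CARD('n) * (2 * W))) ^ N * cmod (fourier ?\<phi> \<xi>) \<le> (D * C) * fact N powr s" for N
  proof -
   let ?B = "H * H ^ (CARD('n) - 1) * D * (2 * W) ^ N * fact N powr s"
   have B: "?B \<ge> 0" using H W D by auto
   have "\<bar>\<xi> $ k\<bar> ^ N * cmod (fourier ?\<phi> \<xi>) = cmod (fourier (F N) \<xi>)"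
    unfolding ft by (simp add: norm_mult norm_power)
   also have "\<dots> \<le> ?B * measure lborel (cube (4 * L) :: (real^'n) set)"
    unfolding fourier_def
   proof (rule integral_bound_cube[OF _ _ B])
    show "cmod (cis (- (x \<bullet> \<xi>)) * F N x) \<le> ?B" if "x \<in> cube (4 * L)" for x
     unfolding norm_mult norm_cis mult_1 by (rule bF[OF that])
    show "cis (- (x \<bullet> \<xi>)) * F N x = 0" if "x \<notin> cube (4 * L)" for x
     using F(4)[OF that] by simp
   qed
   also have "\<dots> \<le> ?B * V" by (intro mult_left_mono V B)
   finally have 1: "\<bar>\<xi> $ k\<bar> ^ N * cmod (fourier ?\<phi> \<xi>) \<le> (2 * W) ^ N * (D * C * fact N powr s)"
    by (simp add: C_def mult_ac)
   have "norm \<xi> / (real CARD('n) * (2 * W)) \<le> \<bar>\<xi> $ k\<bar> / (2 * W)"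
    using k W by (simp add: field_simps)
   then have "(norm \<xi> / (real CARD('n) * (2 * W))) ^ N \<le> (\<bar>\<xi> $ k\<bar> / (2 * W)) ^ N"
    using W by (intro power_mono) auto
   then have "(norm \<xi> / (real CARD('n) * (2 * W))) ^ N * cmod (fourier ?\<phi> \<xi>) \<le> (\<bar>\<xi> $ k\<bar> / (2 * W)) ^ N * cmod (fourier ?\<phi> \<xi>)"
    by (intro mult_right_mono) auto
   also have "\<dots> = (\<bar>\<xi> $ k\<bar> ^ N * cmod (fourier ?\<phi> \<xi>)) / (2 * W) ^ N" by (simp add: power_divide)
   also have "\<dots> \<le> (D * C) * fact N powr s" using 1 W by (simp add: field_simps)
   finally show ?thesis .
  qed
  have "cmod (fourier ?\<phi> \<xi>) \<le> D * C * exp 1 * exp (- ((norm \<xi> / (real CARD('n) * (2 * W)) / exp 1) powr (1 / s)))"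
   using W C D s le by (intro gevrey_optimal_order) auto
  also have "(norm \<xi> / (real CARD('n) * (2 * W)) / exp 1) powr (1 / s) = c * norm \<xi> powr (1 / s)"
   using W by (simp add: c_def powr_mult[symmetric])
  finally show "cmod (fourier ?\<phi> \<xi>) \<le> D * (C * exp 1) * decay c (1 / s) \<xi>"
   by (simp add: decay_def mult.assoc)
 qed
qed

subsection \<open>Holmgren's uniqueness theorem\<close>

text \<open>Differentiability in time uniformly on cubes. Limits in the Gevrey topology provide it,
  and it suffices for differentiating integrals against compactly supported test functions.\<close>

definition tder :: "real => (real => real^'n::finite => complex) => (real => real^'n => complex) => bool" where
 "tder T w w' \<longleftrightarrow> (\<forall>t\<in>{0..T}. \<forall>r. \<forall>e>0. \<forall>\<^sub>F \<tau> in at t within {0..T}.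
   \<forall>x\<in>cube r. cmod ((w \<tau> x - w t x) /\<^sub>R (\<tau> - t) - w' t x) \<le> e)"

lemma tderD:
 "tder T w w' ==> t \<in> {0..T} ==> e > 0 ==> \<forall>\<^sub>F \<tau> in at t within {0..T}.
   \<forall>x\<in>cube r. cmod ((w \<tau> x - w t x) /\<^sub>R (\<tau> - t) - w' t x) \<le> e"
 by (simp add: tder_def)

lemma has_vector_derivative_quotient_within:
 fixes f :: "real => complex"
 assumes "\<And>e. e > 0 ==> \<forall>\<^sub>F \<tau> in at t within S. cmod ((f \<tau> - f t) /\<^sub>R (\<tau> - t) - d) \<le> e"
 shows "(f has_vector_derivative d) (at t within S)"
proof -
 have "((\<lambda>\<tau>. norm ((f \<tau> - f t) /\<^sub>R (\<tau> - t) - d)) \<longlongrightarrow> 0) (at t within S)"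
 proof (rule tendstoI)
  fix e :: real assume "e > 0"
  then have E: "\<forall>\<^sub>F \<tau> in at t within S. cmod ((f \<tau> - f t) /\<^sub>R (\<tau> - t) - d) \<le> e / 2" by (intro assms) simp
  show "\<forall>\<^sub>F \<tau> in at t within S. dist (cmod ((f \<tau> - f t) /\<^sub>R (\<tau> - t) - d)) 0 < e"
   using E by (rule eventually_mono) (use \<open>e > 0\<close> in simp)
 qed
 then have L: "((\<lambda>\<tau>. (1 / norm (\<tau> - t)) *\<^sub>R (f \<tau> - (f t + (\<tau> - t) *\<^sub>R d))) \<longlongrightarrow> 0) (at t within S)"
 proof (subst tendsto_norm_zero_iff[symmetric], rule Lim_transform_eventually)
  have "norm ((f \<tau> - f t) /\<^sub>R (\<tau> - t) - d) = norm ((1 / norm (\<tau> - t)) *\<^sub>R (f \<tau> - (f t + (\<tau> - t) *\<^sub>R d)))" if "\<tau> \<noteq> t" for \<tau>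
  proof -
   have "f \<tau> - (f t + (\<tau> - t) *\<^sub>R d) = (\<tau> - t) *\<^sub>R ((f \<tau> - f t) /\<^sub>R (\<tau> - t) - d)"
    unfolding scaleR_diff_right[where x = "(f \<tau> - f t) /\<^sub>R (\<tau> - t)" and y = d] using that by simp
   then show ?thesis using that by simp
  qed
  then show "\<forall>\<^sub>F \<tau> in at t within S. norm ((f \<tau> - f t) /\<^sub>R (\<tau> - t) - d) = norm ((1 / norm (\<tau> - t)) *\<^sub>R (f \<tau> - (f t + (\<tau> - t) *\<^sub>R d)))"
   by (auto simp: eventually_at_filter)
 qed
 show ?thesis
  unfolding has_vector_derivative_def has_derivative_within using L by (auto intro: bounded_linear_scaleR_left)
qed

lemma tder_has_vector_derivative:
 assumes "tder T w w'" "t \<in> {0..T}"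
 shows "((\<lambda>t. w t x) has_vector_derivative w' t x) (at t within {0..T})"
proof (rule has_vector_derivative_quotient_within)
 fix e :: real assume e: "e > 0"
 have "x \<in> cube (norm x)" by (simp add: cube_def component_le_norm_cart)
 then show "\<forall>\<^sub>F \<tau> in at t within {0..T}. cmod ((w \<tau> x - w t x) /\<^sub>R (\<tau> - t) - w' t x) \<le> e"
  using tderD[OF assms e, of "norm x"] by (auto elim: eventually_mono)
qed

lemma cube_bounded:
 fixes f :: "real^'n::finite => complex"
 assumes "continuous_on UNIV f"
 obtains B where "B > 0" "\<And>x. x \<in> cube r ==> cmod (f x) \<le> B"
proof -
 have "bounded (f ` cube r)"
  by (intro compact_imp_bounded compact_continuous_image compact_cube continuous_on_subset[OF assms]) simp
 then show ?thesis using that unfolding bounded_pos by auto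
qed

text \<open>Near each time the difference quotients are bounded on the cube, hence so is
  \<open>w\<close>; bisection of [0, T] turns the local bounds into a global one.\<close>

lemma tder_bounded:
 fixes w w' :: "real => real^'n::finite => complex"
 assumes d: "tder T w w'" and T: "T > 0"
  and c: "\<And>t. t \<in> {0..T} ==> continuous_on UNIV (w t)" "\<And>t. t \<in> {0..T} ==> continuous_on UNIV (w' t)"
 obtains D where "D > 0" "\<And>t x. t \<in> {0..T} ==> x \<in> cube r ==> cmod (w t x) \<le> D"
proof -
 have "\<exists>D. \<forall>t\<in>{0..T}. \<forall>x\<in>cube r. cmod (w t x) \<le> D"
 proof -
  have "0 \<le> T" using T by simp
  then have "\<exists>D. \<forall>t\<in>{0..T} \<inter> {0..T}. \<forall>x\<in>cube r. cmod (w t x) \<le> D"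
  proof (rule Bolzano[where P = "\<lambda>a b. \<exists>D. \<forall>t\<in>{a..b} \<inter> {0..T}. \<forall>x\<in>cube r. cmod (w t x) \<le> D"])
   fix a b c
   assume "\<exists>D. \<forall>t\<in>{a..b} \<inter> {0..T}. \<forall>x\<in>cube r. cmod (w t x) \<le> D"
    and "\<exists>D. \<forall>t\<in>{b..c} \<inter> {0..T}. \<forall>x\<in>cube r. cmod (w t x) \<le> D"
   then obtain D E where D: "\<forall>t\<in>{a..b} \<inter> {0..T}. \<forall>x\<in>cube r. cmod (w t x) \<le> D"
    and E: "\<forall>t\<in>{b..c} \<inter> {0..T}. \<forall>x\<in>cube r. cmod (w t x) \<le> E" by blast
   have "cmod (w t x) \<le> max D E" if "t \<in> {a..c} \<inter> {0..T}" "x \<in> cube r" for t x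
   proof (cases "t \<le> b")
    case True
    then have "cmod (w t x) \<le> D" using D that by simp
    then show ?thesis by simp
   next
    case False
    then have "cmod (w t x) \<le> E" using E that by simp
    then show ?thesis by simp
   qed
   then show "\<exists>D. \<forall>t\<in>{a..c} \<inter> {0..T}. \<forall>x\<in>cube r. cmod (w t x) \<le> D" by blast
  next
   fix t assume "0 \<le> t" "t \<le> T"
   then have t: "t \<in> {0..T}" by simp
   obtain B where B: "B > 0" "\<And>x. x \<in> cube r ==> cmod (w t x) \<le> B" using cube_bounded[OF c(1)[OF t]] by blast
   obtain B' where B': "B' > 0" "\<And>x. x \<in> cube r ==> cmod (w' t x) \<le> B'" using cube_bounded[OF c(2)[OF t]] by blast
   from tderD[OF d t, of 1 r] obtain \<delta> where \<delta>: "\<delta> > 0"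
    "\<And>\<tau> x. \<tau> \<in> {0..T} ==> \<tau> \<noteq> t ==> dist \<tau> t < \<delta> ==> x \<in> cube r ==> cmod ((w \<tau> x - w t x) /\<^sub>R (\<tau> - t) - w' t x) \<le> 1"
    unfolding eventually_at by auto
   have bd: "cmod (w \<tau> x) \<le> B + \<delta> * (1 + B')" if "\<tau> \<in> {0..T}" "\<bar>\<tau> - t\<bar> < \<delta>" "x \<in> cube r" for \<tau> x
   proof (cases "\<tau> = t")
    case True
    then show ?thesis using B(2)[OF that(3)] \<delta>(1) B'(1) by (simp add: add_increasing2)
   next
    case False
    have e: "w \<tau> x = w t x + (\<tau> - t) *\<^sub>R (((w \<tau> x - w t x) /\<^sub>R (\<tau> - t) - w' t x) + w' t x)"
     using False by simp
    have "cmod (((w \<tau> x - w t x) /\<^sub>R (\<tau> - t) - w' t x) + w' t x) \<le> 1 + B'"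
     using that False by (intro norm_triangle_le add_mono \<delta>(2) B'(2)) (auto simp: dist_real_def)
    then have "cmod ((\<tau> - t) *\<^sub>R (((w \<tau> x - w t x) /\<^sub>R (\<tau> - t) - w' t x) + w' t x)) \<le> \<delta> * (1 + B')"
     unfolding norm_scaleR using that \<delta>(1) by (intro mult_mono) auto
    then show ?thesis by (subst e) (intro norm_triangle_le add_mono B(2) that(3))
   qed
   show "\<exists>d>0. \<forall>u v. u \<le> t \<and> t \<le> v \<and> v - u < d --> (\<exists>D. \<forall>t\<in>{u..v} \<inter> {0..T}. \<forall>x\<in>cube r. cmod (w t x) \<le> D)"
   proof (rule exI[of _ \<delta>], intro conjI allI impI \<delta>(1))
    fix u v assume uv: "u \<le> t \<and> t \<le> v \<and> v - u < \<delta>"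
    show "\<exists>D. \<forall>t\<in>{u..v} \<inter> {0..T}. \<forall>x\<in>cube r. cmod (w t x) \<le> D"
    proof (intro exI[of _ "B + \<delta> * (1 + B')"] ballI)
     fix \<tau> and x :: "real^'n" assume *: "\<tau> \<in> {u..v} \<inter> {0..T}" "x \<in> cube r"
     then have "\<bar>\<tau> - t\<bar> < \<delta>" using uv by auto
     then show "cmod (w \<tau> x) \<le> B + \<delta> * (1 + B')" using * by (intro bd) auto
    qed
   qed
  qed
  then show ?thesis by simp
 qed
 then obtain D where D: "\<And>t x. t \<in> {0..T} ==> x \<in> cube r ==> cmod (w t x) \<le> D" by blast
 show ?thesis
  by (rule that[of "max D 1"]) (use D in \<open>auto simp: le_max_iff_disj\<close>)
qed

lemma tder_integral:
 fixes w w' :: "real => real^'n::finite => complex"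
 assumes d: "tder T w w'" and t: "t \<in> {0..T}"
  and c: "\<And>t. t \<in> {0..T} ==> continuous_on UNIV (w t)" "\<And>t. t \<in> {0..T} ==> continuous_on UNIV (w' t)"
  and \<omega>: "continuous_on UNIV \<omega>" "\<And>x. x \<notin> cube r ==> \<omega> x = 0"
 shows "((\<lambda>t. \<integral>x. \<omega> x * w t x \<partial>lborel) has_vector_derivative (\<integral>x. \<omega> x * w' t x \<partial>lborel)) (at t within {0..T})"
proof (rule has_vector_derivative_quotient_within)
 fix e :: real assume e: "e > 0"
 obtain B where B: "B > 0" "\<And>x. x \<in> cube r ==> cmod (\<omega> x) \<le> B" using cube_bounded[OF \<omega>(1)] by blast
 define V where "V = measure lborel (cube r :: (real^'n) set) + 1"
 have V: "V > 0" "measure lborel (cube r :: (real^'n) set) \<le> V" by (auto simp: V_def add_nonneg_pos)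
 define e' where "e' = e / (B * V)"
 have e': "e' > 0" using e B V by (simp add: e'_def)
 have ev: "\<forall>\<^sub>F \<tau> in at t within {0..T}. \<tau> \<in> {0..T}" by (simp add: eventually_at_filter)
 have i: "integrable lborel (\<lambda>x. \<omega> x * g x)" if "continuous_on UNIV g" for g
  by (rule integrable_compact_support[where r = r]) (auto intro!: continuous_intros \<omega> that)
 show "\<forall>\<^sub>F \<tau> in at t within {0..T}. cmod (((\<integral>x. \<omega> x * w \<tau> x \<partial>lborel) - (\<integral>x. \<omega> x * w t x \<partial>lborel)) /\<^sub>R (\<tau> - t) - (\<integral>x. \<omega> x * w' t x \<partial>lborel)) \<le> e"
  using tderD[OF d t e', of r] ev
 proof eventually_elim
  case (elim \<tau>)
  have eq: "((\<integral>x. \<omega> x * w \<tau> x \<partial>lborel) - (\<integral>x. \<omega> x * w t x \<partial>lborel)) /\<^sub>R (\<tau> - t) - (\<integral>x. \<omega> x * w' t x \<partial>lborel)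
    = (\<integral>x. \<omega> x * ((w \<tau> x - w t x) /\<^sub>R (\<tau> - t) - w' t x) \<partial>lborel)"
  proof -
   have "(\<integral>x. \<omega> x * ((w \<tau> x - w t x) /\<^sub>R (\<tau> - t) - w' t x) \<partial>lborel) =
     (\<integral>x. (\<omega> x * w \<tau> x - \<omega> x * w t x) /\<^sub>R (\<tau> - t) - \<omega> x * w' t x \<partial>lborel)"
    by (intro Bochner_Integration.integral_cong refl) (simp add: algebra_simps)
   also have "\<dots> = ((\<integral>x. \<omega> x * w \<tau> x \<partial>lborel) - (\<integral>x. \<omega> x * w t x \<partial>lborel)) /\<^sub>R (\<tau> - t) - (\<integral>x. \<omega> x * w' t x \<partial>lborel)"
    using i[OF c(1)[OF elim(2)]] i[OF c(1)[OF t]] i[OF c(2)[OF t]] by simp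
   finally show ?thesis by simp
  qed
  have "cmod (\<integral>x. \<omega> x * ((w \<tau> x - w t x) /\<^sub>R (\<tau> - t) - w' t x) \<partial>lborel) \<le> (B * e') * measure lborel (cube r :: (real^'n) set)"
  proof (rule integral_bound_cube)
   show "cmod (\<omega> x * ((w \<tau> x - w t x) /\<^sub>R (\<tau> - t) - w' t x)) \<le> B * e'" if "x \<in> cube r" for x
    unfolding norm_mult using elim(1) that B by (intro mult_mono) auto
  qed (use B e' \<omega>(2) in auto)
  also have "\<dots> \<le> (B * e') * V" using B e' V by (intro mult_left_mono) auto
  also have "\<dots> = e" using B V by (simp add: e'_def)
  finally show ?case unfolding eq .
 qed
qed

text \<open>Derivatives of the Gaussian of variance \<open>eps\<close>, taken on the complex plane
  so that Cauchy's inequality gives factorial bounds on circles of any radius.\<close>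

definition gauss1 :: "real => nat => real => complex" where
 "gauss1 eps j y = (deriv ^^ j) (\<lambda>z. exp (- (z\<^sup>2) / cor (2 * eps))) (cor y)"

lemma gauss1_0: "gauss1 eps 0 y = cor (exp (- (y\<^sup>2) / (2 * eps)))"
 by (simp add: gauss1_def flip: exp_of_real)

lemma has_vector_derivative_gauss1: "(gauss1 eps j has_vector_derivative gauss1 eps (Suc j) y) (at y)"
proof -
 let ?f = "\<lambda>z. exp (- (z\<^sup>2) / cor (2 * eps))"
 have "(deriv ^^ j) ?f holomorphic_on UNIV"
  by (intro holomorphic_higher_deriv holomorphic_intros) auto
 then have "((deriv ^^ j) ?f has_field_derivative deriv ((deriv ^^ j) ?f) (cor y)) (at (cor y))"
  by (rule holomorphic_derivI) auto
 from has_vector_derivative_real_field[OF this]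
 show ?thesis by (simp add: gauss1_def[abs_def])
qed

lemma gauss1_bound:
 assumes eps: "eps > 0" and r: "r > 0" and b: "\<And>z. cmod (z - cor y) = r ==> Re (z\<^sup>2) \<ge> c"
 shows "cmod (gauss1 eps j y) \<le> fact j / r ^ j * exp (- c / (2 * eps))"
proof -
 let ?f = "\<lambda>z. exp (- (z\<^sup>2) / cor (2 * eps))"
 have "cmod ((deriv ^^ j) ?f (cor y)) \<le> fact j * exp (- c / (2 * eps)) / r ^ j"
 proof (rule Cauchy_inequality)
  show "?f holomorphic_on ball (cor y) r" by (intro holomorphic_intros) (use eps in auto)
  show "continuous_on (cball (cor y) r) ?f" by (intro continuous_intros) (use eps in auto)
  fix z assume z: "cmod (cor y - z) = r"
  have "Re (z\<^sup>2) \<ge> c" by (rule b) (use z in \<open>simp add: norm_minus_commute\<close>)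
  have "cmod (?f z) = exp (- Re (z\<^sup>2) / (2 * eps))"
   unfolding norm_exp_eq_Re by (simp only: Re_divide_of_real uminus_complex.sel)
  also have "\<dots> \<le> exp (- c / (2 * eps))" using \<open>Re (z\<^sup>2) \<ge> c\<close> eps by (simp add: divide_right_mono)
  finally show "cmod (?f z) \<le> exp (- c / (2 * eps))" .
 qed (fact r)
 then show ?thesis by (simp add: gauss1_def)
qed

lemma gauss1_bound_any:
 assumes eps: "eps > 0" and r: "r > 0"
 shows "cmod (gauss1 eps j y) \<le> fact j / r ^ j * exp (r\<^sup>2 / (2 * eps))"
proof -
 have "cmod (gauss1 eps j y) \<le> fact j / r ^ j * exp (- (- r\<^sup>2) / (2 * eps))"
 proof (rule gauss1_bound[OF eps r])
  fix z assume z: "cmod (z - cor y) = r"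
  have "\<bar>Im z\<bar> \<le> r" using abs_Im_le_cmod[of "z - cor y"] z by simp
  then have "(Im z)\<^sup>2 \<le> r\<^sup>2" using power_mono[of "\<bar>Im z\<bar>" r 2] by simp
  then show "- r\<^sup>2 \<le> Re (z\<^sup>2)" by (simp add: power2_eq_square) (smt (verit) zero_le_square)
 qed
 then show ?thesis by simp
qed

text \<open>On the circle |Re z| >= 7 L / 4 and |Im z| <= L / 4, so the real part of z^2 is at least
  3 L^2. The value 2 L^2 that is kept is ample for several dimensions, where the other coordinates
  may grow.\<close>

lemma gauss1_bound_far:
 assumes eps: "eps > 0" and r: "r > 0" "r \<le> L / 4" and y: "\<bar>y\<bar> \<ge> 2 * L"
 shows "cmod (gauss1 eps j y) \<le> fact j / r ^ j * exp (- (L\<^sup>2) / eps)"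
proof -
 have "cmod (gauss1 eps j y) \<le> fact j / r ^ j * exp (- (2 * L\<^sup>2) / (2 * eps))"
 proof (rule gauss1_bound[OF eps r(1)])
  fix z assume z: "cmod (z - cor y) = r"
  have 1: "\<bar>Im z\<bar> \<le> L / 4" using abs_Im_le_cmod[of "z - cor y"] z r by simp
  have "\<bar>Re z - y\<bar> \<le> L / 4" using abs_Re_le_cmod[of "z - cor y"] z r by simp
  then have 2: "\<bar>Re z\<bar> \<ge> 7 * L / 4" using y by linarith
  have "(Im z)\<^sup>2 \<le> (L / 4)\<^sup>2" using power_mono[OF 1, of 2] by simp
  moreover have "(7 * L / 4)\<^sup>2 \<le> (Re z)\<^sup>2" using power_mono[OF 2, of 2] r by simp
  ultimately show "2 * L\<^sup>2 \<le> Re (z\<^sup>2)" by (simp add: power2_eq_square) (smt (verit) zero_le_square)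
 qed
 then show ?thesis by simp
qed

section \<open>Majorants for the loss of one derivative\<close>

definition bump_index :: "'n => ('n => nat) => 'n => nat" where
 "bump_index k \<beta> = \<beta>(k := Suc (\<beta> k))"

lemma sum_bump_index: "(\<Sum>j\<in>(UNIV::'n::finite set). bump_index k \<beta> j) = Suc (\<Sum>j\<in>UNIV. \<beta> j)"
proof -
 have "(\<Sum>j\<in>UNIV - {k}. bump_index k \<beta> j) = (\<Sum>j\<in>UNIV - {k}. \<beta> j)"
  by (intro sum.cong) (auto simp: bump_index_def)
 then show ?thesis
  by (simp add: sum.remove[of UNIV k] bump_index_def)
qed

text \<open>The classical majorant N! / (a - b t)^(N+1): differentiating in t raises N by one, just
  as the equation loses one space derivative. The exponential factor accommodates the terms without
  loss.\<close>

lemma has_derivative_factorial_majorant: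
 fixes a b c t :: real
 assumes "a - b * t > 0"
 shows "((\<lambda>t. exp (c * t) * fact N / (a - b * t) ^ Suc N) has_real_derivative
  (c * (exp (c * t) * fact N / (a - b * t) ^ Suc N) + b * (exp (c * t) * fact (Suc N) / (a - b * t) ^ Suc (Suc N)))) (at t within S)"
proof -
 have ne: "a - b * t \<noteq> 0" using assms by simp
 define z where "z = a - b * t"
 have z: "z \<noteq> 0" using ne by (simp add: z_def)
 have d: "((\<lambda>t. exp (c * t) * fact N / (a - b * t) ^ Suc N) has_real_derivative
   (exp (c * t) * c * fact N * (a - b * t) ^ Suc N - exp (c * t) * fact N * (real (Suc N) * (- b) * (a - b * t) ^ N)) /
   ((a - b * t) ^ Suc N * (a - b * t) ^ Suc N)) (at t within S)"
 proof (rule DERIV_divide)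
  show "((\<lambda>t. exp (c * t) * fact N) has_real_derivative exp (c * t) * c * fact N) (at t within S)"
   by (rule derivative_eq_intros refl | simp)+
  show "((\<lambda>t. (a - b * t) ^ Suc N) has_real_derivative real (Suc N) * (- b) * (a - b * t) ^ N) (at t within S)"
   by (rule derivative_eq_intros refl | simp)+
  show "(a - b * t) ^ Suc N \<noteq> 0" using ne by simp
 qed
 have "(exp (c * t) * c * fact N * z ^ Suc N - exp (c * t) * fact N * (real (Suc N) * (- b) * z ^ N)) / (z ^ Suc N * z ^ Suc N)
   = c * (exp (c * t) * fact N / z ^ Suc N) + b * (exp (c * t) * fact (Suc N) / z ^ Suc (Suc N))"
  using z by (simp add: field_simps del: of_nat_Suc)
 then show ?thesis using d unfolding z_def by simp
qed

text \<open>The scale of bounds is closed under the loss of one derivative: the majorants \<open>Z\<close> absorb the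
 source term, while the a priori bound \<open>Y\<close> is halved in each step of the induction.\<close>

lemma cauchy_kovalevskaya_majorant:
 fixes \<Phi> \<Phi>' :: "('n::finite => nat) => 'm::finite => real => complex"
 assumes K: "K > 0" and T: "T > 0" and r: "K * T < r" and \<rho>: "2 * K * T < \<rho>" and \<eta>: "\<eta> \<ge> 0" and D: "D \<ge> 0"
  and d: "\<And>\<beta> i t. t \<in> {0..T} ==> (\<Phi> \<beta> i has_vector_derivative \<Phi>' \<beta> i t) (at t within {0..T})"
  and le: "\<And>\<beta> i t U0 U1. t \<in> {0..T} ==> (\<And>j. cmod (\<Phi> \<beta> j t) \<le> U0) ==>
    (\<And>k j. cmod (\<Phi> (bump_index k \<beta>) j t) \<le> U1) ==>
    cmod (\<Phi>' \<beta> i t) \<le> K * (U1 + U0 + \<eta> * fact (\<Sum>j\<in>UNIV. \<beta> j) / r ^ Suc (\<Sum>j\<in>UNIV. \<beta> j))"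
  and init: "\<And>\<beta> i. \<Phi> \<beta> i 0 = 0"
  and ap: "\<And>\<beta> i t. t \<in> {0..T} ==> cmod (\<Phi> \<beta> i t) \<le> D * fact (\<Sum>j\<in>UNIV. \<beta> j) / \<rho> ^ Suc (\<Sum>j\<in>UNIV. \<beta> j)"
  and t: "t \<in> {0..T}"
 shows "cmod (\<Phi> (\<lambda>_. 0) i t) \<le> \<eta> * exp (2 * K * T) / (r - K * T)"
proof -
 \<comment> \<open>Z_N' = 2 K Z_N + K Z_(N+1): one K pays for the zero order term and one for the
   source, which is at most Z_N. The rates of \<open>Y\<close> are doubled, so half of Y_N'
   dominates K (Y_N + Y_(N+1)); this is why the factor 1/2 is gained in each step.\<close>
 define Z where "Z N t = \<eta> * (exp (2 * K * t) * fact N / (r - K * t) ^ Suc N)" for N :: nat and t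
 define Y where "Y N t = D * (exp (4 * K * t) * fact N / (\<rho> - 2 * K * t) ^ Suc N)" for N :: nat and t
 have pos: "r - K * t > 0" "\<rho> - 2 * K * t > 0" if "t \<in> {0..T}" for t
 proof -
  have "K * t \<le> K * T" using that K by (intro mult_left_mono) auto
  then show "r - K * t > 0" "\<rho> - 2 * K * t > 0" using r \<rho> by auto
 qed
 have r0: "r > 0" "\<rho> > 0" using pos[of 0] T by auto
 have Z0: "Z N t \<ge> 0" and Y0: "Y N t \<ge> 0" if "t \<in> {0..T}" for N t
  using pos[OF that] \<eta> D by (auto simp: Z_def Y_def)
 have dZ: "(Z N has_real_derivative (2 * K * Z N t + K * Z (Suc N) t)) (at t within S)" if "t \<in> {0..T}" for N t S
  using DERIV_cmult[OF has_derivative_factorial_majorant[OF pos(1)[OF that], of "2 * K" N], of \<eta>]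
  unfolding Z_def[abs_def] by (simp add: algebra_simps)
 have dY: "(Y N has_real_derivative (4 * K * Y N t + 2 * K * Y (Suc N) t)) (at t within S)" if "t \<in> {0..T}" for N t S
  using DERIV_cmult[OF has_derivative_factorial_majorant[OF pos(2)[OF that], of "4 * K" N], of D]
  unfolding Y_def[abs_def] by (simp add: algebra_simps)
 have e: "\<eta> * fact N / r ^ Suc N \<le> Z N t" if t: "t \<in> {0..T}" for N t
 proof -
  have "fact N / r ^ Suc N \<le> fact N / (r - K * t) ^ Suc N"
   using pos[OF t] K t r0 by (intro divide_left_mono power_mono mult_pos_pos zero_less_power) (auto simp: less_imp_le)
  also have "\<dots> = 1 * fact N / (r - K * t) ^ Suc N" by simp
  also have "\<dots> \<le> exp (2 * K * t) * fact N / (r - K * t) ^ Suc N"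
   using pos[OF t] K t by (intro divide_right_mono mult_right_mono) auto
  finally have "\<eta> * (fact N / r ^ Suc N) \<le> Z N t" unfolding Z_def by (intro mult_left_mono \<eta>)
  then show ?thesis by simp
 qed
 have ind: "cmod (\<Phi> \<beta> i t) \<le> Z (\<Sum>j\<in>UNIV. \<beta> j) t + (1 / 2) ^ J * Y (\<Sum>j\<in>UNIV. \<beta> j) t" if "t \<in> {0..T}" for J \<beta> i t
  using that
 proof (induction J arbitrary: \<beta> i t)
  case 0
  let ?N = "\<Sum>j\<in>UNIV. \<beta> j"
  note t = 0
  have "fact ?N / \<rho> ^ Suc ?N \<le> fact ?N / (\<rho> - 2 * K * t) ^ Suc ?N"
   using pos[OF t] K t r0 by (intro divide_left_mono power_mono mult_pos_pos zero_less_power) (auto simp: less_imp_le)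
  also have "\<dots> = 1 * fact ?N / (\<rho> - 2 * K * t) ^ Suc ?N" by simp
  also have "\<dots> \<le> exp (4 * K * t) * fact ?N / (\<rho> - 2 * K * t) ^ Suc ?N"
   using pos[OF t] K t by (intro divide_right_mono mult_right_mono) auto
  finally have "D * (fact ?N / \<rho> ^ Suc ?N) \<le> Y ?N t" unfolding Y_def by (intro mult_left_mono D)
  then show ?case using ap[OF t, of \<beta> i] Z0[OF t, of ?N] by simp
 next
  case (Suc J)
  let ?N = "\<Sum>j\<in>UNIV. \<beta> j"
  let ?g = "\<lambda>t. Z ?N t + (1 / 2) ^ Suc J * Y ?N t"
  let ?g' = "\<lambda>t. (2 * K * Z ?N t + K * Z (Suc ?N) t) + (1 / 2) ^ Suc J * (4 * K * Y ?N t + 2 * K * Y (Suc ?N) t)"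
  have sub: "{0..t} \<subseteq> {0..T}" using Suc.prems by auto
  have "cmod (\<Phi> \<beta> i t - \<Phi> \<beta> i 0) \<le> ?g t - ?g 0"
  proof (rule vector_derivative_bound_general[where f' = "\<Phi>' \<beta> i" and g' = ?g'])
   show "0 \<le> t" using Suc.prems by simp
   fix x assume "x \<in> {0..t}"
   then have x: "x \<in> {0..T}" using sub by blast
   show "(\<Phi> \<beta> i has_vector_derivative \<Phi>' \<beta> i x) (at x within {0..t})"
    by (rule has_vector_derivative_within_subset[OF d[OF x] sub])
   show "(?g has_real_derivative ?g' x) (at x within {0..t})"
    by (intro DERIV_add DERIV_cmult dZ dY x)
   have "cmod (\<Phi>' \<beta> i x) \<le> K * ((Z (Suc ?N) x + (1 / 2) ^ J * Y (Suc ?N) x) + (Z ?N x + (1 / 2) ^ J * Y ?N x) + \<eta> * fact ?N / r ^ Suc ?N)"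
    using Suc.IH[OF x, of \<beta>] Suc.IH[OF x, of "bump_index k \<beta>" for k] by (intro le x) (simp_all only: sum_bump_index)
   also have "\<dots> \<le> K * ((Z (Suc ?N) x + (1 / 2) ^ J * Y (Suc ?N) x) + (Z ?N x + (1 / 2) ^ J * Y ?N x) + Z ?N x)"
    using K by (intro mult_left_mono add_left_mono e x) auto
   also have "\<dots> = ?g' x - K * (1 / 2) ^ J * Y ?N x" by (simp add: algebra_simps)
   also have "\<dots> \<le> ?g' x" using K Y0[OF x, of ?N] by simp
   finally show "cmod (\<Phi>' \<beta> i x) \<le> ?g' x" .
  qed
  moreover have "?g 0 \<ge> 0" using Z0[of 0] Y0[of 0] T by simp
  ultimately show ?case by (simp add: init)
 qed
 have "cmod (\<Phi> (\<lambda>_. 0) i t) \<le> Z 0 t"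
 proof (rule LIMSEQ_le_const)
  have "(\<lambda>J. Z 0 t + (1 / 2) ^ J * Y 0 t) \<longlonglongrightarrow> Z 0 t + 0 * Y 0 t"
   by (intro tendsto_intros LIMSEQ_power_zero) simp
  then show "(\<lambda>J. Z 0 t + (1 / 2) ^ J * Y 0 t) \<longlonglongrightarrow> Z 0 t" by simp
  show "\<exists>N. \<forall>J\<ge>N. cmod (\<Phi> (\<lambda>_. 0) i t) \<le> Z 0 t + (1 / 2) ^ J * Y 0 t"
   using ind[OF t, of "\<lambda>_. 0" i] by simp
 qed
 also have "Z 0 t \<le> \<eta> * (exp (2 * K * T) / (r - K * T))"
  unfolding Z_def using t pos[of T] T K by (intro mult_left_mono frac_le \<eta>) (auto intro: mult_left_mono)
 finally show ?thesis by simp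
qed

section \<open>Gaussian test functions in several variables\<close>

definition gaussn :: "real => ('n::finite => nat) => real^'n => complex" where
 "gaussn eps \<beta> x = (\<Prod>j\<in>UNIV. gauss1 eps (\<beta> j) (x $ j))"

lemma prod_fact_le_fact_sum: "finite I ==> (\<Prod>j\<in>I. fact (\<beta> j) :: real) \<le> fact (\<Sum>j\<in>I. \<beta> j)"
proof (induction rule: finite_induct)
 case (insert i I)
 have "fact (\<beta> i) * (\<Prod>j\<in>I. fact (\<beta> j) :: real) \<le> fact (\<beta> i) * fact (\<Sum>j\<in>I. \<beta> j)"
  by (intro mult_left_mono insert) auto
 also have "\<dots> \<le> fact (\<beta> i + (\<Sum>j\<in>I. \<beta> j))"
  using powr_fact_mult_le[of "\<beta> i" "\<beta> i + (\<Sum>j\<in>I. \<beta> j)" 1] by simp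
 finally show ?case using insert by simp
qed simp

lemma norm_gaussn_le:
 assumes "r > 0" and "\<And>j. cmod (gauss1 eps (\<beta> j) (x $ j)) \<le> fact (\<beta> j) / r ^ \<beta> j * E j"
 shows "cmod (gaussn eps \<beta> x) \<le> fact (\<Sum>j\<in>UNIV. \<beta> j) / r ^ (\<Sum>j\<in>UNIV. \<beta> j) * (\<Prod>j\<in>UNIV. E j)"
proof -
 have E: "E j \<ge> 0" for j
 proof -
  have "0 \<le> fact (\<beta> j) / r ^ \<beta> j * E j" using order_trans[OF norm_ge_zero assms(2)] .
  moreover have "fact (\<beta> j) / r ^ \<beta> j > 0" using assms(1) by simp
  ultimately show ?thesis by (metis mult_pos_neg not_le)
 qed
 have "cmod (gaussn eps \<beta> x) \<le> (\<Prod>j\<in>UNIV. fact (\<beta> j) / r ^ \<beta> j * E j)"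
  unfolding gaussn_def prod_norm[symmetric] by (intro prod_mono) (use assms(2) in auto)
 also have "\<dots> = (\<Prod>j\<in>UNIV. fact (\<beta> j)) / r ^ (\<Sum>j\<in>UNIV. \<beta> j) * (\<Prod>j\<in>UNIV. E j)"
  by (simp add: prod.distrib prod_dividef power_sum)
 also have "\<dots> \<le> fact (\<Sum>j\<in>UNIV. \<beta> j) / r ^ (\<Sum>j\<in>UNIV. \<beta> j) * (\<Prod>j\<in>UNIV. E j)"
  using assms(1) E by (intro mult_right_mono divide_right_mono prod_fact_le_fact_sum prod_nonneg) auto
 finally show ?thesis .
qed

lemma gaussn_bound_any:
 fixes x :: "real^'n::finite"
 assumes "eps > 0" "r > 0"
 shows "cmod (gaussn eps \<beta> x) \<le> fact (\<Sum>j\<in>UNIV. \<beta> j) / r ^ (\<Sum>j\<in>UNIV. \<beta> j) * exp (real CARD('n) * r\<^sup>2 / (2 * eps))"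
 using norm_gaussn_le[where r = r and E = "\<lambda>_. exp (r\<^sup>2 / (2 * eps))", OF assms(2) gauss1_bound_any[OF assms], of \<beta> x]
 by (simp flip: exp_of_nat_mult)

text \<open>One coordinate exceeds 2 L and contributes exp (- L^2 / eps). With r = L / (4 n) the
  other coordinates together contribute at most exp (L^2 / (2 eps)), so half of the exponent
  remains.\<close>

lemma gaussn_bound_far:
 fixes x :: "real^'n::finite"
 assumes eps: "eps > 0" and L: "L > 0" and x: "x \<notin> cube (2 * L)"
 defines "r \<equiv> L / (4 * real CARD('n))"
 shows "cmod (gaussn eps \<beta> x) \<le> fact (\<Sum>j\<in>UNIV. \<beta> j) / r ^ (\<Sum>j\<in>UNIV. \<beta> j) * exp (- (L\<^sup>2) / (2 * eps))"
proof -
 have n: "real CARD('n) \<ge> 1" by (simp add: Suc_leI)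
 have r0: "r > 0" using L by (simp add: r_def)
 have "L / (4 * real CARD('n)) \<le> L / 4" using L n by (intro divide_left_mono) auto
 with r0 have r: "r > 0" "r \<le> L / 4" by (simp_all add: r_def)
 from x obtain k where "\<not> \<bar>x $ k\<bar> \<le> 2 * L" by (auto simp: cube_def)
 then have k: "\<bar>x $ k\<bar> \<ge> 2 * L" by simp
 define E where "E j = (if j = k then exp (- (L\<^sup>2) / eps) else exp (r\<^sup>2 / (2 * eps)))" for j
 have 1: "cmod (gaussn eps \<beta> x) \<le> fact (\<Sum>j\<in>UNIV. \<beta> j) / r ^ (\<Sum>j\<in>UNIV. \<beta> j) * (\<Prod>j\<in>UNIV. E j)"
 proof (rule norm_gaussn_le[OF r(1)])
  show "cmod (gauss1 eps (\<beta> j) (x $ j)) \<le> fact (\<beta> j) / r ^ \<beta> j * E j" for j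
   using gauss1_bound_far[OF eps r k, of "\<beta> k"] gauss1_bound_any[OF eps r(1), of "\<beta> j" "x $ j"]
   by (cases "j = k") (simp_all only: E_def if_True if_False simp_thms)
 qed
 define d where "d = CARD('n) - 1"
 have "(\<Prod>j\<in>UNIV. E j) = E k * (\<Prod>j\<in>UNIV - {k}. exp (r\<^sup>2 / (2 * eps)))"
  by (subst prod.remove[of UNIV k]) (auto simp: E_def intro!: prod.cong)
 also have "\<dots> = exp (- (L\<^sup>2) / eps) * exp (real d * (r\<^sup>2 / (2 * eps)))"
  unfolding exp_of_nat_mult d_def by (simp add: E_def card_Diff_singleton)
 also have "\<dots> = exp (- (L\<^sup>2) / eps + real d * (r\<^sup>2 / (2 * eps)))" by (rule exp_add[symmetric])
 also have "\<dots> \<le> exp (- (L\<^sup>2) / (2 * eps))"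
 proof -
  have "real d \<le> real CARD('n) * 1" by (simp add: d_def)
  also have "\<dots> \<le> real CARD('n) * real CARD('n)" using n by (intro mult_left_mono) auto
  finally have "real d * r\<^sup>2 \<le> (real CARD('n))\<^sup>2 * r\<^sup>2"
   unfolding power2_eq_square[of "real CARD('n)"] by (intro mult_right_mono) auto
  also have "\<dots> = L\<^sup>2 / 16" using n unfolding r_def by (simp add: power_divide power_mult_distrib)
  also have "\<dots> \<le> L\<^sup>2" by simp
  finally have "real d * (r\<^sup>2 / (2 * eps)) \<le> L\<^sup>2 / (2 * eps)" using eps by (simp add: divide_right_mono)
  then have "- (L\<^sup>2) / eps + real d * (r\<^sup>2 / (2 * eps)) \<le> - (L\<^sup>2) / eps + L\<^sup>2 / (2 * eps)" by simp
  also have "\<dots> = - (L\<^sup>2) / (2 * eps)" using eps by (simp add: field_simps)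
  finally show ?thesis by simp
 qed
 finally have "(\<Prod>j\<in>UNIV. E j) \<le> exp (- (L\<^sup>2) / (2 * eps))" .
 then show ?thesis using r by (intro order_trans[OF 1] mult_left_mono) auto
qed

lemma has_partial_prod_dir:
 fixes f :: "'n::finite => real => complex"
 assumes "(f k has_vector_derivative d) (at (x $ k))"
 shows "has_partial k (\<lambda>x. \<Prod>j\<in>UNIV. f j (x $ j)) (d * (\<Prod>j\<in>UNIV - {k}. f j (x $ j))) x"
proof -
 have "((\<lambda>h. x $ k + h) has_real_derivative 0 + 1) (at 0)"
  by (rule DERIV_add[OF DERIV_const DERIV_ident])
 then have 1: "((\<lambda>h. x $ k + h) has_vector_derivative 1) (at 0)"
  by (simp add: has_real_derivative_iff_has_vector_derivative)
 have "((f k \<circ> (\<lambda>h. x $ k + h)) has_vector_derivative 1 *\<^sub>R d) (at 0)"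
  by (rule vector_diff_chain_at[OF 1]) (simp add: assms)
 then have "((\<lambda>h. f k (x $ k + h) * (\<Prod>j\<in>UNIV - {k}. f j (x $ j))) has_vector_derivative (d * (\<Prod>j\<in>UNIV - {k}. f j (x $ j)))) (at 0)"
  by (intro has_vector_derivative_mult_left) (simp add: o_def)
 moreover have "(\<Prod>j\<in>UNIV. f j ((x + h *\<^sub>R axis k 1) $ j)) = f k (x $ k + h) * (\<Prod>j\<in>UNIV - {k}. f j (x $ j))" for h
  by (subst prod.remove[of UNIV k]) (auto simp: axis_def intro!: prod.cong)
 ultimately show ?thesis unfolding has_partial_def by simp
qed

lemma has_partial_gaussn: "has_partial k (gaussn eps \<beta>) (gaussn eps (bump_index k \<beta>) x) x"
proof -
 have "gaussn eps (bump_index k \<beta>) x = gauss1 eps (Suc (\<beta> k)) (x $ k) * (\<Prod>j\<in>UNIV - {k}. gauss1 eps (\<beta> j) (x $ j))"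
  unfolding gaussn_def by (subst prod.remove[of UNIV k]) (auto simp: bump_index_def intro!: prod.cong)
 then show ?thesis
  using has_partial_prod_dir[where f = "\<lambda>j. gauss1 eps (\<beta> j)", OF has_vector_derivative_gauss1, of k x] unfolding gaussn_def[abs_def] by simp
qed

lemma continuous_on_gaussn: "continuous_on UNIV (gaussn eps \<beta>)"
proof -
 have c: "continuous_on UNIV (gauss1 eps j)" for j
 proof (rule continuous_at_imp_continuous_on, rule ballI)
  show "isCont (gauss1 eps j) y" for y
   by (rule has_vector_derivative_continuous[OF has_vector_derivative_gauss1])
 qed
 have "continuous_on UNIV (\<lambda>x::real^'a. gauss1 eps (\<beta> i) (x $ i))" for i
  by (rule continuous_on_component_fun[OF c[of "\<beta> i"], of i])
 then show ?thesis
  unfolding gaussn_def[abs_def] by (intro continuous_on_prod)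
qed

lemma gaussn_0: "gaussn (\<delta>\<^sup>2) (\<lambda>_. 0) x = cor (gaussian (x /\<^sub>R \<delta>))"
proof -
 have 1: "exp (- ((x $ j)\<^sup>2) / (2 * \<delta>\<^sup>2)) = exp (- ((x /\<^sub>R \<delta>) $ j)\<^sup>2 / 2)" for j
 proof -
  have "(x /\<^sub>R \<delta>) $ j = x $ j / \<delta>" by (simp only: vector_scaleR_component divide_real_def real_scaleR_def mult.commute)
  then show ?thesis by (simp only: power_divide) simp
 qed
 show ?thesis
  by (simp only: gaussn_def gauss1_0 gaussian_def of_real_prod 1)
qed

text \<open>The system solved for the ordinary time derivative. Since both \<open>D\<^sub>t\<close>
  and the space derivatives carry a factor - \<i>, the matrices A_k appear unchanged as
  \<open>a\<close>, while B enters as \<i> B.\<close>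

definition pde_rhs ::
 "('n::finite => 'm => 'm => real => complex) => ('m => 'm => real => complex) =>
  ('m::finite => real => real^'n => complex) => 'm => real => real^'n => complex" where
 "pde_rhs a b w i t x = (\<Sum>k\<in>UNIV. \<Sum>j\<in>UNIV. a k i j t * iterated_partial [k] (w j t) x) + (\<Sum>j\<in>UNIV. b i j t * w j t x)"

text \<open>A solution concept without Gevrey bounds, wide enough for the synthesised solutions, the
  patched solution and any competitor in the uniqueness statement.\<close>

definition pde_sol ::
 "real => ('n::finite => 'm => 'm => real => complex) => ('m => 'm => real => complex) =>
  ('m::finite => real => real^'n => complex) => bool" where
 "pde_sol T a b w \<longleftrightarrow> (\<forall>i. \<forall>t\<in>{0..T}. smooth (w i t)) \<and> (\<forall>i. tder T (w i) (pde_rhs a b w i))"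

lemma continuous_on_pde_rhs:
 assumes "\<And>j. smooth (w j t)"
 shows "continuous_on UNIV (pde_rhs a b w i t)"
 unfolding pde_rhs_def[abs_def]
 using smooth_continuous[OF assms, where ks = "[]"]
 by (intro continuous_on_add continuous_on_sum continuous_on_mult continuous_on_const smooth_continuous[OF assms]) simp

text \<open>After division by \<delta>^n the integrals tend to \<phi>(0) times the mass of the
  Gaussian, whereas the assumed bound still tends to 0, since exp (- \<kappa> / \<delta>^2) beats
  every power of \<delta>.\<close>

lemma gaussian_concentration:
 fixes \<phi> :: "real^'n::finite => complex"
 assumes c: "continuous_on UNIV \<phi>" and supp: "\<And>x. x \<notin> cube R ==> \<phi> x = 0" and \<kappa>: "\<kappa> > 0"
  and le: "\<And>\<delta>. \<delta> > 0 ==> cmod (\<integral>x. \<phi> x * cor (gaussian (x /\<^sub>R \<delta>)) \<partial>lborel) \<le> C * exp (- \<kappa> / \<delta>\<^sup>2)"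
 shows "\<phi> 0 = 0"
proof -
 note cont' = continuous_on_compose2[OF c _ subset_UNIV] continuous_on_compose2[OF continuous_on_gaussian _ subset_UNIV]
 obtain B where B: "B > 0" "\<And>x. x \<in> cube R ==> cmod (\<phi> x) \<le> B" using cube_bounded[OF c] by blast
 then have B': "cmod (\<phi> x) \<le> B" for x using supp[of x] by (cases "x \<in> cube R") auto
 define e where "e k = 1 / real (Suc k)" for k
 have e: "e k > 0" for k by (simp add: e_def)
 have e0: "e \<longlonglongrightarrow> 0"
  unfolding e_def[abs_def] using LIMSEQ_inverse_real_of_nat[unfolded inverse_eq_divide] .
 define I where "I k = (\<integral>x. \<phi> (e k *\<^sub>R x) * cor (gaussian x) \<partial>lborel)" for k
 have L: "I \<longlonglongrightarrow> (\<integral>x. \<phi> 0 * cor (gaussian (x::real^'n)) \<partial>lborel)"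
  unfolding I_def
 proof (rule integral_dominated_convergence[where w = "\<lambda>x. B * gaussian x"])
  show "(\<lambda>x::real^'n. \<phi> 0 * cor (gaussian x)) \<in> borel_measurable lborel"
   unfolding measurable_lborel2 by (intro borel_measurable_continuous_onI continuous_intros continuous_on_gaussian)
  show "(\<lambda>x. \<phi> (e k *\<^sub>R x) * cor (gaussian x)) \<in> borel_measurable lborel" for k
   unfolding measurable_lborel2 by (intro borel_measurable_continuous_onI continuous_intros cont')
  show "integrable lborel (\<lambda>x::real^'n. B * gaussian x)" by (intro integrable_mult_right integrable_gaussian)
  show "AE x in lborel. (\<lambda>k. \<phi> (e k *\<^sub>R x) * cor (gaussian x)) \<longlonglongrightarrow> \<phi> 0 * cor (gaussian x)"
  proof (rule AE_I2)
   fix x :: "real^'n"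
   have i: "isCont \<phi> 0" using c by (simp add: continuous_on_eq_continuous_at)
   have "(\<lambda>k. e k *\<^sub>R x) \<longlonglongrightarrow> 0 *\<^sub>R x" by (intro tendsto_intros e0)
   then have "(\<lambda>k. \<phi> (e k *\<^sub>R x)) \<longlonglongrightarrow> \<phi> 0"
    using isCont_tendsto_compose[OF i, of "\<lambda>k. e k *\<^sub>R x"] by simp
   then show "(\<lambda>k. \<phi> (e k *\<^sub>R x) * cor (gaussian x)) \<longlonglongrightarrow> \<phi> 0 * cor (gaussian x)"
    by (rule tendsto_mult_right)
  qed
  show "AE x in lborel. norm (\<phi> (e k *\<^sub>R x) * cor (gaussian x)) \<le> B * gaussian x" for k
   by (rule AE_I2) (simp add: norm_mult B' mult_right_mono gaussian_pos less_imp_le)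
 qed
 have I: "cmod (I k) \<le> C * (real (Suc k) ^ CARD('n) * exp (- \<kappa> * (real (Suc k))\<^sup>2))" for k
 proof -
  have "(\<integral>x. \<phi> x * cor (gaussian (x /\<^sub>R e k)) \<partial>lborel) =
    e k ^ CARD('n) * (\<integral>x. \<phi> (0 + e k *\<^sub>R x) * cor (gaussian ((0 + e k *\<^sub>R x) /\<^sub>R e k)) \<partial>lborel)"
   using integral_affine[OF e[of k], of "\<lambda>x. \<phi> x * cor (gaussian (x /\<^sub>R e k))" 0]
   by (simp add: borel_measurable_continuous_onI continuous_intros cont' c)
  also have "(\<integral>x. \<phi> (0 + e k *\<^sub>R x) * cor (gaussian ((0 + e k *\<^sub>R x) /\<^sub>R e k)) \<partial>lborel) = I k"
   unfolding I_def using e[of k] by simp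
  finally have "e k ^ CARD('n) * cmod (I k) \<le> C * exp (- \<kappa> / (e k)\<^sup>2)"
   using le[OF e[of k]] e[of k] by (simp add: norm_mult norm_power)
  then have "cmod (I k) \<le> C * exp (- \<kappa> / (e k)\<^sup>2) / e k ^ CARD('n)"
   using e[of k] by (simp add: pos_le_divide_eq mult.commute)
  also have "\<dots> = C * (real (Suc k) ^ CARD('n) * exp (- \<kappa> * (real (Suc k))\<^sup>2))"
   by (simp add: e_def power_one_over del: of_nat_Suc)
  finally show ?thesis .
 qed
 have lim0: "((\<lambda>x::real. x ^ CARD('n) * exp (- \<kappa> * x\<^sup>2)) \<longlongrightarrow> 0) at_top"
  using \<kappa> by real_asymp
 have "(\<lambda>k. C * (real (Suc k) ^ CARD('n) * exp (- \<kappa> * (real (Suc k))\<^sup>2))) \<longlonglongrightarrow> C * 0"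
  by (rule tendsto_mult_left, rule filterlim_compose[OF lim0])
    (rule filterlim_compose[OF filterlim_real_sequentially filterlim_Suc])
 then have "I \<longlonglongrightarrow> 0"
  by (intro Lim_null_comparison[where f = I and g = "\<lambda>k. C * (real (Suc k) ^ CARD('n) * exp (- \<kappa> * (real (Suc k))\<^sup>2))"])
    (use I in \<open>auto simp del: of_nat_Suc\<close>)
 from LIMSEQ_unique[OF this L] have "\<phi> 0 * cor (\<integral>x. gaussian (x::real^'n) \<partial>lborel) = 0"
  by (simp add: integrable_gaussian integral_complex_of_real)
 moreover have "(\<integral>x. gaussian (x::real^'n) \<partial>lborel) \<noteq> 0"
  using gauss_const_pos[where 'n = 'n] unfolding gauss_const_def by auto
 ultimately show ?thesis by simp
qed

definition cutoff_grad :: "(nat => real => real) => 'n::finite => real^'n => complex" where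
 "cutoff_grad \<psi> k x = cor (\<psi> 1 (x $ k) * (\<Prod>j\<in>UNIV - {k}. \<psi> 0 (x $ j)))"

lemma cutoff_partial:
 assumes \<psi>: "is_cutoff L \<psi>"
 shows "has_partial k (\<lambda>x. cor (box_cutoff \<psi> x)) (cutoff_grad \<psi> k x) x"
  and "continuous_on UNIV (cutoff_grad \<psi> k)"
  and "x \<notin> cube (4 * L) ==> cutoff_grad \<psi> k x = 0" and "x \<in> cube (2 * L) ==> cutoff_grad \<psi> k x = 0"
proof -
 have "((\<lambda>y. cor (\<psi> 0 y)) has_vector_derivative cor (\<psi> 1 (x $ k))) (at (x $ k))"
  using is_cutoffD(1)[OF \<psi>, of 0 "x $ k"]
  by (intro bounded_linear.has_vector_derivative[OF bounded_linear_of_real]) (simp add: has_real_derivative_iff_has_vector_derivative)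
 from has_partial_prod_dir[where f = "\<lambda>_ y. cor (\<psi> 0 y)", OF this]
 show "has_partial k (\<lambda>x. cor (box_cutoff \<psi> x)) (cutoff_grad \<psi> k x) x"
  by (simp add: box_cutoff_def cutoff_grad_def)
 have c: "continuous_on UNIV (\<lambda>x::real^'a. \<psi> l (x $ j))" for l j
  by (rule continuous_on_component_fun[OF cutoff_continuous[OF \<psi>]])
 show "continuous_on UNIV (cutoff_grad \<psi> k)"
  unfolding cutoff_grad_def[abs_def] by (intro continuous_on_of_real continuous_on_mult continuous_on_prod c)
 show "cutoff_grad \<psi> k x = 0" if "x \<in> cube (2 * L)"
  using is_cutoffD(3)[OF \<psi>, of "x $ k" 0] that by (simp add: cutoff_grad_def cube_def)
 show "cutoff_grad \<psi> k x = 0" if "x \<notin> cube (4 * L)"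
 proof -
  from that obtain j where "\<not> \<bar>x $ j\<bar> \<le> 4 * L" by (auto simp: cube_def)
  then have j: "\<bar>x $ j\<bar> \<ge> 4 * L" by simp
  note z = is_cutoffD(4)[OF \<psi> j]
  show ?thesis
  proof (cases "j = k")
   case False
   then have 0: "(\<Prod>j\<in>UNIV - {k}. \<psi> 0 (x $ j)) = 0" using z by (intro prod_zero) auto
   show ?thesis unfolding cutoff_grad_def by (simp only: 0 mult_zero_right of_real_0)
  qed (use z in \<open>simp add: cutoff_grad_def\<close>)
 qed
qed

lemma integration_by_parts_cutoff:
 fixes f :: "real^'n::finite => complex"
 assumes \<psi>: "is_cutoff L \<psi>" and f: "smooth f"
 defines "\<omega> \<equiv> \<lambda>x. cor (box_cutoff \<psi> x)"
 shows "(\<integral>x. \<omega> x * gaussn eps \<beta> x * iterated_partial [k] f x \<partial>lborel) =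
  - (\<integral>x. cutoff_grad \<psi> k x * gaussn eps \<beta> x * f x \<partial>lborel) - (\<integral>x. \<omega> x * gaussn eps (bump_index k \<beta>) x * f x \<partial>lborel)"
proof -
 note cp = cutoff_partial[OF \<psi>]
 have \<omega>0: "\<omega> x = 0" if "x \<notin> cube (4 * L)" for x using box_cutoff_eq_0[OF \<psi> that] by (simp add: \<omega>_def)
 have c: "continuous_on UNIV \<omega>" unfolding \<omega>_def by (intro continuous_intros continuous_on_box_cutoff[OF \<psi>])
 have cf: "continuous_on UNIV f" using smooth_continuous[OF f, of "[]"] by simp
 let ?F' = "\<lambda>x. \<omega> x * (gaussn eps \<beta> x * iterated_partial [k] f x + gaussn eps (bump_index k \<beta>) x * f x) + cutoff_grad \<psi> k x * (gaussn eps \<beta> x * f x)"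
 \<comment> \<open>At frequency 0 this formula says that the integral of a compactly supported
   partial derivative vanishes.\<close>
 have "fourier ?F' 0 = \<i> * cor ((0::real^'n) $ k) * fourier (\<lambda>x. \<omega> x * (gaussn eps \<beta> x * f x)) 0"
 proof (rule fourier_partial[where r = "4 * L"])
  show "has_partial k (\<lambda>x. \<omega> x * (gaussn eps \<beta> x * f x)) (?F' x) x" for x
   using smooth_has_partial[OF f, of k "[]" x] cp(1)[of k x]
   by (intro has_partial_mult has_partial_gaussn) (simp_all add: \<omega>_def)
  show "continuous_on UNIV (\<lambda>x. \<omega> x * (gaussn eps \<beta> x * f x))"
   by (intro continuous_on_mult c cf continuous_on_gaussn)
  show "continuous_on UNIV ?F'"
   by (intro continuous_on_mult continuous_on_add c cf continuous_on_gaussn cp(2) smooth_continuous[OF f])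
 qed (simp_all add: \<omega>0 cp(3))
 then have 0: "integral\<^sup>L lborel ?F' = 0" by (simp add: fourier_def del: of_real_0)
 have i1: "integrable lborel (\<lambda>x. \<omega> x * gaussn eps \<beta> x * iterated_partial [k] f x)"
  by (rule integrable_compact_support[where r = "4 * L"])
    (simp_all add: \<omega>0 continuous_on_mult c continuous_on_gaussn smooth_continuous[OF f])
 have i2: "integrable lborel (\<lambda>x. \<omega> x * gaussn eps (bump_index k \<beta>) x * f x)"
  by (rule integrable_compact_support[where r = "4 * L"])
    (simp_all add: \<omega>0 continuous_on_mult c continuous_on_gaussn cf)
 have i3: "integrable lborel (\<lambda>x. cutoff_grad \<psi> k x * gaussn eps \<beta> x * f x)"
  by (rule integrable_compact_support[where r = "4 * L"])
    (simp_all add: cp(3) continuous_on_mult cp(2) continuous_on_gaussn cf)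
 have "?F' = (\<lambda>x. \<omega> x * gaussn eps \<beta> x * iterated_partial [k] f x + \<omega> x * gaussn eps (bump_index k \<beta>) x * f x + cutoff_grad \<psi> k x * gaussn eps \<beta> x * f x)"
  by (simp add: algebra_simps)
 with 0 have "(\<integral>x. \<omega> x * gaussn eps \<beta> x * iterated_partial [k] f x \<partial>lborel) + (\<integral>x. \<omega> x * gaussn eps (bump_index k \<beta>) x * f x \<partial>lborel)
   + (\<integral>x. cutoff_grad \<psi> k x * gaussn eps \<beta> x * f x \<partial>lborel) = 0"
  using i1 i2 i3 by simp
 then show ?thesis by (simp add: algebra_simps eq_neg_iff_add_eq_0)
qed

text \<open>Holmgren's method: the solution is tested against derivatives of narrow Gaussians. The commutator with
 the cutoff only sees the Gaussians far from their centre, where they are exponentially small.\<close>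

lemma local_uniqueness_at_0:
 fixes a :: "'n::finite => 'm::finite => 'm => real => complex"
 assumes T: "T > 0" and Ka: "\<And>k i j t. t \<in> {0..T} ==> cmod (a k i j t) \<le> Ka" and Kb: "\<And>i j t. t \<in> {0..T} ==> cmod (b i j t) \<le> Kb"
  and K: "K \<ge> real CARD('n) * real CARD('m) * Ka + real CARD('m) * Kb" "K > 0" "Ka \<ge> 0" "Kb \<ge> 0"
  and L: "L > 4 * real CARD('n) * K * T"
  and w: "pde_sol T a b w" and init: "\<And>i x. x \<in> cube (4 * L) ==> w i 0 x = 0" and t0: "t \<in> {0..T}"
 shows "w i t 0 = 0"
proof -
 have n: "real CARD('n) \<ge> 1" by (simp add: Suc_leI)
 have "4 * real CARD('n) * K * T > 0" using K(2) T by simp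
 then have L0: "L > 0" using L by linarith
 \<comment> \<open>Only the first derivative of the cutoff enters below; 2 is an arbitrary
   admissible order.\<close>
 define \<psi> where "\<psi> = gevrey_cutoff 2 L"
 have \<psi>: "is_cutoff L \<psi>" unfolding \<psi>_def using L0 by (intro is_cutoff_gevrey_cutoff) auto
 let ?\<omega> = "\<lambda>x::real^'n. cor (box_cutoff \<psi> x)"
 have c\<omega>: "continuous_on UNIV ?\<omega>" by (intro continuous_intros continuous_on_box_cutoff[OF \<psi>])
 note cp = cutoff_partial[OF \<psi>]
 have \<omega>0: "?\<omega> x = 0" if "x \<notin> cube (4 * L)" for x :: "real^'n" using box_cutoff_eq_0[OF \<psi> that] by simp
 have "\<exists>S>0. \<forall>k. \<forall>x\<in>cube (4 * L). cmod (?\<omega> x) \<le> S \<and> cmod (cutoff_grad \<psi> k (x::real^'n)) \<le> S"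
 proof (rule finite_family_bound)
  fix k
  obtain S0 S1 where "\<And>x. x \<in> cube (4 * L) ==> cmod (?\<omega> x) \<le> S0" "\<And>x. x \<in> cube (4 * L) ==> cmod (cutoff_grad \<psi> k (x::real^'n)) \<le> S1"
   using cube_bounded[OF c\<omega>] cube_bounded[OF cp(2)] by metis
  then show "\<exists>S. \<forall>x\<in>cube (4 * L). cmod (?\<omega> x) \<le> S \<and> cmod (cutoff_grad \<psi> k (x::real^'n)) \<le> S"
   by (intro exI[of _ "max S0 S1"]) (simp add: le_max_iff_disj)
 qed (use order_trans in blast)
 then obtain S where S: "S > 0" "\<And>x. x \<in> cube (4 * L) ==> cmod (?\<omega> x) \<le> S" "\<And>k x. x \<in> cube (4 * L) ==> cmod (cutoff_grad \<psi> k (x::real^'n)) \<le> S"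
  by blast
 have sm: "smooth (w i t)" if "t \<in> {0..T}" for i t using w that by (simp add: pde_sol_def)
 have cw: "continuous_on UNIV (w i t)" if "t \<in> {0..T}" for i t
  using smooth_continuous[OF sm[OF that], of "[]"] by simp
 have cr: "continuous_on UNIV (pde_rhs a b w i t)" if "t \<in> {0..T}" for i t
  by (intro continuous_on_pde_rhs sm that)
 have td: "tder T (w i) (pde_rhs a b w i)" for i using w by (simp add: pde_sol_def)
 have "\<exists>D>0. \<forall>i. \<forall>t\<in>{0..T}. \<forall>x\<in>cube (4 * L). cmod (w i t x) \<le> D"
 proof (rule finite_family_bound)
  show "\<exists>D. \<forall>t\<in>{0..T}. \<forall>x\<in>cube (4 * L). cmod (w i t x) \<le> D" for i
   using tder_bounded[OF td T cw cr] by metis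
 qed (use order_trans in blast)
 then obtain D0 where D0: "D0 > 0" and wD: "\<And>i t x. t \<in> {0..T} ==> x \<in> cube (4 * L) ==> cmod (w i t x) \<le> D0"
  by blast
 define V where "V = measure lborel (cube (4 * L) :: (real^'n) set) + 1"
 have V: "V > 0" "measure lborel (cube (4 * L) :: (real^'n) set) \<le> V" by (auto simp: V_def add_nonneg_pos)
 \<comment> \<open>With this radius the hypothesis on \<open>L\<close> reads K T < r: the radius of
   the majorants, which shrinks at speed K, stays positive up to time T.\<close>
 define r where "r = L / (4 * real CARD('n))"
 have r: "r > 0" "K * T < r" using L L0 n by (auto simp: r_def field_simps)
 \<comment> \<open>Gaussians are entire, so factorial bounds hold for every radius. The constant for
   this radius explodes as eps tends to 0, but the a priori bound drops out of the majorant
   argument.\<close>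
 define \<rho> where "\<rho> = 2 * K * T + 1"
 have \<rho>: "\<rho> > 0" "2 * K * T < \<rho>" using K(2) T by (auto simp: \<rho>_def add_pos_pos)
 define C where "C = V * S * D0 * r * exp (2 * K * T) / (r - K * T)"
 have main: "cmod (\<integral>x. (?\<omega> x * w i t x) * cor (gaussian (x /\<^sub>R \<delta>)) \<partial>lborel) \<le> C * exp (- (L\<^sup>2 / 2) / \<delta>\<^sup>2)" if \<delta>: "\<delta> > 0" for \<delta> i
 proof -
  define eps where "eps = \<delta>\<^sup>2"
  have eps: "eps > 0" using \<delta> by (simp add: eps_def)
  define \<Phi> where "\<Phi> \<beta> i t = (\<integral>x. (?\<omega> x * gaussn eps \<beta> x) * w i t x \<partial>lborel)" for \<beta> i t
  define \<Phi>' where "\<Phi>' \<beta> i t = (\<integral>x. (?\<omega> x * gaussn eps \<beta> x) * pde_rhs a b w i t x \<partial>lborel)" for \<beta> i t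
  define e where "e \<beta> k j t = (\<integral>x. cutoff_grad \<psi> k x * gaussn eps \<beta> x * w j t x \<partial>lborel)" for \<beta> k j t
  define \<eta> where "\<eta> = V * S * D0 * r * exp (- (L\<^sup>2) / (2 * eps))"
  have \<eta>: "\<eta> \<ge> 0" using V S D0 r by (simp add: \<eta>_def)
  define D where "D = V * S * D0 * \<rho> * exp (real CARD('n) * \<rho>\<^sup>2 / (2 * eps))"
  have D: "D \<ge> 0" using V S D0 \<rho> by (simp add: D_def)
  have int: "integrable lborel (\<lambda>x. ?\<omega> x * gaussn eps \<beta> x * f x)" if "continuous_on UNIV f" for f \<beta>
   by (rule integrable_compact_support[where r = "4 * L"])
     (simp_all only: \<omega>0 continuous_on_mult c\<omega> continuous_on_gaussn that mult_zero_left not_False_eq_True)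
  have eb: "cmod (e \<beta> k j t) \<le> \<eta> * fact (\<Sum>j\<in>UNIV. \<beta> j) / r ^ Suc (\<Sum>j\<in>UNIV. \<beta> j)" if t: "t \<in> {0..T}" for \<beta> k j t
  proof -
   let ?N = "\<Sum>j\<in>UNIV. \<beta> j"
   let ?B = "S * (fact ?N / r ^ ?N * exp (- (L\<^sup>2) / (2 * eps))) * D0"
   have B: "?B \<ge> 0" using S D0 r by simp
   have "cmod (e \<beta> k j t) \<le> ?B * measure lborel (cube (4 * L) :: (real^'n) set)"
    unfolding e_def
   proof (rule integral_bound_cube[OF _ _ B])
    fix x :: "real^'n" assume x: "x \<in> cube (4 * L)"
    show "cmod (cutoff_grad \<psi> k x * gaussn eps \<beta> x * w j t x) \<le> ?B"
    proof (cases "x \<in> cube (2 * L)")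
     case True
     then show ?thesis using B by (simp add: cp(4))
    next
     case False
     have "cmod (gaussn eps \<beta> x) \<le> fact ?N / r ^ ?N * exp (- (L\<^sup>2) / (2 * eps))"
      using gaussn_bound_far[OF eps L0 False, of \<beta>] by (simp only: r_def)
     then show ?thesis
      unfolding norm_mult using S x t r by (intro mult_mono wD S) auto
    qed
   qed (simp add: cp(3))
   also have "\<dots> \<le> ?B * V" by (intro mult_left_mono V B)
   also have "\<dots> = \<eta> * fact ?N / r ^ Suc ?N" using r by (simp add: \<eta>_def)
   finally show ?thesis .
  qed
  have "cmod (\<Phi> (\<lambda>_. 0) i t) \<le> \<eta> * exp (2 * K * T) / (r - K * T)"
  proof (rule cauchy_kovalevskaya_majorant[where \<Phi>' = \<Phi>' and \<rho> = \<rho> and D = D, OF K(2) T r(2) \<rho>(2) \<eta> D _ _ _ _ t0])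
   fix \<beta> :: "'n => nat" and i t assume t: "t \<in> {0..T}"
   show "(\<Phi> \<beta> i has_vector_derivative \<Phi>' \<beta> i t) (at t within {0..T})"
    unfolding \<Phi>_def[abs_def] \<Phi>'_def
    by (rule tder_integral[OF td t cw cr, where r = "4 * L"])
      (simp_all only: \<omega>0 continuous_on_mult c\<omega> continuous_on_gaussn mult_zero_left not_False_eq_True)
   show "cmod (\<Phi> \<beta> i t) \<le> D * fact (\<Sum>j\<in>UNIV. \<beta> j) / \<rho> ^ Suc (\<Sum>j\<in>UNIV. \<beta> j)"
   proof -
    let ?N = "\<Sum>j\<in>UNIV. \<beta> j"
    let ?B = "S * (fact ?N / \<rho> ^ ?N * exp (real CARD('n) * \<rho>\<^sup>2 / (2 * eps))) * D0"
    have B: "?B \<ge> 0" using S D0 \<rho> by simp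
    have "cmod (\<Phi> \<beta> i t) \<le> ?B * measure lborel (cube (4 * L) :: (real^'n) set)"
     unfolding \<Phi>_def
    proof (rule integral_bound_cube[OF _ _ B])
     fix x :: "real^'n" assume x: "x \<in> cube (4 * L)"
     show "cmod (?\<omega> x * gaussn eps \<beta> x * w i t x) \<le> ?B"
      unfolding norm_mult using S x t \<rho> by (intro mult_mono wD S gaussn_bound_any eps) auto
    qed (simp only: \<omega>0 mult_zero_left not_False_eq_True)
    also have "\<dots> \<le> ?B * V" by (intro mult_left_mono V B)
    also have "\<dots> = D * fact ?N / \<rho> ^ Suc ?N" using \<rho> by (simp add: D_def)
    finally show ?thesis .
   qed
   fix U0 U1
   assume U0: "\<And>j. cmod (\<Phi> \<beta> j t) \<le> U0" and U1: "\<And>k j. cmod (\<Phi> (bump_index k \<beta>) j t) \<le> U1"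
   let ?e = "\<eta> * fact (\<Sum>j\<in>UNIV. \<beta> j) / r ^ Suc (\<Sum>j\<in>UNIV. \<beta> j)"
   have nn: "U0 \<ge> 0" "U1 \<ge> 0" "?e \<ge> 0"
    using order_trans[OF norm_ge_zero U0] order_trans[OF norm_ge_zero U1] order_trans[OF norm_ge_zero eb[OF t]] by blast+
   have "\<Phi>' \<beta> i t = (\<integral>x. (\<Sum>k\<in>UNIV. \<Sum>j\<in>UNIV. a k i j t * (?\<omega> x * gaussn eps \<beta> x * iterated_partial [k] (w j t) x))
     + (\<Sum>j\<in>UNIV. b i j t * (?\<omega> x * gaussn eps \<beta> x * w j t x)) \<partial>lborel)"
    unfolding \<Phi>'_def pde_rhs_def
    by (intro Bochner_Integration.integral_cong refl) (simp add: algebra_simps sum_distrib_left)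
   also have "\<dots> = (\<Sum>k\<in>UNIV. \<Sum>j\<in>UNIV. a k i j t * (\<integral>x. ?\<omega> x * gaussn eps \<beta> x * iterated_partial [k] (w j t) x \<partial>lborel))
     + (\<Sum>j\<in>UNIV. b i j t * (\<integral>x. ?\<omega> x * gaussn eps \<beta> x * w j t x \<partial>lborel))"
    using int[OF smooth_continuous[OF sm[OF t]], of \<beta>] int[OF cw[OF t], of \<beta>] by simp
   also have "\<dots> = (\<Sum>k\<in>UNIV. \<Sum>j\<in>UNIV. a k i j t * (- e \<beta> k j t - \<Phi> (bump_index k \<beta>) j t)) + (\<Sum>j\<in>UNIV. b i j t * \<Phi> \<beta> j t)"
    by (simp only: integration_by_parts_cutoff[OF \<psi> sm[OF t]] e_def \<Phi>_def)
   also have "cmod \<dots> \<le> (\<Sum>k\<in>(UNIV::'n set). \<Sum>j\<in>(UNIV::'m set). Ka * (?e + U1)) + (\<Sum>j\<in>(UNIV::'m set). Kb * U0)"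
   proof (rule order_trans[OF norm_triangle_ineq], rule add_mono)
    have 1: "cmod (a k i j t * (- e \<beta> k j t - \<Phi> (bump_index k \<beta>) j t)) \<le> Ka * (?e + U1)" for k j
    proof -
     have "cmod (- e \<beta> k j t - \<Phi> (bump_index k \<beta>) j t) \<le> ?e + U1"
      using eb[OF t, of \<beta> k j] U1[of k j] norm_triangle_ineq4[of "- e \<beta> k j t" "\<Phi> (bump_index k \<beta>) j t"] by simp
     then show ?thesis unfolding norm_mult using K by (intro mult_mono Ka t) auto
    qed
    show "cmod (\<Sum>k\<in>UNIV. \<Sum>j\<in>UNIV. a k i j t * (- e \<beta> k j t - \<Phi> (bump_index k \<beta>) j t)) \<le> (\<Sum>k\<in>(UNIV::'n set). \<Sum>j\<in>(UNIV::'m set). Ka * (?e + U1))"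
     by (rule order_trans[OF norm_sum], rule sum_mono, rule order_trans[OF norm_sum], rule sum_mono, rule 1)
    show "cmod (\<Sum>j\<in>UNIV. b i j t * \<Phi> \<beta> j t) \<le> (\<Sum>j\<in>(UNIV::'m set). Kb * U0)"
     by (rule order_trans[OF norm_sum], rule sum_mono) (use K U0 in \<open>auto simp: norm_mult intro!: mult_mono Kb t\<close>)
   qed
   also have "\<dots> = real CARD('n) * real CARD('m) * Ka * (?e + U1) + real CARD('m) * Kb * U0" by simp
   also have "\<dots> \<le> real CARD('n) * real CARD('m) * Ka * (U1 + U0 + ?e) + real CARD('m) * Kb * (U1 + U0 + ?e)"
   proof -
    have q: "?e + U1 \<le> U1 + U0 + ?e" "U0 \<le> U1 + U0 + ?e" using nn by linarith+
    show ?thesis using K by (intro add_mono mult_left_mono q) simp_all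
   qed
   also have "\<dots> = (real CARD('n) * real CARD('m) * Ka + real CARD('m) * Kb) * (U1 + U0 + ?e)" by (simp add: distrib_right)
   also have "\<dots> \<le> K * (U1 + U0 + ?e)" using nn by (intro mult_right_mono K) auto
   finally show "cmod (\<Phi>' \<beta> i t) \<le> K * (U1 + U0 + ?e)" .
  next
   fix \<beta> :: "'n => nat" and i
   have z: "?\<omega> x * gaussn eps \<beta> x * w i 0 x = 0" for x :: "real^'n"
    using \<omega>0[of x] init[of x i] by (cases "x \<in> cube (4 * L)") auto
   show "\<Phi> \<beta> i 0 = 0" unfolding \<Phi>_def by (simp only: z integral_zero)
  qed
  moreover have "\<Phi> (\<lambda>_. 0) i t = (\<integral>x. (?\<omega> x * w i t x) * cor (gaussian (x /\<^sub>R \<delta>)) \<partial>lborel)"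
   unfolding \<Phi>_def eps_def gaussn_0 by (simp only: mult_ac)
  moreover have "\<eta> * exp (2 * K * T) / (r - K * T) = C * exp (- (L\<^sup>2 / 2) / \<delta>\<^sup>2)"
   by (simp add: \<eta>_def C_def eps_def)
  ultimately show ?thesis by simp
 qed
 have "?\<omega> 0 * w i t 0 = 0"
 proof (rule gaussian_concentration[where \<phi> = "\<lambda>x. ?\<omega> x * w i t x" and R = "4 * L" and \<kappa> = "L\<^sup>2 / 2" and C = C])
  show "continuous_on UNIV (\<lambda>x. ?\<omega> x * w i t x)" by (intro continuous_on_mult c\<omega> cw t0)
  show "?\<omega> x * w i t x = 0" if "x \<notin> cube (4 * L)" for x using \<omega>0[OF that] by simp
  show "L\<^sup>2 / 2 > 0" using L0 by simp
 qed (rule main)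
 moreover have "?\<omega> 0 = 1"
  using box_cutoff_eq_1[OF \<psi>, of "0 :: real^'n"] L0 by (simp add: cube_def)
 ultimately show ?thesis by simp
qed

section \<open>Uniqueness at arbitrary points by translation\<close>

lemma
 fixes f :: "real^'n::finite => complex"
 assumes f: "smooth f"
 shows smooth_translate: "smooth (\<lambda>x. f (x + z))"
  and iterated_partial_translate: "iterated_partial ks (\<lambda>x. f (x + z)) x = iterated_partial ks f (x + z)"
proof -
 let ?D = "\<lambda>ks x. iterated_partial ks f (x + z)"
 have 1: "has_partial k (?D ks) (?D (k # ks) x) x" for k ks x
  using smooth_has_partial[OF f, of k ks "x + z"] by (simp add: has_partial_def algebra_simps)
 have 2: "continuous_on UNIV (?D ks)" for ks
  by (rule continuous_on_compose2[OF smooth_continuous[OF f] _ subset_UNIV]) (intro continuous_intros)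
 show "smooth (\<lambda>x. f (x + z))"
  by (rule smooth_by_derivatives(1)[where D = ?D, OF _ 1 2]) simp
 show "iterated_partial ks (\<lambda>x. f (x + z)) x = ?D ks x"
  by (subst smooth_by_derivatives(2)[where D = ?D, OF _ 1 2]) simp_all
qed

lemma cube_translate: "x \<in> cube r ==> x + z \<in> cube (r + norm z)"
 unfolding cube_def mem_Collect_eq vector_add_component
 using component_le_norm_cart[of z] by (meson abs_triangle_ineq add_mono order_trans)

lemma pde_sol_translate:
 assumes "pde_sol T a b w"
 shows "pde_sol T a b (\<lambda>i t x. w i t (x + z))"
proof -
 have sm: "smooth (w i t)" if "t \<in> {0..T}" for i t using assms that by (simp add: pde_sol_def)
 have td: "tder T (w i) (pde_rhs a b w i)" for i using assms by (simp add: pde_sol_def)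
 have eq: "pde_rhs a b (\<lambda>i t x. w i t (x + z)) i t x = pde_rhs a b w i t (x + z)" if "t \<in> {0..T}" for i t x
  by (simp add: pde_rhs_def iterated_partial_translate[OF sm[OF that]])
 show ?thesis
  unfolding pde_sol_def tder_def
 proof (intro conjI allI ballI impI)
  show "smooth (\<lambda>x. w i t (x + z))" if "t \<in> {0..T}" for i t by (intro smooth_translate sm that)
  fix i t r and e :: real assume t: "t \<in> {0..T}" and e: "e > 0"
  show "\<forall>\<^sub>F \<tau> in at t within {0..T}. \<forall>x\<in>cube r.
    cmod ((w i \<tau> (x + z) - w i t (x + z)) /\<^sub>R (\<tau> - t) - pde_rhs a b (\<lambda>i t x. w i t (x + z)) i t x) \<le> e"
   using tderD[OF td t e, of "r + norm z" i] by (rule eventually_mono) (simp add: eq[OF t] cube_translate)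
 qed
qed

text \<open>Translations in x preserve the system because its coefficients depend on t only. The
  size of the cube depends only on T, the dimensions and the bounds of the coefficients, so one cube
  serves all solutions and all points.\<close>

lemma local_uniqueness:
 fixes a :: "'n::finite => 'm::finite => 'm => real => complex"
 assumes T: "T > 0" and Ka: "\<And>k i j t. t \<in> {0..T} ==> cmod (a k i j t) \<le> Ka" and Kb: "\<And>i j t. t \<in> {0..T} ==> cmod (b i j t) \<le> Kb"
 obtains R where "R > 0" "\<And>w i t z. pde_sol T a b w ==> (\<And>i x. x - z \<in> cube R ==> w i 0 x = 0) ==> t \<in> {0..T} ==> w i t z = 0"
proof -
 define Ka' Kb' where "Ka' = max Ka 0" and "Kb' = max Kb 0"
 define K where "K = real CARD('n) * real CARD('m) * Ka' + real CARD('m) * Kb' + 1"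
 define L where "L = 4 * real CARD('n) * K * T + 1"
 have "K > 0" unfolding K_def Ka'_def Kb'_def by (intro add_nonneg_pos add_nonneg_nonneg mult_nonneg_nonneg) auto
 then have "L > 0" using T by (simp add: L_def add_nonneg_pos)
 show ?thesis
 proof (rule that[of "4 * L"])
  show "4 * L > 0" using \<open>L > 0\<close> by simp
  fix w i t z assume w: "pde_sol T a b w" and i: "\<And>i x. x - z \<in> cube (4 * L) ==> w i 0 x = 0" and t: "t \<in> {0..T}"
  have "w i t (0 + z) = 0"
  proof (rule local_uniqueness_at_0[where Ka = Ka' and Kb = Kb' and K = K and L = L and w = "\<lambda>i t x. w i t (x + z)", OF T _ _ _ \<open>K > 0\<close> _ _ _ pde_sol_translate[OF w] _ t])
   show "cmod (a k i j t) \<le> Ka'" if "t \<in> {0..T}" for k i j t using Ka[OF that] by (simp add: Ka'_def le_max_iff_disj)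
   show "cmod (b i j t) \<le> Kb'" if "t \<in> {0..T}" for i j t using Kb[OF that] by (simp add: Kb'_def le_max_iff_disj)
   show "w i 0 (x + z) = 0" if "x \<in> cube (4 * L)" for i x using i[of "x + z" i] that by simp
  qed (simp_all add: K_def L_def Ka'_def Kb'_def)
  then show "w i t z = 0" by simp
 qed
qed

subsection \<open>Synthesis of solutions from Fourier modes\<close>

lemma continuous_on_interval_bounded:
 fixes f :: "real => complex"
 assumes "continuous_on {a..b} f"
 obtains B where "B \<ge> 0" "\<And>t. t \<in> {a..b} ==> cmod (f t) \<le> B"
proof -
 have "bounded (f ` {a..b})" by (intro compact_imp_bounded compact_continuous_image assms) simp
 then obtain B where "B > 0" "\<forall>x\<in>f ` {a..b}. norm x \<le> B" unfolding bounded_pos by blast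
 then show ?thesis using that[of B] by auto
qed

lemma norm_vec_le_sum: "norm (v :: complex^'m::finite) \<le> (\<Sum>i\<in>UNIV. cmod (v $ i))"
 unfolding norm_vec_def by (rule L2_set_le_sum) simp

text \<open>The synthesis of solutions for a general first order system with coefficients continuous
  in t. Hyperbolicity enters only through the growth estimate \<open>est\<close>, whose exponent p
  lies below the decay exponent q of the data.\<close>

locale fourier_system =
 fixes a :: "'n::finite => 'm::finite => 'm => real => complex" and b :: "'m => 'm => real => complex"
  and T p q :: real and M :: "'m => 'm => real => real^'n => complex"
 defines M_def: "M i j t \<xi> \<equiv> (\<Sum>k\<in>UNIV. \<i> * cor (\<xi> $ k) * a k i j t) + b i j t"
 assumes T: "T > 0" and p: "0 < p" "p < q"
  and ca: "continuous_on {0..T} (a k i j)" and cb: "continuous_on {0..T} (b i j)"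
  and est: "\<exists>C>0. \<forall>\<xi> y. (\<forall>i. \<forall>t\<in>{0..T}. (y i has_vector_derivative (\<Sum>j\<in>UNIV. M i j t \<xi> * y j t)) (at t within {0..T})) -->
    (\<forall>i. \<forall>t\<in>{0..T}. cmod (y i t) \<le> C * exp (C * (1 + norm \<xi>) powr p) * (\<Sum>j\<in>UNIV. cmod (y j 0)))"
begin

lemma q: "q > 0" using p by simp

definition coeff_bound :: real where
 "coeff_bound = (SOME K. K > 0 \<and> (\<forall>k i j. \<forall>t\<in>{0..T}. cmod (a k i j t) \<le> K \<and> cmod (b i j t) \<le> K))"

lemma coeff_bound: "coeff_bound > 0" "t \<in> {0..T} ==> cmod (a k i j t) \<le> coeff_bound" "t \<in> {0..T} ==> cmod (b i j t) \<le> coeff_bound"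
proof -
 have fin: "\<exists>K>0. \<forall>z. \<forall>t\<in>{0..T}. cmod (f z t) \<le> K" if "\<And>z. continuous_on {0..T} (f z)" for f :: "'z::finite => real => complex"
 proof (rule finite_family_bound)
  show "\<exists>K. \<forall>t\<in>{0..T}. cmod (f z t) \<le> K" for z using continuous_on_interval_bounded[OF that] by metis
 qed (use order_trans in blast)
 obtain K where K: "\<forall>z. \<forall>t\<in>{0..T}. cmod (a (fst z) (fst (snd z)) (snd (snd z)) t) \<le> K" "K > 0"
  using fin[of "\<lambda>z::'n \<times> 'm \<times> 'm. a (fst z) (fst (snd z)) (snd (snd z))", OF ca] by blast
 obtain K' where K': "\<forall>z. \<forall>t\<in>{0..T}. cmod (b (fst z) (snd z) t) \<le> K'"
  using fin[of "\<lambda>z::'m \<times> 'm. b (fst z) (snd z)", OF cb] by blast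
 have "\<exists>K. K > 0 \<and> (\<forall>k i j. \<forall>t\<in>{0..T}. cmod (a k i j t) \<le> K \<and> cmod (b i j t) \<le> K)"
  using K K' by (intro exI[of _ "max K K'"]) (auto simp: le_max_iff_disj)
 from someI_ex[OF this, folded coeff_bound_def]
 show "coeff_bound > 0" "t \<in> {0..T} ==> cmod (a k i j t) \<le> coeff_bound" "t \<in> {0..T} ==> cmod (b i j t) \<le> coeff_bound"
  by blast+
qed

definition Kc :: real where "Kc = real (CARD('n) + 1) * coeff_bound"

lemma Kc: "Kc > 0" using coeff_bound(1) by (simp add: Kc_def)

lemma sum_symbol_le:
 assumes "\<And>k. cmod (f k) \<le> B" "cmod g \<le> B"
 shows "cmod ((\<Sum>k\<in>(UNIV::'n set). \<i> * cor (\<xi> $ k) * f k) + g) \<le> real (CARD('n) + 1) * B * (1 + norm \<xi>)"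
proof -
 have B: "B \<ge> 0" using order_trans[OF norm_ge_zero assms(2)] .
 have "cmod (\<i> * cor (\<xi> $ k) * f k) \<le> (1 + norm \<xi>) * B" for k
  unfolding norm_mult using component_le_norm_cart[of \<xi> k] by (intro mult_mono assms) auto
 then have "cmod (\<Sum>k\<in>(UNIV::'n set). \<i> * cor (\<xi> $ k) * f k) \<le> (\<Sum>k\<in>(UNIV::'n set). (1 + norm \<xi>) * B)"
  by (intro order_trans[OF norm_sum sum_mono])
 moreover have "cmod g \<le> (1 + norm \<xi>) * B"
  using assms(2) mult_right_mono[of 1 "1 + norm \<xi>" B] B by simp
 ultimately have "cmod ((\<Sum>k\<in>(UNIV::'n set). \<i> * cor (\<xi> $ k) * f k) + g) \<le> (\<Sum>k\<in>(UNIV::'n set). (1 + norm \<xi>) * B) + (1 + norm \<xi>) * B"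
  by (intro norm_triangle_le add_mono)
 then show ?thesis by (simp add: algebra_simps)
qed

lemma M_bound: "t \<in> {0..T} ==> cmod (M i j t \<xi>) \<le> Kc * (1 + norm \<xi>)"
 unfolding M_def Kc_def by (intro sum_symbol_le coeff_bound)

lemma M_diff: "t \<in> {0..T} ==> cmod (M i j t \<xi> - M i j t \<eta>) \<le> Kc * norm (\<xi> - \<eta>)"
proof -
 assume t: "t \<in> {0..T}"
 have "M i j t \<xi> - M i j t \<eta> = (\<Sum>k\<in>UNIV. \<i> * cor ((\<xi> - \<eta>) $ k) * a k i j t)"
  unfolding M_def by (simp add: algebra_simps sum_subtractf)
 also have "cmod \<dots> \<le> (\<Sum>k\<in>(UNIV::'n set). norm (\<xi> - \<eta>) * coeff_bound)"
 proof (intro order_trans[OF norm_sum sum_mono])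
  show "cmod (\<i> * cor ((\<xi> - \<eta>) $ k) * a k i j t) \<le> norm (\<xi> - \<eta>) * coeff_bound" for k
   unfolding norm_mult norm_ii norm_of_real mult_1
   by (intro mult_mono component_le_norm_cart coeff_bound(2)[OF t]) auto
 qed
 also have "\<dots> \<le> Kc * norm (\<xi> - \<eta>)"
  using coeff_bound(1) by (simp add: Kc_def algebra_simps)
 finally show "cmod (M i j t \<xi> - M i j t \<eta>) \<le> Kc * norm (\<xi> - \<eta>)" .
qed

text \<open>Frequency enters \<open>M\<close> only through the factors \<xi>_k, so continuity of the
  coefficients gives one \<delta> for all \<xi> once the error is weighted by 1 + |\<xi>|.\<close>

lemma M_time:
 assumes t: "t \<in> {0..T}" and e: "e > 0"
 shows "\<exists>\<delta>>0. \<forall>\<sigma>\<in>{0..T}. \<bar>\<sigma> - t\<bar> < \<delta> --> (\<forall>i j \<xi>. cmod (M i j \<sigma> \<xi> - M i j t \<xi>) \<le> e * (1 + norm \<xi>))"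
proof -
 define e' where "e' = e / real (CARD('n) + 1)"
 have e': "e' > 0" using e by (simp add: e'_def)
 have ev: "\<forall>\<^sub>F \<sigma> in at t within {0..T}. cmod (f \<sigma> - f t) < e'" if "continuous_on {0..T} f" for f :: "real => complex"
 proof -
  have "(f \<longlongrightarrow> f t) (at t within {0..T})" using that t by (simp add: continuous_on_def)
  from tendstoD[OF this e'] show ?thesis by (simp add: dist_norm)
 qed
 have "\<forall>\<^sub>F \<sigma> in at t within {0..T}. (\<forall>k i j. cmod (a k i j \<sigma> - a k i j t) < e') \<and> (\<forall>i j. cmod (b i j \<sigma> - b i j t) < e')"
  by (intro eventually_conj eventually_all_finite ev ca cb)
 then obtain \<delta> where \<delta>: "\<delta> > 0" "\<And>\<sigma>. \<sigma> \<in> {0..T} ==> \<sigma> \<noteq> t ==> dist \<sigma> t < \<delta> ==>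
   (\<forall>k i j. cmod (a k i j \<sigma> - a k i j t) < e') \<and> (\<forall>i j. cmod (b i j \<sigma> - b i j t) < e')"
  unfolding eventually_at by blast
 show ?thesis
 proof (rule exI[of _ \<delta>], intro conjI ballI impI allI \<delta>(1))
  fix \<sigma> i j and \<xi> :: "real^'n" assume \<sigma>: "\<sigma> \<in> {0..T}" "\<bar>\<sigma> - t\<bar> < \<delta>"
  show "cmod (M i j \<sigma> \<xi> - M i j t \<xi>) \<le> e * (1 + norm \<xi>)"
  proof (cases "\<sigma> = t")
   case True
   then show ?thesis using e by simp
  next
   case False
   note d = \<delta>(2)[OF \<sigma>(1) False]
   have "M i j \<sigma> \<xi> - M i j t \<xi> = (\<Sum>k\<in>UNIV. \<i> * cor (\<xi> $ k) * (a k i j \<sigma> - a k i j t)) + (b i j \<sigma> - b i j t)"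
    unfolding M_def by (simp add: algebra_simps sum_subtractf)
   also have "cmod \<dots> \<le> real (CARD('n) + 1) * e' * (1 + norm \<xi>)"
    using d \<sigma>(2) by (intro sum_symbol_le) (auto simp: dist_real_def less_imp_le)
   finally show ?thesis by (simp add: e'_def)
  qed
 qed
qed

definition flow :: "('m => real^'n => complex) => ('m => real => real^'n => complex) => bool" where
 "flow h y \<longleftrightarrow> (\<forall>i \<xi>. y i 0 \<xi> = h i \<xi>) \<and> (\<forall>i \<xi>. \<forall>t\<in>{0..T}.
   ((\<lambda>t. y i t \<xi>) has_vector_derivative (\<Sum>j\<in>UNIV. M i j t \<xi> * y j t \<xi>)) (at t within {0..T}))"

lemma flowD: "flow h y ==> y i 0 \<xi> = h i \<xi>" "flow h y ==> t \<in> {0..T} ==>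
   ((\<lambda>t. y i t \<xi>) has_vector_derivative (\<Sum>j\<in>UNIV. M i j t \<xi> * y j t \<xi>)) (at t within {0..T})"
 unfolding flow_def by blast+

lemma continuous_on_M_time: "continuous_on {0..T} (\<lambda>t. M i j t \<xi>)"
 unfolding M_def by (intro continuous_intros ca cb)

lemma flow_exists: "\<exists>y. flow h y"
proof -
 have "\<exists>y. (\<forall>i. y i 0 = h i \<xi>) \<and> (\<forall>i. \<forall>t\<in>{0..T}. (y i has_vector_derivative (\<Sum>j\<in>UNIV. M i j t \<xi> * y j t)) (at t within {0..T}))" for \<xi>
 proof -
  define F where "F t v = (\<chi> i. \<Sum>j\<in>UNIV. M i j t \<xi> * v $ j)" for t and v :: "complex^'m"
  define K where "K = real CARD('m) * (real CARD('m) * (Kc * (1 + norm \<xi>)))"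
  have K: "K > 0" using Kc by (simp add: K_def add_pos_nonneg)
  obtain v where v: "v 0 = (\<chi> i. h i \<xi>)" "\<And>t. t \<in> {0..T} ==> (v has_vector_derivative F t (v t)) (at t within {0..T})"
  proof (rule ode_lipschitz_exists[of T K F, OF T K])
   show "continuous_on {0..T} (\<lambda>t. F t (y t))" if "continuous_on {0..T} y" for y
    unfolding F_def by (intro continuous_on_vec_lambda continuous_intros continuous_on_M_time that)
   fix t and x y :: "complex^'m" assume t: "t \<in> {0..T}"
   have "norm (F t x - F t y) \<le> (\<Sum>i\<in>UNIV. cmod ((F t x - F t y) $ i))" by (rule norm_vec_le_sum)
   also have "\<dots> \<le> (\<Sum>i\<in>(UNIV::'m set). real CARD('m) * (Kc * (1 + norm \<xi>) * norm (x - y)))"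
   proof (rule sum_mono)
    fix i
    have "(F t x - F t y) $ i = (\<Sum>j\<in>UNIV. M i j t \<xi> * (x - y) $ j)"
     by (simp add: F_def algebra_simps sum_subtractf)
    also have "cmod \<dots> \<le> (\<Sum>j\<in>(UNIV::'m set). Kc * (1 + norm \<xi>) * norm (x - y))"
     by (intro order_trans[OF norm_sum sum_mono])
       (simp only: norm_mult, intro mult_mono M_bound[OF t] Finite_Cartesian_Product.norm_nth_le, use Kc in auto)
    finally show "cmod ((F t x - F t y) $ i) \<le> real CARD('m) * (Kc * (1 + norm \<xi>) * norm (x - y))" by simp
   qed
   finally show "norm (F t x - F t y) \<le> K * norm (x - y)" by (simp add: K_def mult_ac)
  qed blast
  show ?thesis
  proof (rule exI[of _ "\<lambda>i t. v t $ i"], intro conjI allI ballI)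
   show "v 0 $ i = h i \<xi>" for i by (simp add: v(1))
   fix i t assume t: "t \<in> {0..T}"
   have "((\<lambda>t. v t $ i) has_vector_derivative F t (v t) $ i) (at t within {0..T})"
    by (rule bounded_linear.has_vector_derivative[OF bounded_linear_vec_nth v(2)[OF t]])
   then show "((\<lambda>t. v t $ i) has_vector_derivative (\<Sum>j\<in>UNIV. M i j t \<xi> * v t $ j)) (at t within {0..T})"
    by (simp add: F_def)
  qed
 qed
 then obtain Y where Y: "\<And>\<xi> i. Y \<xi> i 0 = h i \<xi>"
  "\<And>\<xi> i t. t \<in> {0..T} ==> (Y \<xi> i has_vector_derivative (\<Sum>j\<in>UNIV. M i j t \<xi> * Y \<xi> j t)) (at t within {0..T})"
  by metis
 show ?thesis
  by (rule exI[of _ "\<lambda>i t \<xi>. Y \<xi> i t"]) (simp add: flow_def Y)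
qed

text \<open>The equations for different frequencies are uncoupled, so any multiplier in \<xi>
  commutes with the flow. With \<open>freq ks\<close> as the multiplier this transports space
  derivatives from the data to the solution.\<close>

lemma flow_mult: "flow h y ==> flow (\<lambda>i \<xi>. f \<xi> * h i \<xi>) (\<lambda>i t \<xi>. f \<xi> * y i t \<xi>)"
 unfolding flow_def
proof (intro conjI allI ballI)
 fix i \<xi> t
 assume f: "(\<forall>i \<xi>. y i 0 \<xi> = h i \<xi>) \<and> (\<forall>i \<xi>. \<forall>t\<in>{0..T}.
   ((\<lambda>t. y i t \<xi>) has_vector_derivative (\<Sum>j\<in>UNIV. M i j t \<xi> * y j t \<xi>)) (at t within {0..T}))"
 then show "f \<xi> * y i 0 \<xi> = f \<xi> * h i \<xi>" by simp
 assume t: "t \<in> {0..T}"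
 have "((\<lambda>t. f \<xi> * y i t \<xi>) has_vector_derivative f \<xi> * (\<Sum>j\<in>UNIV. M i j t \<xi> * y j t \<xi>)) (at t within {0..T})"
  using f t by (intro has_vector_derivative_mult_right) blast
 then show "((\<lambda>t. f \<xi> * y i t \<xi>) has_vector_derivative (\<Sum>j\<in>UNIV. M i j t \<xi> * (f \<xi> * y j t \<xi>))) (at t within {0..T})"
  by (simp add: sum_distrib_left mult_ac)
qed

lemma flow_growth:
 "\<exists>C>0. \<forall>h y i t \<xi>. flow h y --> t \<in> {0..T} --> cmod (y i t \<xi>) \<le> C * exp (C * (1 + norm \<xi>) powr p) * (\<Sum>j\<in>UNIV. cmod (h j \<xi>))"
proof -
 obtain C where C: "C > 0" "\<And>\<xi> y i t. (\<And>i t. t \<in> {0..T} ==> (y i has_vector_derivative (\<Sum>j\<in>UNIV. M i j t \<xi> * y j t)) (at t within {0..T})) ==>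
    t \<in> {0..T} ==> cmod (y i t) \<le> C * exp (C * (1 + norm \<xi>) powr p) * (\<Sum>j\<in>UNIV. cmod (y j 0))"
  using est by blast
 have "cmod (y i t \<xi>) \<le> C * exp (C * (1 + norm \<xi>) powr p) * (\<Sum>j\<in>UNIV. cmod (h j \<xi>))" if f: "flow h y" and t: "t \<in> {0..T}" for h y i t \<xi>
  using C(2)[of "\<lambda>i t. y i t \<xi>", OF flowD(2)[OF f] t] flowD(1)[OF f] by simp
 then show ?thesis using C(1) by blast
qed

text \<open>Existence was obtained separately for each frequency. Continuity in \<xi>, which the
  inverse Fourier integrals require, follows from a Gronwall estimate for the difference of two
  modes.\<close>

lemma flow_continuous:
 assumes f: "flow h y" and h: "\<And>i. continuous_on UNIV (h i)" and t: "t \<in> {0..T}"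
 shows "continuous_on UNIV (y i t)"
proof (rule continuous_at_imp_continuous_on, rule ballI)
 fix \<xi>0 :: "real^'n"
 have "\<exists>Y>0. \<forall>j. \<forall>t\<in>{0..T}. cmod (y j t \<xi>0) \<le> Y"
 proof (rule finite_family_bound)
  fix j
  have "continuous_on {0..T} (\<lambda>t. y j t \<xi>0)"
   using has_vector_derivative_continuous[OF flowD(2)[OF f]] by (simp add: continuous_on_eq_continuous_within)
  then show "\<exists>Y. \<forall>t\<in>{0..T}. cmod (y j t \<xi>0) \<le> Y" using continuous_on_interval_bounded by metis
 qed (use order_trans in blast)
 then obtain Y where Y: "Y > 0" "\<And>j t. t \<in> {0..T} ==> cmod (y j t \<xi>0) \<le> Y" by blast
 define \<kappa> where "\<kappa> = Kc * (2 + norm \<xi>0) + real CARD('m) * Kc * Y"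
 have \<kappa>: "\<kappa> \<ge> 0" using Kc Y by (simp add: \<kappa>_def)
 define N where "N = real (card (UNIV :: 'm option set))"
 define E where "E \<xi> = ((\<Sum>j\<in>UNIV. (cmod (h j \<xi> - h j \<xi>0))\<^sup>2) + (norm (\<xi> - \<xi>0))\<^sup>2) * exp (2 * \<kappa> * N * T)" for \<xi>
 have main: "(cmod (y i t \<xi> - y i t \<xi>0))\<^sup>2 \<le> E \<xi>" if \<xi>: "norm (\<xi> - \<xi>0) \<le> 1" for \<xi>
 proof -
  \<comment> \<open>The additional constant component |\<xi> - \<xi>0| turns the inhomogeneity
    caused by the change of \<open>M\<close> into a linear term, so that the homogeneous Gronwall
    estimate applies, with rotation speed 0.\<close>
  define v where "v z t = (case z of Some i => y i t \<xi> - y i t \<xi>0 | None => cor (norm (\<xi> - \<xi>0)))" for z t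
  define g where "g z t = (case z of Some i => (\<Sum>j\<in>UNIV. M i j t \<xi> * y j t \<xi>) - (\<Sum>j\<in>UNIV. M i j t \<xi>0 * y j t \<xi>0) | None => 0)" for z t
  have sO: "(\<Sum>z\<in>UNIV. F z) = F None + (\<Sum>i\<in>UNIV. F (Some i))" for F :: "'m option => real"
   unfolding UNIV_option_conv by (simp add: sum.reindex)
  have "(\<Sum>z\<in>UNIV. (cmod (v z t))\<^sup>2) \<le> (\<Sum>z\<in>UNIV. (cmod (v z 0))\<^sup>2) * exp (2 * \<kappa> * real (card (UNIV::'m option set)) * t)"
  proof (rule gronwall_skew[where \<theta> = "\<lambda>_ _. 0" and h = g])
   fix z t assume t: "t \<in> {0..T}"
   show "(v z has_vector_derivative \<i> * cor 0 * v z t + g z t) (at t within {0..T})"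
   proof (cases z)
    case None
    then show ?thesis by (simp add: v_def[abs_def] g_def)
   next
    case (Some i)
    then show ?thesis
     using has_vector_derivative_diff[OF flowD(2)[OF f t] flowD(2)[OF f t], of i \<xi> i \<xi>0] by (simp add: v_def[abs_def] g_def)
   qed
   show "cmod (g z t) \<le> \<kappa> * (\<Sum>b\<in>UNIV. cmod (v b t))"
   proof (cases z)
    case None
    then show ?thesis using \<kappa> by (simp add: g_def sum_nonneg)
   next
    case (Some i)
    let ?S = "\<Sum>j\<in>UNIV. cmod (y j t \<xi> - y j t \<xi>0)"
    have "norm \<xi> \<le> norm (\<xi> - \<xi>0) + norm \<xi>0" using norm_triangle_ineq[of "\<xi> - \<xi>0" \<xi>0] by simp
    then have n: "1 + norm \<xi> \<le> 2 + norm \<xi>0" using \<xi> by linarith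
    have "g z t = (\<Sum>j\<in>UNIV. M i j t \<xi> * (y j t \<xi> - y j t \<xi>0)) + (\<Sum>j\<in>UNIV. (M i j t \<xi> - M i j t \<xi>0) * y j t \<xi>0)"
     by (simp add: g_def Some algebra_simps sum_subtractf)
    also have "cmod \<dots> \<le> (\<Sum>j\<in>UNIV. Kc * (2 + norm \<xi>0) * cmod (y j t \<xi> - y j t \<xi>0)) + (\<Sum>j\<in>(UNIV::'m set). Kc * norm (\<xi> - \<xi>0) * Y)"
    proof (rule norm_triangle_le, rule add_mono)
     have "cmod (M i j t \<xi>) \<le> Kc * (2 + norm \<xi>0)" for j
      using M_bound[OF t, of i j \<xi>] mult_left_mono[OF n, of Kc] Kc by linarith
     then show "cmod (\<Sum>j\<in>UNIV. M i j t \<xi> * (y j t \<xi> - y j t \<xi>0)) \<le> (\<Sum>j\<in>UNIV. Kc * (2 + norm \<xi>0) * cmod (y j t \<xi> - y j t \<xi>0))"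
      by (intro order_trans[OF norm_sum sum_mono]) (auto simp: norm_mult mult_right_mono)
     show "cmod (\<Sum>j\<in>UNIV. (M i j t \<xi> - M i j t \<xi>0) * y j t \<xi>0) \<le> (\<Sum>j\<in>(UNIV::'m set). Kc * norm (\<xi> - \<xi>0) * Y)"
      by (intro order_trans[OF norm_sum sum_mono])
        (use Kc in \<open>simp only: norm_mult, intro mult_mono M_diff[OF t] Y(2)[OF t], auto\<close>)
    qed
    also have "\<dots> = Kc * (2 + norm \<xi>0) * ?S + real CARD('m) * Kc * Y * norm (\<xi> - \<xi>0)"
     by (simp add: sum_distrib_left)
    also have "\<dots> \<le> \<kappa> * ?S + \<kappa> * norm (\<xi> - \<xi>0)"
     unfolding \<kappa>_def using Kc Y by (intro add_mono mult_right_mono) (auto intro: sum_nonneg)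
    also have "\<dots> = \<kappa> * (\<Sum>b\<in>UNIV. cmod (v b t))" by (simp add: sO v_def algebra_simps)
    finally show ?thesis .
   qed
  qed (use \<kappa> t in auto)
  then have "(\<Sum>z\<in>UNIV. (cmod (v z t))\<^sup>2) \<le> (\<Sum>z\<in>UNIV. (cmod (v z 0))\<^sup>2) * exp (2 * \<kappa> * N * t)" by (simp add: N_def)
  also have "\<dots> \<le> (\<Sum>z\<in>UNIV. (cmod (v z 0))\<^sup>2) * exp (2 * \<kappa> * N * T)"
   using t \<kappa> by (intro mult_left_mono sum_nonneg) (auto simp: N_def intro!: mult_left_mono)
  also have "(\<Sum>z\<in>UNIV. (cmod (v z 0))\<^sup>2) = (\<Sum>j\<in>UNIV. (cmod (h j \<xi> - h j \<xi>0))\<^sup>2) + (norm (\<xi> - \<xi>0))\<^sup>2"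
   by (simp add: sO v_def flowD(1)[OF f])
  finally have "(\<Sum>z\<in>UNIV. (cmod (v z t))\<^sup>2) \<le> E \<xi>" by (simp add: E_def)
  moreover have "(cmod (v (Some i) t))\<^sup>2 \<le> (\<Sum>z\<in>UNIV. (cmod (v z t))\<^sup>2)" by (rule member_le_sum) auto
  ultimately show ?thesis by (simp add: v_def)
 qed
 have hc: "(h j \<longlongrightarrow> h j \<xi>0) (at \<xi>0)" for j using h[of j] by (simp add: continuous_on_def)
 have "(E \<longlongrightarrow> ((\<Sum>j\<in>UNIV. (cmod (h j \<xi>0 - h j \<xi>0))\<^sup>2) + (norm (\<xi>0 - \<xi>0))\<^sup>2) * exp (2 * \<kappa> * N * T)) (at \<xi>0)"
  unfolding E_def by (intro tendsto_intros hc)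
 then have E0: "(E \<longlongrightarrow> 0) (at \<xi>0)" by simp
 have "((\<lambda>\<xi>. (cmod (y i t \<xi> - y i t \<xi>0))\<^sup>2) \<longlongrightarrow> 0) (at \<xi>0)"
 proof (rule Lim_null_comparison[OF _ E0])
  have "\<forall>\<^sub>F \<xi> in at \<xi>0. norm (\<xi> - \<xi>0) \<le> 1"
   unfolding eventually_at by (rule exI[of _ 1]) (auto simp: dist_norm)
  then show "\<forall>\<^sub>F \<xi> in at \<xi>0. norm ((cmod (y i t \<xi> - y i t \<xi>0))\<^sup>2) \<le> E \<xi>"
   by (rule eventually_mono) (simp add: main)
 qed
 from tendsto_real_sqrt[OF this] have "((\<lambda>\<xi>. cmod (y i t \<xi> - y i t \<xi>0)) \<longlongrightarrow> 0) (at \<xi>0)" by simp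
 then show "isCont (y i t) \<xi>0"
  unfolding isCont_def by (rule LIM_zero_cancel[OF tendsto_norm_zero_cancel])
qed

end

section \<open>Bounds for the synthesised solutions, linear in the data\<close>

definition decay_mass :: "'n::finite itself => real => real => real" where
 "decay_mass _ c q = (\<integral>\<xi>. decay c q (\<xi> :: real^'n) \<partial>lborel)"

lemma decay_mass_nonneg: "decay_mass TYPE('n::finite) c q \<ge> 0"
 unfolding decay_mass_def by (intro integral_nonneg_AE AE_I2 less_imp_le decay_pos)

lemma inv_fourier_bound:
 fixes f :: "real^'n::finite => complex"
 assumes "q > 0" "c > 0" "continuous_on UNIV f" "\<And>\<xi>. cmod (f \<xi>) \<le> D * decay c q \<xi>"
 shows "cmod (inv_fourier f x) \<le> D * decay_mass TYPE('n) c q"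
proof -
 have i: "integrable lborel (\<lambda>\<xi>::real^'n. D * decay c q \<xi>)"
  using integrable_power_decay[OF assms(1,2), of 0] by (intro integrable_mult_right) simp
 have "cmod (inv_fourier f x) \<le> (\<integral>\<xi>. D * decay c q (\<xi> :: real^'n) \<partial>lborel)"
  unfolding inv_fourier_def
 proof (rule Bochner_Integration.integral_norm_bound_integral[OF _ i])
  show "integrable lborel (\<lambda>\<xi>. cis (x \<bullet> \<xi>) * f \<xi>)"
   using integrable_cis_mult[OF integrable_by_decay(2)[OF assms], of 1 x] by (simp add: inner_commute)
  show "cmod (cis (x \<bullet> \<xi>) * f \<xi>) \<le> D * decay c q \<xi>" for \<xi> using assms(4)[of \<xi>] by (simp add: norm_mult)
 qed
 then show ?thesis by (simp add: decay_mass_def)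
qed

lemma inv_fourier_lincomb:
 fixes f g :: "real^'n::finite => complex"
 assumes "integrable lborel f" "integrable lborel g"
 shows "inv_fourier (\<lambda>\<xi>. \<alpha> * f \<xi> + \<beta> * g \<xi>) x = \<alpha> * inv_fourier f x + \<beta> * inv_fourier g x"
proof -
 have i: "integrable lborel (\<lambda>\<xi>. cis (x \<bullet> \<xi>) * h \<xi>)" if "integrable lborel h" for h :: "real^'n => complex"
  using integrable_cis_mult[OF that, of 1 x] by (simp add: inner_commute)
 have "(\<lambda>\<xi>. cis (x \<bullet> \<xi>) * (\<alpha> * f \<xi> + \<beta> * g \<xi>)) = (\<lambda>\<xi>. \<alpha> * (cis (x \<bullet> \<xi>) * f \<xi>) + \<beta> * (cis (x \<bullet> \<xi>) * g \<xi>))"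
  by (simp add: algebra_simps)
 then show ?thesis unfolding inv_fourier_def using i[OF assms(1)] i[OF assms(2)] by simp
qed

lemma inv_fourier_cmult: "inv_fourier (\<lambda>\<xi>. c * f \<xi>) x = c * inv_fourier f x"
proof -
 have "(\<lambda>\<xi>. cis (x \<bullet> \<xi>) * (c * f \<xi>)) = (\<lambda>\<xi>. c * (cis (x \<bullet> \<xi>) * f \<xi>))" by (simp add: mult_ac)
 then show ?thesis by (simp add: inv_fourier_def)
qed

lemma inv_fourier_sum:
 fixes f :: "'i => real^'n::finite => complex"
 assumes "finite I" "\<And>i. i \<in> I ==> integrable lborel (f i)"
 shows "inv_fourier (\<lambda>\<xi>. \<Sum>i\<in>I. f i \<xi>) x = (\<Sum>i\<in>I. inv_fourier (f i) x)"
proof -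
 have i: "integrable lborel (\<lambda>\<xi>. cis (x \<bullet> \<xi>) * f i \<xi>)" if "i \<in> I" for i
  using integrable_cis_mult[OF assms(2)[OF that], of 1 x] by (simp add: inner_commute)
 show ?thesis unfolding inv_fourier_def by (simp add: sum_distrib_left i)
qed

context fourier_system
begin

definition decays :: "('m => real^'n => complex) => real => real => bool" where
 "decays h D c \<longleftrightarrow> (\<forall>i. continuous_on UNIV (h i)) \<and> (\<forall>i \<xi>. cmod (h i \<xi>) \<le> D * decay c q \<xi>)"

lemma decaysD: "decays h D c ==> continuous_on UNIV (h i)" "decays h D c ==> cmod (h i \<xi>) \<le> D * decay c q \<xi>"
 unfolding decays_def by blast+

lemma decays_nonneg: "decays h D c ==> D \<ge> 0"
proof -
 assume d: "decays h D c"
 have "0 \<le> D * decay c q (0::real^'n)" using order_trans[OF norm_ge_zero decaysD(2)[OF d]] .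
 then show "D \<ge> 0" using decay_pos[of c q "0::real^'n"] by (simp add: zero_le_mult_iff)
qed

definition dflow :: "('m => real => real^'n => complex) => 'm => real => real^'n => complex" where
 "dflow y i t \<xi> = (\<Sum>j\<in>UNIV. M i j t \<xi> * y j t \<xi>)"

lemma poly1_decay:
 assumes c: "c > 0"
 obtains B where "B > 0" "\<And>\<xi>::real^'n. (1 + norm \<xi>) * decay c q \<xi> \<le> B * decay (c / 2) q \<xi>"
 using power_decay[OF q c, of 1] by auto

text \<open>Half of the decay rate absorbs the growth of the modes, and half of what is left absorbs
  the factor 1 + |\<xi>| of the time derivative. The constant depends on the rate c but not on the
  data or on \<open>D\<close>.\<close>

lemma decay_const_exists:
 assumes c: "c > 0"
 shows "\<exists>C>0. \<forall>h D y i t \<xi>. decays h D c --> flow h y --> t \<in> {0..T} -->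
  cmod (y i t \<xi>) \<le> D * C * decay (c / 2) q \<xi> \<and> cmod (dflow y i t \<xi>) \<le> D * C * decay (c / 4) q \<xi>"
proof -
 obtain C where C: "C > 0" "\<And>h y i t \<xi>. flow h y ==> t \<in> {0..T} ==> cmod (y i t \<xi>) \<le> C * exp (C * (1 + norm \<xi>) powr p) * (\<Sum>j\<in>UNIV. cmod (h j \<xi>))"
  using flow_growth by blast
 obtain B where B: "B > 0" "\<And>\<xi>::real^'n. exp (C * (1 + norm \<xi>) powr p) * decay c q \<xi> \<le> B * decay (c / 2) q \<xi>"
  using exp_growth_decay[OF p c less_imp_le[OF C(1)]] by blast
 obtain B' where B': "B' > 0" "\<And>\<xi>::real^'n. (1 + norm \<xi>) * decay (c / 2) q \<xi> \<le> B' * decay (c / 2 / 2) q \<xi>"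
  using poly1_decay[of "c / 2"] c by auto
 define C1 where "C1 = C * real CARD('m) * B"
 define C2 where "C2 = real CARD('m) * Kc * C1 * B'"
 have pos: "C1 > 0" "C2 > 0" using C(1) B(1) B'(1) Kc by (auto simp: C1_def C2_def)
 have "cmod (y i t \<xi>) \<le> D * max C1 C2 * decay (c / 2) q \<xi> \<and> cmod (dflow y i t \<xi>) \<le> D * max C1 C2 * decay (c / 4) q \<xi>"
  if d: "decays h D c" and f: "flow h y" and t: "t \<in> {0..T}" for h D y i t \<xi>
 proof -
  note D0 = decays_nonneg[OF d]
  have 1: "cmod (y i t \<xi>) \<le> D * C1 * decay (c / 2) q \<xi>" for i
  proof -
   have "cmod (y i t \<xi>) \<le> C * exp (C * (1 + norm \<xi>) powr p) * (\<Sum>j\<in>UNIV. cmod (h j \<xi>))" by (rule C(2)[OF f t])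
   also have "\<dots> \<le> C * exp (C * (1 + norm \<xi>) powr p) * (\<Sum>j\<in>(UNIV::'m set). D * decay c q \<xi>)"
    using C(1) by (intro mult_left_mono sum_mono decaysD(2)[OF d]) auto
   also have "\<dots> = D * C * real CARD('m) * (exp (C * (1 + norm \<xi>) powr p) * decay c q \<xi>)" by simp
   also have "\<dots> \<le> D * C * real CARD('m) * (B * decay (c / 2) q \<xi>)"
    using C(1) D0 by (intro mult_left_mono B) auto
   finally show ?thesis by (simp add: C1_def mult_ac)
  qed
  have "cmod (dflow y i t \<xi>) \<le> (\<Sum>j\<in>(UNIV::'m set). Kc * (1 + norm \<xi>) * (D * C1 * decay (c / 2) q \<xi>))"
   unfolding dflow_def
   by (rule order_trans[OF norm_sum sum_mono], unfold norm_mult, intro mult_mono M_bound t 1)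
     (use Kc in auto)
  also have "\<dots> = (real CARD('m) * Kc * D * C1) * ((1 + norm \<xi>) * decay (c / 2) q \<xi>)" by simp
  also have "\<dots> \<le> (real CARD('m) * Kc * D * C1) * (B' * decay (c / 2 / 2) q \<xi>)"
   using pos Kc D0 by (intro mult_left_mono B') auto
  finally have 2: "cmod (dflow y i t \<xi>) \<le> D * C2 * decay (c / 4) q \<xi>" by (simp add: C2_def mult_ac)
  have "D * C1 * z \<le> D * max C1 C2 * z" "D * C2 * z \<le> D * max C1 C2 * z" if "z > 0" for z
   using D0 that by (auto intro!: mult_right_mono mult_left_mono)
  with 1[of i] 2 show ?thesis by (meson decay_pos order_trans)
 qed
 moreover have "max C1 C2 > 0" using pos by simp
 ultimately show ?thesis by blast
qed

definition decay_const :: "real => real" where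
 "decay_const c = (SOME C. C > 0 \<and> (\<forall>h D y i t \<xi>. decays h D c --> flow h y --> t \<in> {0..T} -->
  cmod (y i t \<xi>) \<le> D * C * decay (c / 2) q \<xi> \<and> cmod (dflow y i t \<xi>) \<le> D * C * decay (c / 4) q \<xi>))"

lemma decay_const:
 assumes "c > 0"
 shows "decay_const c > 0"
  and "decays h D c ==> flow h y ==> t \<in> {0..T} ==> cmod (y i t \<xi>) \<le> D * decay_const c * decay (c / 2) q \<xi>"
  and "decays h D c ==> flow h y ==> t \<in> {0..T} ==> cmod (dflow y i t \<xi>) \<le> D * decay_const c * decay (c / 4) q \<xi>"
 using someI_ex[OF decay_const_exists[OF assms], folded decay_const_def] by blast+

lemma dflow_continuous:
 assumes "decays h D c" "flow h y" "t \<in> {0..T}"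
 shows "continuous_on UNIV (dflow y i t)"
 unfolding dflow_def[abs_def] M_def
 by (intro continuous_intros flow_continuous[OF assms(2) decaysD(1)[OF assms(1)] assms(3)])

text \<open>The mean value inequality with a reference slope z: z = 0 gives Lipschitz continuity in
  time, and z = \<open>dflow\<close> at time s gives the error of the difference quotient.\<close>

lemma flow_lipschitz:
 assumes f: "flow h y" and t: "s \<in> {0..T}" "t \<in> {0..T}"
  and b: "\<And>\<sigma>. \<sigma> \<in> {0..T} ==> \<bar>\<sigma> - s\<bar> \<le> \<bar>t - s\<bar> ==> cmod (dflow y i \<sigma> \<xi> - z) \<le> B"
 shows "cmod (y i t \<xi> - y i s \<xi> - (t - s) *\<^sub>R z) \<le> B * \<bar>t - s\<bar>"
proof -
 have D: "((\<lambda>t. y i t \<xi> - t *\<^sub>R z) has_vector_derivative (dflow y i \<sigma> \<xi> - z)) (at \<sigma> within {u..v})"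
  if "\<sigma> \<in> {u..v}" "0 \<le> u" "v \<le> T" for \<sigma> u v
 proof -
  have "\<sigma> \<in> {0..T}" "{u..v} \<subseteq> {0..T}" using that by auto
  then have "((\<lambda>t. y i t \<xi>) has_vector_derivative dflow y i \<sigma> \<xi>) (at \<sigma> within {u..v})"
   unfolding dflow_def using has_vector_derivative_within_subset[OF flowD(2)[OF f]] by blast
  moreover have "((\<lambda>t. t *\<^sub>R z) has_vector_derivative z) (at \<sigma> within {u..v})"
   by (auto intro!: derivative_eq_intros simp: has_vector_derivative_def)
  ultimately show ?thesis by (rule has_vector_derivative_diff)
 qed
 show ?thesis
 proof (cases "s \<le> t")
  case True
  have "cmod ((y i t \<xi> - t *\<^sub>R z) - (y i s \<xi> - s *\<^sub>R z)) \<le> B * (t - s)"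
   by (rule vector_derivative_bound_le[where f' = "\<lambda>\<sigma>. dflow y i \<sigma> \<xi> - z"]) (use True t b D in auto)
  then show ?thesis using True by (simp add: algebra_simps)
 next
  case False
  have "cmod ((y i s \<xi> - s *\<^sub>R z) - (y i t \<xi> - t *\<^sub>R z)) \<le> B * (s - t)"
   by (rule vector_derivative_bound_le[where f' = "\<lambda>\<sigma>. dflow y i \<sigma> \<xi> - z"]) (use False t b D in auto)
  moreover have "(y i s \<xi> - s *\<^sub>R z) - (y i t \<xi> - t *\<^sub>R z) = - (y i t \<xi> - y i s \<xi> - (t - s) *\<^sub>R z)"
   by (simp add: algebra_simps)
  ultimately show ?thesis using False by (simp only: norm_minus_cancel) simp
 qed
qed

text \<open>Both the change of \<open>M\<close> and the change of the modes are small multiples of D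
  times a decaying factor; another halving of the rate pays for 1 + |\<xi>|. The time step is chosen
  before the data, so the continuity is uniform over all of them.\<close>

lemma dflow_time:
 assumes c: "c > 0" and t: "t \<in> {0..T}" and e: "e > 0"
 shows "\<exists>\<delta>>0. \<forall>\<sigma>\<in>{0..T}. \<bar>\<sigma> - t\<bar> < \<delta> --> (\<forall>h D y i \<xi>. decays h D c --> flow h y -->
   cmod (dflow y i \<sigma> \<xi> - dflow y i t \<xi>) \<le> D * e * decay (c / 8) q \<xi>)"
proof -
 define C where "C = decay_const c"
 note C = decay_const[OF c, folded C_def]
 obtain B where B: "B > 0" "\<And>\<xi>::real^'n. (1 + norm \<xi>) * decay (c / 4) q \<xi> \<le> B * decay (c / 4 / 2) q \<xi>"
  using poly1_decay[of "c / 4"] c by auto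
 have le: "decay (c / 2) q \<xi> \<le> decay (c / 4) q \<xi>" for \<xi> :: "real^'n"
  using c unfolding decay_def by (simp add: mult_right_mono)
 define X where "X = real CARD('m) * (C + Kc * C) * B"
 define e' where "e' = e / X"
 have X: "X > 0" using C(1) Kc B by (simp add: X_def add_pos_pos)
 have e': "e' > 0" using e X by (simp add: e'_def)
 obtain \<delta> where \<delta>: "\<delta> > 0" "\<And>\<sigma> i j \<xi>. \<sigma> \<in> {0..T} ==> \<bar>\<sigma> - t\<bar> < \<delta> ==> cmod (M i j \<sigma> \<xi> - M i j t \<xi>) \<le> e' * (1 + norm \<xi>)"
  using M_time[OF t e'] by blast
 show ?thesis
 proof (rule exI[of _ "min \<delta> e'"], intro conjI ballI impI allI)
  show "min \<delta> e' > 0" using \<delta>(1) e' by simp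
  fix \<sigma> D :: real and h :: "'m => real^'n => complex" and y :: "'m => real => real^'n => complex" and i and \<xi> :: "real^'n"
  assume \<sigma>: "\<sigma> \<in> {0..T}" "\<bar>\<sigma> - t\<bar> < min \<delta> e'" and d: "decays h D c" and f: "flow h y"
  note D0 = decays_nonneg[OF d]
  let ?d = "decay (c / 4) q \<xi>"
  have eq: "dflow y i \<sigma> \<xi> - dflow y i t \<xi> = (\<Sum>j\<in>UNIV. (M i j \<sigma> \<xi> - M i j t \<xi>) * y j \<sigma> \<xi> + M i j t \<xi> * (y j \<sigma> \<xi> - y j t \<xi>))"
   unfolding dflow_def by (simp add: algebra_simps flip: sum_subtractf)
  have "cmod (dflow y i \<sigma> \<xi> - dflow y i t \<xi>) \<le> (\<Sum>j\<in>(UNIV::'m set). (e' * (1 + norm \<xi>)) * (D * C * ?d) + (Kc * (1 + norm \<xi>)) * (D * C * ?d * e'))"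
   unfolding eq
  proof (rule order_trans[OF norm_sum sum_mono], rule norm_triangle_le, rule add_mono)
   fix j
   have "cmod (y j \<sigma> \<xi>) \<le> D * C * ?d"
    using C(2)[OF d f \<sigma>(1), of j \<xi>] mult_left_mono[OF le[of \<xi>], of "D * C"] D0 C(1) by simp
   then show "cmod ((M i j \<sigma> \<xi> - M i j t \<xi>) * y j \<sigma> \<xi>) \<le> (e' * (1 + norm \<xi>)) * (D * C * ?d)"
    unfolding norm_mult using e' \<sigma> by (intro mult_mono \<delta>(2)) auto
   have nn: "D * C * ?d \<ge> 0" using D0 C(1) by (simp add: decay_pos less_imp_le)
   have "cmod (y j \<sigma> \<xi> - y j t \<xi> - (\<sigma> - t) *\<^sub>R 0) \<le> D * C * ?d * \<bar>\<sigma> - t\<bar>"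
    by (rule flow_lipschitz[OF f t \<sigma>(1)]) (use C(3)[OF d f] in simp)
   also have "\<dots> \<le> D * C * ?d * e'" using \<sigma>(2) by (intro mult_left_mono nn) simp
   finally have "cmod (y j \<sigma> \<xi> - y j t \<xi>) \<le> D * C * ?d * e'" by simp
   then show "cmod (M i j t \<xi> * (y j \<sigma> \<xi> - y j t \<xi>)) \<le> (Kc * (1 + norm \<xi>)) * (D * C * ?d * e')"
    unfolding norm_mult using Kc by (intro mult_mono M_bound t) auto
  qed
  also have "\<dots> = D * e' * real CARD('m) * (C + Kc * C) * ((1 + norm \<xi>) * ?d)"
  proof -
   have "m * ((e' * X) * (D * C * z) + (Kc * X) * (D * C * z * e')) = D * e' * m * (C + Kc * C) * (X * z)" for m X z :: real
    by (simp add: algebra_simps)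
   then show ?thesis by (simp only: sum_constant)
  qed
  also have "\<dots> \<le> D * e' * real CARD('m) * (C + Kc * C) * (B * decay (c / 4 / 2) q \<xi>)"
   using D0 e' C(1) Kc by (intro mult_left_mono B) auto
  also have "\<dots> = D * (e' * (real CARD('m) * (C + Kc * C) * B)) * decay (c / 8) q \<xi>" by simp
  also have "e' * (real CARD('m) * (C + Kc * C) * B) = e" unfolding X_def[symmetric] using X by (simp add: e'_def)
  finally show "cmod (dflow y i \<sigma> \<xi> - dflow y i t \<xi>) \<le> D * e * decay (c / 8) q \<xi>" .
 qed
qed

definition synth :: "('m => real => real^'n => complex) => 'm => real => real^'n => complex" where
 "synth y i t = inv_fourier (y i t)"

lemma synth_bound:
 assumes c: "c > 0" and d: "decays h D c" and f: "flow h y" and t: "t \<in> {0..T}"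
 defines "K \<equiv> decay_const c * (decay_mass TYPE('n) (c / 2) q + decay_mass TYPE('n) (c / 4) q)"
 shows "cmod (synth y i t x) \<le> D * K" "cmod (synth (dflow y) i t x) \<le> D * K"
proof -
 define C where "C = decay_const c"
 note C = decay_const[OF c, folded C_def]
 have K: "C * decay_mass TYPE('n) (c / 2) q \<le> K" "C * decay_mass TYPE('n) (c / 4) q \<le> K"
  using C(1) decay_mass_nonneg[where 'n = 'n] by (auto simp: K_def C_def intro!: mult_left_mono)
 note D0 = decays_nonneg[OF d]
 have "cmod (synth y i t x) \<le> (D * C) * decay_mass TYPE('n) (c / 2) q"
  unfolding synth_def using c by (intro inv_fourier_bound q flow_continuous[OF f decaysD(1)[OF d] t] C(2)[OF d f t]) simp
 also have "\<dots> \<le> D * K" unfolding mult.assoc by (intro mult_left_mono D0 K)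
 finally show "cmod (synth y i t x) \<le> D * K" .
 have "cmod (synth (dflow y) i t x) \<le> (D * C) * decay_mass TYPE('n) (c / 4) q"
  unfolding synth_def using c by (intro inv_fourier_bound q dflow_continuous[OF d f t] C(3)[OF d f t]) simp
 also have "\<dots> \<le> D * K" unfolding mult.assoc by (intro mult_left_mono D0 K)
 finally show "cmod (synth (dflow y) i t x) \<le> D * K" .
qed

text \<open>All constants and moduli depend on the initial data only through the factor \<open>D\<close>; this linearity
 carries the estimates over to derivatives of every order.\<close>

lemma synth_time:
 assumes c: "c > 0" and t: "t \<in> {0..T}" and e: "e > 0"
 shows "\<forall>\<^sub>F \<tau> in at t within {0..T}. \<forall>h D y i x. decays h D c --> flow h y -->
   cmod ((synth y i \<tau> x - synth y i t x) /\<^sub>R (\<tau> - t) - synth (dflow y) i t x) \<le> D * e \<and>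
   cmod (synth (dflow y) i \<tau> x - synth (dflow y) i t x) \<le> D * e"
proof -
 define J where "J = decay_mass TYPE('n) (c / 8) q + 1"
 have J: "J > 0" "decay_mass TYPE('n) (c / 8) q \<le> J" using decay_mass_nonneg[where 'n = 'n, of "c / 8" q] by (auto simp: J_def)
 define e' where "e' = e / J"
 have e': "e' > 0" using e J by (simp add: e'_def)
 have c': "c / 8 > 0" "c / 2 > 0" "c / 4 > 0" using c by auto
 define C where "C = decay_const c"
 note C = decay_const[OF c, folded C_def]
 obtain \<delta> where \<delta>: "\<delta> > 0" "\<And>\<sigma> h D y i \<xi>. \<sigma> \<in> {0..T} ==> \<bar>\<sigma> - t\<bar> < \<delta> ==> decays h D c ==> flow h y ==>
   cmod (dflow y i \<sigma> \<xi> - dflow y i t \<xi>) \<le> D * e' * decay (c / 8) q \<xi>"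
  using dflow_time[OF c t e'] by blast
 have "\<forall>\<^sub>F \<tau> in at t within {0..T}. \<tau> \<in> {0..T} \<and> \<tau> \<noteq> t \<and> \<bar>\<tau> - t\<bar> < \<delta>"
  unfolding eventually_at by (rule exI[of _ \<delta>]) (auto simp: \<delta>(1) dist_real_def)
 then show ?thesis
 proof (rule eventually_mono, intro allI impI)
  fix \<tau> D :: real and h :: "'m => real^'n => complex" and y :: "'m => real => real^'n => complex" and i and x :: "real^'n"
  assume \<tau>: "\<tau> \<in> {0..T} \<and> \<tau> \<noteq> t \<and> \<bar>\<tau> - t\<bar> < \<delta>" and d: "decays h D c" and f: "flow h y"
  have \<tau>T: "\<tau> \<in> {0..T}" using \<tau> by blast
  note D0 = decays_nonneg[OF d]
  note fc = flow_continuous[OF f decaysD(1)[OF d]] and gc = dflow_continuous[OF d f]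
  have iy: "integrable lborel (y i s)" if "s \<in> {0..T}" for s
   by (rule integrable_by_decay(2)[OF q c'(2) fc[OF that] C(2)[OF d f that]])
  have iz: "integrable lborel (dflow y i s)" if "s \<in> {0..T}" for s
   by (rule integrable_by_decay(2)[OF q c'(3) gc[OF that] C(3)[OF d f that]])
  have fin: "D * e' * decay_mass TYPE('n) (c / 8) q \<le> D * e"
  proof -
   have "D * e' * decay_mass TYPE('n) (c / 8) q \<le> D * e' * J" using D0 e' J by (intro mult_left_mono) auto
   then show ?thesis using J by (simp add: e'_def)
  qed
  show "cmod ((synth y i \<tau> x - synth y i t x) /\<^sub>R (\<tau> - t) - synth (dflow y) i t x) \<le> D * e \<and>
   cmod (synth (dflow y) i \<tau> x - synth (dflow y) i t x) \<le> D * e"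
  proof
   let ?r = "cor (inverse (\<tau> - t))"
   let ?F = "\<lambda>\<xi>. 1 * (?r * y i \<tau> \<xi> + (- ?r) * y i t \<xi>) + (- 1) * dflow y i t \<xi>"
   have "(synth y i \<tau> x - synth y i t x) /\<^sub>R (\<tau> - t) - synth (dflow y) i t x = inv_fourier ?F x"
    unfolding synth_def using iy[OF \<tau>T] iy[OF t] iz[OF t]
    by (subst inv_fourier_lincomb, simp, simp, subst inv_fourier_lincomb) (simp_all add: scaleR_conv_of_real algebra_simps)
   also have "cmod \<dots> \<le> D * e' * decay_mass TYPE('n) (c / 8) q"
   proof (rule inv_fourier_bound[OF q c'(1)])
    show "continuous_on UNIV ?F" by (intro continuous_intros fc gc \<tau>T t)
    fix \<xi>
    have "cmod (y i \<tau> \<xi> - y i t \<xi> - (\<tau> - t) *\<^sub>R dflow y i t \<xi>) \<le> (D * e' * decay (c / 8) q \<xi>) * \<bar>\<tau> - t\<bar>"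
     by (rule flow_lipschitz[OF f t \<tau>T]) (use \<delta>(2)[OF _ _ d f] \<tau> in auto)
    moreover have rr: "cor (\<tau> - t) * cor (inverse (\<tau> - t)) = 1"
     using \<tau> by (simp only: of_real_mult[symmetric]) simp
    moreover have "?F \<xi> = inverse (\<tau> - t) *\<^sub>R (y i \<tau> \<xi> - y i t \<xi> - (\<tau> - t) *\<^sub>R dflow y i t \<xi>)"
     using rr by (simp add: scaleR_diff_right scaleR_conv_of_real algebra_simps del: of_real_inverse of_real_diff)
    ultimately show "cmod (?F \<xi>) \<le> D * e' * decay (c / 8) q \<xi>"
     using \<tau> by (simp only: norm_scaleR) (simp add: divide_simps mult.commute)
   qed
   finally show "cmod ((synth y i \<tau> x - synth y i t x) /\<^sub>R (\<tau> - t) - synth (dflow y) i t x) \<le> D * e" using fin by linarith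
   have "synth (dflow y) i \<tau> x - synth (dflow y) i t x = inv_fourier (\<lambda>\<xi>. 1 * dflow y i \<tau> \<xi> + (- 1) * dflow y i t \<xi>) x"
    unfolding synth_def using iz[OF \<tau>T] iz[OF t] by (subst inv_fourier_lincomb) simp_all
   also have "cmod \<dots> \<le> D * e' * decay_mass TYPE('n) (c / 8) q"
   proof (rule inv_fourier_bound[OF q c'(1)])
    show "continuous_on UNIV (\<lambda>\<xi>. 1 * dflow y i \<tau> \<xi> + (- 1) * dflow y i t \<xi>)" by (intro continuous_intros gc \<tau>T t)
    show "cmod (1 * dflow y i \<tau> \<xi> + (- 1) * dflow y i t \<xi>) \<le> D * e' * decay (c / 8) q \<xi>" for \<xi>
     using \<delta>(2)[OF \<tau>T _ d f, of i \<xi>] \<tau> by simp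
   qed
   finally show "cmod (synth (dflow y) i \<tau> x - synth (dflow y) i t x) \<le> D * e" using fin by linarith
  qed
 qed
qed

lemma decays_freq:
 assumes c: "c > 0" and d: "decays h D c"
 obtains B where "B > 0" "decays (\<lambda>i \<xi>. freq ks \<xi> * h i \<xi>) (B * D) (c / 2)"
proof -
 obtain B where B: "B > 0" "\<And>D (f :: real^'n => complex) \<xi>. cmod (f \<xi>) \<le> D * decay c q \<xi> ==> cmod (freq ks \<xi> * f \<xi>) \<le> B * D * decay (c / 2) q \<xi>"
  using freq_decay[OF q c, of ks] by blast
 show ?thesis
 proof (rule that[OF B(1)])
  show "decays (\<lambda>i \<xi>. freq ks \<xi> * h i \<xi>) (B * D) (c / 2)"
   unfolding decays_def
   by (intro conjI allI continuous_on_mult continuous_on_freq decaysD(1)[OF d] B(2) decaysD(2)[OF d])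
 qed
qed

text \<open>Space derivatives act on the modes as multiplication by \<open>freq ks\<close>, which
  commutes with the flow. Inverting the first order symbol term by term identifies the synthesised
  time derivative with the right-hand side of the system.\<close>

lemma
 assumes c: "c > 0" and d: "decays h D c" and f: "flow h y" and t: "t \<in> {0..T}"
 shows smooth_synth: "smooth (synth y i t)"
  and iterated_partial_synth: "iterated_partial ks (synth y i t) = synth (\<lambda>i t \<xi>. freq ks \<xi> * y i t \<xi>) i t"
  and iterated_partial_dsynth: "iterated_partial ks (synth (dflow y) i t) = synth (dflow (\<lambda>i t \<xi>. freq ks \<xi> * y i t \<xi>)) i t"
  and dsynth_eq: "synth (dflow y) i t x = pde_rhs a b (synth y) i t x"
proof -
 define C where "C = decay_const c"
 note C = decay_const[OF c, folded C_def]
 have c': "c / 2 > 0" "c / 4 > 0" using c by auto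
 note fc = flow_continuous[OF f decaysD(1)[OF d] t] and gc = dflow_continuous[OF d f t]
 note fd = C(2)[OF d f t] and gd = C(3)[OF d f t]
 show "smooth (synth y i t)" unfolding synth_def by (rule smooth_inv_fourier[OF q c'(1) fc fd])
 have ip: "iterated_partial ks (synth y i t) = synth (\<lambda>i t \<xi>. freq ks \<xi> * y i t \<xi>) i t" for ks i
  unfolding synth_def by (rule iterated_partial_inv_fourier[OF q c'(1) fc fd])
 then show "iterated_partial ks (synth y i t) = synth (\<lambda>i t \<xi>. freq ks \<xi> * y i t \<xi>) i t" .
 have "dflow (\<lambda>i t \<xi>. freq ks \<xi> * y i t \<xi>) i t = (\<lambda>\<xi>. freq ks \<xi> * dflow y i t \<xi>)"
  by (rule ext) (simp add: dflow_def sum_distrib_left mult_ac)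
 then show "iterated_partial ks (synth (dflow y) i t) = synth (dflow (\<lambda>i t \<xi>. freq ks \<xi> * y i t \<xi>)) i t"
  unfolding synth_def using iterated_partial_inv_fourier[OF q c'(2) gc gd, of ks] by simp
 have i1: "integrable lborel (y j t)" for j by (rule integrable_by_decay(2)[OF q c'(1) fc fd])
 have i2: "integrable lborel (\<lambda>\<xi>. freq ks \<xi> * y j t \<xi>)" for j ks
 proof -
  obtain B where B: "B > 0" "\<And>\<xi>. cmod (freq ks \<xi> * y j t \<xi>) \<le> B * (D * C) * decay (c / 2 / 2) q \<xi>"
   using freq_decay[OF q c'(1), of ks] fd by metis
  show ?thesis
   by (rule integrable_by_decay(2)[OF q _ _ B(2)]) (use c in \<open>auto intro!: continuous_intros continuous_on_freq fc\<close>)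
 qed
 have i3: "integrable lborel (\<lambda>\<xi>. \<Sum>k\<in>UNIV. \<Sum>j\<in>UNIV. a k i j t * (freq [k] \<xi> * y j t \<xi>))"
  by (intro Bochner_Integration.integrable_sum integrable_mult_right i2)
 have i4: "integrable lborel (\<lambda>\<xi>. \<Sum>j\<in>UNIV. b i j t * y j t \<xi>)"
  by (intro Bochner_Integration.integrable_sum integrable_mult_right i1)
 have "dflow y i t = (\<lambda>\<xi>. 1 * (\<Sum>k\<in>UNIV. \<Sum>j\<in>UNIV. a k i j t * (freq [k] \<xi> * y j t \<xi>)) + 1 * (\<Sum>j\<in>UNIV. b i j t * y j t \<xi>))"
  unfolding dflow_def[abs_def] M_def distrib_right sum.distrib sum_distrib_right
  by (subst sum.swap) (simp add: freq_Cons mult_ac)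
 then show "synth (dflow y) i t x = pde_rhs a b (synth y) i t x"
  by (simp only: synth_def inv_fourier_lincomb[OF i3 i4])
    (simp add: inv_fourier_sum inv_fourier_cmult i1 i2 pde_rhs_def ip[unfolded synth_def] synth_def)
qed

lemma pde_sol_synth:
 assumes c: "c > 0" and d: "decays h D c" and f: "flow h y"
 shows "pde_sol T a b (synth y)"
 unfolding pde_sol_def tder_def
proof (intro conjI allI ballI impI)
 show "smooth (synth y i t)" if "t \<in> {0..T}" for i t by (rule smooth_synth[OF c d f that])
 fix i t r and e :: real assume t: "t \<in> {0..T}" and e: "e > 0"
 have "D \<ge> 0" by (rule decays_nonneg[OF d])
 \<comment> \<open>The denominator is D + 1 because D may be 0.\<close>
 then have "e / (D + 1) > 0" and De: "D * (e / (D + 1)) \<le> e" using e by (auto simp: field_simps)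
 from synth_time[OF c t this(1)]
 show "\<forall>\<^sub>F \<tau> in at t within {0..T}. \<forall>x\<in>cube r. cmod ((synth y i \<tau> x - synth y i t x) /\<^sub>R (\<tau> - t) - pde_rhs a b (synth y) i t x) \<le> e"
 proof (rule eventually_mono, intro ballI)
  fix \<tau> :: real and x :: "real^'n"
  assume *: "\<forall>h D' y i x. decays h D' c --> flow h y -->
   cmod ((synth y i \<tau> x - synth y i t x) /\<^sub>R (\<tau> - t) - synth (dflow y) i t x) \<le> D' * (e / (D + 1)) \<and>
   cmod (synth (dflow y) i \<tau> x - synth (dflow y) i t x) \<le> D' * (e / (D + 1))"
  have "cmod ((synth y i \<tau> x - synth y i t x) /\<^sub>R (\<tau> - t) - synth (dflow y) i t x) \<le> D * (e / (D + 1))"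
   using * d f by blast
  also note De
  finally show "cmod ((synth y i \<tau> x - synth y i t x) /\<^sub>R (\<tau> - t) - pde_rhs a b (synth y) i t x) \<le> e"
   by (simp only: dsynth_eq[OF c d f t])
 qed
qed

end

subsection \<open>Gevrey bounds\<close>

text \<open>Gives a name to the arbitrary order of differentiation hidden in
  \<open>multi_deriv\<close>.\<close>

definition index_list :: "('n::finite => nat) => 'n list" where
 "index_list \<beta> = (SOME ks. \<forall>k. count_list ks k = \<beta> k)"

lemma multi_deriv_index_list: "multi_deriv \<beta> f = iterated_partial (index_list \<beta>) f"
 by (simp add: multi_deriv_def index_list_def)

lemma count_mset_list: "count (mset ks) k = count_list ks k"
 by (induction ks) auto

lemma count_index_list: "count_list (index_list \<beta>) k = \<beta> (k :: 'n::finite)"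
proof -
 have "count (Abs_multiset \<beta>) = \<beta>" by (rule Abs_multiset_inverse) simp
 moreover obtain ks where "mset ks = Abs_multiset \<beta>" using ex_mset by blast
 ultimately have "\<exists>ks. \<forall>k. count_list ks k = \<beta> k" by (metis count_mset_list)
 from someI_ex[OF this] show ?thesis unfolding index_list_def by blast
qed

lemma mset_eq_counts: "(\<And>k. count_list ks k = count_list ls k) ==> mset ks = mset ls"
 by (rule multiset_eqI) (simp add: count_mset_list)

lemma freq_mset: "freq ks \<xi> = prod_mset (image_mset (\<lambda>k. \<i> * cor (\<xi> $ k)) (mset ks))"
 by (induction ks) (simp_all add: freq_Cons)

lemma freq_cong: "(\<And>k. count_list ks k = count_list ls k) ==> freq ks = freq ls"
 using mset_eq_counts[of ks ls] by (auto simp: freq_mset)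

definition single_index :: "'n => nat => 'n::finite => nat" where
 "single_index k N j = (if j = k then N else 0)"

text \<open>For a multi-index supported in one direction the chosen list is forced, which identifies
  pure derivatives with instances of \<open>multi_deriv\<close>.\<close>

lemma index_list_single: "index_list (single_index k N) = replicate N (k :: 'n::finite)"
proof -
 have c: "count_list (index_list (single_index k N)) j = single_index k N j" for j by (rule count_index_list)
 have "j = k" if "j \<in> set (index_list (single_index k N))" for j
 proof (rule ccontr)
  assume "j \<noteq> k"
  then have "count_list (index_list (single_index k N)) j = 0" by (simp add: c single_index_def)
  then show False using that by (simp add: count_list_0_iff)
 qed
 then have e: "index_list (single_index k N) = replicate (length (index_list (single_index k N))) k"
  by (metis replicate_length_same)
 have cr: "count_list (replicate l k) k = l" for l by (induction l) auto
 have "N = count_list (index_list (single_index k N)) k" unfolding c by (simp add: single_index_def)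
 also have "\<dots> = count_list (replicate (length (index_list (single_index k N))) k) k"
  by (rule arg_cong[where f = "\<lambda>l. count_list l k"], rule e)
 also have "\<dots> = length (index_list (single_index k N))" by (rule cr)
 finally have NL: "N = length (index_list (single_index k N))" .
 have "replicate (length (index_list (single_index k N))) k = replicate N k"
  by (rule arg_cong[where f = "\<lambda>l. replicate l k"], rule NL[symmetric])
 with e show ?thesis by (rule trans)
qed

lemma multi_abs_single: "multi_abs (single_index (k :: 'n::finite) N) = N"
 by (simp add: multi_abs_def single_index_def)

lemma multi_fact_single: "multi_fact (single_index (k :: 'n::finite) N) = fact N"
proof -
 have "(\<Prod>j\<in>UNIV. fact (single_index k N j) :: nat) = (\<Prod>j\<in>UNIV. if j = k then fact N else 1)"
  by (intro prod.cong) (auto simp: single_index_def)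
 then show ?thesis by (simp add: multi_fact_def)
qed

lemma multi_deriv_0: "multi_deriv (\<lambda>_. 0) f = f"
proof -
 have "index_list (\<lambda>_. 0) = ([] :: 'a list)"
  using count_index_list[of "\<lambda>_. 0 :: nat"] by (metis count_list_0_iff ex_in_conv set_empty)
 then show ?thesis by (simp add: multi_deriv_index_list)
qed

definition gevrey_weight :: "real => real => ('n::finite => nat) => real" where
 "gevrey_weight s h \<beta> = h ^ multi_abs \<beta> * real (multi_fact \<beta>) powr s"

lemma gevrey_weight_mono: "0 < h ==> h \<le> h' ==> gevrey_weight s h \<beta> \<le> gevrey_weight s h' \<beta>"
 unfolding gevrey_weight_def by (intro mult_right_mono power_mono) auto

lemma gevrey_weight_nonneg: "h > 0 ==> gevrey_weight s h \<beta> \<ge> 0"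
 by (simp add: gevrey_weight_def)

lemma gevrey_bound_iff: "gevrey_bound s K h M f \<longleftrightarrow> smooth f \<and> (\<forall>\<beta>. \<forall>x\<in>K. cmod (multi_deriv \<beta> f x) \<le> M * gevrey_weight s h \<beta>)"
 by (simp add: gevrey_bound_def gevrey_weight_def mult.assoc)

lemma gevrey_bound_mono:
 assumes "gevrey_bound s K h M f" "0 < h" "h \<le> h'" "0 \<le> M" "M \<le> M'" "K' \<subseteq> K"
 shows "gevrey_bound s K' h' M' f"
proof -
 have "M * gevrey_weight s h \<beta> \<le> M' * gevrey_weight s h' \<beta>" for \<beta> :: "'a => nat"
  using assms by (intro mult_mono gevrey_weight_mono gevrey_weight_nonneg) auto
 then show ?thesis using assms(1,6) unfolding gevrey_bound_iff by (meson order_trans subsetD)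
qed

lemma gevrey_smooth: "f \<in> gevrey s ==> smooth f"
 by (simp add: gevrey_def)

lemma gevrey_imp_bound:
 assumes f: "f \<in> gevrey s" and K: "compact K"
 shows "\<exists>C>0. gevrey_bound s K C C f"
proof -
 have "\<exists>C>0. \<forall>\<beta>. \<forall>x\<in>K. cmod (multi_deriv \<beta> f x) \<le> C ^ (multi_abs \<beta> + 1) * real (multi_fact \<beta>) powr s"
  using conjunct2[OF f[unfolded gevrey_def mem_Collect_eq]] K by (elim allE[of _ K] impE)
 then show ?thesis
  using gevrey_smooth[OF f] by (elim exE conjE) (intro exI conjI, assumption, simp add: gevrey_bound_def)
qed

lemma gevrey_pure_bound:
 fixes f :: "real^'n::finite => complex"
 assumes f: "gevrey_bound s (cube r) C C f" and C: "C > 0" and s: "s \<le> s'"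
 shows "pure_bound s' r C C f"
 unfolding pure_bound_def
proof (intro conjI allI ballI)
 show "smooth f" using f by (simp add: gevrey_bound_def)
 fix N k and x :: "real^'n" assume x: "x \<in> cube r"
 have "cmod (multi_deriv (single_index k N) f x) \<le> C * gevrey_weight s C (single_index k N)"
  using f x unfolding gevrey_bound_iff by blast
 then have "cmod (iterated_partial (replicate N k) f x) \<le> C * C ^ N * fact N powr s"
  by (simp add: gevrey_weight_def multi_deriv_index_list index_list_single multi_abs_single multi_fact_single mult.assoc)
 also have "\<dots> \<le> C * C ^ N * fact N powr s'"
  using C s by (intro mult_left_mono powr_mono) auto
 finally show "cmod (iterated_partial (replicate N k) f x) \<le> C * C ^ N * fact N powr s'" .
qed

text \<open>The transform of the truncated function, divided by the inversion constant so that
  \<open>inv_fourier\<close> returns the truncated function itself.\<close>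

definition cut_data :: "real => real => (real^'n::finite => complex) => real^'n => complex" where
 "cut_data s L f = (\<lambda>\<xi>. fourier (\<lambda>x. cor (box_cutoff (gevrey_cutoff s L) x) * f x) \<xi> / cor (gauss_const TYPE('n)))"

text \<open>The constants precede \<open>f\<close> and \<open>D\<close>: all functions with pure
  bounds of the same radius \<open>G\<close> share one decay rate, and only the size is proportional
  to D.\<close>

lemma cut_data:
 assumes s: "s > 1" and L: "L > 0" and G: "G > 0"
 shows "\<exists>C>0. \<exists>c>0. \<forall>(f :: real^'n::finite => complex) D. pure_bound s (4 * L) G D f -->
  continuous_on UNIV (cut_data s L f) \<and> (\<forall>\<xi>. cmod (cut_data s L f \<xi>) \<le> D * C * decay c (1 / s) \<xi>) \<and>
  (\<forall>x. inv_fourier (cut_data s L f) x = cor (box_cutoff (gevrey_cutoff s L) x) * f x)"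
proof -
 define \<psi> where "\<psi> = gevrey_cutoff s L"
 have \<psi>: "is_cutoff L \<psi>" unfolding \<psi>_def using s L by (rule is_cutoff_gevrey_cutoff)
 obtain H where H: "H > 0" "\<And>j x. \<bar>\<psi> j x\<bar> \<le> H ^ Suc j * fact j powr s" unfolding \<psi>_def using gevrey_cutoff_bound[OF s L] by blast
 have q: "1 / s > 0" and s1: "s \<ge> 1" using s by auto
 let ?g = "gauss_const TYPE('n)"
 have g: "?g > 0" by (rule gauss_const_pos)
 obtain C c where C: "C > 0" "c > 0" and d: "\<forall>(f :: real^'n => complex) D. pure_bound s (4 * L) G D f -->
    (\<forall>\<xi>. cmod (fourier (\<lambda>x. cor (box_cutoff \<psi> x) * f x) \<xi>) \<le> D * C * decay c (1 / s) \<xi>)"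
  using gevrey_fourier_decay[OF \<psi> L s1 H(1) G H(2), where 'n = 'n] by (elim exE conjE)
 have pos: "C / ?g > 0" using C g by simp
 show ?thesis
 proof (rule exI[of _ "C / ?g"], rule conjI[OF pos], rule exI[of _ c], rule conjI[OF C(2)], intro conjI allI impI)
  fix f :: "real^'n => complex" and D assume pb: "pure_bound s (4 * L) G D f"
  let ?f = "\<lambda>x. cor (box_cutoff \<psi> x) * f x"
  have h: "cut_data s L f = (\<lambda>\<xi>. fourier ?f \<xi> / cor ?g)" by (simp add: cut_data_def \<psi>_def)
  have d: "cmod (fourier ?f \<xi>) \<le> D * C * decay c (1 / s) \<xi>" for \<xi> using d pb by blast
  have c: "continuous_on UNIV ?f"
   using pb smooth_continuous[of f "[]"] by (intro continuous_intros continuous_on_box_cutoff[OF \<psi>]) (simp add: pure_bound_def)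
  have i: "integrable lborel ?f"
   by (rule integrable_compact_support[OF c, where r = "4 * L"]) (simp add: box_cutoff_eq_0[OF \<psi>])
  have cf: "continuous_on UNIV (fourier ?f)" by (rule continuous_on_fourier[OF i])
  show "continuous_on UNIV (cut_data s L f)" unfolding h using g by (intro continuous_intros cf) auto
  show "cmod (cut_data s L f \<xi>) \<le> D * (C / ?g) * decay c (1 / s) \<xi>" for \<xi>
   using d[of \<xi>] g by (simp add: h norm_divide divide_right_mono)
  obtain B where B: "\<And>x. x \<in> cube (4 * L) ==> cmod (?f x) \<le> B" and "B > 0" using cube_bounded[OF c] by blast
  then have B': "cmod (?f x) \<le> B" for x
   using box_cutoff_eq_0[OF \<psi>, of x] by (cases "x \<in> cube (4 * L)") auto
  have "inv_fourier (fourier ?f) x = ?g * ?f x" for x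
   by (rule fourier_inversion[OF c i B' integrable_by_decay(2)[OF q C(2) cf d]])
  moreover have "inv_fourier (cut_data s L f) x = inv_fourier (fourier ?f) x / cor ?g" for x
   unfolding inv_fourier_def h by simp
  ultimately show "inv_fourier (cut_data s L f) x = cor (box_cutoff (gevrey_cutoff s L) x) * f x" for x
   using g by (simp add: \<psi>_def)
 qed
qed

definition open_cube :: "real => (real^'n::finite) set" where
 "open_cube r = {x. \<forall>j. \<bar>x $ j\<bar> < r}"

lemma open_open_cube: "open (open_cube r :: (real^'n::finite) set)"
proof -
 have "(open_cube r :: (real^'n) set) = box (\<chi> i. - r) (\<chi> i. r)"
  by (auto simp: open_cube_def mem_box_cart abs_less_iff minus_less_iff)
 then show ?thesis by (simp only: open_box)
qed

lemma open_cube_subset: "r \<le> r' ==> x \<in> open_cube r ==> x \<in> cube r'"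
 unfolding open_cube_def cube_def mem_Collect_eq by (meson less_imp_le order_trans)

lemma cube_subset_open_cube: "r < r' ==> x \<in> cube r ==> x \<in> open_cube r'"
 unfolding open_cube_def cube_def mem_Collect_eq by (meson le_less_trans)

lemma mem_open_cube_norm: "norm x < r ==> x \<in> open_cube r"
 unfolding open_cube_def mem_Collect_eq by (meson component_le_norm_cart le_less_trans)

text \<open>Near a given point f coincides with an inverse Fourier integral, whose derivatives are
  given by the multiplier \<open>freq\<close>; the latter depends only on how often each direction
  occurs.\<close>

lemma gevrey_partial_commute:
 fixes f :: "real^'n::finite => complex"
 assumes f: "f \<in> gevrey s" and "\<And>k. count_list ks k = count_list ls k"
 shows "iterated_partial ks f x = iterated_partial ls f x"
proof -
 \<comment> \<open>An order above 1 is required for the cutoff, also when s = 1.\<close>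
 define s' where "s' = max s 2"
 define L where "L = norm x + 1"
 have s': "s' > 1" "s \<le> s'" and q: "1 / s' > 0" by (auto simp: s'_def)
 have L: "L > 0" by (simp add: L_def add_nonneg_pos)
 obtain G where G: "G > 0" "gevrey_bound s (cube (4 * L)) G G f" using gevrey_imp_bound[OF f compact_cube] by blast
 define h where "h = cut_data s' L f"
 obtain C c where c: "c > 0" and "continuous_on UNIV h \<and> (\<forall>\<xi>. cmod (h \<xi>) \<le> G * C * decay c (1 / s') \<xi>) \<and>
  (\<forall>x. inv_fourier h x = cor (box_cutoff (gevrey_cutoff s' L) x) * f x)"
  unfolding h_def using cut_data[OF s'(1) L G(1), where 'n = 'n] gevrey_pure_bound[OF G(2,1) s'(2)] by blast
 then have hc: "continuous_on UNIV h" and hd: "\<And>\<xi>. cmod (h \<xi>) \<le> G * C * decay c (1 / s') \<xi>"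
  and hi: "\<And>x. inv_fourier h x = cor (box_cutoff (gevrey_cutoff s' L) x) * f x" by auto
 have x: "x \<in> open_cube (2 * L)" by (rule mem_open_cube_norm) (simp add: L_def add_nonneg_pos)
 have eq: "f y = inv_fourier h y" if "y \<in> open_cube (2 * L)" for y
  using box_cutoff_eq_1[OF is_cutoff_gevrey_cutoff[OF s'(1) L] open_cube_subset[OF order_refl that]] by (simp add: hi)
 have "iterated_partial ms f x = inv_fourier (\<lambda>\<xi>. freq ms \<xi> * h \<xi>) x" for ms
  using iterated_partial_cong_open[where f = f and g = "inv_fourier h", OF open_open_cube eq x, of ms]
   iterated_partial_inv_fourier[OF q c hc hd, of ms] by simp
 then show ?thesis using freq_cong[OF assms(2)] by simp
qed

lemma count_list_replicate: "count_list (replicate N k) j = (if j = k then N else 0)"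
 by (induction N) auto

text \<open>The estimate (N + \<beta>_k)! <= 2^(N + |\<beta>|) N! \<beta>_k! splits the derivatives
  of total index \<beta> + N e_k. The part belonging to \<beta> keeps the order s and becomes the
  size of the new datum, while the part belonging to N is weakened to the order s'. The powers of 2
  are absorbed in \<open>h\<close>.\<close>

lemma gevrey_mixed_bound:
 fixes f :: "real^'n::finite => complex"
 assumes f: "f \<in> gevrey s" and s: "1 \<le> s" "s \<le> s'" and C: "C > 0" "gevrey_bound s (cube r) C C f"
 defines "h \<equiv> C * 2 powr s"
 shows "pure_bound s' r h (C * gevrey_weight s h \<beta>) (multi_deriv \<beta> f)"
 unfolding pure_bound_def
proof (intro conjI allI ballI)
  show "smooth (multi_deriv \<beta> f)"
   unfolding multi_deriv_index_list by (intro smooth_iterated_partial gevrey_smooth[OF f])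
  fix N :: nat and k :: 'n and x :: "real^'n" assume x: "x \<in> cube r"
  define \<gamma> where "\<gamma> j = (if j = k then N else 0) + \<beta> j" for j
  have "iterated_partial (replicate N k) (multi_deriv \<beta> f) x = iterated_partial (replicate N k @ index_list \<beta>) f x"
   by (simp add: multi_deriv_index_list iterated_partial_append)
  also have "\<dots> = multi_deriv \<gamma> f x"
   unfolding multi_deriv_index_list
   by (rule gevrey_partial_commute[OF f]) (simp add: count_index_list count_list_replicate \<gamma>_def)
  finally have eq: "iterated_partial (replicate N k) (multi_deriv \<beta> f) x = multi_deriv \<gamma> f x" .
  have abs: "multi_abs \<gamma> = N + multi_abs \<beta>"
   by (simp add: multi_abs_def \<gamma>_def sum.distrib)
  have le: "\<beta> k \<le> multi_abs \<beta>" unfolding multi_abs_def by (rule member_le_sum) auto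
  have fact1: "real (fact (N + \<beta> k)) \<le> 2 ^ (N + multi_abs \<beta>) * (fact N * fact (\<beta> k))"
  proof -
   have "fact N * fact (N + \<beta> k - N) * ((N + \<beta> k) choose N) = (fact (N + \<beta> k) :: nat)"
    by (rule binomial_fact_lemma) simp
   then have "real (fact (N + \<beta> k)) = real (fact N * fact (\<beta> k) * ((N + \<beta> k) choose N))" by simp
   also have "\<dots> = real ((N + \<beta> k) choose N) * (fact N * fact (\<beta> k))" by simp
   also have "\<dots> \<le> 2 ^ (N + \<beta> k) * (fact N * fact (\<beta> k))"
   proof (rule mult_right_mono)
    have "real ((N + \<beta> k) choose N) \<le> real (2 ^ (N + \<beta> k))" by (intro of_nat_mono binomial_le_pow2)
    then show "real ((N + \<beta> k) choose N) \<le> 2 ^ (N + \<beta> k)" by simp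
   qed simp
   also have "\<dots> \<le> 2 ^ (N + multi_abs \<beta>) * (fact N * fact (\<beta> k))"
    using le by (intro mult_right_mono power_increasing) auto
   finally show ?thesis .
  qed
  have "real (multi_fact \<gamma>) = real (fact (N + \<beta> k)) * (\<Prod>j\<in>UNIV - {k}. fact (\<beta> j))"
   unfolding multi_fact_def by (subst prod.remove[of UNIV k]) (auto simp: \<gamma>_def intro!: prod.cong)
  also have "\<dots> \<le> (2 ^ (N + multi_abs \<beta>) * (fact N * fact (\<beta> k))) * (\<Prod>j\<in>UNIV - {k}. fact (\<beta> j))"
   by (intro mult_right_mono fact1 prod_nonneg) auto
  also have "\<dots> = 2 ^ (N + multi_abs \<beta>) * fact N * real (multi_fact \<beta>)"
  proof -
   have pr: "(\<Prod>j\<in>UNIV. fact (\<beta> j)) = fact (\<beta> k) * (\<Prod>j\<in>UNIV - {k}. fact (\<beta> j) :: nat)"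
    by (subst prod.remove[of UNIV k]) auto
   show ?thesis unfolding multi_fact_def pr by simp
  qed
  finally have mf: "real (multi_fact \<gamma>) \<le> 2 ^ (N + multi_abs \<beta>) * fact N * real (multi_fact \<beta>)" .
  have p2: "((2::real) ^ K) powr s = (2 powr s) ^ K" for K
  proof -
   have "((2::real) ^ K) powr s = (2 powr real K) powr s" by (simp add: powr_realpow)
   also have "\<dots> = (2 powr s) powr real K" by (simp only: powr_powr mult.commute)
   also have "\<dots> = (2 powr s) ^ K" by (simp add: powr_realpow)
   finally show ?thesis .
  qed
  have "real (multi_fact \<gamma>) powr s \<le> (2 ^ (N + multi_abs \<beta>) * fact N * real (multi_fact \<beta>)) powr s"
   using s by (intro powr_mono2 mf) auto
  also have "\<dots> = (2 powr s) ^ (N + multi_abs \<beta>) * fact N powr s * real (multi_fact \<beta>) powr s"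
   by (simp add: powr_mult p2)
  also have "\<dots> \<le> (2 powr s) ^ (N + multi_abs \<beta>) * fact N powr s' * real (multi_fact \<beta>) powr s"
   using s by (intro mult_right_mono mult_left_mono powr_mono) auto
  finally have 1: "real (multi_fact \<gamma>) powr s \<le> (2 powr s) ^ (N + multi_abs \<beta>) * fact N powr s' * real (multi_fact \<beta>) powr s" .
  have "cmod (multi_deriv \<gamma> f x) \<le> C * gevrey_weight s C \<gamma>"
   using C(2) x unfolding gevrey_bound_iff by blast
  also have "\<dots> = C * C ^ (N + multi_abs \<beta>) * real (multi_fact \<gamma>) powr s" by (simp add: gevrey_weight_def abs)
  also have "\<dots> \<le> C * C ^ (N + multi_abs \<beta>) * ((2 powr s) ^ (N + multi_abs \<beta>) * fact N powr s' * real (multi_fact \<beta>) powr s)"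
   using C(1) by (intro mult_left_mono 1) auto
  also have "\<dots> = C * gevrey_weight s h \<beta> * h ^ N * fact N powr s'"
   by (simp add: h_def gevrey_weight_def power_add power_mult_distrib mult_ac)
  finally show "cmod (iterated_partial (replicate N k) (multi_deriv \<beta> f) x) \<le> C * gevrey_weight s h \<beta> * h ^ N * fact N powr s'"
   unfolding eq .
qed

subsection \<open>The patched solution\<close>

lemma pde_rhs_lincomb:
 assumes "\<And>j. smooth (w1 j t)" "\<And>j. smooth (w2 j t)"
 shows "pde_rhs a b (\<lambda>i t x. \<alpha> * w1 i t x + \<gamma> * w2 i t x) i t x = \<alpha> * pde_rhs a b w1 i t x + \<gamma> * pde_rhs a b w2 i t x"
 unfolding pde_rhs_def iterated_partial_lincomb[OF assms]
 by (simp add: algebra_simps sum.distrib sum_distrib_left)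

lemma pde_sol_diff:
 assumes w1: "pde_sol T a b w1" and w2: "pde_sol T a b w2"
 shows "pde_sol T a b (\<lambda>i t x. w1 i t x - w2 i t x)"
proof -
 have s1: "smooth (w1 i t)" and s2: "smooth (w2 i t)" if "t \<in> {0..T}" for i t
  using w1 w2 that by (auto simp: pde_sol_def)
 have d1: "tder T (w1 i) (pde_rhs a b w1 i)" and d2: "tder T (w2 i) (pde_rhs a b w2 i)" for i
  using w1 w2 by (auto simp: pde_sol_def)
 have rhs: "pde_rhs a b (\<lambda>i t x. w1 i t x - w2 i t x) i t x = pde_rhs a b w1 i t x - pde_rhs a b w2 i t x" if "t \<in> {0..T}" for i t x
  using pde_rhs_lincomb[of w1 t w2 a b 1 "-1" i x] s1[OF that] s2[OF that] by simp
 show ?thesis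
  unfolding pde_sol_def tder_def
 proof (intro conjI allI ballI impI)
  show "smooth (\<lambda>x. w1 i t x - w2 i t x)" if "t \<in> {0..T}" for i t
   using smooth_lincomb[where a = 1 and b = "-1", OF s1[OF that] s2[OF that]] by simp
  fix i t r and e :: real assume t: "t \<in> {0..T}" and e: "e > 0"
  have e2: "e / 2 > 0" using e by simp
  show "\<forall>\<^sub>F \<tau> in at t within {0..T}. \<forall>x\<in>cube r.
    cmod ((w1 i \<tau> x - w2 i \<tau> x - (w1 i t x - w2 i t x)) /\<^sub>R (\<tau> - t) - pde_rhs a b (\<lambda>i t x. w1 i t x - w2 i t x) i t x) \<le> e"
   using tderD[OF d1 t e2, of r i] tderD[OF d2 t e2, of r i]
  proof eventually_elim
   case (elim \<tau>)
   show ?case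
   proof
    fix x :: "real^'a" assume x: "x \<in> cube r"
    let ?X = "(w1 i \<tau> x - w1 i t x) /\<^sub>R (\<tau> - t) - pde_rhs a b w1 i t x"
    let ?Y = "(w2 i \<tau> x - w2 i t x) /\<^sub>R (\<tau> - t) - pde_rhs a b w2 i t x"
    have "(w1 i \<tau> x - w2 i \<tau> x - (w1 i t x - w2 i t x)) /\<^sub>R (\<tau> - t) - pde_rhs a b (\<lambda>i t x. w1 i t x - w2 i t x) i t x = ?X - ?Y"
     unfolding rhs[OF t] by (simp add: algebra_simps)
    moreover have "cmod ?X \<le> e / 2" "cmod ?Y \<le> e / 2" using elim x by blast+
    ultimately show "cmod ((w1 i \<tau> x - w2 i \<tau> x - (w1 i t x - w2 i t x)) /\<^sub>R (\<tau> - t) - pde_rhs a b (\<lambda>i t x. w1 i t x - w2 i t x) i t x) \<le> e"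
     using norm_triangle_ineq4[of ?X ?Y] by simp
   qed
  qed
 qed
qed

lemma pde_rhs_cong_open:
 assumes "open S" "x \<in> S" "\<And>i y. y \<in> S ==> w1 i t y = w2 i t y"
 shows "pde_rhs a b w1 i t x = pde_rhs a b w2 i t x"
 unfolding pde_rhs_def
 using iterated_partial_cong_open[of S "w1 j t" "w2 j t" x for j, OF assms(1,3,2)] assms(2,3) by simp

lemma smooth_pde_rhs:
 assumes "\<And>j. smooth (w j t)"
 shows "smooth (pde_rhs a b w i t)"
proof -
 have eq: "pde_rhs a b w i t = (\<lambda>x. 1 * (\<Sum>k\<in>UNIV. 1 * (\<Sum>j\<in>UNIV. a k i j t * iterated_partial [k] (w j t) x)) + 1 * (\<Sum>j\<in>UNIV. b i j t * w j t x))"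
  by (simp add: pde_rhs_def[abs_def])
 show ?thesis
  unfolding eq by (intro smooth_lincomb smooth_sum smooth_iterated_partial assms finite)
qed

lemma cube_add: "x - z \<in> cube R ==> z \<in> cube r ==> x \<in> cube (r + R)"
 unfolding cube_def mem_Collect_eq
proof
 fix j assume "\<forall>j. \<bar>(x - z) $ j\<bar> \<le> R" "\<forall>j. \<bar>z $ j\<bar> \<le> r"
 then have "\<bar>x $ j - z $ j\<bar> \<le> R" "\<bar>z $ j\<bar> \<le> r" by auto
 then show "\<bar>x $ j\<bar> \<le> r + R" by linarith
qed

lemma cube_mono: "r \<le> r' ==> x \<in> cube r ==> x \<in> cube r'"
 unfolding cube_def mem_Collect_eq by (meson order_trans)

lemma mem_cube_norm: "x \<in> cube (norm x)"
 by (simp add: cube_def component_le_norm_cart)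

lemma compact_subset_open_cube:
 fixes K :: "(real^'n::finite) set"
 assumes "compact K"
 shows "\<exists>\<rho>\<ge>0. K \<subseteq> open_cube (\<rho> + 1)"
proof -
 obtain B where B: "B > 0" "\<And>x. x \<in> K ==> norm x \<le> B"
  using compact_imp_bounded[OF assms] unfolding bounded_pos by blast
 then have "K \<subseteq> open_cube (B + 1)" by (intro subsetI mem_open_cube_norm) (meson add_strict_increasing2 le_less_trans less_add_one)
 then show ?thesis using B(1) by (intro exI[of _ B]) simp
qed

lemma
 fixes f g :: "real^'n::finite => complex"
 assumes "smooth f" "smooth g"
 shows smooth_diff: "smooth (\<lambda>x. f x - g x)"
  and multi_deriv_diff: "multi_deriv \<beta> (\<lambda>x. f x - g x) x = multi_deriv \<beta> f x - multi_deriv \<beta> g x"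
 using smooth_lincomb[where a = 1 and b = "-1", OF assms] iterated_partial_lincomb[where a = 1 and b = "-1", OF assms]
 by (simp_all add: multi_deriv_index_list)

lemma
 fixes f :: "real^'n::finite => complex"
 assumes "smooth f"
 shows smooth_cmult: "smooth (\<lambda>x. c * f x)"
  and multi_deriv_cmult: "multi_deriv \<beta> (\<lambda>x. c * f x) x = c * multi_deriv \<beta> f x"
 using smooth_lincomb[where a = c and b = 0, OF assms assms] iterated_partial_lincomb[where a = c and b = 0, OF assms assms]
 by (simp_all add: multi_deriv_index_list)

lemma
 fixes f g :: "real^'n::finite => complex"
 assumes "smooth f" "smooth g"
 shows smooth_quotient: "smooth (\<lambda>x. (f x - g x) /\<^sub>R r)"
  and multi_deriv_quotient: "multi_deriv \<beta> (\<lambda>x. (f x - g x) /\<^sub>R r) x = (multi_deriv \<beta> f x - multi_deriv \<beta> g x) /\<^sub>R r"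
 unfolding scaleR_conv_of_real using assms
 by (simp_all only: smooth_cmult smooth_diff multi_deriv_cmult multi_deriv_diff)

lemma gevrey_bound_cong:
 assumes "gevrey_bound s S h M f" "open S" "\<And>x. x \<in> S ==> g x = f x" "smooth g"
 shows "gevrey_bound s S h M g"
proof -
 have "multi_deriv \<beta> g x = multi_deriv \<beta> f x" if "x \<in> S" for \<beta> x
  unfolding multi_deriv_index_list by (rule iterated_partial_cong_open[OF assms(2,3) that])
 then show ?thesis using assms(1,4) by (simp add: gevrey_bound_iff)
qed

text \<open>Continuous differentiability in quantitative form: one radius h serves all times and all
  tolerances e. The convergence thus takes place within a single step of the inductive limit, from
  which convergence in the Gevrey topology follows.\<close>

definition gevrey_C1_bound ::
 "real => real => (real^'n::finite) set => ('m => real => real^'n => complex) => ('m => real => real^'n => complex) => real => real => bool" where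
 "gevrey_C1_bound s T K u u' h C \<longleftrightarrow>
  (\<forall>i. \<forall>t\<in>{0..T}. gevrey_bound s K h C (u i t) \<and> gevrey_bound s K h C (u' i t)) \<and>
  (\<forall>t\<in>{0..T}. \<forall>e>0. \<forall>\<^sub>F \<tau> in at t within {0..T}. \<forall>i.
   gevrey_bound s K h e (\<lambda>x. (u i \<tau> x - u i t x) /\<^sub>R (\<tau> - t) - u' i t x) \<and> gevrey_bound s K h e (\<lambda>x. u' i \<tau> x - u' i t x))"

lemma eventually_within: "\<forall>\<^sub>F \<tau> in at t within S. \<tau> \<in> S"
 by (simp add: eventually_at_filter)

lemma gevrey_C1_bound_cong:
 assumes b: "gevrey_C1_bound s T S u u' h C" and S: "open S"
  and eq: "\<And>i t x. t \<in> {0..T} ==> x \<in> S ==> v i t x = u i t x" "\<And>i t x. t \<in> {0..T} ==> x \<in> S ==> v' i t x = u' i t x"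
  and sm: "\<And>i t. t \<in> {0..T} ==> smooth (v i t)" "\<And>i t. t \<in> {0..T} ==> smooth (v' i t)"
 shows "gevrey_C1_bound s T S v v' h C"
 unfolding gevrey_C1_bound_def
proof (intro conjI allI ballI impI)
 fix i t assume t: "t \<in> {0..T}"
 have 1: "gevrey_bound s S h C (u i t)" "gevrey_bound s S h C (u' i t)" using b t unfolding gevrey_C1_bound_def by blast+
 show "gevrey_bound s S h C (v i t)" "gevrey_bound s S h C (v' i t)"
  by (rule gevrey_bound_cong[OF 1(1) S eq(1)[OF t] sm(1)[OF t]], assumption,
    rule gevrey_bound_cong[OF 1(2) S eq(2)[OF t] sm(2)[OF t]], assumption)
next
 fix t and e :: real assume t: "t \<in> {0..T}" and e: "e > 0"
 have "\<forall>\<^sub>F \<tau> in at t within {0..T}. \<forall>i. gevrey_bound s S h e (\<lambda>x. (u i \<tau> x - u i t x) /\<^sub>R (\<tau> - t) - u' i t x) \<and>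
   gevrey_bound s S h e (\<lambda>x. u' i \<tau> x - u' i t x)"
  using b t e unfolding gevrey_C1_bound_def by blast
 then show "\<forall>\<^sub>F \<tau> in at t within {0..T}. \<forall>i. gevrey_bound s S h e (\<lambda>x. (v i \<tau> x - v i t x) /\<^sub>R (\<tau> - t) - v' i t x) \<and>
   gevrey_bound s S h e (\<lambda>x. v' i \<tau> x - v' i t x)"
  using eventually_within
 proof eventually_elim
  case (elim \<tau>)
  show ?case
  proof (intro allI conjI)
   fix i
   show "gevrey_bound s S h e (\<lambda>x. (v i \<tau> x - v i t x) /\<^sub>R (\<tau> - t) - v' i t x)"
    by (rule gevrey_bound_cong[OF conjunct1[OF spec[OF elim(1), of i]] S], simp only: eq[OF t] eq[OF elim(2)])
      (intro smooth_diff smooth_quotient sm t elim(2))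
   show "gevrey_bound s S h e (\<lambda>x. v' i \<tau> x - v' i t x)"
    by (rule gevrey_bound_cong[OF conjunct2[OF spec[OF elim(1), of i]] S], simp only: eq[OF t] eq[OF elim(2)])
      (intro smooth_diff sm t elim(2))
  qed
 qed
qed

lemma gevrey_C1_bound_subset:
 assumes b: "gevrey_C1_bound s T S u u' h C" and K: "K \<subseteq> S"
 shows "gevrey_C1_bound s T K u u' h C"
proof -
 have sub: "gevrey_bound s K h M f" if "gevrey_bound s S h M f" for M f using that K unfolding gevrey_bound_def by blast
 show ?thesis
  unfolding gevrey_C1_bound_def
 proof (intro conjI allI ballI impI)
  fix i t assume t: "t \<in> {0..T}"
  show "gevrey_bound s K h C (u i t)" "gevrey_bound s K h C (u' i t)"
   by (rule sub, use b t in \<open>unfold gevrey_C1_bound_def, blast\<close>)+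
 next
  fix t and e :: real assume t: "t \<in> {0..T}" and e: "e > 0"
  from conjunct2[OF b[unfolded gevrey_C1_bound_def], rule_format, OF t e]
  show "\<forall>\<^sub>F \<tau> in at t within {0..T}. \<forall>i.
   gevrey_bound s K h e (\<lambda>x. (u i \<tau> x - u i t x) /\<^sub>R (\<tau> - t) - u' i t x) \<and> gevrey_bound s K h e (\<lambda>x. u' i \<tau> x - u' i t x)"
   by (rule eventually_mono) (intro allI conjI sub; blast)
 qed
qed

text \<open>Two orders are kept: s for the data and the solution, s' for cutoffs and Fourier decay.
  With q = 1 / s' the condition p < q of the Fourier system says that s' lies below the threshold 1
  / p.\<close>

locale gevrey_problem = fourier_system a b T p q M
 for a :: "'n::finite => 'm::finite => 'm => real => complex" and b T p q M +
 fixes s s' :: real and g :: "'m => real^'n => complex"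
 assumes s: "1 \<le> s" "s \<le> s'" "1 < s'" "q = 1 / s'" and g: "\<And>i. g i \<in> gevrey s"
begin

lemma decays_freq_ex:
 assumes c: "c > 0" and d: "decays h D c"
 shows "\<exists>D'. decays (\<lambda>i \<xi>. freq ks \<xi> * h i \<xi>) D' (c / 2)"
proof (rule decays_freq[OF c d, of ks])
 fix B assume "decays (\<lambda>i \<xi>. freq ks \<xi> * h i \<xi>) (B * D) (c / 2)"
 then show ?thesis by (rule exI)
qed

lemma cone_exists: "\<exists>R>0. \<forall>w1 w2 i t z. pde_sol T a b w1 --> pde_sol T a b w2 --> (\<forall>i x. x - z \<in> cube R --> w1 i 0 x = w2 i 0 x) -->
  t \<in> {0..T} --> w1 i t z = w2 i t z"
proof (rule local_uniqueness[OF T coeff_bound(2,3)])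
 fix R :: real
 assume R: "R > 0" and *: "\<And>w i t z. pde_sol T a b w ==> (\<And>i x. x - z \<in> cube R ==> w i 0 x = 0) ==> t \<in> {0..T} ==> w i t z = 0"
 show ?thesis
 proof (rule exI[of _ R], intro conjI allI impI R)
  fix w1 w2 i t z
  assume w: "pde_sol T a b w1" "pde_sol T a b w2" and 0: "\<forall>i x. x - z \<in> cube R --> w1 i 0 x = w2 i 0 x" and t: "t \<in> {0..T}"
  have "w1 i t z - w2 i t z = 0"
   by (rule *[OF pde_sol_diff[OF w] _ t]) (use 0 in simp)
  then show "w1 i t z = w2 i t z" by simp
 qed
qed

text \<open>A radius of dependence: values up to time T at a point are determined by the initial
  data on the cube of this radius around it.\<close>

definition R :: real where
 "R = (SOME R. R > 0 \<and> (\<forall>w1 w2 i t z. pde_sol T a b w1 --> pde_sol T a b w2 --> (\<forall>i x. x - z \<in> cube R --> w1 i 0 x = w2 i 0 x) -->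
  t \<in> {0..T} --> w1 i t z = w2 i t z))"

lemma R: "R > 0"
 and cone: "pde_sol T a b w1 ==> pde_sol T a b w2 ==> (\<And>i x. x - z \<in> cube R ==> w1 i 0 x = w2 i 0 x) ==> t \<in> {0..T} ==> w1 i t z = w2 i t z"
 using someI_ex[OF cone_exists] unfolding R_def[symmetric] by blast+

definition cdata :: "real => ('m => real^'n => complex) => 'm => real^'n => complex" where
 "cdata L f i = cut_data s' L (f i)"

definition cflow :: "real => ('m => real^'n => complex) => 'm => real => real^'n => complex" where
 "cflow L f = (SOME y. flow (cdata L f) y)"

lemma cflow: "flow (cdata L f) (cflow L f)"
 unfolding cflow_def by (rule someI_ex[OF flow_exists])

text \<open>The solution for the data truncated at scale L. It is the desired solution only at
  points whose cube of dependence does not meet the transition region of the cutoff.\<close>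

definition csol :: "real => ('m => real^'n => complex) => 'm => real => real^'n => complex" where
 "csol L f = synth (cflow L f)"

lemma csol_0: "csol L f i 0 x = inv_fourier (cdata L f i) x"
proof -
 have "cflow L f i 0 = cdata L f i" by (rule ext) (rule flowD(1)[OF cflow])
 then show ?thesis by (simp add: csol_def synth_def)
qed

text \<open>Finite propagation speed: near the cube, the derivatives of the solution agree with the solution for the
 derivatives of the data, to which the linear estimates apply.\<close>

lemma csol_properties:
 assumes \<rho>: "\<rho> \<ge> 0"
 defines "L \<equiv> \<rho> + R + 2"
 shows "pde_sol T a b (csol L g)"
  and "x \<in> cube (2 * L) ==> csol L g i 0 x = g i x"
  and "\<exists>h>0. \<exists>C\<ge>0. gevrey_C1_bound s T (open_cube (\<rho> + 1)) (csol L g) (pde_rhs a b (csol L g)) h C"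
proof -
 \<comment> \<open>Points of the open cube of radius \<rho> + 1 depend on data in a cube where the
   cutoff equals 1, with room left for a neighbourhood in which data can be differentiated.\<close>
 have L: "L > 0" "\<rho> + 1 + R < 2 * L" using \<rho> R by (auto simp: L_def)
 have "\<exists>C>0. \<forall>i. C > 0 \<and> gevrey_bound s (cube (4 * L)) C C (g i)"
 proof (rule finite_family_bound)
  show "\<exists>C. C > 0 \<and> gevrey_bound s (cube (4 * L)) C C (g i)" for i by (rule gevrey_imp_bound[OF g compact_cube])
  fix i C C' assume "C > 0 \<and> gevrey_bound s (cube (4 * L)) C C (g i)" "C \<le> C'"
  then show "C' > 0 \<and> gevrey_bound s (cube (4 * L)) C' C' (g i)" using gevrey_bound_mono[of s "cube (4 * L)" C C "g i" C' C'] by simp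
 qed
 then obtain C1 where C1: "C1 > 0" "\<And>i. gevrey_bound s (cube (4 * L)) C1 C1 (g i)" by blast
 define h where "h = C1 * 2 powr s"
 have h: "h > 0" using C1(1) by (simp add: h_def)
 define gd where "gd \<beta> i = multi_deriv \<beta> (g i)" for \<beta> :: "'n => nat" and i
 have pb: "pure_bound s' (4 * L) h (C1 * gevrey_weight s h \<beta>) (gd \<beta> i)" for \<beta> i
  unfolding gd_def h_def by (rule gevrey_mixed_bound[OF g s(1,2) C1])
 obtain C2 c where c: "C2 > 0" "c > 0" and cd: "\<forall>(f :: real^'n => complex) D. pure_bound s' (4 * L) h D f -->
  continuous_on UNIV (cut_data s' L f) \<and> (\<forall>\<xi>. cmod (cut_data s' L f \<xi>) \<le> D * C2 * decay c (1 / s') \<xi>) \<and>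
  (\<forall>x. inv_fourier (cut_data s' L f) x = cor (box_cutoff (gevrey_cutoff s' L) x) * f x)"
  using cut_data[OF s(3) L(1) h, where 'n = 'n] by (elim exE conjE)
 have dec: "decays (cdata L (gd \<beta>)) (C1 * gevrey_weight s h \<beta> * C2) c"
  and inv: "inv_fourier (cdata L (gd \<beta>) i) x = cor (box_cutoff (gevrey_cutoff s' L) x) * gd \<beta> i x" for \<beta> i x
 proof -
  note cd1 = cd[rule_format, OF pb] and cd2 = conjunct2[OF cd[rule_format, OF pb]]
  show "decays (cdata L (gd \<beta>)) (C1 * gevrey_weight s h \<beta> * C2) c"
   unfolding decays_def unfolding cdata_def s(4) by (intro conjI allI conjunct1[OF cd1] conjunct1[OF cd2, rule_format])
  show "inv_fourier (cdata L (gd \<beta>) i) x = cor (box_cutoff (gevrey_cutoff s' L) x) * gd \<beta> i x"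
   unfolding cdata_def by (rule conjunct2[OF cd2, rule_format])
 qed
 have gd0: "gd (\<lambda>_. 0) = g" by (simp add: gd_def[abs_def] multi_deriv_0)
 note dec0 = dec[of "\<lambda>_. 0", unfolded gd0]
 show P: "pde_sol T a b (csol L g)" unfolding csol_def by (rule pde_sol_synth[OF c(2) dec0 cflow])
 have P\<beta>: "pde_sol T a b (csol L (gd \<beta>))" for \<beta> unfolding csol_def by (rule pde_sol_synth[OF c(2) dec cflow])
 have init\<beta>: "csol L (gd \<beta>) i 0 x = gd \<beta> i x" if "x \<in> cube (2 * L)" for \<beta> i x
  using box_cutoff_eq_1[OF is_cutoff_gevrey_cutoff[OF s(3) L(1)] that] by (simp add: csol_0 inv)
 show init: "csol L g i 0 x = g i x" if "x \<in> cube (2 * L)" for i x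
  using init\<beta>[OF that, of "\<lambda>_. 0" i] by (simp add: gd0)
 \<comment> \<open>The modes of the \<beta>-th derivative of the solution. Estimated directly, the
   multiplier would spoil the constants as \<beta> grows; hence the detour through the solution for
   the derived data \<open>gd \<beta>\<close>.\<close>
 define z where "z \<beta> i t \<xi> = freq (index_list \<beta>) \<xi> * cflow L g i t \<xi>" for \<beta> :: "'n => nat" and i t \<xi>
 have zf: "flow (\<lambda>i \<xi>. freq (index_list \<beta>) \<xi> * cdata L g i \<xi>) (z \<beta>)" for \<beta>
  unfolding z_def[abs_def] by (rule flow_mult[OF cflow])
 have zs: "multi_deriv \<beta> (csol L g i t) = synth (z \<beta>) i t" and zd: "multi_deriv \<beta> (pde_rhs a b (csol L g) i t) = synth (dflow (z \<beta>)) i t"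
  if t: "t \<in> {0..T}" for \<beta> i t
 proof -
  show "multi_deriv \<beta> (csol L g i t) = synth (z \<beta>) i t"
   unfolding multi_deriv_index_list csol_def z_def[abs_def] by (rule iterated_partial_synth[OF c(2) dec0 cflow t])
  have "pde_rhs a b (csol L g) i t = synth (dflow (cflow L g)) i t"
   unfolding csol_def by (rule ext) (rule dsynth_eq[OF c(2) dec0 cflow t, symmetric])
  then show "multi_deriv \<beta> (pde_rhs a b (csol L g) i t) = synth (dflow (z \<beta>)) i t"
   unfolding multi_deriv_index_list z_def[abs_def] by (simp add: iterated_partial_dsynth[OF c(2) dec0 cflow t])
 qed
 \<comment> \<open>Both sides solve the system, and on \<open>cube R\<close> around x both have the
   derivative of g as initial value, one by differentiating the solution at time 0, the other by
   truncating the derivative.\<close>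
 have agree: "synth (z \<beta>) i t x = csol L (gd \<beta>) i t x" if t: "t \<in> {0..T}" and x: "x \<in> open_cube (\<rho> + 1)" for \<beta> i t x
 proof -
  obtain B where B: "decays (\<lambda>i \<xi>. freq (index_list \<beta>) \<xi> * cdata L g i \<xi>) B (c / 2)"
   using decays_freq_ex[OF c(2) dec0, of "index_list \<beta>"] by (rule exE)
  have Pz: "pde_sol T a b (synth (z \<beta>))" by (rule pde_sol_synth[OF _ B zf]) (use c(2) in simp)
  show ?thesis
  proof (rule cone[OF Pz P\<beta> _ t])
   fix i y assume "y - x \<in> cube R"
   then have "y \<in> cube (\<rho> + 1 + R)" using cube_add open_cube_subset[OF order_refl x] by blast
   then have y: "y \<in> open_cube (2 * L)" using cube_subset_open_cube L(2) by blast
   have "synth (z \<beta>) i 0 y = iterated_partial (index_list \<beta>) (csol L g i 0) y"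
    using zs[of 0 \<beta> i] T by (simp add: multi_deriv_index_list)
   also have "\<dots> = iterated_partial (index_list \<beta>) (g i) y"
    by (rule iterated_partial_cong_open[OF open_open_cube _ y]) (rule init[OF open_cube_subset[OF order_refl]])
   also have "\<dots> = csol L (gd \<beta>) i 0 y"
    using init\<beta>[OF open_cube_subset[OF order_refl y], of \<beta> i] by (simp add: gd_def multi_deriv_index_list)
   finally show "synth (z \<beta>) i 0 y = csol L (gd \<beta>) i 0 y" .
  qed
 qed
 note agree' = agree[unfolded csol_def]
 have dagree: "synth (dflow (z \<beta>)) i t x = synth (dflow (cflow L (gd \<beta>))) i t x" if t: "t \<in> {0..T}" and x: "x \<in> open_cube (\<rho> + 1)" for \<beta> i t x
 proof -
  obtain B where B: "decays (\<lambda>i \<xi>. freq (index_list \<beta>) \<xi> * cdata L g i \<xi>) B (c / 2)"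
   using decays_freq_ex[OF c(2) dec0, of "index_list \<beta>"] by (rule exE)
  have "synth (dflow (z \<beta>)) i t x = pde_rhs a b (synth (z \<beta>)) i t x"
   by (rule dsynth_eq[OF _ B zf t]) (use c(2) in simp)
  also have "\<dots> = pde_rhs a b (csol L (gd \<beta>)) i t x"
   by (rule pde_rhs_cong_open[OF open_open_cube x]) (rule agree[OF t])
  also have "\<dots> = synth (dflow (cflow L (gd \<beta>))) i t x"
   unfolding csol_def by (rule dsynth_eq[OF c(2) dec cflow t, symmetric])
  finally show ?thesis .
 qed
 have sm: "smooth (csol L g i t)" if "t \<in> {0..T}" for i t using P that by (simp add: pde_sol_def)
 have smr: "smooth (pde_rhs a b (csol L g) i t)" if "t \<in> {0..T}" for i t by (rule smooth_pde_rhs) (rule sm[OF that])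
 define K where "K = C1 * C2"
 have K: "K > 0" using C1(1) c(1) by (simp add: K_def)
 define S where "S = decay_const c * (decay_mass TYPE('n) (c / 2) q + decay_mass TYPE('n) (c / 4) q)"
 have S: "S \<ge> 0" using decay_const(1)[OF c(2)] decay_mass_nonneg[where 'n = 'n] by (simp add: S_def)
 have "gevrey_C1_bound s T (open_cube (\<rho> + 1)) (csol L g) (pde_rhs a b (csol L g)) h (K * S)"
  unfolding gevrey_C1_bound_def gevrey_bound_iff
 proof (intro conjI allI ballI impI)
  fix i t and \<beta> :: "'n => nat" and x :: "real^'n" assume t: "t \<in> {0..T}" and x: "x \<in> open_cube (\<rho> + 1)"
  note b = synth_bound[OF c(2) dec[of \<beta>] cflow t, of i x, folded S_def]
  show "cmod (multi_deriv \<beta> (csol L g i t) x) \<le> K * S * gevrey_weight s h \<beta>"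
   using b(1) unfolding zs[OF t] agree'[OF t x] by (simp add: K_def mult_ac)
  show "cmod (multi_deriv \<beta> (pde_rhs a b (csol L g) i t) x) \<le> K * S * gevrey_weight s h \<beta>"
   using b(2) unfolding zd[OF t] dagree[OF t x] by (simp add: K_def mult_ac)
 next
  fix t and e :: real assume t: "t \<in> {0..T}" and e: "e > 0"
  have e': "e / K > 0" using e K by simp
  show "\<forall>\<^sub>F \<tau> in at t within {0..T}. \<forall>i.
    (smooth (\<lambda>x. (csol L g i \<tau> x - csol L g i t x) /\<^sub>R (\<tau> - t) - pde_rhs a b (csol L g) i t x) \<and>
    (\<forall>\<beta>. \<forall>x\<in>open_cube (\<rho> + 1). cmod (multi_deriv \<beta> (\<lambda>x. (csol L g i \<tau> x - csol L g i t x) /\<^sub>R (\<tau> - t) - pde_rhs a b (csol L g) i t x) x) \<le> e * gevrey_weight s h \<beta>)) \<and>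
    smooth (\<lambda>x. pde_rhs a b (csol L g) i \<tau> x - pde_rhs a b (csol L g) i t x) \<and>
    (\<forall>\<beta>. \<forall>x\<in>open_cube (\<rho> + 1). cmod (multi_deriv \<beta> (\<lambda>x. pde_rhs a b (csol L g) i \<tau> x - pde_rhs a b (csol L g) i t x) x) \<le> e * gevrey_weight s h \<beta>)"
   using synth_time[OF c(2) t e'] eventually_within
  proof eventually_elim
   case (elim \<tau>)
   note \<tau> = elim(2)
   note smq = smooth_quotient[OF sm[OF \<tau>] sm[OF t]]
   \<comment> \<open>The data for index \<beta> have size D = K times the Gevrey weight of \<beta>,
     so the tolerance e / K, common to all \<beta>, yields the error e times that weight.\<close>
   have "C1 * gevrey_weight s h \<beta> * C2 * (e / K) = e * gevrey_weight s h \<beta>" for \<beta> :: "'n => nat"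
    using C1(1) c(1) by (simp add: K_def)
   then have est: "cmod ((synth (cflow L (gd \<beta>)) i \<tau> x - synth (cflow L (gd \<beta>)) i t x) /\<^sub>R (\<tau> - t) - synth (dflow (cflow L (gd \<beta>))) i t x) \<le> e * gevrey_weight s h \<beta>"
    "cmod (synth (dflow (cflow L (gd \<beta>))) i \<tau> x - synth (dflow (cflow L (gd \<beta>))) i t x) \<le> e * gevrey_weight s h \<beta>" for i \<beta> x
    using elim(1) dec[of \<beta>] cflow[of L "gd \<beta>"] by metis+
   show ?case
   proof (intro allI ballI conjI smooth_diff smq smr \<tau> t)
    fix i and \<beta> :: "'n => nat" and x :: "real^'n" assume x: "x \<in> open_cube (\<rho> + 1)"
    note e = zs[OF t] zs[OF \<tau>] zd[OF t] zd[OF \<tau>] agree'[OF t x] agree'[OF \<tau> x] dagree[OF t x] dagree[OF \<tau> x]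
    show "cmod (multi_deriv \<beta> (\<lambda>x. (csol L g i \<tau> x - csol L g i t x) /\<^sub>R (\<tau> - t) - pde_rhs a b (csol L g) i t x) x) \<le> e * gevrey_weight s h \<beta>"
     unfolding multi_deriv_diff[OF smq smr[OF t]] multi_deriv_quotient[OF sm[OF \<tau>] sm[OF t]] e by (rule est)
    show "cmod (multi_deriv \<beta> (\<lambda>x. pde_rhs a b (csol L g) i \<tau> x - pde_rhs a b (csol L g) i t x) x) \<le> e * gevrey_weight s h \<beta>"
     unfolding multi_deriv_diff[OF smr[OF \<tau>] smr[OF t]] e by (rule est)
   qed
  qed
 qed (rule sm smr, assumption)+
 then show "\<exists>h>0. \<exists>C\<ge>0. gevrey_C1_bound s T (open_cube (\<rho> + 1)) (csol L g) (pde_rhs a b (csol L g)) h C"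
  using h K S by (meson less_imp_le mult_nonneg_nonneg)
qed

text \<open>At each point the truncation scale is adapted to |x|, so that the cutoff lies beyond the
  domain of dependence.\<close>

definition usol :: "'m => real => real^'n => complex" where
 "usol i t x = csol (norm x + R + 2) g i t x"

text \<open>Two truncations that both equal the data on the cube of dependence give the same value.
  Thus \<open>usol\<close> coincides on each cube with one synthesised solution, from which all
  local properties are inherited.\<close>

lemma usol_eq:
 assumes \<rho>: "\<rho> \<ge> 0" and t: "t \<in> {0..T}" and x: "x \<in> open_cube (\<rho> + 1)"
 shows "usol i t x = csol (\<rho> + R + 2) g i t x"
 unfolding usol_def
proof (rule cone[OF csol_properties(1)[OF norm_ge_zero] csol_properties(1)[OF \<rho>] _ t])
 fix i y assume y: "y - x \<in> cube R"
 have "y \<in> cube (norm x + R)" by (rule cube_add[OF y mem_cube_norm])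
 then have 1: "y \<in> cube (2 * (norm x + R + 2))" by (rule cube_mono[rotated]) (use R in \<open>simp add: add_nonneg_nonneg\<close>)
 have "y \<in> cube (\<rho> + 1 + R)" by (rule cube_add[OF y open_cube_subset[OF order_refl x]])
 then have 2: "y \<in> cube (2 * (\<rho> + R + 2))" by (rule cube_mono[rotated]) (use R \<rho> in simp)
 show "csol (norm x + R + 2) g i 0 y = csol (\<rho> + R + 2) g i 0 y"
  using csol_properties(2)[OF norm_ge_zero 1, of i] csol_properties(2)[OF \<rho> 2, of i] by simp
qed

lemma usol_0: "usol i 0 x = g i x"
 unfolding usol_def
 by (rule csol_properties(2)[OF norm_ge_zero]) (rule cube_mono[OF _ mem_cube_norm], use R in \<open>simp add: add_nonneg_nonneg\<close>)

lemma mem_open_cube_norm': "x \<in> open_cube (norm x + 1)"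
 by (rule mem_open_cube_norm) simp

lemma smooth_usol:
 assumes t: "t \<in> {0..T}" shows "smooth (usol i t)"
proof (rule smooth_locally)
 fix x :: "real^'n"
 have "smooth (csol (norm x + R + 2) g i t)" using csol_properties(1)[OF norm_ge_zero, of x] t by (simp add: pde_sol_def)
 then show "\<exists>S g. open S \<and> x \<in> S \<and> smooth g \<and> (\<forall>y\<in>S. usol i t y = g y)"
  by (intro exI[of _ "open_cube (norm x + 1)"] exI[of _ "csol (norm x + R + 2) g i t"] conjI ballI
   open_open_cube mem_open_cube_norm' usol_eq[OF norm_ge_zero t])
qed

lemma usol_rhs_eq:
 assumes "\<rho> \<ge> 0" "t \<in> {0..T}" "x \<in> open_cube (\<rho> + 1)"
 shows "pde_rhs a b usol i t x = pde_rhs a b (csol (\<rho> + R + 2) g) i t x"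
 by (rule pde_rhs_cong_open[OF open_open_cube assms(3)]) (rule usol_eq[OF assms(1,2)])

lemma pde_sol_usol: "pde_sol T a b usol"
 unfolding pde_sol_def tder_def
proof (intro conjI allI ballI impI smooth_usol)
 fix i and t r e :: real assume t: "t \<in> {0..T}" and e: "e > 0"
 define \<rho> where "\<rho> = \<bar>r\<bar>"
 have \<rho>: "\<rho> \<ge> 0" by (simp add: \<rho>_def)
 have oc: "x \<in> open_cube (\<rho> + 1)" if "x \<in> cube r" for x :: "real^'n"
  by (rule cube_subset_open_cube[OF _ that]) (simp add: \<rho>_def)
 have d: "tder T (csol (\<rho> + R + 2) g i) (pde_rhs a b (csol (\<rho> + R + 2) g) i)"
  using csol_properties(1)[OF \<rho>] by (simp add: pde_sol_def)
 show "\<forall>\<^sub>F \<tau> in at t within {0..T}. \<forall>x\<in>cube r. cmod ((usol i \<tau> x - usol i t x) /\<^sub>R (\<tau> - t) - pde_rhs a b usol i t x) \<le> e"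
  using tderD[OF d t e, of r] eventually_within
 proof eventually_elim
  case (elim \<tau>)
  then show ?case
   by (simp add: usol_eq[OF \<rho> t oc] usol_eq[OF \<rho> elim(2) oc] usol_rhs_eq[OF \<rho> t oc])
 qed
qed

lemma smooth_usol_rhs: "t \<in> {0..T} ==> smooth (pde_rhs a b usol i t)"
 by (rule smooth_pde_rhs) (rule smooth_usol)

lemma usol_C1_bound:
 assumes K: "compact K"
 shows "\<exists>h>0. \<exists>C\<ge>0. gevrey_C1_bound s T K usol (pde_rhs a b usol) h C"
proof -
 obtain \<rho> where \<rho>: "\<rho> \<ge> 0" "K \<subseteq> open_cube (\<rho> + 1)" using compact_subset_open_cube[OF K] by blast
 obtain h C where h: "h > 0" "C \<ge> 0" "gevrey_C1_bound s T (open_cube (\<rho> + 1)) (csol (\<rho> + R + 2) g) (pde_rhs a b (csol (\<rho> + R + 2) g)) h C"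
  using csol_properties(3)[OF \<rho>(1)] by (elim exE conjE)
 have "gevrey_C1_bound s T (open_cube (\<rho> + 1)) usol (pde_rhs a b usol) h C"
  using h(3) open_open_cube
 proof (rule gevrey_C1_bound_cong)
  fix i t x assume "t \<in> {0..T}" "x \<in> (open_cube (\<rho> + 1) :: (real^'n) set)"
  note * = \<rho>(1) this
  show "usol i t x = csol (\<rho> + R + 2) g i t x" by (rule usol_eq[OF *])
  show "pde_rhs a b usol i t x = pde_rhs a b (csol (\<rho> + R + 2) g) i t x" by (rule usol_rhs_eq[OF *])
 qed (rule smooth_usol smooth_usol_rhs, assumption)+
 from gevrey_C1_bound_subset[OF this \<rho>(2)] h(1,2) show ?thesis by (intro exI conjI)
qed

end

subsection \<open>The Gevrey topology\<close>

lemma gevrey_bound_diff: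
 assumes f: "gevrey_bound s K h M f" and g: "gevrey_bound s K h' M' g" and pos: "h > 0" "h' > 0" "M \<ge> 0" "M' \<ge> 0"
 shows "gevrey_bound s K (max h h') (M + M') (\<lambda>x. f x - g x)"
proof -
 have f': "gevrey_bound s K (max h h') M f" and g': "gevrey_bound s K (max h h') M' g"
  using gevrey_bound_mono[OF f, of "max h h'" M K] gevrey_bound_mono[OF g, of "max h h'" M' K] pos by auto
 have sm: "smooth f" "smooth g" using f g by (auto simp: gevrey_bound_iff)
 show ?thesis
  unfolding gevrey_bound_iff multi_deriv_diff[OF sm] distrib_right
  by (intro conjI allI ballI smooth_diff sm order_trans[OF norm_triangle_ineq4 add_mono])
    (use f' g' in \<open>auto simp: gevrey_bound_iff\<close>)
qed

lemma gevrey_bound_cmult: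
 assumes f: "gevrey_bound s K h M f"
 shows "gevrey_bound s K h (cmod c * M) (\<lambda>x. c * f x)"
proof -
 have sm: "smooth f" using f by (auto simp: gevrey_bound_iff)
 have "cmod (c * multi_deriv \<beta> f x) \<le> cmod c * M * gevrey_weight s h \<beta>" if x: "x \<in> K" for \<beta> x
 proof -
  have "cmod c * cmod (multi_deriv \<beta> f x) \<le> cmod c * (M * gevrey_weight s h \<beta>)"
   using f x by (intro mult_left_mono) (auto simp: gevrey_bound_iff)
  then show ?thesis by (simp add: norm_mult mult.assoc)
 qed
 then show ?thesis using sm by (simp add: gevrey_bound_iff smooth_cmult multi_deriv_cmult)
qed

lemma gevreyI:
 assumes "\<And>K. compact K ==> \<exists>h>0. \<exists>M\<ge>0. gevrey_bound s K h M f"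
 shows "f \<in> gevrey s"
proof -
 have sm: "smooth f" using assms[of "{}"] by (auto simp: gevrey_bound_def)
 have "\<exists>C>0. \<forall>\<beta>. \<forall>x\<in>K. cmod (multi_deriv \<beta> f x) \<le> C ^ (multi_abs \<beta> + 1) * real (multi_fact \<beta>) powr s" if K: "compact K" for K
 proof -
  obtain h M where h: "h > 0" "M \<ge> 0" "gevrey_bound s K h M f" using assms[OF K] by blast
  have "gevrey_bound s K (max h M) (max h M) f" by (rule gevrey_bound_mono[OF h(3,1) _ h(2)]) auto
  then show ?thesis using h(1) by (intro exI[of _ "max h M"]) (auto simp: gevrey_bound_def)
 qed
 then show ?thesis unfolding gevrey_def using sm by simp
qed

lemma gevrey_diff: "f \<in> gevrey s ==> g \<in> gevrey s ==> (\<lambda>x. f x - g x) \<in> gevrey s"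
proof (rule gevreyI)
 fix K :: "(real^'a) set" assume f: "f \<in> gevrey s" and g: "g \<in> gevrey s" and K: "compact K"
 obtain C C' where C: "C > 0" "gevrey_bound s K C C f" "C' > 0" "gevrey_bound s K C' C' g"
  using gevrey_imp_bound[OF f K] gevrey_imp_bound[OF g K] by blast
 have "gevrey_bound s K (max C C') (C + C') (\<lambda>x. f x - g x)"
  by (rule gevrey_bound_diff[OF C(2,4)]) (use C in auto)
 then show "\<exists>h>0. \<exists>M\<ge>0. gevrey_bound s K h M (\<lambda>x. f x - g x)"
  using C by (intro exI[of _ "max C C'"] conjI exI[of _ "C + C'"]) auto
qed

lemma gevrey_cmult: "f \<in> gevrey s ==> (\<lambda>x. c * f x) \<in> gevrey s"
proof (rule gevreyI)
 fix K :: "(real^'a) set" assume f: "f \<in> gevrey s" and K: "compact K"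
 obtain C where C: "C > 0" "gevrey_bound s K C C f" using gevrey_imp_bound[OF f K] by blast
 show "\<exists>h>0. \<exists>M\<ge>0. gevrey_bound s K h M (\<lambda>x. c * f x)"
  using gevrey_bound_cmult[OF C(2), of c] C(1) by (intro exI[of _ C] conjI exI[of _ "cmod c * C"]) auto
qed

lemma gevrey_bound_gevrey_on: "gevrey_bound s K h M f ==> h > 0 ==> f \<in> gevrey_on s K"
 unfolding gevrey_on_def by blast

definition gevrey_subbasis :: "real => (real^'n::finite => complex) set set" where
 "gevrey_subbasis s = {{f \<in> gevrey s. q (\<lambda>x. f x - g x) < eps} | K q g eps.
    compact K \<and> gevrey_seminorm s K q \<and> g \<in> gevrey s \<and> eps > 0}"

lemma gevrey_topology_subbasis: "gevrey_topology s = topology_generated_by (gevrey_subbasis s)"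
 by (simp add: gevrey_topology_def gevrey_subbasis_def)

text \<open>The carrier of a generated topology is the union of its subbasis; the zero seminorm over
  the empty compact set contributes the whole Gevrey class.\<close>

lemma topspace_gevrey_topology: "topspace (gevrey_topology s :: (real^'n::finite => complex) topology) = gevrey s"
proof -
 have z: "gevrey_seminorm s {} (\<lambda>_. 0)" unfolding gevrey_seminorm_def by (auto intro!: exI[of _ 0])
 have "(gevrey s :: (real^'n => complex) set) \<in> gevrey_subbasis s" if "g \<in> gevrey s" for g :: "real^'n => complex"
  unfolding gevrey_subbasis_def mem_Collect_eq
  by (rule exI[of _ "{}"], rule exI[of _ "\<lambda>_. 0"], rule exI[of _ g], rule exI[of _ 1]) (simp add: z that)
 then have "(gevrey s :: (real^'n => complex) set) \<subseteq> \<Union>(gevrey_subbasis s)" by blast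
 moreover have "\<Union>(gevrey_subbasis s) \<subseteq> (gevrey s :: (real^'n => complex) set)"
  unfolding gevrey_subbasis_def by blast
 ultimately show ?thesis
  unfolding gevrey_topology_subbasis topology_generated_by_topspace by blast
qed

text \<open>A continuous seminorm of the inductive limit is dominated by the norm of the step of
  radius h. By the triangle inequality a subbasic neighbourhood of f, centred at any g, thus
  contains everything sufficiently close to f in that norm.\<close>

lemma limitin_gevrey_topology:
 fixes F :: "'a => real^'n::finite => complex"
 assumes f: "f \<in> gevrey s" and ev: "\<forall>\<^sub>F \<tau> in \<F>. F \<tau> \<in> gevrey s"
  and conv: "\<And>K. compact K ==> \<exists>h>0. \<forall>e>0. \<forall>\<^sub>F \<tau> in \<F>. gevrey_bound s K h e (\<lambda>x. F \<tau> x - f x)"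
 shows "limitin (gevrey_topology s) F f \<F>"
proof -
 have basis: "\<forall>\<^sub>F \<tau> in \<F>. F \<tau> \<in> U" if U: "U \<in> gevrey_subbasis s" and fU: "f \<in> U" for U
 proof -
  obtain K q g eps where U: "U = {f \<in> gevrey s. q (\<lambda>x. f x - g x) < eps}" and K: "compact K" and q: "gevrey_seminorm s K q"
   and g: "g \<in> gevrey s" and eps: "eps > 0"
   using U unfolding gevrey_subbasis_def by blast
  have tri: "q (\<lambda>x. \<phi> x + \<phi>' x) \<le> q \<phi> + q \<phi>'" if "\<phi> \<in> gevrey_on s K" "\<phi>' \<in> gevrey_on s K" for \<phi> \<phi>'
   using q that unfolding gevrey_seminorm_def by blast
  define d where "d = eps - q (\<lambda>x. f x - g x)"
  have d: "d > 0" using fU by (simp add: U d_def)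
  obtain h where h: "h > 0" "\<And>e. e > 0 ==> \<forall>\<^sub>F \<tau> in \<F>. gevrey_bound s K h e (\<lambda>x. F \<tau> x - f x)"
   using conv[OF K] by blast
  obtain C where C: "\<And>\<phi> M. gevrey_bound s K h M \<phi> ==> q \<phi> \<le> C * M"
   using q h(1) unfolding gevrey_seminorm_def by blast
  \<comment> \<open>\<open>C\<close> may be zero or negative; the absolute value plus 1 keeps e
    positive and C e below d.\<close>
  define e where "e = d / (\<bar>C\<bar> + 1)"
  have e: "e > 0" using d by (simp add: e_def add_nonneg_pos)
  have Ce: "C * e < d"
  proof -
   have "C * e \<le> \<bar>C\<bar> * e" using e by (intro mult_right_mono) auto
   also have "\<dots> < (\<bar>C\<bar> + 1) * e" using e by (simp add: distrib_right)
   also have "\<dots> = d" unfolding e_def by (simp add: add_nonneg_eq_0_iff)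
   finally show ?thesis .
  qed
  obtain Cg where "Cg > 0" "gevrey_bound s K Cg Cg (\<lambda>x. f x - g x)" using gevrey_imp_bound[OF gevrey_diff[OF f g] K] by blast
  then have fg: "(\<lambda>x. f x - g x) \<in> gevrey_on s K" by (intro gevrey_bound_gevrey_on)
  show ?thesis
   using ev h(2)[OF e]
  proof eventually_elim
   case (elim \<tau>)
   note b = elim(2)
   have "q (\<lambda>x. (F \<tau> x - f x) + (f x - g x)) \<le> q (\<lambda>x. F \<tau> x - f x) + q (\<lambda>x. f x - g x)"
    by (rule tri[OF gevrey_bound_gevrey_on[OF b h(1)] fg])
   also have "\<dots> \<le> C * e + q (\<lambda>x. f x - g x)" using C[OF b] by simp
   also have "\<dots> < eps" using Ce by (simp add: d_def)
   finally show ?case using elim(1) by (simp add: U)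
  qed
 qed
 have "\<forall>\<^sub>F \<tau> in \<F>. F \<tau> \<in> U" if "generate_topology_on (gevrey_subbasis s) U" "f \<in> U" for U
  using that
 proof (induction rule: generate_topology_on.induct)
  case (Int a b)
  then have "\<forall>\<^sub>F \<tau> in \<F>. F \<tau> \<in> a" "\<forall>\<^sub>F \<tau> in \<F>. F \<tau> \<in> b" by auto
  then show ?case by eventually_elim simp
 next
  case (UN K)
  then obtain k where "k \<in> K" "f \<in> k" by blast
  then have "\<forall>\<^sub>F \<tau> in \<F>. F \<tau> \<in> k" using UN by blast
  then show ?case using \<open>k \<in> K\<close> by (auto elim: eventually_mono)
 qed (use basis in auto)
 then show ?thesis
  unfolding limitin_def topspace_gevrey_topology
  using f by (simp add: gevrey_topology_subbasis openin_topology_generated_by_iff)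
qed

section \<open>Gevrey convergence is locally uniform\<close>

lemma gevrey_on_bounded:
 fixes f :: "real^'n::finite => complex"
 assumes "f \<in> gevrey_on s K" "compact K"
 shows "bdd_above ((\<lambda>x. cmod (f x)) ` K)"
proof -
 have "smooth f" using assms(1) by (auto simp: gevrey_on_def gevrey_bound_def)
 then have "continuous_on UNIV f" using smooth_continuous[of f "[]"] by simp
 then have "continuous_on K (\<lambda>x. cmod (f x))" by (intro continuous_on_norm) (rule continuous_on_subset, auto)
 then show ?thesis
  by (intro bounded_imp_bdd_above compact_imp_bounded compact_continuous_image assms(2))
qed

text \<open>The supremum over a compact set is an admissible seminorm, bounded by the term \<beta> =
  0 of each norm; hence the Gevrey topology is finer than local uniform convergence.\<close>

lemma gevrey_seminorm_sup:
 fixes K :: "(real^'n::finite) set"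
 assumes K: "compact K" "K \<noteq> {}"
 shows "gevrey_seminorm s K (\<lambda>f. SUP x\<in>K. cmod (f x))"
 unfolding gevrey_seminorm_def
proof (intro conjI ballI allI impI)
 note bd = gevrey_on_bounded[OF _ K(1)]
 fix f :: "real^'n => complex" assume f: "f \<in> gevrey_on s K"
 have up: "cmod (g x) \<le> (SUP x\<in>K. cmod (g x))" if "g \<in> gevrey_on s K" "x \<in> K" for g :: "real^'n => complex" and x
  by (rule cSUP_upper[OF that(2) bd[OF that(1)]])
 show "(SUP x\<in>K. cmod (f x + g x)) \<le> (SUP x\<in>K. cmod (f x)) + (SUP x\<in>K. cmod (g x))" if g: "g \<in> gevrey_on s K" for g
  by (rule cSUP_least[OF K(2)]) (use up[OF f] up[OF g] in \<open>auto intro: norm_triangle_le add_mono\<close>)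
 fix c
 have cf: "(\<lambda>x. c * f x) \<in> gevrey_on s K" using f gevrey_bound_cmult unfolding gevrey_on_def by blast
 show "(SUP x\<in>K. cmod (c * f x)) = cmod c * (SUP x\<in>K. cmod (f x))"
 proof (rule antisym)
  show "(SUP x\<in>K. cmod (c * f x)) \<le> cmod c * (SUP x\<in>K. cmod (f x))"
   by (rule cSUP_least[OF K(2)]) (use up[OF f] in \<open>auto simp: norm_mult intro: mult_left_mono\<close>)
  show "cmod c * (SUP x\<in>K. cmod (f x)) \<le> (SUP x\<in>K. cmod (c * f x))"
  proof (cases "c = 0")
   case True
   then show ?thesis using K(2) by simp
  next
   case False
   have "(SUP x\<in>K. cmod (f x)) \<le> (SUP x\<in>K. cmod (c * f x)) / cmod c"
    by (rule cSUP_least[OF K(2)]) (use up[OF cf] False in \<open>auto simp: norm_mult pos_le_divide_eq mult.commute\<close>)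
   then show ?thesis using False by (simp add: pos_le_divide_eq mult.commute)
  qed
 qed
next
 fix h :: real assume "h > 0"
 show "\<exists>C. \<forall>f M. gevrey_bound s K h M f --> (SUP x\<in>K. cmod (f x)) \<le> C * M"
 proof (rule exI[of _ 1], intro allI impI)
  fix f :: "real^'n => complex" and M assume "gevrey_bound s K h M f"
  then have "cmod (multi_deriv (\<lambda>_. 0) f x) \<le> M * h ^ multi_abs (\<lambda>_::'n. 0) * real (multi_fact (\<lambda>_::'n. 0)) powr s" if "x \<in> K" for x
   using that unfolding gevrey_bound_def by blast
  then show "(SUP x\<in>K. cmod (f x)) \<le> 1 * M"
   by (intro cSUP_least[OF K(2)]) (simp add: multi_deriv_0 multi_abs_def multi_fact_def)
 qed
qed

lemma limitin_gevrey_uniform: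
 fixes F :: "'a => real^'n::finite => complex"
 assumes lim: "limitin (gevrey_topology s) F f \<F>" and e: "e > 0"
 shows "\<forall>\<^sub>F \<tau> in \<F>. \<forall>x\<in>cube r. cmod (F \<tau> x - f x) \<le> e"
proof -
 \<comment> \<open>The absolute value makes the cube nonempty, as the supremum requires.\<close>
 define K where "K = (cube \<bar>r\<bar> :: (real^'n) set)"
 have K: "compact K" "0 \<in> K" "cube r \<subseteq> K" using compact_cube by (auto simp: K_def cube_def intro: order_trans[OF _ abs_ge_self])
 have f: "f \<in> gevrey s" using lim by (simp add: limitin_def topspace_gevrey_topology)
 define U where "U = {\<phi> \<in> gevrey s. (SUP x\<in>K. cmod (\<phi> x - f x)) < e}"
 have "gevrey_seminorm s K (\<lambda>f. SUP x\<in>K. cmod (f x))" using K by (intro gevrey_seminorm_sup) auto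
 then have "U \<in> gevrey_subbasis s"
  unfolding gevrey_subbasis_def mem_Collect_eq U_def
  by (intro exI[of _ K] exI[of _ "\<lambda>f. SUP x\<in>K. cmod (f x)"] exI[of _ f] exI[of _ e] conjI refl K f e)
 then have "openin (gevrey_topology s) U"
  unfolding gevrey_topology_subbasis openin_topology_generated_by_iff by (rule generate_topology_on.Basis)
 moreover have "(SUP x\<in>K. cmod (f x - f x)) = 0"
 proof -
  have "K \<noteq> {}" using K(2) by blast
  from cSUP_const[OF this, of "0::real"] show ?thesis by simp
 qed
 then have "f \<in> U" using f e by (simp only: U_def mem_Collect_eq)
 ultimately have "\<forall>\<^sub>F \<tau> in \<F>. F \<tau> \<in> U" using lim unfolding limitin_def by blast
 then show ?thesis
 proof eventually_elim
  case (elim \<tau>)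
  then have g: "F \<tau> \<in> gevrey s" and lt: "(SUP x\<in>K. cmod (F \<tau> x - f x)) < e" by (auto simp: U_def)
  obtain C where C: "C > 0" "gevrey_bound s K C C (\<lambda>x. F \<tau> x - f x)" using gevrey_imp_bound[OF gevrey_diff[OF g f] K(1)] by blast
  have on: "(\<lambda>x. F \<tau> x - f x) \<in> gevrey_on s K" by (rule gevrey_bound_gevrey_on[OF C(2,1)])
  show ?case
  proof
   fix x :: "real^'n" assume "x \<in> cube r"
   then have "x \<in> K" using K(3) by blast
   then have "cmod (F \<tau> x - f x) \<le> (SUP x\<in>K. cmod (F \<tau> x - f x))"
    by (rule cSUP_upper[OF _ gevrey_on_bounded[OF on K(1)]])
   then show "cmod (F \<tau> x - f x) \<le> e" using lt by linarith
  qed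
 qed
qed

lemma limitin_gevrey_vec:
 fixes F :: "'a => real^'n::finite => complex^'m::finite"
 assumes f: "f \<in> gevrey_vec s" and ev: "\<forall>\<^sub>F \<tau> in \<F>. F \<tau> \<in> gevrey_vec s"
  and lim: "\<And>i. limitin (gevrey_topology s) (\<lambda>\<tau> x. F \<tau> x $ i) (\<lambda>x. f x $ i) \<F>"
 shows "limitin (gevrey_vec_topology s) F f \<F>"
proof -
 let ?P = "product_topology (\<lambda>_::'m. gevrey_topology s :: (real^'n => complex) topology) UNIV"
 have "\<forall>\<^sub>F \<tau> in \<F>. (\<lambda>i x. F \<tau> x $ i) \<in> topspace ?P"
  using ev by (rule eventually_mono) (auto simp: gevrey_vec_def topspace_gevrey_topology)
 then have L: "limitin ?P (\<lambda>\<tau> i x. F \<tau> x $ i) (\<lambda>i x. f x $ i) \<F>"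
  unfolding limitin_componentwise using lim by simp
 show ?thesis
  unfolding limitin_def
 proof (intro conjI allI impI)
  show "f \<in> topspace (gevrey_vec_topology s)"
   using f by (auto simp: gevrey_vec_topology_def topspace_pullback_topology gevrey_vec_def topspace_gevrey_topology)
  fix U assume "openin (gevrey_vec_topology s) U \<and> f \<in> U"
  then obtain W where W: "openin ?P W" "U = (\<lambda>f i x. f x $ i) -` W \<inter> gevrey_vec s" and fU: "f \<in> U"
   unfolding gevrey_vec_topology_def openin_pullback_topology by blast
  then have "\<forall>\<^sub>F \<tau> in \<F>. (\<lambda>i x. F \<tau> x $ i) \<in> W" using L unfolding limitin_def by blast
  then show "\<forall>\<^sub>F \<tau> in \<F>. F \<tau> \<in> U" using ev by eventually_elim (simp add: W(2))
 qed
qed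

lemma limitin_gevrey_vec_component:
 fixes F :: "'a => real^'n::finite => complex^'m::finite"
 assumes lim: "limitin (gevrey_vec_topology s) F f \<F>"
 shows "limitin (gevrey_topology s) (\<lambda>\<tau> x. F \<tau> x $ i) (\<lambda>x. f x $ i) \<F>"
proof -
 let ?P = "product_topology (\<lambda>_::'m. gevrey_topology s :: (real^'n => complex) topology) UNIV"
 have f: "f \<in> gevrey_vec s" "(\<lambda>i x. f x $ i) \<in> topspace ?P"
  using lim unfolding limitin_def gevrey_vec_topology_def topspace_pullback_topology by auto
 have "limitin ?P (\<lambda>\<tau> i x. F \<tau> x $ i) (\<lambda>i x. f x $ i) \<F>"
  unfolding limitin_def
 proof (intro conjI allI impI f(2))
  fix W assume W: "openin ?P W \<and> (\<lambda>i x. f x $ i) \<in> W"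
  then have "openin (gevrey_vec_topology s) ((\<lambda>f i x. f x $ i) -` W \<inter> gevrey_vec s)"
   unfolding gevrey_vec_topology_def openin_pullback_topology by blast
  then have "\<forall>\<^sub>F \<tau> in \<F>. F \<tau> \<in> (\<lambda>f i x. f x $ i) -` W \<inter> gevrey_vec s"
   using lim W f(1) unfolding limitin_def by blast
  then show "\<forall>\<^sub>F \<tau> in \<F>. (\<lambda>i x. F \<tau> x $ i) \<in> W" by (rule eventually_mono) simp
 qed
 then show ?thesis unfolding limitin_componentwise by simp
qed

text \<open>Continuity on an interval can be tested by limits because the source is metric, whatever
  the target topology.\<close>

lemma continuous_map_interval_limitin:
 fixes S :: "real set"
 assumes "\<And>t. t \<in> S ==> limitin Y f (f t) (at t within S)"
 shows "continuous_map (top_of_set S) Y f"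
 unfolding continuous_map_def
proof (intro conjI allI impI)
 show "f \<in> topspace (top_of_set S) \<rightarrow> topspace Y" using assms by (auto simp: limitin_def)
 fix U assume U: "openin Y U"
 show "openin (top_of_set S) {x \<in> topspace (top_of_set S). f x \<in> U}"
  unfolding openin_euclidean_subtopology_iff
 proof (intro conjI ballI)
  fix x assume "x \<in> {x \<in> topspace (top_of_set S). f x \<in> U}"
  then have x: "x \<in> S" "f x \<in> U" by auto
  then have "\<forall>\<^sub>F y in at x within S. f y \<in> U" using assms[OF x(1)] U by (simp add: limitin_def)
  then obtain d where "d > 0" "\<And>y. y \<in> S ==> y \<noteq> x ==> dist y x < d ==> f y \<in> U"
   unfolding eventually_at by blast
  then show "\<exists>e>0. \<forall>x'\<in>S. dist x' x < e --> x' \<in> {x \<in> topspace (top_of_set S). f x \<in> U}"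
   using x by (intro exI[of _ d]) auto
 qed auto
qed

subsection \<open>The Cauchy problem\<close>

lemma has_vector_derivative_vec:
 fixes f :: "real => complex^'m::finite"
 assumes "\<And>i. ((\<lambda>t. f t $ i) has_vector_derivative d $ i) (at t within S)"
 shows "(f has_vector_derivative d) (at t within S)"
proof -
 have "((\<lambda>y. (1 / norm (y - t)) *\<^sub>R (f y - (f t + (y - t) *\<^sub>R d))) \<longlongrightarrow> 0) (at t within S)"
 proof (rule vec_tendstoI)
  fix i
  have "((\<lambda>y. (1 / norm (y - t)) *\<^sub>R (f y $ i - (f t $ i + (y - t) *\<^sub>R d $ i))) \<longlongrightarrow> 0) (at t within S)"
   using assms[of i] unfolding has_vector_derivative_def has_derivative_within by blast
  then show "((\<lambda>y. ((1 / norm (y - t)) *\<^sub>R (f y - (f t + (y - t) *\<^sub>R d))) $ i) \<longlongrightarrow> 0 $ i) (at t within S)"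
   by simp
 qed
 then show ?thesis
  unfolding has_vector_derivative_def has_derivative_within by (simp add: bounded_linear_scaleR_left)
qed

lemma partial_deriv_component:
 fixes f :: "real^'n::finite => complex^'m::finite"
 assumes "\<And>i. smooth (\<lambda>x. f x $ i)"
 shows "partial_deriv k f x $ i = iterated_partial [k] (\<lambda>x. f x $ i) x"
proof -
 have "has_partial k f (\<chi> i. iterated_partial [k] (\<lambda>x. f x $ i) x) x"
  unfolding has_partial_def
 proof (rule has_vector_derivative_vec)
  fix i
  show "((\<lambda>h. f (x + h *\<^sub>R axis k 1) $ i) has_vector_derivative (\<chi> i. iterated_partial [k] (\<lambda>x. f x $ i) x) $ i) (at 0)"
   using smooth_has_partial[OF assms[of i], of k "[]" x] by (simp add: has_partial_def)
 qed
 from has_partial_imp[OF this] show ?thesis by simp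
qed

text \<open>Each component of the left-hand side is - \<i> times the difference of the time
  derivative and \<open>pde_rhs\<close>, so the equation in terms of \<open>Dt\<close> and
  \<open>Dx\<close> is equivalent to the evolution form.\<close>

lemma cauchy_equation_component:
 fixes u :: "real => real^'n::finite => complex^'m::finite"
 assumes T: "T > 0" and t: "t \<in> {0..T}"
  and sm: "\<And>i. smooth (\<lambda>x. u t x $ i)"
  and d: "\<And>i. ((\<lambda>\<tau>. u \<tau> x $ i) has_vector_derivative d $ i) (at t within {0..T})"
 shows "Dt T u t x - (\<Sum>k\<in>UNIV. A k t *v Dx k (u t) x) - B t *v u t x = 0 \<longleftrightarrow>
  (\<forall>i. d $ i = pde_rhs (\<lambda>k i j t. A k t $ i $ j) (\<lambda>i j t. \<i> * B t $ i $ j) (\<lambda>i t x. u t x $ i) i t x)"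
proof -
 have "((\<lambda>\<tau>. u \<tau> x) has_vector_derivative d) (at t within {0..T})"
  by (rule has_vector_derivative_vec) (rule d)
 then have vd: "vector_derivative (\<lambda>\<tau>. u \<tau> x) (at t within {0..T}) = d"
  using T t by (intro vector_derivative_within_cbox[of 0 T t, unfolded box_real]) auto
 let ?L = "Dt T u t x - (\<Sum>k\<in>UNIV. A k t *v Dx k (u t) x) - B t *v u t x"
 have L: "?L $ i = - \<i> * (d $ i - pde_rhs (\<lambda>k i j t. A k t $ i $ j) (\<lambda>i j t. \<i> * B t $ i $ j) (\<lambda>i t x. u t x $ i) i t x)" for i
 proof -
  have "?L $ i = - \<i> * d $ i - (\<Sum>k\<in>UNIV. \<Sum>j\<in>UNIV. A k t $ i $ j * (- \<i> * iterated_partial [k] (\<lambda>x. u t x $ j) x)) - (\<Sum>j\<in>UNIV. B t $ i $ j * u t x $ j)"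
   by (simp add: Dt_def Dx_def vd matrix_vector_mult_def partial_deriv_component[OF sm])
  also have "\<dots> = - \<i> * (d $ i - ((\<Sum>k\<in>UNIV. \<Sum>j\<in>UNIV. A k t $ i $ j * iterated_partial [k] (\<lambda>x. u t x $ j) x) + (\<Sum>j\<in>UNIV. \<i> * B t $ i $ j * u t x $ j)))"
  proof -
   have 1: "(\<Sum>k\<in>UNIV. \<Sum>j\<in>UNIV. A k t $ i $ j * (- \<i> * iterated_partial [k] (\<lambda>x. u t x $ j) x)) =
     - \<i> * (\<Sum>k\<in>UNIV. \<Sum>j\<in>UNIV. A k t $ i $ j * iterated_partial [k] (\<lambda>x. u t x $ j) x)"
    unfolding sum_distrib_left by (intro sum.cong refl) (simp only: mult_ac)
   have 2: "(\<Sum>j\<in>UNIV. \<i> * B t $ i $ j * u t x $ j) = \<i> * (\<Sum>j\<in>UNIV. B t $ i $ j * u t x $ j)"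
    unfolding sum_distrib_left by (intro sum.cong refl) (simp only: mult_ac)
   show ?thesis unfolding 1 2 by (simp add: algebra_simps)
  qed
  finally show ?thesis by (simp only: pde_rhs_def)
 qed
 have "?L = 0 \<longleftrightarrow> (\<forall>i. ?L $ i = 0)" by (simp add: vec_eq_iff)
 also have "\<dots> \<longleftrightarrow> (\<forall>i. d $ i = pde_rhs (\<lambda>k i j t. A k t $ i $ j) (\<lambda>i j t. \<i> * B t $ i $ j) (\<lambda>i t x. u t x $ i) i t x)"
  unfolding L by simp
 finally show ?thesis .
qed

lemma Ck_on_continuous: "Ck_on k S f ==> continuous_on S f"
 unfolding Ck_on_def by (metis continuous_on_cong le0)

text \<open>Limits in the Gevrey topology are uniform on cubes, so an arbitrary solution in the
  Gevrey class belongs to the class in which Holmgren's uniqueness holds.\<close>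

lemma gevrey_C1_pde_sol:
 fixes v :: "real => real^'n::finite => complex^'m::finite"
 assumes T: "T > 0" and v: "v \<in> gevrey_C1 s T" and sol: "cauchy_solution A B T g v"
 shows "pde_sol T (\<lambda>k i j t. A k t $ i $ j) (\<lambda>i j t. \<i> * B t $ i $ j) (\<lambda>i t x. v t x $ i)"
proof -
 obtain v' where v': "\<And>t. t \<in> {0..T} ==> limitin (gevrey_vec_topology s) (\<lambda>\<tau> x. (v \<tau> x - v t x) /\<^sub>R (\<tau> - t)) (v' t) (at t within {0..T})"
  using v unfolding gevrey_C1_def by blast
 have sm: "smooth (\<lambda>x. v t x $ i)" if "t \<in> {0..T}" for t i
  using v that unfolding gevrey_C1_def gevrey_vec_def by (intro gevrey_smooth) blast
 have td: "tder T (\<lambda>t x. v t x $ i) (\<lambda>t x. v' t x $ i)" for i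
  unfolding tder_def
 proof (intro ballI allI impI)
  fix t r and e :: real assume t: "t \<in> {0..T}" and e: "e > 0"
  show "\<forall>\<^sub>F \<tau> in at t within {0..T}. \<forall>x\<in>cube r. cmod ((v \<tau> x $ i - v t x $ i) /\<^sub>R (\<tau> - t) - v' t x $ i) \<le> e"
   using limitin_gevrey_uniform[OF limitin_gevrey_vec_component[OF v'[OF t]] e, of r i] by simp
 qed
 have rhs: "v' t x $ i = pde_rhs (\<lambda>k i j t. A k t $ i $ j) (\<lambda>i j t. \<i> * B t $ i $ j) (\<lambda>i t x. v t x $ i) i t x"
  if t: "t \<in> {0..T}" for t x i
  using cauchy_equation_component[where u = v and d = "v' t x", OF T t sm[OF t] tder_has_vector_derivative[OF td t]] sol t
  unfolding cauchy_solution_def by blast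
 show ?thesis
  unfolding pde_sol_def
 proof (intro conjI allI ballI sm)
  show "tder T (\<lambda>t x. v t x $ i) (pde_rhs (\<lambda>k i j t. A k t $ i $ j) (\<lambda>i j t. \<i> * B t $ i $ j) (\<lambda>i t x. v t x $ i) i)" for i
   using td[of i] unfolding tder_def by (simp add: rhs)
 qed
qed

section \<open>The patched solution as a differentiable curve in the Gevrey space\<close>

context gevrey_problem
begin

lemma usol_gevrey:
 assumes t: "t \<in> {0..T}"
 shows "usol i t \<in> gevrey s" "pde_rhs a b usol i t \<in> gevrey s"
 using usol_C1_bound t unfolding gevrey_C1_bound_def by (intro gevreyI; meson)+

lemma usol_limits:
 assumes t: "t \<in> {0..T}"
 shows "limitin (gevrey_topology s) (\<lambda>\<tau> x. (usol i \<tau> x - usol i t x) /\<^sub>R (\<tau> - t)) (pde_rhs a b usol i t) (at t within {0..T})"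
  and "limitin (gevrey_topology s) (pde_rhs a b usol i) (pde_rhs a b usol i t) (at t within {0..T})"
  and "\<tau> \<in> {0..T} ==> (\<lambda>x. (usol i \<tau> x - usol i t x) /\<^sub>R (\<tau> - t)) \<in> gevrey s"
proof -
 let ?Q = "\<lambda>\<tau> x. (usol i \<tau> x - usol i t x) /\<^sub>R (\<tau> - t)"
 show g: "?Q \<tau> \<in> gevrey s" if "\<tau> \<in> {0..T}" for \<tau>
  unfolding scaleR_conv_of_real by (intro gevrey_cmult gevrey_diff usol_gevrey that t)
 have E: "\<exists>h>0. (\<forall>e>0. \<forall>\<^sub>F \<tau> in at t within {0..T}. gevrey_bound s K h e (\<lambda>x. ?Q \<tau> x - pde_rhs a b usol i t x)) \<and>
   (\<forall>e>0. \<forall>\<^sub>F \<tau> in at t within {0..T}. gevrey_bound s K h e (\<lambda>x. pde_rhs a b usol i \<tau> x - pde_rhs a b usol i t x))"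
  if K: "compact K" for K
 proof -
  obtain h C where h: "h > 0" "gevrey_C1_bound s T K usol (pde_rhs a b usol) h C" using usol_C1_bound[OF K] by blast
  have "\<forall>\<^sub>F \<tau> in at t within {0..T}. \<forall>i. gevrey_bound s K h e (\<lambda>x. (usol i \<tau> x - usol i t x) /\<^sub>R (\<tau> - t) - pde_rhs a b usol i t x) \<and>
   gevrey_bound s K h e (\<lambda>x. pde_rhs a b usol i \<tau> x - pde_rhs a b usol i t x)" if "e > 0" for e
   using h(2) t that unfolding gevrey_C1_bound_def by blast
  then show ?thesis using h(1) by (intro exI[of _ h] conjI allI impI; fast elim: eventually_mono)
 qed
 show "limitin (gevrey_topology s) ?Q (pde_rhs a b usol i t) (at t within {0..T})"
  by (rule limitin_gevrey_topology[OF usol_gevrey(2)[OF t] eventually_mono[OF eventually_within g]]) (use E in blast)+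
 show "limitin (gevrey_topology s) (pde_rhs a b usol i) (pde_rhs a b usol i t) (at t within {0..T})"
  by (rule limitin_gevrey_topology[OF usol_gevrey(2)[OF t] eventually_mono[OF eventually_within usol_gevrey(2)]]) (use E in blast)+
qed

definition uvec :: "real => real^'n => complex^'m" where
 "uvec t x = (\<chi> i. usol i t x)"

definition uvec' :: "real => real^'n => complex^'m" where
 "uvec' t x = (\<chi> i. pde_rhs a b usol i t x)"

lemma uvec_gevrey: "t \<in> {0..T} ==> uvec t \<in> gevrey_vec s" "t \<in> {0..T} ==> uvec' t \<in> gevrey_vec s"
 by (simp_all add: gevrey_vec_def uvec_def uvec'_def usol_gevrey[unfolded eta_contract_eq])

lemma uvec_limits:
 assumes t: "t \<in> {0..T}"
 shows "limitin (gevrey_vec_topology s) (\<lambda>\<tau> x. (uvec \<tau> x - uvec t x) /\<^sub>R (\<tau> - t)) (uvec' t) (at t within {0..T})"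
  and "limitin (gevrey_vec_topology s) uvec' (uvec' t) (at t within {0..T})"
proof -
 have "(\<lambda>x. (uvec \<tau> x - uvec t x) /\<^sub>R (\<tau> - t)) \<in> gevrey_vec s" if "\<tau> \<in> {0..T}" for \<tau>
  using usol_limits(3)[OF t that] by (simp add: gevrey_vec_def uvec_def)
 then show "limitin (gevrey_vec_topology s) (\<lambda>\<tau> x. (uvec \<tau> x - uvec t x) /\<^sub>R (\<tau> - t)) (uvec' t) (at t within {0..T})"
  by (intro limitin_gevrey_vec uvec_gevrey t eventually_mono[OF eventually_within])
    (simp_all add: uvec_def uvec'_def usol_limits(1)[OF t])
 show "limitin (gevrey_vec_topology s) uvec' (uvec' t) (at t within {0..T})"
  by (intro limitin_gevrey_vec uvec_gevrey t eventually_mono[OF eventually_within uvec_gevrey(2)])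
    (simp_all add: uvec'_def usol_limits(2)[OF t])
qed

lemma uvec_C1: "uvec \<in> gevrey_C1 s T"
 unfolding gevrey_C1_def
 using uvec_gevrey(1) uvec_limits(1) continuous_map_interval_limitin[of "{0..T}" "gevrey_vec_topology s" uvec', OF uvec_limits(2)]
 by blast

end

theorem theorem1p1:
  fixes A :: "'n::finite \<Rightarrow> real \<Rightarrow> complex^'m^'m::finite"
    and B :: "real \<Rightarrow> complex^'m^'m"
    and lam :: "nat \<Rightarrow> real \<Rightarrow> real^'n \<Rightarrow> real"
    and g\<^sub>0 :: "real^'n \<Rightarrow> complex^'m"
    and T \<alpha> M c s :: real
  assumes "T > 0"
    and "\<And>k i j. Ck_on (CARD('m) - 1) {0..T} (\<lambda>t. A k t $ i $ j)"
    and "\<And>i j. Ck_on (CARD('m) - 1) {0..T} (\<lambda>t. B t $ i $ j)"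
    and "\<And>t \<xi>. t \<in> {0..T} \<Longrightarrow> ordered_real_eigenvalues (symbol A t \<xi>) (\<lambda>j. lam j t \<xi>)"
    and "0 < \<alpha>" "\<alpha> \<le> 1" "M > 0"
    and "\<And>j t t' \<xi>. \<lbrakk>1 \<le> j; j \<le> CARD('m); t \<in> {0..T}; t' \<in> {0..T}\<rbrakk> \<Longrightarrow>
           \<bar>lam j t \<xi> - lam j t' \<xi>\<bar> \<le> M * norm \<xi> * \<bar>t - t'\<bar> powr \<alpha>"
    and "c > 0"
    and "\<And>i j k t \<xi>. \<lbrakk>1 \<le> i; i \<le> CARD('m); 1 \<le> j; j \<le> CARD('m); 2 \<le> k; k \<le> CARD('m);
             t \<in> {0..T}\<rbrakk> \<Longrightarrow>
           \<bar>lam i t \<xi> - lam j t \<xi>\<bar> \<le> c * \<bar>lam k t \<xi> - lam (k - 1) t \<xi>\<bar>"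
    and "1 \<le> s"
    and "s < 1 + (if CARD('m) = 1 then \<alpha> else min \<alpha> (1 / (real CARD('m) - 1)))"
    and "g\<^sub>0 \<in> gevrey_vec s"
  shows "\<exists>u. u \<in> gevrey_C1 s T \<and> cauchy_solution A B T g\<^sub>0 u \<and>
           (\<forall>v. v \<in> gevrey_C1 s T \<and> cauchy_solution A B T g\<^sub>0 v \<longrightarrow> (\<forall>t\<in>{0..T}. v t = u t))"
proof -
 \<comment> \<open>For m = 1 the bound 1 / (m - 1) is read as infinity, so only \<alpha>
   remains.\<close>
 define \<beta> where "\<beta> = (if CARD('m) = 1 then \<alpha> else min \<alpha> (1 / (real CARD('m) - 1)))"
 have m: "CARD('m) \<ge> 1" by (simp add: Suc_leI)
 have \<beta>: "0 < \<beta>" "\<beta> \<le> \<alpha>" "\<beta> * (real CARD('m) - 1) \<le> 1"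
 proof -
  show "\<beta> \<le> \<alpha>" by (simp add: \<beta>_def)
  have m1: "real CARD('m) - 1 > 0" if "CARD('m) \<noteq> 1"
  proof -
   have "CARD('m) > 1" using that m by linarith
   then show ?thesis by simp
  qed
  show "0 < \<beta>" using assms(5) m1 by (auto simp: \<beta>_def)
  show "\<beta> * (real CARD('m) - 1) \<le> 1"
  proof (cases "CARD('m) = 1")
   case False
   note m1 = m1[OF False]
   have "\<beta> \<le> 1 / (real CARD('m) - 1)" using False by (simp add: \<beta>_def)
   then show ?thesis using m1 by (simp add: pos_le_divide_eq)
  qed simp
 qed
 \<comment> \<open>The midpoint between s and the threshold: above s and below 1 + \<beta>, and
   above 1 even when s = 1.\<close>
 define s' where "s' = (s + 1 + \<beta>) / 2"
 have "s < 1 + \<beta>" using assms(12) by (simp only: \<beta>_def)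
 then have s': "s \<le> s'" "1 < s'" "s' < 1 + \<beta>" using assms(11) \<beta>(1) by (auto simp: s'_def)
 let ?a = "\<lambda>k i j t. A k t $ i $ j" and ?b = "\<lambda>i j t. \<i> * B t $ i $ j"
 \<comment> \<open>The Fourier transform of the evolution form: this is \<i> times A(t, \<xi>) +
   B(t).\<close>
 define Ms where "Ms i j t \<xi> = (\<Sum>k\<in>UNIV. \<i> * cor (\<xi> $ k) * A k t $ i $ j) + \<i> * B t $ i $ j" for i j t and \<xi> :: "real^'n"
 have Ms: "(\<Sum>j\<in>UNIV. Ms i j t \<xi> * y j) = \<i> * (\<Sum>j\<in>UNIV. (symbol A t \<xi> $ i $ j + B t $ i $ j) * y j)" for i t \<xi> y
  unfolding Ms_def symbol_component sum_distrib_left by (intro sum.cong refl) (simp add: algebra_simps sum_distrib_left)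
 have ode: "ode_bound A B T (1 / (1 + \<beta>))"
  using energy_estimate[OF assms(1-5,7,8) \<beta>] by blast
 interpret gevrey_problem ?a ?b T "1 / (1 + \<beta>)" "1 / s'" Ms s s' "\<lambda>i x. g\<^sub>0 x $ i"
 proof unfold_locales
  show "Ms i j t \<xi> \<equiv> (\<Sum>k\<in>UNIV. \<i> * cor (\<xi> $ k) * A k t $ i $ j) + \<i> * B t $ i $ j" for i j t \<xi>
   by (rule eq_reflection) (rule Ms_def)
  show "continuous_on {0..T} (\<lambda>t. A k t $ i $ j)" for k i j by (rule Ck_on_continuous[OF assms(2)])
  show "continuous_on {0..T} (\<lambda>t. \<i> * B t $ i $ j)" for i j
   by (intro continuous_on_mult_left Ck_on_continuous[OF assms(3)])
  show "\<exists>C>0. \<forall>\<xi> y. (\<forall>i. \<forall>t\<in>{0..T}. (y i has_vector_derivative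
    (\<Sum>j\<in>UNIV. ((\<Sum>k\<in>UNIV. \<i> * cor (\<xi> $ k) * A k t $ i $ j) + \<i> * B t $ i $ j) * y j t)) (at t within {0..T})) -->
    (\<forall>i. \<forall>t\<in>{0..T}. cmod (y i t) \<le> C * exp (C * (1 + norm \<xi>) powr (1 / (1 + \<beta>))) * (\<Sum>j\<in>UNIV. cmod (y j 0)))"
   using ode unfolding ode_bound_def Ms[symmetric] Ms_def .
  show "1 / (1 + \<beta>) < 1 / s'" using s' by (intro divide_strict_left_mono) auto
  show "(\<lambda>x. g\<^sub>0 x $ i) \<in> gevrey s" for i using assms(13) by (simp add: gevrey_vec_def)
 qed (use assms \<beta> s' in auto)
 have comp: "(\<lambda>i t x. uvec t x $ i) = usol" by (simp add: uvec_def fun_eq_iff)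
 have "cauchy_solution A B T g\<^sub>0 uvec"
  unfolding cauchy_solution_def
 proof (intro conjI ballI allI)
  show "uvec 0 x = g\<^sub>0 x" for x by (simp add: uvec_def usol_0 vec_eq_iff)
  fix t x assume t: "t \<in> {0..T}"
  have sm: "smooth (\<lambda>x. uvec t x $ i)" for i using smooth_usol[OF t, of i] by (simp add: uvec_def)
  have "tder T (usol i) (pde_rhs ?a ?b usol i)" for i using pde_sol_usol by (simp add: pde_sol_def)
  from tder_has_vector_derivative[OF this t]
  have d: "((\<lambda>\<tau>. uvec \<tau> x $ i) has_vector_derivative uvec' t x $ i) (at t within {0..T})" for i
   by (simp add: uvec_def uvec'_def)
  show "Dt T uvec t x - (\<Sum>k\<in>UNIV. A k t *v Dx k (uvec t) x) - B t *v uvec t x = 0"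
   unfolding cauchy_equation_component[OF assms(1) t sm d] comp by (simp add: uvec'_def)
 qed
 \<comment> \<open>A competitor has the same initial values on the whole space, so the local
   uniqueness statement \<open>cone\<close> applies at every point.\<close>
 moreover have "v t = uvec t" if v: "v \<in> gevrey_C1 s T" "cauchy_solution A B T g\<^sub>0 v" and t: "t \<in> {0..T}" for v t
 proof
  fix x
  have p: "pde_sol T ?a ?b (\<lambda>i t x. v t x $ i)" by (rule gevrey_C1_pde_sol[OF assms(1) v])
  have "v t x $ i = usol i t x" for i
   by (rule cone[OF p pde_sol_usol _ t]) (use v(2) in \<open>simp add: cauchy_solution_def usol_0\<close>)
  then show "v t x = uvec t x" by (simp add: uvec_def vec_eq_iff)
 qed
 ultimately show ?thesis using uvec_C1 by blast
qed

end
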